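(* Let $\mathbf{u}(t,x,y)$ be a divergence-free vector field on $\mathbb{T}^2$ that is $d(\nu)$-relaxation enhancing. Then there exists a threshold $\nu_*\in(0,1)$ depending only on $\mathbf{u}$ (and on the rate function $d$ and constants associated with $\mathbf{u}$ in the definition of relaxation enhancing flow) such that, for all $B_1>0$ and $B_2\ge1$, there exist constants $C_1(B_2)$, depending only on $B_2$, and $C_2(B_1,B_2,\mathbf{u})$, depending only on $B_1$, $B_2$ and $\mathbf{u}$ (with its associated rate and constants), for which the following holds. Let $\mathcal{I}$ be a finite index set, let $\nu_\alpha\in(0,\nu_*]$ and $\epsilon_{\alpha\beta}\ge0$ for $\alpha,\beta\in\mathcal{I}$, and let $\{n_\alpha\}_{\alpha\in\mathcal{I}}$, $n_\alpha\ge0$, be the solution on $\mathbb{T}^2$ of $$\partial_t n_\alpha=\nu_\alpha\Delta n_\alpha-\mathbf{u}\cdot\nabla n_\alpha-\sum_{\beta\in\mathcal{I}}\epsilon_{\alpha\beta}n_\alpha n_\beta,\qquad n_\alpha(0,\cdot)=n_{\alpha;0}(\cdot),\qquad\alpha\in\mathcal{I},$$ with nonnegative initial data $n_{\alpha;0}\in C^2(\mathbb{T}^2)$. If for all $t\in[0,T]$ $$\min_{\alpha\in\mathcal{I}}\|n_\alpha(t)\|_{L^1}\ge\frac1{B_1}\qquad\text{and}\qquad 1\le\frac{\sum_{\alpha\in\mathcal{I}}\|n_\alpha(t)\|_{L^1}}{\min_{\alpha\in\mathcal{I}}\|n_\alpha(t)\|_{L^1}}\le B_2,$$ then for all $t\in[0,T]$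 $$\sum_{\alpha\in\mathcal{I}}\|n_\alpha(t)\|_{L^1}\le C_1(B_2)\sum_{\alpha\in\mathcal{I}}\|n_{\alpha;0}\|_{L^1}\exp\left\{-\frac{1}{C_2(B_1,B_2,\mathbf{u})}\left(\max_{\alpha\in\mathcal{I}}\frac{|\log\nu_\alpha|}{d(\nu_\alpha)}+\Big(\min_{\alpha\in\mathcal{I}}\max_{\beta\in\mathcal{I}}\epsilon_{\alpha\beta}\Big)^{-1}\right)^{-1}t\right\}.$$
   Context: $\mathbb{T}^2=[-1/2,1/2]^2$ is the torus with opposite sides identified, so $|\mathbb{T}^2|=1$; $L^1=L^1(\mathbb{T}^2)$. If $\min_{\alpha}\max_{\beta}\epsilon_{\alpha\beta}=0$, its inverse is understood as $+\infty$, so that the exponential rate is $0$. Definition ($d(\nu)$-relaxation enhancing flow). The vector field $\mathbf{u}(t,x,y)$ is $d(\nu)$-relaxation enhancing if there exist a threshold $\nu_0(\mathbf{u})>0$ and constants $\delta\in(0,1)$, $C\ge1$ depending only on $\mathbf{u}$ (and not on $\nu$) such that, for every $\nu\in(0,\nu_0]$, every solution $f_\sim$ of the passive scalar equation $\partial_t f_\sim+\mathbf{u}\cdot\nabla f_\sim=\nu\Delta f_\sim$ on $\mathbb{T}^2$ with initial datum satisfying $\int_{\mathbb{T}^2}f_{0;\sim}\,dx\,dy=0$ obeys $$\|f_\sim(s+t)\|_{L^2}\le C\|f_\sim(s)\|_{L^2}e^{-\delta d(\nu)t}\qquad\text{for all } s,t\in[0,\infty).$$ Here the rate $d(\nu)>0$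 satisfies $\lim_{\nu\to0^+}\nu/d(\nu)=0$. *)

theory Defs
  imports "HOL-Analysis.Analysis"
begin

text \<open>
  Functions on the torus are functions on the plane that have period 1 in each variable;
  integrals are taken over the fundamental square. Time-dependent functions
  are written \<open>f t p\<close> with \<open>p = (x, y)\<close>.
\<close>

definition periodic :: "(real \<times> real \<Rightarrow> 'a) \<Rightarrow> bool" where
  "periodic f \<longleftrightarrow> (\<forall>x y. f (x + 1, y) = f (x, y) \<and> f (x, y + 1) = f (x, y))"

definition torus_integral :: "(real \<times> real \<Rightarrow> real) \<Rightarrow> real" where
  "torus_integral f = (LINT p : {-1/2..1/2} \<times> {-1/2..1/2} | lborel. f p)"

definition L1_norm :: "(real \<times> real \<Rightarrow> real) \<Rightarrow> real" where
  "L1_norm f = torus_integral (\<lambda>p. \<bar>f p\<bar>)"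

definition L2_norm :: "(real \<times> real \<Rightarrow> real) \<Rightarrow> real" where
  "L2_norm f = sqrt (torus_integral (\<lambda>p. (f p)\<^sup>2))"

definition Dx :: "(real \<times> real \<Rightarrow> real) \<Rightarrow> real \<times> real \<Rightarrow> real" where
  "Dx f = (\<lambda>(x, y). deriv (\<lambda>s. f (s, y)) x)"

definition Dy :: "(real \<times> real \<Rightarrow> real) \<Rightarrow> real \<times> real \<Rightarrow> real" where
  "Dy f = (\<lambda>(x, y). deriv (\<lambda>s. f (x, s)) y)"

definition laplacian :: "(real \<times> real \<Rightarrow> real) \<Rightarrow> real \<times> real \<Rightarrow> real" where
  "laplacian f p = Dx (Dx f) p + Dy (Dy f) p"

text \<open>
  All spatial partial derivatives up to order \<open>k\<close> exist at every time in \<open>J\<close> and are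
  continuous jointly in time and space.
\<close>

fun C_space :: "nat \<Rightarrow> real set \<Rightarrow> (real \<Rightarrow> real \<times> real \<Rightarrow> real) \<Rightarrow> bool" where
  "C_space 0 J f \<longleftrightarrow> (\<forall>t\<in>J. periodic (f t)) \<and> continuous_on (J \<times> UNIV) (\<lambda>(t, p). f t p)"
| "C_space (Suc k) J f \<longleftrightarrow>
     C_space 0 J f \<and>
     (\<forall>t\<in>J. \<forall>x y. (\<lambda>s. f t (s, y)) differentiable (at x) \<and>
                   (\<lambda>s. f t (x, s)) differentiable (at y)) \<and>
     C_space k J (\<lambda>t. Dx (f t)) \<and> C_space k J (\<lambda>t. Dy (f t))"

definition C_torus :: "nat \<Rightarrow> (real \<times> real \<Rightarrow> real) \<Rightarrow> bool" where
  "C_torus k f \<longleftrightarrow> C_space k UNIV (\<lambda>t. f)"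

definition torus_vector_field :: "(real \<Rightarrow> real \<times> real \<Rightarrow> real \<times> real) \<Rightarrow> bool" where
  "torus_vector_field u \<longleftrightarrow>
     C_space 1 {0..} (\<lambda>t p. fst (u t p)) \<and> C_space 1 {0..} (\<lambda>t p. snd (u t p))"

definition divergence_free :: "(real \<Rightarrow> real \<times> real \<Rightarrow> real \<times> real) \<Rightarrow> bool" where
  "divergence_free u \<longleftrightarrow>
     (\<forall>t\<ge>0. \<forall>p. Dx (\<lambda>q. fst (u t q)) p + Dy (\<lambda>q. snd (u t q)) p = 0)"

text \<open>
  Classical solutions on the time interval \<open>J\<close> of
  \<open>\<partial>\<^sub>t f = \<nu> \<Delta>f - u \<cdot> \<nabla>f - r\<close>: continuous on all of \<open>J\<close>, with the
  derivatives and the equation required only in the interior of \<open>J\<close>. Continuity of the time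
  derivative then follows from the equation when \<open>u\<close> and \<open>r\<close> are continuous.
\<close>

definition adv_diff_solution ::
  "real set \<Rightarrow> (real \<Rightarrow> real \<times> real \<Rightarrow> real \<times> real) \<Rightarrow> real \<Rightarrow>
   (real \<Rightarrow> real \<times> real \<Rightarrow> real) \<Rightarrow> (real \<Rightarrow> real \<times> real \<Rightarrow> real) \<Rightarrow> bool" where
  "adv_diff_solution J u \<nu> r f \<longleftrightarrow>
     C_space 0 J f \<and> C_space 2 (interior J) f \<and>
     (\<forall>t\<in>interior J. \<forall>p.
        ((\<lambda>s. f s p) has_real_derivative
           \<nu> * laplacian (f t) p
           - (fst (u t p) * Dx (f t) p + snd (u t p) * Dy (f t) p)
           - r t p) (at t))"

definition passive_scalar_solution ::
  "(real \<Rightarrow> real \<times> real \<Rightarrow> real \<times> real) \<Rightarrow> real \<Rightarrow> (real \<Rightarrow> real \<times> real \<Rightarrow> real) \<Rightarrow> bool" where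
  "passive_scalar_solution u \<nu> f \<longleftrightarrow> adv_diff_solution {0..} u \<nu> (\<lambda>t p. 0) f"

definition relaxation_enhancing ::
  "(real \<Rightarrow> real) \<Rightarrow> (real \<Rightarrow> real \<times> real \<Rightarrow> real \<times> real) \<Rightarrow> bool" where
  "relaxation_enhancing d u \<longleftrightarrow>
     ((\<lambda>\<nu>. \<nu> / d \<nu>) \<longlongrightarrow> 0) (at_right 0) \<and>
     (\<exists>\<nu>0 \<delta> C. 0 < \<nu>0 \<and> 0 < \<delta> \<and> \<delta> < 1 \<and> 1 \<le> C \<and>
        (\<forall>\<nu>. 0 < \<nu> \<and> \<nu> \<le> \<nu>0 \<longrightarrow>
           0 < d \<nu> \<and>
           (\<forall>f. passive_scalar_solution u \<nu> f \<and> torus_integral (f 0) = 0 \<longrightarrow>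
              (\<forall>s\<ge>0. \<forall>t\<ge>0.
                 L2_norm (f (s + t)) \<le> C * L2_norm (f s) * exp (- (\<delta> * d \<nu> * t))))))"

definition reaction_system_solution ::
  "nat set \<Rightarrow> real set \<Rightarrow> (real \<Rightarrow> real \<times> real \<Rightarrow> real \<times> real) \<Rightarrow> (nat \<Rightarrow> real) \<Rightarrow>
   (nat \<Rightarrow> nat \<Rightarrow> real) \<Rightarrow> (nat \<Rightarrow> real \<times> real \<Rightarrow> real) \<Rightarrow>
   (nat \<Rightarrow> real \<Rightarrow> real \<times> real \<Rightarrow> real) \<Rightarrow> bool" where
  "reaction_system_solution I J u \<nu> \<epsilon> n0 n \<longleftrightarrow>
     (\<forall>\<alpha>\<in>I. n \<alpha> 0 = n0 \<alpha> \<and>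
        adv_diff_solution J u (\<nu> \<alpha>) (\<lambda>t p. \<Sum>\<beta>\<in>I. \<epsilon> \<alpha> \<beta> * n \<alpha> t p * n \<beta> t p) (n \<alpha>))"

definition min_L1 :: "nat set \<Rightarrow> (nat \<Rightarrow> real \<Rightarrow> real \<times> real \<Rightarrow> real) \<Rightarrow> real \<Rightarrow> real" where
  "min_L1 I n t = Min ((\<lambda>\<alpha>. L1_norm (n \<alpha> t)) ` I)"

definition minmax :: "nat set \<Rightarrow> (nat \<Rightarrow> nat \<Rightarrow> real) \<Rightarrow> real" where
  "minmax I \<epsilon> = Min ((\<lambda>\<alpha>. Max (\<epsilon> \<alpha> ` I)) ` I)"

text \<open>
  The quantity \<open>(max \<bar>log \<nu>\<bar> / d(\<nu>) + (min max \<epsilon>)\<^sup>-\<^sup>1)\<^sup>-\<^sup>1\<close>. The case distinction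
  implements the convention that the inverse of 0 is infinite, so that the rate is 0
  (whereas \<open>inverse 0 = 0\<close> in HOL).
\<close>

definition decay_rate ::
  "nat set \<Rightarrow> (real \<Rightarrow> real) \<Rightarrow> (nat \<Rightarrow> real) \<Rightarrow> (nat \<Rightarrow> nat \<Rightarrow> real) \<Rightarrow> real" where
  "decay_rate I d \<nu> \<epsilon> =
     (if minmax I \<epsilon> = 0 then 0
      else inverse (Max ((\<lambda>\<alpha>. \<bar>ln (\<nu> \<alpha>)\<bar> / d (\<nu> \<alpha>)) ` I) + inverse (minmax I \<epsilon>)))"

end

theory Submission
  imports Defs "HOL-Probability.Probability"
begin

text \<open>
  A species that loses less than a sixteenth of its mass during a time window is governed by the
  passive scalar equation up to an \<open>L\<^sup>1\<close> error of the size of that drop. A Nash inequality smooths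
  its state from \<open>L\<^sup>1\<close> to \<open>L\<^sup>2\<close> within time \<open>h\<close> at a polynomial cost in \<open>1 / (\<nu> h)\<close>, and after a time of order
  \<open>|log \<nu>| / d(\<nu>)\<close> the relaxation estimate has made it almost constant. If this held for a species
  \<open>\<alpha>\<close> minimising \<open>max\<^sub>\<beta> \<epsilon>\<^sub>\<alpha>\<^sub>\<beta>\<close> and for a partner \<open>\<beta>\<close> realising the maximum, then the two densities
  would overlap, and the reaction would consume more of \<open>\<alpha>\<close> within a time of order \<open>B\<^sub>1 / \<epsilon>\<^sub>\<alpha>\<^sub>\<beta>\<close>.
  So some species loses a sixteenth of its mass, and the total mass drops by a fixed factor depending
  on \<open>B\<^sub>2\<close>, in each window of length comparable to the inverse of the asserted rate.

  The relaxation estimate concerns solutions that start at time 0, whereas it is needed for data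
  given at later times. The states reachable from time 0 are dense among mean-zero data, by duality
  with the time-reversed equation and backward uniqueness, and the estimate passes to limits. Backward
  uniqueness also gives \<open>d(\<nu>) \<le> D / \<nu>\<close>, so that the smoothing cost is at most a power of \<open>1 / \<nu>\<close> for
  \<open>h = |log \<nu>| / d(\<nu>)\<close>, whatever the rate function is.
\<close>

subsection \<open>Differential calculus on the torus\<close>

text \<open>The hypothesis on \<open>u\<close> speaks about given classical solutions, so every
  solution used for comparison has to be built. \<open>passive_scalar_exists\<close> does this with
  heat averages and a Picard iteration, for C^2 data and with two spatial derivatives continuous
  down to time 0. It serves the density argument (forward and time-reversed), the bound on
  \<open>d\<close> (sine datum), and the equidistribution of a species: started from the state after
  smoothing, the passive profile stays above the species by the comparison principle, and the
  integral of the nonnegative difference is exactly the mass lost. This is the source of the error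
  of the size of the drop. The Nash inequality is proved with a weaker exponent than the sharp one.
  That is affordable, because a relaxation time of \<open>4 / \<delta>\<close> times
  \<open>|log \<nu>| / d(\<nu>)\<close> gains the power 4 of \<open>\<nu>\<close>, while smoothing
  costs only the power -3. A window is long enough for all species at once: smoothing and relaxation
  take at most a multiple of the maximum of \<open>|log \<nu>| / d(\<nu>)\<close>, and the rest is
  left to the reaction.\<close>

lemma C_space_imp_0: "C_space k J f \<Longrightarrow> C_space 0 J f"
  by (cases k) auto

lemma C_space_mono: "C_space k J f \<Longrightarrow> J' \<subseteq> J \<Longrightarrow> C_space k J' f"
proof (induction k arbitrary: f)
  case 0
  then show ?case by (auto intro: continuous_on_subset)
next
  case (Suc k)
  have "C_space 0 J' f" using Suc.prems by (auto intro: continuous_on_subset)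
  then show ?case using Suc by auto
qed

lemma C_space_SucD: "C_space (Suc k) J f \<Longrightarrow> C_space k J f"
proof (induction k arbitrary: f)
  case (Suc k)
  have "C_space k J (\<lambda>t. Dx (f t))" "C_space k J (\<lambda>t. Dy (f t))"
    using Suc.prems by (auto intro!: Suc.IH)
  then show ?case using Suc.prems by auto
qed auto

lemma C_space_0_time:
  assumes "C_space 0 J f" "continuous_on J' \<phi>" "\<phi> ` J' \<subseteq> J"
  shows "C_space 0 J' (\<lambda>t. f (\<phi> t))"
proof -
  have 1: "continuous_on (J' \<times> (UNIV :: (real \<times> real) set)) (\<lambda>q. (\<phi> (fst q), snd q))"
    by (rule continuous_on_Pair[OF continuous_on_compose2[OF assms(2)
        continuous_on_fst[OF continuous_on_id]] continuous_on_snd[OF continuous_on_id]]) auto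
  have 2: "continuous_on (J \<times> UNIV) (\<lambda>(t, p). f t p)"
    using assms(1) unfolding C_space.simps by blast
  have 3: "(\<lambda>q. (\<phi> (fst q), snd q)) ` (J' \<times> UNIV) \<subseteq> J \<times> (UNIV :: (real \<times> real) set)"
    using assms(3) by auto
  have "continuous_on (J' \<times> UNIV) (\<lambda>q. (\<lambda>(t, p). f t p) (\<phi> (fst q), snd q))"
    by (rule continuous_on_compose2[OF 2 1 3])
  moreover have "\<forall>t\<in>J'. periodic (f (\<phi> t))" using assms unfolding C_space.simps by blast
  ultimately show ?thesis unfolding C_space.simps case_prod_beta by simp
qed

lemma C_space_time:
  "C_space k J f \<Longrightarrow> continuous_on J' \<phi> \<Longrightarrow> \<phi> ` J' \<subseteq> J \<Longrightarrow> C_space k J' (\<lambda>t. f (\<phi> t))"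
proof (induction k arbitrary: f)
  case (Suc k)
  have "C_space 0 J' (\<lambda>t. f (\<phi> t))" by (rule C_space_0_time) (use Suc.prems in auto)
  then show ?case using Suc by auto
qed (rule C_space_0_time)

lemma C_space_at: "C_space k J f \<Longrightarrow> t \<in> J \<Longrightarrow> C_torus k (f t)"
  unfolding C_torus_def by (rule C_space_time[where \<phi>="\<lambda>_. t"]) auto

lemma C_space_const: "C_torus k f \<Longrightarrow> C_space k J (\<lambda>t. f)"
  unfolding C_torus_def by (rule C_space_mono) auto

lemma C_torus_0: "C_torus 0 f \<longleftrightarrow> periodic f \<and> continuous_on UNIV f"
proof -
  have "continuous_on UNIV f" if "continuous_on (UNIV \<times> UNIV) (\<lambda>(t::real, p). f p)"
    using continuous_on_compose2[OF that, where f="\<lambda>p. (0, p)" and s=UNIV]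
    by (auto simp: continuous_on_Pair continuous_on_const continuous_on_id)
  moreover have "continuous_on (UNIV \<times> UNIV) (\<lambda>(t::real, p). f p)" if "continuous_on UNIV f"
    unfolding case_prod_beta by (intro continuous_on_compose2[OF that] continuous_intros) auto
  ultimately show ?thesis by (auto simp: C_torus_def)
qed

lemma C_torus_imp_0: "C_torus k f \<Longrightarrow> C_torus 0 f"
  unfolding C_torus_def by (rule C_space_imp_0)

lemma C_torus_mono: "C_torus k f \<Longrightarrow> j \<le> k \<Longrightarrow> C_torus j f"
  unfolding C_torus_def
  by (induction k) (auto simp del: C_space.simps simp: le_Suc_eq dest: C_space_SucD)

lemma C_torus_Suc: "C_torus (Suc k) f \<Longrightarrow> C_torus k (Dx f) \<and> C_torus k (Dy f)"
  unfolding C_torus_def by auto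

lemma C_space_Dx: "C_space (Suc k) J f \<Longrightarrow> C_space k J (\<lambda>t. Dx (f t))"
  and C_space_Dy: "C_space (Suc k) J f \<Longrightarrow> C_space k J (\<lambda>t. Dy (f t))"
  by auto

lemma C_space_Dx_2: "C_space 2 J f \<Longrightarrow> C_space 1 J (\<lambda>t. Dx (f t))"
  and C_space_Dy_2: "C_space 2 J f \<Longrightarrow> C_space 1 J (\<lambda>t. Dy (f t))"
  by (auto simp: numeral_2_eq_2)

lemma C_space_2_1: "C_space 2 J f \<Longrightarrow> C_space 1 J f"
  using C_space_SucD[of 1 J f] by (simp add: numeral_2_eq_2)

lemma C_space_Dx_1: "C_space 1 J f \<Longrightarrow> C_space 0 J (\<lambda>t. Dx (f t))"
  and C_space_Dy_1: "C_space 1 J f \<Longrightarrow> C_space 0 J (\<lambda>t. Dy (f t))"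
  by (auto simp: numeral_2_eq_2)

lemma has_Dx: "C_torus 1 f \<Longrightarrow> ((\<lambda>s. f (s, y)) has_real_derivative Dx f (x, y)) (at x)"
  and has_Dy: "C_torus 1 f \<Longrightarrow> ((\<lambda>s. f (x, s)) has_real_derivative Dy f (x, y)) (at y)"
  by (auto simp: C_torus_def Dx_def Dy_def DERIV_deriv_iff_real_differentiable)

lemma Dx_eqI: "(\<And>x y. ((\<lambda>s. f (s, y)) has_real_derivative g (x, y)) (at x)) \<Longrightarrow> Dx f = g"
  by (auto simp: Dx_def fun_eq_iff intro: DERIV_imp_deriv)

lemma Dy_eqI: "(\<And>x y. ((\<lambda>s. f (x, s)) has_real_derivative g (x, y)) (at y)) \<Longrightarrow> Dy f = g"
  by (auto simp: Dy_def fun_eq_iff intro: DERIV_imp_deriv)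

lemma C_space_cong: "(\<And>t. t \<in> J \<Longrightarrow> f t = g t) \<Longrightarrow> C_space k J f \<longleftrightarrow> C_space k J g"
proof (induction k arbitrary: f g)
  case 0
  have "continuous_on (J \<times> UNIV) (\<lambda>(t, p). f t p) = continuous_on (J \<times> UNIV) (\<lambda>(t, p). g t p)"
    by (rule continuous_on_cong) (use 0 in auto)
  then show ?case using 0 by simp
next
  case (Suc k)
  have "continuous_on (J \<times> UNIV) (\<lambda>(t, p). f t p) = continuous_on (J \<times> UNIV) (\<lambda>(t, p). g t p)"
    by (rule continuous_on_cong) (use Suc in auto)
  moreover have "C_space k J (\<lambda>t. Dx (f t)) = C_space k J (\<lambda>t. Dx (g t))"
    "C_space k J (\<lambda>t. Dy (f t)) = C_space k J (\<lambda>t. Dy (g t))"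
    by (rule Suc.IH, simp add: Suc.prems)+
  ultimately show ?case using Suc.prems by simp
qed

lemma C_space_SucI:
  assumes "C_space 0 J f"
    and fx: "\<And>t x y. t \<in> J \<Longrightarrow> ((\<lambda>s. f t (s, y)) has_real_derivative fx t (x, y)) (at x)"
    and fy: "\<And>t x y. t \<in> J \<Longrightarrow> ((\<lambda>s. f t (x, s)) has_real_derivative fy t (x, y)) (at y)"
    and "C_space k J fx" "C_space k J fy"
  shows "C_space (Suc k) J f"
proof -
  have "Dx (f t) = fx t" "Dy (f t) = fy t" if "t \<in> J" for t
    using fx[OF that] fy[OF that] by (auto intro: Dx_eqI Dy_eqI)
  then have "C_space k J (\<lambda>t. Dx (f t))" "C_space k J (\<lambda>t. Dy (f t))"
    using assms(4,5) C_space_cong[of J "\<lambda>t. Dx (f t)" fx] C_space_cong[of J "\<lambda>t. Dy (f t)" fy] by auto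
  moreover have "(\<lambda>s. f t (s, y)) differentiable (at x)" "(\<lambda>s. f t (x, s)) differentiable (at y)"
    if "t \<in> J" for t x y
    unfolding real_differentiable_def using fx[OF that] fy[OF that] by blast+
  ultimately show ?thesis using assms(1) by simp
qed

lemma C_space_has_Dx: "C_space 1 J f \<Longrightarrow> t \<in> J \<Longrightarrow>
    ((\<lambda>s. f t (s, y)) has_real_derivative Dx (f t) (x, y)) (at x)"
  and C_space_has_Dy: "C_space 1 J f \<Longrightarrow> t \<in> J \<Longrightarrow>
    ((\<lambda>s. f t (x, s)) has_real_derivative Dy (f t) (x, y)) (at y)"
  using has_Dx has_Dy C_space_at by blast+

lemma C_space_Suc_1: "C_space (Suc k) J f \<Longrightarrow> C_space 1 J f"
proof (induction k)
  case (Suc k)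
  then show ?case using C_space_SucD by blast
qed auto

lemma C_space_0_add: "C_space 0 J f \<Longrightarrow> C_space 0 J g \<Longrightarrow> C_space 0 J (\<lambda>t p. f t p + g t p)"
  by (auto simp: periodic_def case_prod_beta intro!: continuous_intros)

lemma C_space_0_mult: "C_space 0 J f \<Longrightarrow> C_space 0 J g \<Longrightarrow> C_space 0 J (\<lambda>t p. f t p * g t p)"
  by (auto simp: periodic_def case_prod_beta intro!: continuous_intros)

lemma C_space_0_abs: "C_space 0 J f \<Longrightarrow> C_space 0 J (\<lambda>t p. \<bar>f t p\<bar>)"
  by (auto simp: periodic_def case_prod_beta intro!: continuous_intros)

lemma C_torus_const: "C_torus k (\<lambda>_. c :: real)"
proof (induction k arbitrary: c)
  case (Suc k)
  show ?case unfolding C_torus_def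
    by (rule C_space_SucI[where fx="\<lambda>_ _. 0" and fy="\<lambda>_ _. 0"])
      (use Suc in \<open>auto simp: C_torus_def periodic_def\<close>)
qed (simp add: C_torus_0 periodic_def)

declare C_space.simps [simp del]

lemma C_space_0: "C_space 0 J f \<longleftrightarrow> (\<forall>t\<in>J. periodic (f t)) \<and> continuous_on (J \<times> UNIV) (\<lambda>(t, p). f t p)"
  by (simp add: C_space.simps)

lemma C_space_add: "C_space k J f \<Longrightarrow> C_space k J g \<Longrightarrow> C_space k J (\<lambda>t p. f t p + g t p)"
proof (induction k arbitrary: f g)
  case (Suc k)
  show ?case
    by (rule C_space_SucI[OF C_space_0_add DERIV_add DERIV_add Suc.IH Suc.IH])
      (use Suc.prems in \<open>auto simp del: One_nat_def intro: C_space_imp_0 C_space_has_Dx C_space_has_Dy C_space_Suc_1 dest: C_space_Dx C_space_Dy\<close>)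
qed (rule C_space_0_add)

lemma C_space_mult: "C_space k J f \<Longrightarrow> C_space k J g \<Longrightarrow> C_space k J (\<lambda>t p. f t p * g t p)"
proof (induction k arbitrary: f g)
  case (Suc k)
  show ?case
    by (rule C_space_SucI[OF C_space_0_mult DERIV_mult DERIV_mult C_space_add C_space_add])
      (use Suc.prems in \<open>auto simp del: One_nat_def intro: C_space_imp_0 C_space_has_Dx C_space_has_Dy C_space_Suc_1
         intro!: Suc.IH dest: C_space_SucD C_space_Dx C_space_Dy\<close>)
qed (rule C_space_0_mult)

lemma C_space_const': "C_space k J (\<lambda>_ _. c :: real)"
  using C_space_const[OF C_torus_const] .

lemma C_space_cmult: "C_space k J f \<Longrightarrow> C_space k J (\<lambda>t p. c * f t p)"
  using C_space_mult[OF C_space_const'] .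

lemma C_space_diff: "C_space k J f \<Longrightarrow> C_space k J g \<Longrightarrow> C_space k J (\<lambda>t p. f t p - g t p)"
  using C_space_add[of k J f "\<lambda>t p. (-1) * g t p"] C_space_cmult[of k J g "-1"] by simp

lemma C_space_minus: "C_space k J f \<Longrightarrow> C_space k J (\<lambda>t p. - f t p)"
  using C_space_cmult[of k J f "-1"] by simp

lemma C_space_power2: "C_space k J f \<Longrightarrow> C_space k J (\<lambda>t p. (f t p)\<^sup>2)"
  unfolding power2_eq_square by (rule C_space_mult)

lemma C_space_sum: "(\<And>i. i \<in> A \<Longrightarrow> C_space k J (f i)) \<Longrightarrow> C_space k J (\<lambda>t p. \<Sum>i\<in>A. f i t p)"
  by (induction A rule: infinite_finite_induct) (auto intro: C_space_const' C_space_add)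

lemmas C_space_intros = C_space_add C_space_diff C_space_mult C_space_cmult C_space_minus
  C_space_power2 C_space_const'

lemma C_torus_add: "C_torus k f \<Longrightarrow> C_torus k g \<Longrightarrow> C_torus k (\<lambda>p. f p + g p)"
  and C_torus_diff: "C_torus k f \<Longrightarrow> C_torus k g \<Longrightarrow> C_torus k (\<lambda>p. f p - g p)"
  and C_torus_mult: "C_torus k f \<Longrightarrow> C_torus k g \<Longrightarrow> C_torus k (\<lambda>p. f p * g p)"
  and C_torus_cmult: "C_torus k f \<Longrightarrow> C_torus k (\<lambda>p. c * f p)"
  and C_torus_power2: "C_torus k f \<Longrightarrow> C_torus k (\<lambda>p. (f p)\<^sup>2)"
  and C_torus_minus: "C_torus k f \<Longrightarrow> C_torus k (\<lambda>p. - f p)"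
  unfolding C_torus_def
  by (auto simp del: C_space.simps intro: C_space_intros)

lemma C_torus_abs: "C_torus 0 f \<Longrightarrow> C_torus 0 (\<lambda>p. \<bar>f p\<bar>)"
  unfolding C_torus_def by (rule C_space_0_abs)

lemmas C_torus_intros = C_torus_add C_torus_diff C_torus_mult C_torus_cmult C_torus_power2 C_torus_minus
  C_torus_const

lemma Dx_add: "C_torus 1 f \<Longrightarrow> C_torus 1 g \<Longrightarrow> Dx (\<lambda>p. f p + g p) = (\<lambda>p. Dx f p + Dx g p)"
  and Dx_diff: "C_torus 1 f \<Longrightarrow> C_torus 1 g \<Longrightarrow> Dx (\<lambda>p. f p - g p) = (\<lambda>p. Dx f p - Dx g p)"
  and Dx_cmult: "C_torus 1 f \<Longrightarrow> Dx (\<lambda>p. c * f p) = (\<lambda>p. c * Dx f p)"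
  and Dx_mult: "C_torus 1 f \<Longrightarrow> C_torus 1 g \<Longrightarrow> Dx (\<lambda>p. f p * g p) = (\<lambda>p. Dx f p * g p + Dx g p * f p)"
  by (rule Dx_eqI; auto intro!: DERIV_add DERIV_diff DERIV_cmult DERIV_mult has_Dx)+

lemma Dy_add: "C_torus 1 f \<Longrightarrow> C_torus 1 g \<Longrightarrow> Dy (\<lambda>p. f p + g p) = (\<lambda>p. Dy f p + Dy g p)"
  and Dy_diff: "C_torus 1 f \<Longrightarrow> C_torus 1 g \<Longrightarrow> Dy (\<lambda>p. f p - g p) = (\<lambda>p. Dy f p - Dy g p)"
  and Dy_cmult: "C_torus 1 f \<Longrightarrow> Dy (\<lambda>p. c * f p) = (\<lambda>p. c * Dy f p)"
  and Dy_mult: "C_torus 1 f \<Longrightarrow> C_torus 1 g \<Longrightarrow> Dy (\<lambda>p. f p * g p) = (\<lambda>p. Dy f p * g p + Dy g p * f p)"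
  by (rule Dy_eqI; auto intro!: DERIV_add DERIV_diff DERIV_cmult DERIV_mult has_Dy)+

lemma C_torus_2D: "C_torus 2 f \<Longrightarrow> C_torus 1 f \<and> C_torus 1 (Dx f) \<and> C_torus 1 (Dy f)"
  using C_torus_Suc[of 1 f] C_torus_mono[of 2 f 1] by (simp add: numeral_2_eq_2)

lemma C_torus_1D: "C_torus 1 f \<Longrightarrow> C_torus 0 f \<and> C_torus 0 (Dx f) \<and> C_torus 0 (Dy f)"
  using C_torus_Suc[of 0 f] C_torus_mono[of 1 f 0] by simp

lemma laplacian_add: "C_torus 2 f \<Longrightarrow> C_torus 2 g \<Longrightarrow> laplacian (\<lambda>p. f p + g p) p = laplacian f p + laplacian g p"
  and laplacian_cmult: "C_torus 2 f \<Longrightarrow> laplacian (\<lambda>p. c * f p) p = c * laplacian f p"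
  using C_torus_2D[of f] C_torus_2D[of g] unfolding laplacian_def
  by (simp_all add: Dx_add Dy_add Dx_diff Dy_diff Dx_cmult Dy_cmult algebra_simps)

lemma C_torus_laplacian: "C_torus 2 f \<Longrightarrow> C_torus 0 (laplacian f)"
  using C_torus_2D C_torus_1D C_torus_add[of 0 "Dx (Dx f)" "Dy (Dy f)"] unfolding laplacian_def[abs_def]
  by blast

lemma C_space_laplacian: "C_space 2 J f \<Longrightarrow> C_space 0 J (\<lambda>t. laplacian (f t))"
  unfolding laplacian_def[abs_def]
  by (intro C_space_add C_space_Dx_1 C_space_Dy_1 C_space_Dx_2 C_space_Dy_2)

subsection \<open>Integration over the torus\<close>

abbreviation torus_cell :: "(real \<times> real) set" where
  "torus_cell \<equiv> cbox (-(1/2), -(1/2)) (1/2, 1/2)"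

lemma torus_integral_cbox:
  assumes "C_torus 0 f" shows "torus_integral f = integral torus_cell f"
proof -
  have c: "continuous_on torus_cell f"
    using assms by (auto simp: C_torus_0 intro: continuous_on_subset)
  have "set_integrable lborel torus_cell f"
    unfolding set_integrable_def
    by (rule borel_integrable_compact[OF compact_cbox c])
  from set_borel_integral_eq_integral(2)[OF this] show ?thesis
    by (simp add: torus_integral_def cbox_Pair_eq)
qed

lemma torus_integrable: "C_torus 0 f \<Longrightarrow> f integrable_on torus_cell"
  by (auto simp: C_torus_0 intro!: integrable_continuous intro: continuous_on_subset)

lemma torus_integral_add: "C_torus 0 f \<Longrightarrow> C_torus 0 g \<Longrightarrow>
    torus_integral (\<lambda>p. f p + g p) = torus_integral f + torus_integral g"
  by (simp add: torus_integral_cbox C_torus_intros integral_add torus_integrable)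

lemma torus_integral_diff: "C_torus 0 f \<Longrightarrow> C_torus 0 g \<Longrightarrow>
    torus_integral (\<lambda>p. f p - g p) = torus_integral f - torus_integral g"
  by (simp add: torus_integral_cbox C_torus_diff integral_diff torus_integrable)

lemma torus_integral_cmult: "C_torus 0 f \<Longrightarrow>
    torus_integral (\<lambda>p. c * f p) = c * torus_integral f"
  by (simp add: torus_integral_cbox C_torus_intros)

lemma torus_integral_minus: "C_torus 0 f \<Longrightarrow>
    torus_integral (\<lambda>p. - f p) = - torus_integral f"
  by (simp add: torus_integral_cbox C_torus_intros)

lemma torus_integral_const: "torus_integral (\<lambda>p. c) = c"
proof -
  have "measure lborel torus_cell = 1"
    by (subst content_Pair) simp
  then show ?thesis
  by (simp add: torus_integral_cbox C_torus_const)
qed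

lemma torus_integral_mono: "C_torus 0 f \<Longrightarrow> C_torus 0 g \<Longrightarrow> (\<And>p. f p \<le> g p) \<Longrightarrow>
    torus_integral f \<le> torus_integral g"
  by (simp add: torus_integral_cbox torus_integrable integral_le)

lemma torus_integral_nonneg: "C_torus 0 f \<Longrightarrow> (\<And>p. 0 \<le> f p) \<Longrightarrow> 0 \<le> torus_integral f"
  using torus_integral_mono[OF C_torus_const, of f 0] by (simp add: torus_integral_const)

lemma torus_integral_iterated:
  assumes "C_torus 0 f"
  shows "torus_integral f = integral {-(1/2)..1/2} (\<lambda>y. integral {-(1/2)..1/2} (\<lambda>x. f (x, y)))"
    and "torus_integral f = integral {-(1/2)..1/2} (\<lambda>x. integral {-(1/2)..1/2} (\<lambda>y. f (x, y)))"
proof -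
  have c: "continuous_on torus_cell f"
    using assms by (auto simp: C_torus_0 intro: continuous_on_subset)
  show 1: "torus_integral f = integral {-(1/2)..1/2} (\<lambda>x. integral {-(1/2)..1/2} (\<lambda>y. f (x, y)))"
    using integral_prod_continuous[OF c] assms by (simp add: torus_integral_cbox)
  show "torus_integral f = integral {-(1/2)..1/2} (\<lambda>y. integral {-(1/2)..1/2} (\<lambda>x. f (x, y)))"
    using integral_swap_continuous[of "-(1/2)" "-(1/2)" "1/2" "1/2" "\<lambda>x y. f (x, y)"] c 1 by simp
qed

lemma periodic_half:
  assumes "periodic f" shows "f (1/2, y) = f (-(1/2), y)" "f (x, 1/2) = f (x, -(1/2))"
proof -
  have "f (-1/2 + 1, y) = f (-1/2, y)" "f (x, -1/2 + 1) = f (x, -1/2)"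
    using assms unfolding periodic_def by blast+
  then show "f (1/2, y) = f (-(1/2), y)" "f (x, 1/2) = f (x, -(1/2))" by simp_all
qed

lemma torus_integral_Dx: assumes "C_torus 1 f" shows "torus_integral (Dx f) = 0"
proof -
  have "((\<lambda>x. Dx f (x, y)) has_integral f (1/2, y) - f (-(1/2), y)) {-(1/2)..1/2}" for y
    by (rule fundamental_theorem_of_calculus)
      (simp_all add: has_real_derivative_iff_has_vector_derivative[symmetric] has_field_derivative_at_within[OF has_Dx[OF assms]])
  moreover have "periodic f" using C_torus_1D[OF assms] by (simp add: C_torus_0)
  ultimately have "integral {-(1/2)..1/2} (\<lambda>x. Dx f (x, y)) = 0" for y
    by (simp add: integral_unique periodic_half(1)[of f])
  then show ?thesis using torus_integral_iterated(1)[of "Dx f"] C_torus_1D[OF assms] by simp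
qed

lemma torus_integral_Dy: assumes "C_torus 1 f" shows "torus_integral (Dy f) = 0"
proof -
  have "((\<lambda>y. Dy f (x, y)) has_integral f (x, 1/2) - f (x, -(1/2))) {-(1/2)..1/2}" for x
    by (rule fundamental_theorem_of_calculus)
      (simp_all add: has_real_derivative_iff_has_vector_derivative[symmetric] has_field_derivative_at_within[OF has_Dy[OF assms]])
  moreover have "periodic f" using C_torus_1D[OF assms] by (simp add: C_torus_0)
  ultimately have "integral {-(1/2)..1/2} (\<lambda>y. Dy f (x, y)) = 0" for x
    by (simp add: integral_unique periodic_half(2)[of f])
  then show ?thesis using torus_integral_iterated(2)[of "Dy f"] C_torus_1D[OF assms] by simp
qed

lemma torus_ibp_x: assumes "C_torus 1 f" "C_torus 1 g"
  shows "torus_integral (\<lambda>p. Dx f p * g p) = - torus_integral (\<lambda>p. f p * Dx g p)"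
proof -
  have "torus_integral (\<lambda>p. Dx f p * g p) + torus_integral (\<lambda>p. f p * Dx g p) =
      torus_integral (\<lambda>p. Dx f p * g p + f p * Dx g p)"
    using C_torus_1D[OF assms(1)] C_torus_1D[OF assms(2)]
    by (intro torus_integral_add[symmetric] C_torus_intros) auto
  also have "\<dots> = torus_integral (Dx (\<lambda>p. f p * g p))"
    using assms by (simp add: Dx_mult mult.commute)
  also have "\<dots> = 0" using assms by (intro torus_integral_Dx C_torus_mult)
  finally show ?thesis by simp
qed

lemma torus_ibp_y: assumes "C_torus 1 f" "C_torus 1 g"
  shows "torus_integral (\<lambda>p. Dy f p * g p) = - torus_integral (\<lambda>p. f p * Dy g p)"
proof -
  have "torus_integral (\<lambda>p. Dy f p * g p) + torus_integral (\<lambda>p. f p * Dy g p) =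
      torus_integral (\<lambda>p. Dy f p * g p + f p * Dy g p)"
    using C_torus_1D[OF assms(1)] C_torus_1D[OF assms(2)]
    by (intro torus_integral_add[symmetric] C_torus_intros) auto
  also have "\<dots> = torus_integral (Dy (\<lambda>p. f p * g p))"
    using assms by (simp add: Dy_mult mult.commute)
  also have "\<dots> = 0" using assms by (intro torus_integral_Dy C_torus_mult)
  finally show ?thesis by simp
qed

lemma C_space_0_cell: "C_space 0 J f \<Longrightarrow> continuous_on (J \<times> torus_cell) (\<lambda>(t, p). f t p)"
  by (auto simp: C_space_0 intro: continuous_on_subset)

lemma torus_integral_continuous:
  assumes "C_space 0 J f" shows "continuous_on J (\<lambda>t. torus_integral (f t))"
proof -
  have "continuous_on J (\<lambda>t. integral torus_cell (f t))"
    using integral_continuous_on_param[OF C_space_0_cell[OF assms]] .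
  moreover have "torus_integral (f t) = integral torus_cell (f t)" if "t \<in> J" for t
    using C_space_at[OF assms that] by (rule torus_integral_cbox)
  ultimately show ?thesis by simp
qed

lemma torus_integral_deriv:
  assumes "open J" "t \<in> J" "C_space 0 J f" "C_space 0 J f'"
    and d: "\<And>t p. t \<in> J \<Longrightarrow> ((\<lambda>s. f s p) has_real_derivative f' t p) (at t)"
  shows "((\<lambda>t. torus_integral (f t)) has_real_derivative torus_integral (f' t)) (at t)"
proof -
  obtain e where e: "e > 0" "ball t e \<subseteq> J" using assms(1,2) openE by blast
  have "((\<lambda>t. integral torus_cell (f t)) has_field_derivative integral torus_cell (f' t)) (at t within ball t e)"
  proof (rule leibniz_rule_field_derivative)
    show "((\<lambda>s. f s p) has_real_derivative f' s p) (at s within ball t e)" if "s \<in> ball t e" for s p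
      by (rule has_field_derivative_at_within[OF d]) (use e that in auto)
    show "f s integrable_on torus_cell" if "s \<in> ball t e" for s
      using e that by (auto intro!: torus_integrable C_space_at[OF assms(3)])
  qed (use e C_space_0_cell[OF C_space_mono[OF assms(4) e(2)]] in auto)
  then have "((\<lambda>t. integral torus_cell (f t)) has_field_derivative integral torus_cell (f' t)) (at t)"
    using e by (metis at_within_open centre_in_ball open_ball)
  then have "((\<lambda>t. integral torus_cell (f t)) has_real_derivative torus_integral (f' t)) (at t)"
    using torus_integral_cbox[OF C_space_at[OF assms(4,2)]] by simp
  then show ?thesis
    by (rule DERIV_cong_ev[THEN iffD1, rotated -1])
      (use C_space_at[OF assms(3)] in \<open>auto simp: torus_integral_cbox intro!: eventually_mono[OF eventually_nhds_in_open[OF assms(1,2)]]\<close>)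
qed

section \<open>The Cauchy-Schwarz inequality on the torus\<close>

lemma quadratic_discrim:
  fixes a b c :: real assumes "\<And>x. 0 \<le> a + 2 * x * b + x\<^sup>2 * c" shows "b\<^sup>2 \<le> a * c"
proof -
  have "c \<ge> 0"
  proof (rule ccontr)
    assume c: "\<not> c \<ge> 0"
    \<comment> \<open>If \<open>c\<close> were negative, the quadratic would be negative far out: at
      this point, which is at least 1, the term \<open>x\<^sup>2 * c\<close> outweighs
      \<open>a + 2 * x * b\<close>.\<close>
    define x where "x = (\<bar>a\<bar> + 1 + 2*\<bar>b\<bar>) / (-c) + 1"
    have x: "x \<ge> 1" "x * (-c) \<ge> \<bar>a\<bar> + 1 + 2*\<bar>b\<bar>" using c by (auto simp: x_def field_simps)
    have "x * (x * (-c)) \<ge> x * (\<bar>a\<bar> + 1 + 2*\<bar>b\<bar>)" using x by (intro mult_left_mono) auto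
    moreover have "x * (\<bar>a\<bar> + 1 + 2*\<bar>b\<bar>) > a + 2*x*b"
    proof -
      have "x * \<bar>a\<bar> \<ge> a" using x mult_right_mono[of 1 x "\<bar>a\<bar>"] by auto
      moreover have "x * \<bar>b\<bar> \<ge> x * b" using x by (intro mult_left_mono) auto
      ultimately have "a + 2*(x*b) \<le> x * \<bar>a\<bar> + 2 * (x * \<bar>b\<bar>)" by linarith
      then show ?thesis using x by (simp add: algebra_simps)
    qed
    moreover have "0 \<le> a + 2*x*b + x\<^sup>2 * c" using assms .
    ultimately show False by (simp add: power2_eq_square algebra_simps)
  qed
  show ?thesis
  proof (cases "c = 0")
    case True
    have "b = 0"
    proof (rule ccontr)
      assume b: "b \<noteq> 0"
      \<comment> \<open>At this point the affine function \<open>a + 2 * x * b\<close> has the value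
        -1.\<close>
      show False using assms[of "-(a+1)/(2*b)"] b True by (simp add: field_simps)
    qed
    then show ?thesis using True by simp
  next
    case False
    then have "c > 0" using \<open>c \<ge> 0\<close> by simp
    have "0 \<le> a + 2 * (-b/c) * b + (-b/c)\<^sup>2 * c" by (rule assms)
    also have "\<dots> = a - b\<^sup>2 / c" using \<open>c > 0\<close> by (simp add: field_simps power2_eq_square)
    finally show ?thesis using \<open>c > 0\<close> by (simp add: field_simps)
  qed
qed

lemma torus_Cauchy_Schwarz:
  assumes "C_torus 0 f" "C_torus 0 g"
  shows "(torus_integral (\<lambda>p. f p * g p))\<^sup>2 \<le> torus_integral (\<lambda>p. (f p)\<^sup>2) * torus_integral (\<lambda>p. (g p)\<^sup>2)"
proof (rule quadratic_discrim)
  fix x :: real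
  have "0 \<le> torus_integral (\<lambda>p. (f p + x * g p)\<^sup>2)"
    using assms by (intro torus_integral_nonneg C_torus_intros) auto
  also have "(\<lambda>p. (f p + x * g p)\<^sup>2) = (\<lambda>p. (f p)\<^sup>2 + (2 * x) * (f p * g p) + x\<^sup>2 * (g p)\<^sup>2)"
    by (auto simp: power2_eq_square algebra_simps)
  also have "torus_integral \<dots> = torus_integral (\<lambda>p. (f p)\<^sup>2) + 2 * x * torus_integral (\<lambda>p. f p * g p)
      + x\<^sup>2 * torus_integral (\<lambda>p. (g p)\<^sup>2)"
    using assms by (simp add: torus_integral_add torus_integral_cmult C_torus_intros)
  finally show "0 \<le> torus_integral (\<lambda>p. (f p)\<^sup>2) + 2 * x * torus_integral (\<lambda>p. f p * g p)
      + x\<^sup>2 * torus_integral (\<lambda>p. (g p)\<^sup>2)" .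
qed

subsection \<open>Parametric expectations\<close>

text \<open>Dominated convergence along sequences, which suffices in a first-countable space.
  Applied to pairs of time and position it gives the joint continuity of heat averages.\<close>

lemma continuous_on_integral_param:
  fixes X :: "'a::first_countable_topology \<Rightarrow> 'w \<Rightarrow> real"
  assumes m: "\<And>x. x \<in> S \<Longrightarrow> X x \<in> borel_measurable M"
    and W: "integrable M W"
    and c: "\<And>w. continuous_on S (\<lambda>x. X x w)"
    and b: "\<And>x w. x \<in> S \<Longrightarrow> \<bar>X x w\<bar> \<le> W w"
  shows "continuous_on S (\<lambda>x. \<integral>w. X x w \<partial>M)"
  unfolding continuous_on_def tendsto_at_iff_sequentially comp_def
proof (intro ballI allI impI)
  fix x and Y :: "nat \<Rightarrow> 'a"
  assume x: "x \<in> S" and Y: "\<forall>i. Y i \<in> S - {x}" "Y \<longlonglongrightarrow> x"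
  show "(\<lambda>i. \<integral>w. X (Y i) w \<partial>M) \<longlonglongrightarrow> (\<integral>w. X x w \<partial>M)"
  proof (rule integral_dominated_convergence[where w=W])
    show "AE w in M. (\<lambda>i. X (Y i) w) \<longlonglongrightarrow> X x w"
      using c x Y unfolding continuous_on_def tendsto_at_iff_sequentially comp_def by auto
  qed (use m W b x Y in auto)
qed

lemma integrable_bound_real:
  fixes f :: "'w \<Rightarrow> real"
  shows "integrable M W \<Longrightarrow> f \<in> borel_measurable M \<Longrightarrow> (\<And>w. \<bar>f w\<bar> \<le> W w) \<Longrightarrow> integrable M f"
  by (rule Bochner_Integration.integrable_bound[where f=W]) (auto intro: order_trans[OF _ abs_ge_self])

text \<open>Dominated convergence for difference quotients, which the mean value inequality bounds
  by the majorant \<open>W\<close> of the derivative. Working on an interval around \<open>x\<close>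
  allows majorants that are only local in the parameter.\<close>

lemma has_real_derivative_integral_param:
  fixes X :: "real \<Rightarrow> 'w \<Rightarrow> real"
  assumes S: "x \<in> {a<..<b}"
    and i: "\<And>x. x \<in> {a<..<b} \<Longrightarrow> integrable M (X x)"
    and m: "X' x \<in> borel_measurable M"
    and W: "integrable M W"
    and d: "\<And>x w. x \<in> {a<..<b} \<Longrightarrow> ((\<lambda>x. X x w) has_real_derivative X' x w) (at x)"
    and bd: "\<And>x w. x \<in> {a<..<b} \<Longrightarrow> \<bar>X' x w\<bar> \<le> W w"
  shows "((\<lambda>x. \<integral>w. X x w \<partial>M) has_real_derivative (\<integral>w. X' x w \<partial>M)) (at x)"
proof -
  have "((\<lambda>y. ((\<integral>w. X y w \<partial>M) - (\<integral>w. X x w \<partial>M)) / (y - x)) \<longlongrightarrow> (\<integral>w. X' x w \<partial>M)) (at x within {a<..<b})"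
    unfolding tendsto_at_iff_sequentially comp_def
  proof (intro allI impI)
    fix Y assume Y: "\<forall>i. Y i \<in> {a<..<b} - {x}" "Y \<longlonglongrightarrow> x"
    have "(\<lambda>i. \<integral>w. (X (Y i) w - X x w) / (Y i - x) \<partial>M) \<longlonglongrightarrow> (\<integral>w. X' x w \<partial>M)"
    proof (rule integral_dominated_convergence[where w=W])
      show "(\<lambda>w. (X (Y n) w - X x w) / (Y n - x)) \<in> borel_measurable M" for n
        using i[THEN borel_measurable_integrable] S Y by (intro borel_measurable_divide borel_measurable_diff) auto
      have "((\<lambda>y. (X y w - X x w) / (y - x)) \<longlongrightarrow> X' x w) (at x within {a<..<b})" for w
        using has_field_derivative_at_within[OF d[OF S]] unfolding has_field_derivative_iff .
      then show "AE w in M. (\<lambda>i. (X (Y i) w - X x w) / (Y i - x)) \<longlonglongrightarrow> X' x w"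
        using Y unfolding tendsto_at_iff_sequentially comp_def by auto
      have "\<bar>(X (Y n) w - X x w) / (Y n - x)\<bar> \<le> W w" for n w
      proof -
        have "norm (X (Y n) w - X x w) \<le> W w * norm (Y n - x)"
          by (rule field_differentiable_bound[where S="{a<..<b}" and f'="\<lambda>x. X' x w"])
            (use S Y in \<open>auto intro!: has_field_derivative_at_within[OF d] bd\<close>)
        then show ?thesis using Y by (simp add: abs_divide divide_le_eq)
      qed
      then show "\<And>n. AE w in M. norm ((X (Y n) w - X x w) / (Y n - x)) \<le> W w" by simp
    qed (use m W in auto)
    moreover have "(\<integral>w. (X (Y n) w - X x w) / (Y n - x) \<partial>M) = ((\<integral>w. X (Y n) w \<partial>M) - (\<integral>w. X x w \<partial>M)) / (Y n - x)" for n
    proof -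
      have "integrable M (X (Y n))" using i Y by auto
      then show ?thesis using i[OF S] by (simp add: Bochner_Integration.integral_diff)
    qed
    ultimately show "(\<lambda>i. ((\<integral>w. X (Y i) w \<partial>M) - (\<integral>w. X x w \<partial>M)) / (Y i - x)) \<longlonglongrightarrow> (\<integral>w. X' x w \<partial>M)"
      by (simp only:)
  qed
  then show ?thesis
    using S by (simp add: has_field_derivative_iff at_within_open[of x "{a<..<b}"])
qed

text \<open>Continuity is local in time, whereas integrable majorants and uniform convergence are
  only at hand on bounded time intervals.\<close>

lemma C_space_local:
  assumes "\<And>T. C_space 0 {0..T} f" shows "C_space 0 {0..} f"
proof -
  have "periodic (f t)" if "t \<ge> 0" for t using assms[of t] that by (auto simp: C_space_0)
  moreover have "continuous_on ({0..} \<times> UNIV) (\<lambda>(t, p). f t p)"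
    unfolding continuous_on_eq_continuous_within
  proof
    fix q :: "real \<times> (real \<times> real)" assume q: "q \<in> {0..} \<times> UNIV"
    have "continuous (at q within {0..fst q + 1} \<times> UNIV) (\<lambda>(t, p). f t p)"
      using assms[of "fst q + 1"] q by (force simp: C_space_0 continuous_on_eq_continuous_within)
    moreover have "at q within {0..} \<times> UNIV = at q within {0..fst q + 1} \<times> UNIV"
      by (rule at_within_nhd[of _ "{..<fst q + 1} \<times> UNIV"]) (use q in \<open>auto simp: mem_Times_iff intro: open_Times\<close>)
    ultimately show "continuous (at q within {0..} \<times> UNIV) (\<lambda>(t, p). f t p)" by (simp add: continuous_within)
  qed
  ultimately show ?thesis by (auto simp: C_space_0)
qed

lemma periodic_int:
  assumes "periodic f" shows "f (x + of_int k, y + of_int l) = f (x, y)"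
proof -
  have n: "f (x + of_nat k, y) = f (x, y)" "f (x, y + of_nat k) = f (x, y)" for x y and k :: nat
  proof (induction k)
    case (Suc k)
    have "f ((x + of_nat k) + 1, y) = f (x + of_nat k, y)" "f (x, (y + of_nat k) + 1) = f (x, y + of_nat k)"
      using assms unfolding periodic_def by blast+
    with Suc show "f (x + of_nat (Suc k), y) = f (x, y)" "f (x, y + of_nat (Suc k)) = f (x, y)"
      by (simp_all add: add_ac)
  qed auto
  have "f (x + of_int k, y) = f (x, y)" for x y
    using n(1)[of x "nat k" y] n(1)[of "x + of_int k" "nat (-k)" y]
    by (cases "k \<ge> 0") (auto simp: of_nat_nat)
  moreover have "f (x, y + of_int l) = f (x, y)" for x y
    using n(2)[of x y "nat l"] n(2)[of x "y + of_int l" "nat (-l)"]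
    by (cases "l \<ge> 0") (auto simp: of_nat_nat)
  ultimately show ?thesis by simp
qed

lemma periodic_cell:
  assumes "periodic f" obtains q where "q \<in> torus_cell" "f q = f p"
proof (rule that)
  \<comment> \<open>Subtracting the nearest integer moves each coordinate into the fundamental
    square.\<close>
  let ?q = "(fst p + of_int (- \<lfloor>fst p + 1/2\<rfloor>), snd p + of_int (- \<lfloor>snd p + 1/2\<rfloor>))"
  show "?q \<in> torus_cell"
    using floor_correct[of "fst p + 1/2"] floor_correct[of "snd p + 1/2"]
    by (simp add: cbox_Pair_eq) linarith
  show "f ?q = f p" by (subst periodic_int[OF assms]) simp
qed

lemma C_space_bounded:
  assumes "C_space k J f" "compact K" "K \<subseteq> J"
  obtains B where "0 \<le> B" "\<And>t p. t \<in> K \<Longrightarrow> \<bar>f t p\<bar> \<le> B"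
proof -
  have f: "C_space 0 K f" using C_space_mono[OF C_space_imp_0[OF assms(1)] assms(3)] .
  have "compact ((\<lambda>(t, p). f t p) ` (K \<times> torus_cell))"
    by (intro compact_continuous_image compact_Times assms C_space_0_cell[OF f]) auto
  then obtain B where B: "\<And>x. x \<in> (\<lambda>(t, p). f t p) ` (K \<times> torus_cell) \<Longrightarrow> norm x \<le> B"
    using compact_imp_bounded bounded_iff by metis
  have "\<bar>f t p\<bar> \<le> \<bar>B\<bar>" if "t \<in> K" for t p
  proof -
    have "periodic (f t)" using f that by (auto simp: C_space_0)
    from periodic_cell[OF this] obtain q where "q \<in> torus_cell" "f t q = f t p" by metis
    then have "f t p \<in> (\<lambda>(t, p). f t p) ` (K \<times> torus_cell)"
      using that by (intro image_eqI[where x="(t, q)"]) auto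
    from B[OF this] show ?thesis by simp
  qed
  then show ?thesis by (intro that[of "\<bar>B\<bar>"]) auto
qed

subsection \<open>Gaussian measures\<close>

abbreviation gauss :: "real measure" where "gauss \<equiv> std_normal_distribution"

lemma sets_gauss[measurable_cong]: "sets gauss = sets borel" by simp

lemma prob_gauss: "prob_space gauss"
  using real_dist_normal_dist by (simp add: real_distribution_def)

interpretation gauss: prob_space gauss by (rule prob_gauss)

lemma integrable_gauss_abs: "integrable gauss (\<lambda>z. \<bar>z\<bar>)"
  using integrable_abs[OF integrable_std_normal_distribution_moment[of 1]] by simp

text \<open>This is \<open>\<integral> (\<phi> g)' = 0\<close> for the Gaussian density \<open>\<phi>\<close>, as \<open>\<phi>' = - z \<phi>\<close>.\<close>

lemma gauss_ibp:
  assumes d: "\<And>z. (g has_real_derivative g' z) (at z)" and c: "continuous_on UNIV g'"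
    and b: "\<And>z. \<bar>g z\<bar> \<le> B" "\<And>z. \<bar>g' z\<bar> \<le> B"
  shows "(\<integral>z. g' z \<partial>gauss) = (\<integral>z. z * g z \<partial>gauss)"
proof -
  let ?\<phi> = std_normal_density
  have cg: "continuous_on UNIV g" using d DERIV_isCont continuous_at_imp_continuous_on by blast
  have m[measurable]: "g \<in> borel_measurable borel" "g' \<in> borel_measurable borel"
    using borel_measurable_continuous_onI c cg by auto
  have i1: "integrable gauss g'"
    by (rule gauss.integrable_const_bound[of _ B]) (use b in auto)
  have i2: "integrable gauss (\<lambda>z. z * g z)"
  proof (rule integrable_bound_real[where W="\<lambda>z. \<bar>z\<bar> * B"])
    show "\<bar>z * g z\<bar> \<le> \<bar>z\<bar> * B" for z using b by (simp add: abs_mult mult_left_mono)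
  qed (use integrable_gauss_abs in auto)
  have i: "integrable lborel (\<lambda>z. ?\<phi> z * (g' z - z * g z))"
    using Bochner_Integration.integrable_diff[OF i1 i2] by (subst (asm) integrable_density) auto
  have d\<phi>: "(?\<phi> has_real_derivative - z * ?\<phi> z) (at z)" for z
    unfolding std_normal_density_def[abs_def] by (auto intro!: derivative_eq_intros simp: field_simps)
  have cphi: "isCont ?\<phi> z" for z using d\<phi> DERIV_isCont by blast
  have sq: "filterlim (\<lambda>z::real. z\<^sup>2 / 2) at_top at_top"
    by (rule filterlim_at_top_mono[OF filterlim_ident])
      (auto simp: power2_eq_square intro!: eventually_at_top_linorderI[of 2])
  have top: "(?\<phi> \<longlongrightarrow> 0) at_top"
  proof -
    have "((\<lambda>z. exp (- (z\<^sup>2 / 2))) \<longlongrightarrow> (0::real)) at_top"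
      by (rule filterlim_compose[OF exp_at_bot]) (use sq in \<open>simp add: filterlim_uminus_at_bot\<close>)
    from tendsto_mult_right_zero[OF this, of "1 / sqrt (2 * pi)"] show ?thesis
      unfolding std_normal_density_def[abs_def] by simp
  qed
  have bot: "(?\<phi> \<longlongrightarrow> 0) at_bot"
    using top unfolding filterlim_at_bot_mirror std_normal_density_def[abs_def] by simp
  have lim: "((\<lambda>z. ?\<phi> z * g z) \<longlongrightarrow> 0) F" if "(?\<phi> \<longlongrightarrow> 0) F" for F
  proof (rule Lim_null_comparison)
    show "\<forall>\<^sub>F z in F. norm (?\<phi> z * g z) \<le> ?\<phi> z * B"
      using b by (intro always_eventually allI) (simp add: abs_mult mult_left_mono)
    show "((\<lambda>z. ?\<phi> z * B) \<longlongrightarrow> 0) F" using tendsto_mult_left_zero[OF that] .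
  qed
  have "(LBINT z=-\<infinity>..\<infinity>. ?\<phi> z * (g' z - z * g z)) = 0 - 0"
  proof (rule interval_integral_FTC_integrable[where F="\<lambda>z. ?\<phi> z * g z"])
    show "((\<lambda>z. ?\<phi> z * g z) has_vector_derivative ?\<phi> z * (g' z - z * g z)) (at z)" for z
      unfolding has_real_derivative_iff_has_vector_derivative[symmetric]
      by (rule derivative_eq_intros d\<phi> d refl)+ (simp add: algebra_simps)
    show "isCont (\<lambda>z. ?\<phi> z * (g' z - z * g z)) z" for z
      using c cg by (intro continuous_intros cphi) (auto simp: continuous_on_eq_continuous_at)
    show "set_integrable lborel (einterval (- \<infinity>) \<infinity>) (\<lambda>z. ?\<phi> z * (g' z - z * g z))"
      using i by (simp add: set_integrable_def)
  qed (use lim[OF top] lim[OF bot] in \<open>auto simp: ereal_tendsto_simps1\<close>)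
  then have "(\<integral>z. ?\<phi> z * (g' z - z * g z) \<partial>lborel) = 0"
    by (simp add: interval_lebesgue_integral_def set_lebesgue_integral_def)
  then have "(\<integral>z. g' z - z * g z \<partial>gauss) = 0" by (subst integral_density) auto
  then show ?thesis using i1 i2 by simp
qed

section \<open>The product measure behind heat averages\<close>

abbreviation gauss2 :: "(real \<times> real) measure" where "gauss2 \<equiv> gauss \<Otimes>\<^sub>M gauss"

abbreviation unif :: "real measure" where "unif \<equiv> uniform_measure lborel {0..1}"

text \<open>The Gaussian pair is the displacement of the heat kernel in the plane; the uniform
  coordinate parametrises the time integral in Duhamel's formula. A Duhamel term is thus a single
  expectation, accessible to dominated convergence and integration by parts.\<close>

definition heatM :: "((real \<times> real) \<times> real) measure" where "heatM = gauss2 \<Otimes>\<^sub>M unif"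

lemma prob_unif: "prob_space unif"
  by (rule prob_space_uniform_measure) auto

interpretation unif: prob_space unif by (rule prob_unif)

interpretation gauss2: pair_prob_space gauss gauss ..

interpretation heatP: pair_prob_space gauss2 unif ..

interpretation heatM: prob_space heatM unfolding heatM_def by (rule heatP.P.prob_space_axioms)

lemma sets_gauss2: "sets gauss2 = sets borel"
  by (metis borel_prod sets_gauss sets_pair_measure_cong)

lemma sets_heatM: "sets heatM = sets borel"
proof -
  have "sets unif = sets borel" by simp
  then show ?thesis unfolding heatM_def by (metis borel_prod sets_gauss2 sets_pair_measure_cong)
qed

lemma measurable_heatM: "continuous_on UNIV f \<Longrightarrow> f \<in> borel_measurable heatM"
  using borel_measurable_continuous_onI measurable_cong_sets[OF sets_heatM refl] by blast

lemma measurable_gauss2: "continuous_on UNIV f \<Longrightarrow> f \<in> borel_measurable gauss2"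
  using borel_measurable_continuous_onI measurable_cong_sets[OF sets_gauss2 refl] by blast

lemma integrable_pair_fst:
  fixes f :: "'a \<Rightarrow> real"
  assumes "prob_space M2" "integrable M1 f" shows "integrable (M1 \<Otimes>\<^sub>M M2) (\<lambda>w. f (fst w))"
proof -
  have "integrable (distr (M1 \<Otimes>\<^sub>M M2) M1 fst) f"
    using prob_space.distr_pair_fst[OF assms(1), of M1] assms(2) by simp
  then show ?thesis by (rule integrable_distr[rotated]) simp
qed

lemma integrable_pair_snd:
  fixes f :: "'a \<Rightarrow> real"
  assumes "prob_space M1" "prob_space M2" "integrable M2 f"
  shows "integrable (M1 \<Otimes>\<^sub>M M2) (\<lambda>w. f (snd w))"
proof -
  interpret p: pair_sigma_finite M2 M1
    using assms by (simp add: pair_sigma_finite_def prob_space_imp_sigma_finite)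
  show ?thesis
    using p.integrable_product_swap[OF integrable_pair_fst[OF assms(1,3)]] by (simp add: case_prod_beta')
qed

lemma integrable_gauss2_abs: "integrable gauss2 (\<lambda>z. \<bar>fst z\<bar> + \<bar>snd z\<bar>)"
  by (intro Bochner_Integration.integrable_add integrable_pair_fst[OF prob_gauss integrable_gauss_abs]
      integrable_pair_snd[OF prob_gauss prob_gauss integrable_gauss_abs])

text \<open>Up to a factor 2, one integrable majorant for all weights that occur in heat averages:
  1, twice the uniform coordinate, and a component of the Gaussian displacement.\<close>

definition heat_weight :: "(real \<times> real) \<times> real \<Rightarrow> real" where
  "heat_weight w = 1 + \<bar>fst (fst w)\<bar> + \<bar>snd (fst w)\<bar> + \<bar>snd w\<bar>"

lemma integrable_heat_weight: "integrable heatM heat_weight"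
proof -
  have "integrable unif (\<lambda>r. \<bar>r\<bar>)"
  proof (rule unif.integrable_const_bound[of _ 1])
    show "AE r in unif. norm \<bar>r\<bar> \<le> 1" by (rule AE_uniform_measureI) auto
  qed simp
  note 1 = integrable_pair_snd[OF gauss2.P.prob_space_axioms prob_unif this]
  note 2 = integrable_pair_fst[OF prob_unif integrable_gauss2_abs]
  have "integrable heatM (\<lambda>w. 1 + ((\<bar>fst (fst w)\<bar> + \<bar>snd (fst w)\<bar>) + \<bar>snd w\<bar>))"
    unfolding heatM_def
    by (rule Bochner_Integration.integrable_add[OF heatP.P.integrable_const Bochner_Integration.integrable_add[OF 2 1]])
  then show ?thesis unfolding heat_weight_def[abs_def] by (simp add: add_ac)
qed

lemma heat_weight_ge:
  "1 \<le> heat_weight w" "\<bar>snd w\<bar> \<le> heat_weight w" "e \<in> Basis \<Longrightarrow> \<bar>fst w \<bullet> e\<bar> \<le> heat_weight w"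
  by (auto simp: heat_weight_def Basis_prod_def inner_prod_def)

lemma gauss2_ibp:
  fixes g :: "real \<times> real \<Rightarrow> real"
  assumes e: "e \<in> Basis"
    and d: "\<And>z. ((\<lambda>h. g (z + h *\<^sub>R e)) has_real_derivative g' z) (at 0)"
    and c: "continuous_on UNIV g" "continuous_on UNIV g'"
    and b: "\<And>z. \<bar>g z\<bar> \<le> B" "\<And>z. \<bar>g' z\<bar> \<le> B"
  shows "integrable gauss2 g'" "integrable gauss2 (\<lambda>z. (z \<bullet> e) * g z)"
    "(\<integral>z. g' z \<partial>gauss2) = (\<integral>z. (z \<bullet> e) * g z \<partial>gauss2)"
proof -
  show i1: "integrable gauss2 g'"
    by (rule gauss2.P.integrable_const_bound[of _ B]) (use b measurable_gauss2 c in auto)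
  have "integrable gauss2 (\<lambda>z. (\<bar>fst z\<bar> + \<bar>snd z\<bar>) * B)" using integrable_gauss2_abs by simp
  then show i2: "integrable gauss2 (\<lambda>z. (z \<bullet> e) * g z)"
  proof (rule integrable_bound_real)
    show "(\<lambda>z. (z \<bullet> e) * g z) \<in> borel_measurable gauss2"
      by (intro measurable_gauss2 continuous_intros c)
    have "\<bar>z \<bullet> e\<bar> \<le> \<bar>fst z\<bar> + \<bar>snd z\<bar>" for z using e by (auto simp: Basis_prod_def inner_prod_def)
    then show "\<bar>z \<bullet> e * g z\<bar> \<le> (\<bar>fst z\<bar> + \<bar>snd z\<bar>) * B" for z
      unfolding abs_mult using b by (intro mult_mono) auto
  qed
  have sh: "((\<lambda>s. g (z + (s - a) *\<^sub>R e)) has_real_derivative g' (z + (s - a) *\<^sub>R e)) (at s)" for z s a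
  proof -
    have "((\<lambda>h. g ((z + (s - a) *\<^sub>R e) + h *\<^sub>R e)) has_real_derivative g' (z + (s - a) *\<^sub>R e)) (at 0)"
      by (rule d)
    then have "((\<lambda>h. g (z + (h + s - a) *\<^sub>R e)) has_real_derivative g' (z + (s - a) *\<^sub>R e)) (at 0)"
      by (simp add: algebra_simps)
    then show ?thesis using DERIV_shift[of "\<lambda>h. g (z + (h - a) *\<^sub>R e)" _ 0 s] by (simp add: algebra_simps)
  qed
  consider "e = (1, 0)" | "e = (0, 1)" using e by (auto simp: Basis_prod_def)
  then show "(\<integral>z. g' z \<partial>gauss2) = (\<integral>z. (z \<bullet> e) * g z \<partial>gauss2)"
  proof cases
    case 1
    have *: "(\<integral>x. g' (x, y) \<partial>gauss) = (\<integral>x. x * g (x, y) \<partial>gauss)" for y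
      by (rule gauss_ibp[where B=B])
        (use sh[where z="(0, y)" and a=0] b c 1 in \<open>auto intro!: continuous_intros intro: continuous_on_compose2[OF c(2)]\<close>)
    show ?thesis
      using gauss2.integral_snd[of "\<lambda>x y. g' (x, y)"] gauss2.integral_snd[of "\<lambda>x y. x * g (x, y)"]
        i1 i2 * 1 by (simp add: case_prod_beta' inner_prod_def)
  next
    case 2
    have *: "(\<integral>y. g' (x, y) \<partial>gauss) = (\<integral>y. y * g (x, y) \<partial>gauss)" for x
      by (rule gauss_ibp[where B=B])
        (use sh[where z="(x, 0)" and a=0] b c 2 in \<open>auto intro!: continuous_intros intro: continuous_on_compose2[OF c(2)]\<close>)
    show ?thesis
      using gauss2.integral_fst'[of "\<lambda>(x, y). g' (x, y)"] gauss2.integral_fst'[of "\<lambda>(x, y). y * g (x, y)"]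
        i1 i2 * 2 by (simp add: case_prod_beta' inner_prod_def)
  qed
qed

text \<open>The bound on \<open>g'\<close> may grow with the uniform coordinate \<open>r\<close>,
  because differentiating in \<open>z\<close> a function of
  \<open>p + (\<kappa> * sqrt t * r) *\<^sub>R z\<close> brings down a factor \<open>r\<close>, and
  pointwise bounds are asked for all \<open>r\<close>, not only those in
  \<open>{0..1}\<close>.\<close>

lemma heatM_ibp:
  fixes g :: "(real \<times> real) \<times> real \<Rightarrow> real"
  assumes e: "e \<in> Basis"
    and d: "\<And>z r. ((\<lambda>h. g (z + h *\<^sub>R e, r)) has_real_derivative g' (z, r)) (at 0)"
    and c: "continuous_on UNIV g" "continuous_on UNIV g'"
    and b: "\<And>w. \<bar>g w\<bar> \<le> B" "\<And>w. \<bar>g' w\<bar> \<le> B * (1 + \<bar>snd w\<bar>)"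
  shows "(\<integral>w. g' w \<partial>heatM) = (\<integral>w. (fst w \<bullet> e) * g w \<partial>heatM)"
proof -
  have B: "0 \<le> B" using b(1)[of undefined] by (rule order_trans[OF abs_ge_zero])
  have *: "(\<integral>z. g' (z, r) \<partial>gauss2) = (\<integral>z. (z \<bullet> e) * g (z, r) \<partial>gauss2)" for r
  proof (rule gauss2_ibp(3)[OF e, where B="B * (1 + \<bar>r\<bar>)"])
    show "\<bar>g (z, r)\<bar> \<le> B * (1 + \<bar>r\<bar>)" for z
      using b(1)[of "(z, r)"] B mult_left_mono[of 1 "1 + \<bar>r\<bar>" B] by simp
    show "\<bar>g' (z, r)\<bar> \<le> B * (1 + \<bar>r\<bar>)" for z using b(2)[of "(z, r)"] by simp
  qed (use d in \<open>auto intro!: continuous_intros intro: continuous_on_compose2[OF c(1)] continuous_on_compose2[OF c(2)]\<close>)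
  have i1: "integrable heatM g'"
  proof (rule integrable_bound_real)
    show "integrable heatM (\<lambda>w. B * heat_weight w)" using integrable_heat_weight by simp
    show "\<bar>g' w\<bar> \<le> B * heat_weight w" for w
      using b(2)[of w] mult_left_mono[OF _ B, of "1 + \<bar>snd w\<bar>" "heat_weight w"] by (simp add: heat_weight_def)
  qed (rule measurable_heatM[OF c(2)])
  have i2: "integrable heatM (\<lambda>w. (fst w \<bullet> e) * g w)"
  proof (rule integrable_bound_real)
    show "integrable heatM (\<lambda>w. heat_weight w * B)" using integrable_heat_weight by simp
    show "\<bar>fst w \<bullet> e * g w\<bar> \<le> heat_weight w * B" for w
      unfolding abs_mult using b heat_weight_ge[where w=w] e by (intro mult_mono) auto
  qed (intro measurable_heatM continuous_intros c)
  show ?thesis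
    using heatP.integral_snd[of "\<lambda>z r. g' (z, r)"] heatP.integral_snd[of "\<lambda>z r. (z \<bullet> e) * g (z, r)"]
        i1 i2 * by (simp add: case_prod_beta' heatM_def)
qed

subsection \<open>Heat averages\<close>

text \<open>Indexing the partial derivatives by \<open>Basis\<close> lets sums over
  \<open>Basis\<close>, and Gaussian integration by parts along \<open>e\<close>, treat both
  coordinates at once.\<close>

definition dd :: "real \<times> real \<Rightarrow> (real \<times> real \<Rightarrow> real) \<Rightarrow> real \<times> real \<Rightarrow> real" where
  "dd e f = (if e = (1, 0) then Dx f else Dy f)"

lemma Basis_real2: "Basis = {(1 :: real, 0), (0, 1 :: real)}"
  by (auto simp: Basis_prod_def)

lemma Basis_cases: "e \<in> Basis \<Longrightarrow> e = (1, 0) \<or> e = (0, 1)" for e :: "real \<times> real"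
  by (simp add: Basis_real2)

lemma dd_simps [simp]: "dd (1, 0) f = Dx f" "dd (0, 1) f = Dy f"
  by (simp_all add: dd_def)

lemma has_dd:
  assumes "C_torus 1 f" "e \<in> Basis"
  shows "((\<lambda>h. f (p + h *\<^sub>R e)) has_real_derivative dd e f (p + h *\<^sub>R e)) (at h)"
proof -
  obtain x y where p: "p = (x, y)" by (cases p)
  show ?thesis
    using Basis_cases[OF assms(2)] has_Dx[OF assms(1), of y "x + h"] has_Dy[OF assms(1), of x "y + h"]
      DERIV_shift[of "\<lambda>s. f (s, y)" _ h x] DERIV_shift[of "\<lambda>s. f (x, s)" _ h y]
    by (auto simp: p add.commute)
qed

lemma C_space_dd: "C_space (Suc k) J f \<Longrightarrow> C_space k J (\<lambda>t. dd e (f t))"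
  by (cases "e = (1, 0)") (simp_all add: dd_def C_space_Dx C_space_Dy)

lemma C_space_SucI_dd:
  assumes f: "C_space 0 J f"
    and d: "\<And>t p e. t \<in> J \<Longrightarrow> e \<in> Basis \<Longrightarrow> ((\<lambda>h. f t (p + h *\<^sub>R e)) has_real_derivative f' e t p) (at 0)"
    and c: "\<And>e. e \<in> Basis \<Longrightarrow> C_space k J (f' e)"
  shows "C_space (Suc k) J f" "t \<in> J \<Longrightarrow> e \<in> Basis \<Longrightarrow> dd e (f t) = f' e t"
proof -
  have B: "(1, 0) \<in> (Basis :: (real \<times> real) set)" "(0, 1) \<in> (Basis :: (real \<times> real) set)"
    by (auto simp: Basis_real2)
  have x: "((\<lambda>s. f t (s, y)) has_real_derivative f' (1, 0) t (x, y)) (at x)" if "t \<in> J" for t x y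
    using d[OF that B(1), of "(x, y)"] DERIV_shift[of "\<lambda>s. f t (s, y)" _ 0 x] by (simp add: add.commute)
  have y: "((\<lambda>s. f t (x, s)) has_real_derivative f' (0, 1) t (x, y)) (at y)" if "t \<in> J" for t x y
    using d[OF that B(2), of "(x, y)"] DERIV_shift[of "\<lambda>s. f t (x, s)" _ 0 y] by (simp add: add.commute)
  show "C_space (Suc k) J f" by (rule C_space_SucI[OF f x y c c]) (use B in auto)
  show "dd e (f t) = f' e t" if "t \<in> J" "e \<in> Basis"
    using Basis_cases[OF that(2)] Dx_eqI[OF x[OF that(1)]] Dy_eqI[OF y[OF that(1)]] by auto
qed

lemma C_space_0_compose:
  assumes "C_space 0 J G" "continuous_on S \<tau>" "continuous_on S q" "\<And>x. x \<in> S \<Longrightarrow> \<tau> x \<in> J"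
  shows "continuous_on S (\<lambda>x. G (\<tau> x) (q x))"
proof -
  have "continuous_on (J \<times> UNIV) (\<lambda>(t, p). G t p)" using assms(1) by (simp add: C_space_0)
  from continuous_on_compose2[OF this continuous_on_Pair[OF assms(2,3)]]
  show ?thesis using assms(4) by auto
qed

lemma C_space_bounded_Icc:
  assumes "C_space k {0..} f" shows "\<exists>B. 0 \<le> B \<and> (\<forall>s\<in>{0..T}. \<forall>p. \<bar>f s p\<bar> \<le> B)"
proof -
  have "{0..T} \<subseteq> {0..}" by auto
  from C_space_bounded[OF assms compact_Icc this] show ?thesis by metis
qed

lemma periodic_shift:
  assumes "periodic f" shows "periodic (\<lambda>p. f (p + q))"
  unfolding periodic_def
proof (intro allI)
  fix x y
  have "(x + 1, y) + q = ((x + fst q) + 1, y + snd q)" "(x, y + 1) + q = (x + fst q, (y + snd q) + 1)"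
    "(x, y) + q = (x + fst q, y + snd q)" by (simp_all add: prod_eq_iff)
  then show "f ((x + 1, y) + q) = f ((x, y) + q) \<and> f ((x, y + 1) + q) = f ((x, y) + q)"
    using assms unfolding periodic_def by metis
qed

text \<open>The factor 2 accommodates the weight \<open>2 * snd \<omega>\<close>, which together
  with \<open>t\<close> is the Jacobian of the substitution
  \<open>s = t * (1 - r\<^sup>2)\<close>.\<close>

definition heat_wt :: "((real \<times> real) \<times> real \<Rightarrow> real) \<Rightarrow> bool" where
  "heat_wt w \<longleftrightarrow> continuous_on UNIV w \<and> (\<forall>\<omega>. \<bar>w \<omega>\<bar> \<le> 2 * heat_weight \<omega>)"

lemma heat_wt: "heat_wt (\<lambda>_. 1)" "heat_wt (\<lambda>\<omega>. 2 * snd \<omega>)" "e \<in> Basis \<Longrightarrow> heat_wt (\<lambda>\<omega>. fst \<omega> \<bullet> e)"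
proof -
  show "heat_wt (\<lambda>_. 1)" "heat_wt (\<lambda>\<omega>. 2 * snd \<omega>)"
    unfolding heat_wt_def heat_weight_def by (auto intro!: continuous_intros simp: abs_mult)
  assume e: "e \<in> Basis"
  have "\<bar>fst \<omega> \<bullet> e\<bar> \<le> 2 * heat_weight \<omega>" for \<omega> :: "(real \<times> real) \<times> real"
    using heat_weight_ge(1)[of \<omega>] heat_weight_ge(3)[OF e, of \<omega>] by linarith
  then show "heat_wt (\<lambda>\<omega>. fst \<omega> \<bullet> e)"
    unfolding heat_wt_def by (simp add: continuous_intros)
qed

text \<open>
  With \<open>\<kappa> = sqrt (2 * \<nu>)\<close>, the choice \<open>a = 1\<close> and \<open>w = 1\<close> gives the heat flow at time \<open>t\<close> of the
  initial datum \<open>G 0\<close>. For \<open>a = r\<close> and \<open>w = 2 * r\<close>, where \<open>\<omega> = (z, r)\<close>, it is \<open>1 / t\<close>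
  times the Duhamel integral of \<open>G\<close> after the substitution \<open>s = t * (1 - r\<^sup>2)\<close>. The maximum with \<open>0\<close>
  only matters on a null set, outside the range of \<open>r\<close>.
\<close>

definition heat_avg :: "real \<Rightarrow> ((real \<times> real) \<times> real \<Rightarrow> real) \<Rightarrow> ((real \<times> real) \<times> real \<Rightarrow> real) \<Rightarrow>
    (real \<Rightarrow> real \<times> real \<Rightarrow> real) \<Rightarrow> real \<Rightarrow> real \<times> real \<Rightarrow> real" where
  "heat_avg \<kappa> a w G t p =
     (\<integral>\<omega>. w \<omega> * G (t * max 0 (1 - (a \<omega>)\<^sup>2)) (p + (\<kappa> * sqrt t * a \<omega>) *\<^sub>R fst \<omega>) \<partial>heatM)"

lemma heat_time: "0 \<le> t \<Longrightarrow> t * max 0 (1 - (a::real)\<^sup>2) \<in> {0..t}"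
  by (auto simp: max_def mult_left_le intro!: mult_nonneg_nonneg)

lemma heat_time': "0 \<le> t \<Longrightarrow> 0 \<le> t * max 0 (1 - (a::real)\<^sup>2)"
  using heat_time[of t a] by simp

context
  fixes \<kappa> :: real and a w :: "(real \<times> real) \<times> real \<Rightarrow> real" and G :: "real \<Rightarrow> real \<times> real \<Rightarrow> real"
  assumes a: "continuous_on UNIV a" and w: "heat_wt w"
begin

lemma heat_avg_measurable:
  assumes G: "C_space 0 {0..} G" and t: "0 \<le> t"
  shows "(\<lambda>\<omega>. w \<omega> * G (t * max 0 (1 - (a \<omega>)\<^sup>2)) (p + (\<kappa> * sqrt t * a \<omega>) *\<^sub>R fst \<omega>)) \<in> borel_measurable heatM"
proof -
  have 1: "continuous_on UNIV (\<lambda>\<omega>. t * max 0 (1 - (a \<omega>)\<^sup>2))" by (intro continuous_intros a)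
  have 2: "continuous_on UNIV (\<lambda>\<omega>. p + (\<kappa> * sqrt t * a \<omega>) *\<^sub>R fst \<omega>)" by (intro continuous_intros a)
  have w': "continuous_on UNIV w" using w by (simp add: heat_wt_def)
  show ?thesis
    by (intro measurable_heatM continuous_on_mult[OF w' C_space_0_compose[OF G 1 2]])
      (simp add: heat_time'[OF t])
qed

lemma heat_avg_pointwise:
  assumes G: "\<And>s p. s \<in> {0..t} \<Longrightarrow> \<bar>G s p\<bar> \<le> B" and t: "0 \<le> t"
  shows "\<bar>w \<omega> * G (t * max 0 (1 - (a \<omega>)\<^sup>2)) p\<bar> \<le> 2 * heat_weight \<omega> * B"
  unfolding abs_mult
proof (rule mult_mono)
  show "\<bar>w \<omega>\<bar> \<le> 2 * heat_weight \<omega>" using w unfolding heat_wt_def by blast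
qed (use G[OF heat_time[OF t]] heat_weight_ge(1)[of \<omega>] in simp_all)

lemma heat_avg_integrable:
  assumes G: "C_space 0 {0..} G" and t: "0 \<le> t"
  shows "integrable heatM (\<lambda>\<omega>. w \<omega> * G (t * max 0 (1 - (a \<omega>)\<^sup>2)) (p + (\<kappa> * sqrt t * a \<omega>) *\<^sub>R fst \<omega>))"
proof -
  obtain B where B: "\<And>s p. s \<in> {0..t} \<Longrightarrow> \<bar>G s p\<bar> \<le> B"
    using C_space_bounded_Icc[OF G, of t] by blast
  show ?thesis
    by (rule integrable_bound_real[OF _ heat_avg_measurable[OF G t] heat_avg_pointwise[OF B t]])
      (use integrable_heat_weight in auto)
qed

lemma heat_avg_cont:
  assumes G: "C_space 0 {0..} G"
  shows "C_space 0 {0..} (heat_avg \<kappa> a w G)"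
proof (rule C_space_local)
  fix T :: real
  show "C_space 0 {0..T} (heat_avg \<kappa> a w G)"
    unfolding C_space_0
  proof
    have "periodic (heat_avg \<kappa> a w G t)" if t: "t \<in> {0..T}" for t
    proof -
      have "periodic (G (t * max 0 (1 - (a \<omega>)\<^sup>2)))" for \<omega>
        using G heat_time'[of t] t by (auto simp: C_space_0)
      from periodic_shift[OF this] show ?thesis unfolding periodic_def heat_avg_def by simp
    qed
    then show "\<forall>t\<in>{0..T}. periodic (heat_avg \<kappa> a w G t)" ..
    obtain B where B: "\<And>s p. s \<in> {0..T} \<Longrightarrow> \<bar>G s p\<bar> \<le> B"
      using C_space_bounded_Icc[OF G, of T] by blast
    have "continuous_on ({0..T} \<times> UNIV) (\<lambda>x. \<integral>\<omega>. w \<omega> * G (fst x * max 0 (1 - (a \<omega>)\<^sup>2)) (snd x + (\<kappa> * sqrt (fst x) * a \<omega>) *\<^sub>R fst \<omega>) \<partial>heatM)"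
    proof (rule continuous_on_integral_param[where W="\<lambda>\<omega>. 2 * heat_weight \<omega> * B"])
      show "continuous_on ({0..T} \<times> UNIV) (\<lambda>x. w \<omega> * G (fst x * max 0 (1 - (a \<omega>)\<^sup>2)) (snd x + (\<kappa> * sqrt (fst x) * a \<omega>) *\<^sub>R fst \<omega>))" for \<omega>
      proof -
        have 1: "continuous_on ({0..T} \<times> UNIV) (\<lambda>x::real \<times> (real \<times> real). fst x * max 0 (1 - (a \<omega>)\<^sup>2))"
          by (intro continuous_intros)
        have 2: "continuous_on ({0..T} \<times> UNIV) (\<lambda>x::real \<times> (real \<times> real). snd x + (\<kappa> * sqrt (fst x) * a \<omega>) *\<^sub>R fst \<omega>)"
          by (intro continuous_intros)
        show ?thesis
          by (intro continuous_on_mult[OF continuous_on_const C_space_0_compose[OF G 1 2]])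
            (simp add: mem_Times_iff heat_time')
      qed
      show "\<bar>w \<omega> * G (fst x * max 0 (1 - (a \<omega>)\<^sup>2)) (snd x + (\<kappa> * sqrt (fst x) * a \<omega>) *\<^sub>R fst \<omega>)\<bar> \<le> 2 * heat_weight \<omega> * B"
        if "x \<in> {0..T} \<times> UNIV" for x \<omega>
        using that by (intro heat_avg_pointwise B) (simp_all add: mem_Times_iff)
      show "(\<lambda>\<omega>. w \<omega> * G (fst x * max 0 (1 - (a \<omega>)\<^sup>2)) (snd x + (\<kappa> * sqrt (fst x) * a \<omega>) *\<^sub>R fst \<omega>)) \<in> borel_measurable heatM"
        if "x \<in> {0..T} \<times> UNIV" for x
        using that by (intro heat_avg_measurable[OF G]) (simp add: mem_Times_iff)
    qed (simp add: integrable_heat_weight)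
    then show "continuous_on ({0..T} \<times> UNIV) (\<lambda>(t, p). heat_avg \<kappa> a w G t p)"
      unfolding case_prod_beta heat_avg_def .
  qed
qed

end

lemma heat_avg_dd:
  assumes a: "continuous_on UNIV a" and w: "heat_wt w" and G: "C_space 1 {0..} G" and t: "0 \<le> t" and e: "e \<in> Basis"
  shows "((\<lambda>h. heat_avg \<kappa> a w G t (p + h *\<^sub>R e)) has_real_derivative heat_avg \<kappa> a w (\<lambda>s. dd e (G s)) t p) (at 0)"
proof -
  have G0: "C_space 0 {0..} G" using C_space_imp_0[OF G] .
  have G': "C_space 0 {0..} (\<lambda>s. dd e (G s))" using G by (simp add: C_space_dd)
  obtain B where B: "\<And>s p. s \<in> {0..t} \<Longrightarrow> \<bar>dd e (G s) p\<bar> \<le> B"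
    using C_space_bounded_Icc[OF G', of t] by blast
  let ?q = "\<lambda>\<omega>. (\<kappa> * sqrt t * a \<omega>) *\<^sub>R fst \<omega>"
  have "((\<lambda>h. \<integral>\<omega>. w \<omega> * G (t * max 0 (1 - (a \<omega>)\<^sup>2)) ((p + h *\<^sub>R e) + ?q \<omega>) \<partial>heatM) has_real_derivative
      (\<integral>\<omega>. w \<omega> * dd e (G (t * max 0 (1 - (a \<omega>)\<^sup>2))) ((p + 0 *\<^sub>R e) + ?q \<omega>) \<partial>heatM)) (at 0)"
  proof (rule has_real_derivative_integral_param[where a="-1" and b=1 and W="\<lambda>\<omega>. 2 * heat_weight \<omega> * B"
        and X'="\<lambda>h \<omega>. w \<omega> * dd e (G (t * max 0 (1 - (a \<omega>)\<^sup>2))) ((p + h *\<^sub>R e) + ?q \<omega>)"])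
    fix h \<omega>
    have "C_torus 1 (G (t * max 0 (1 - (a \<omega>)\<^sup>2)))" using C_space_at[OF G] heat_time'[OF t] by auto
    from has_dd[OF this e, of "p + ?q \<omega>" h]
    show "((\<lambda>h. w \<omega> * G (t * max 0 (1 - (a \<omega>)\<^sup>2)) ((p + h *\<^sub>R e) + ?q \<omega>)) has_real_derivative
        w \<omega> * dd e (G (t * max 0 (1 - (a \<omega>)\<^sup>2))) ((p + h *\<^sub>R e) + ?q \<omega>)) (at h)"
      by (intro DERIV_cmult) (simp add: add_ac)
    show "\<bar>w \<omega> * dd e (G (t * max 0 (1 - (a \<omega>)\<^sup>2))) ((p + h *\<^sub>R e) + ?q \<omega>)\<bar> \<le> 2 * heat_weight \<omega> * B"
      by (rule heat_avg_pointwise[where G="\<lambda>s. dd e (G s)", OF a w B t])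
    show "(\<lambda>\<omega>. w \<omega> * dd e (G (t * max 0 (1 - (a \<omega>)\<^sup>2))) ((p + 0 *\<^sub>R e) + ?q \<omega>)) \<in> borel_measurable heatM"
      by (rule heat_avg_measurable[OF a w G' t])
  qed (simp_all add: integrable_heat_weight heat_avg_integrable[OF a w G0 t])
  then show ?thesis by (simp add: heat_avg_def)
qed

lemma heat_avg_diff:
  assumes "continuous_on UNIV a" "heat_wt w" "C_space 0 {0..} G" "C_space 0 {0..} H" "0 \<le> t"
  shows "heat_avg \<kappa> a w G t p - heat_avg \<kappa> a w H t p = heat_avg \<kappa> a w (\<lambda>t p. G t p - H t p) t p"
  unfolding heat_avg_def right_diff_distrib
  by (rule Bochner_Integration.integral_diff[symmetric])
    (use heat_avg_integrable[OF assms(1,2)] assms in auto)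

lemma heat_avg_bound:
  assumes G: "C_space 0 {0..} G" and a: "continuous_on UNIV a" and w: "heat_wt w" and t: "0 \<le> t"
    and W: "integrable heatM W"
    and b: "\<And>\<omega> p. \<bar>w \<omega>\<bar> * \<bar>G (t * max 0 (1 - (a \<omega>)\<^sup>2)) p\<bar> \<le> W \<omega>"
  shows "\<bar>heat_avg \<kappa> a w G t p\<bar> \<le> (\<integral>\<omega>. W \<omega> \<partial>heatM)"
proof -
  have "norm (heat_avg \<kappa> a w G t p) \<le> (\<integral>\<omega>. norm (w \<omega> * G (t * max 0 (1 - (a \<omega>)\<^sup>2)) (p + (\<kappa> * sqrt t * a \<omega>) *\<^sub>R fst \<omega>)) \<partial>heatM)"
    unfolding heat_avg_def by (rule integral_norm_bound)
  also have "\<dots> \<le> (\<integral>\<omega>. W \<omega> \<partial>heatM)"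
  proof (rule integral_mono[OF integrable_norm[OF heat_avg_integrable[OF a w G t]] W])
    show "norm (w \<omega> * G (t * max 0 (1 - (a \<omega>)\<^sup>2)) (p + (\<kappa> * sqrt t * a \<omega>) *\<^sub>R fst \<omega>)) \<le> W \<omega>" for \<omega>
      unfolding real_norm_def abs_mult by (rule b)
  qed
  finally show ?thesis by simp
qed

text \<open>
  Smoothing: a derivative falling on a merely continuous source becomes the factor \<open>fst \<omega> \<bullet> e\<close> by Gaussian
  integration by parts. The substitution \<open>s = t (1 - r\<^sup>2)\<close> built into \<^term>\<open>heat_avg\<close> has removed the
  singularity \<open>(t - s)\<^sup>-\<^sup>1\<^sup>/\<^sup>2\<close> of Duhamel's formula.
\<close>

lemma antiderivative_ex:
  fixes g :: "real \<Rightarrow> real"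
  assumes "continuous_on UNIV g" obtains F where "\<And>x. (F has_real_derivative g x) (at x)"
proof -
  have "\<exists>F. \<forall>x::real. (-\<infinity>::ereal) < ereal x \<longrightarrow> ereal x < \<infinity> \<longrightarrow> (F has_vector_derivative g x) (at x)"
    by (rule einterval_antiderivative) (use assms in \<open>auto simp: continuous_on_eq_continuous_at\<close>)
  then show ?thesis using that by (auto simp: has_real_derivative_iff_has_vector_derivative)
qed

lemma integral_antiderivative:
  fixes F g :: "real \<Rightarrow> real"
  assumes "\<And>x. (F has_real_derivative g x) (at x)" "a \<le> b"
  shows "integral {a..b} g = F b - F a"
  using fundamental_theorem_of_calculus[of a b F g] assms
  by (intro integral_unique)
    (auto simp: has_real_derivative_iff_has_vector_derivative[symmetric] intro: has_field_derivative_at_within)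

lemma heat_avg_smoothing:
  assumes G: "C_space 0 {0..} G" and t: "0 \<le> t" and e: "e \<in> Basis" and \<kappa>: "0 < \<kappa>"
  shows "((\<lambda>h. t * heat_avg \<kappa> snd (\<lambda>\<omega>. 2 * snd \<omega>) G t (p + h *\<^sub>R e)) has_real_derivative
      (2 * sqrt t / \<kappa>) * heat_avg \<kappa> snd (\<lambda>\<omega>. fst \<omega> \<bullet> e) G t p) (at 0)"
proof -
  define \<tau> where "\<tau> \<omega> = t * max 0 (1 - (snd \<omega>)\<^sup>2)" for \<omega> :: "(real \<times> real) \<times> real"
  define q where "q s \<omega> = p + s *\<^sub>R e + (\<kappa> * sqrt t * snd \<omega>) *\<^sub>R fst \<omega>" for s and \<omega> :: "(real \<times> real) \<times> real"
  define g where "g \<omega> s = G (\<tau> \<omega>) (q s \<omega>)" for \<omega> s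
  \<comment> \<open>As \<open>G\<close> need not be differentiable, it is first integrated along
    \<open>e\<close>. The primitive is differentiable in \<open>s\<close> and also, since
    \<open>z\<close> enters only through \<open>q\<close>, along \<open>e\<close> in
    \<open>z\<close>.\<close>
  define \<Phi> where "\<Phi> s \<omega> = integral {-1..s} (g \<omega>)" for s \<omega>
  have \<tau>: "\<tau> \<omega> \<in> {0..t}" "0 \<le> \<tau> \<omega>" for \<omega> using heat_time[OF t] by (auto simp: \<tau>_def)
  have c\<tau>: "continuous_on UNIV \<tau>" unfolding \<tau>_def by (intro continuous_intros)
  obtain B where B: "0 \<le> B" "\<And>s p. s \<in> {0..t} \<Longrightarrow> \<bar>G s p\<bar> \<le> B"
    using C_space_bounded_Icc[OF G, of t] by blast
  have gB: "\<bar>g \<omega> s\<bar> \<le> B" for \<omega> s using B \<tau> by (simp add: g_def)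
  have gjoint: "continuous_on UNIV (\<lambda>x. g (fst x) (snd x))"
    unfolding g_def q_def
    by (intro C_space_0_compose[OF G] continuous_on_compose2[OF c\<tau>] continuous_intros) (use \<tau> in auto)
  have cg: "continuous_on UNIV (g \<omega>)" for \<omega>
  proof -
    have "continuous_on UNIV (\<lambda>s. (\<omega>, s :: real))" by (intro continuous_intros)
    from continuous_on_compose2[OF gjoint this] show ?thesis by simp
  qed
  have cg2: "continuous_on UNIV (\<lambda>\<omega>. g \<omega> s)" for s
  proof -
    have "continuous_on UNIV (\<lambda>\<omega> :: (real \<times> real) \<times> real. (\<omega>, s))" by (intro continuous_intros)
    from continuous_on_compose2[OF gjoint this] show ?thesis by simp
  qed
  have gint: "g \<omega> integrable_on {c..d}" for \<omega> c d
    by (rule integrable_continuous_real) (rule continuous_on_subset[OF cg], simp)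
  have c\<Phi>: "continuous_on UNIV (\<Phi> s)" for s
    unfolding \<Phi>_def
    using integral_continuous_on_param[of UNIV "-1" s g] continuous_on_subset[OF gjoint]
    by (simp add: case_prod_beta')
  have \<Phi>B: "\<bar>\<Phi> s \<omega>\<bar> \<le> B * 2" if "s \<in> {-1..1}" for s \<omega>
  proof -
    have "norm (\<Phi> s \<omega>) \<le> B * (s - (-1))" unfolding \<Phi>_def
      by (rule integral_bound) (use that gB continuous_on_subset[OF cg] in auto)
    also have "\<dots> \<le> B * 2" using that B by (intro mult_left_mono) auto
    finally show ?thesis by simp
  qed
  have d\<Phi>: "((\<lambda>s. \<Phi> s \<omega>) has_real_derivative g \<omega> s) (at s)" if "s \<in> {-1<..<1}" for s \<omega>
  proof -
    have "((\<lambda>s. \<Phi> s \<omega>) has_real_derivative g \<omega> s) (at s within {-1..1})"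
      unfolding \<Phi>_def by (rule integral_has_real_derivative) (use that continuous_on_subset[OF cg] in auto)
    then show ?thesis using that at_within_interior[of s "{-1..1}"] by (simp add: interior_atLeastAtMost_real)
  qed
  have key: "t * heat_avg \<kappa> snd (\<lambda>\<omega>. 2 * snd \<omega>) G t (p + s *\<^sub>R e)
     - t * heat_avg \<kappa> snd (\<lambda>\<omega>. 2 * snd \<omega>) G t (p + (-1) *\<^sub>R e)
     = (2 * sqrt t / \<kappa>) * (\<integral>\<omega>. (fst \<omega> \<bullet> e) * \<Phi> s \<omega> \<partial>heatM)" if s: "s \<in> {-1<..<1}" for s
  proof -
    \<comment> \<open>The derivative of \<open>\<Phi>\<close> along \<open>e\<close> in
      \<open>z\<close> carries the factor \<open>\<kappa> * sqrt t * r\<close>; times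
      \<open>?c\<close> this becomes \<open>2 * t * r\<close>, the weight of the Duhamel
      integral.\<close>
    let ?c = "2 * sqrt t / \<kappa>"
    have i: "integrable heatM (\<lambda>\<omega>. (2 * snd \<omega>) * g \<omega> s)" for s
      using heat_avg_integrable[OF continuous_on_snd[OF continuous_on_id] heat_wt(2) G t, where \<kappa>=\<kappa> and p="p + s *\<^sub>R e"]
      by (simp add: g_def q_def \<tau>_def)
    have "(\<integral>\<omega>. (t * (2 * snd \<omega>)) * (g \<omega> s - g \<omega> (-1)) \<partial>heatM) = (\<integral>\<omega>. (fst \<omega> \<bullet> e) * (?c * \<Phi> s \<omega>) \<partial>heatM)"
    proof (rule heatM_ibp[OF e, where B="?c * (B * 2) + 4 * t * B"])
      fix z :: "real \<times> real" and r :: real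
      let ?\<omega> = "(z, r)" and ?k = "\<kappa> * sqrt t * r"
      \<comment> \<open>Moving \<open>z\<close> by \<open>h *\<^sub>R e\<close> shifts both end
        points of the integral that defines \<open>\<Phi>\<close>, so an antiderivative on the whole
        line is taken.\<close>
      obtain F where F: "\<And>x. (F has_real_derivative g ?\<omega> x) (at x)"
        using antiderivative_ex[OF cg] by blast
      have sh: "g (z + h *\<^sub>R e, r) \<eta> = g ?\<omega> (\<eta> + ?k * h)" for h \<eta>
        by (simp add: g_def q_def \<tau>_def algebra_simps)
      have "\<Phi> s (z + h *\<^sub>R e, r) = F (s + ?k * h) - F (-1 + ?k * h)" for h
        unfolding \<Phi>_def sh
        by (rule integral_antiderivative[of "\<lambda>\<eta>. F (\<eta> + ?k * h)"])
          (use s in \<open>auto intro!: F[THEN DERIV_shift[THEN iffD1]]\<close>)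
      moreover have "((\<lambda>h. F (c + ?k * h)) has_real_derivative g ?\<omega> c * ?k) (at 0)" for c
        by (rule DERIV_chain'[where f="\<lambda>h. c + ?k * h" and g=F and E="g ?\<omega> c", OF _ _, THEN DERIV_cong])
          (auto intro!: derivative_eq_intros F[of c, simplified])
      ultimately have "((\<lambda>h. ?c * \<Phi> s (z + h *\<^sub>R e, r)) has_real_derivative
          ?c * (g ?\<omega> s * ?k - g ?\<omega> (-1) * ?k)) (at 0)"
        by (simp only:) (intro DERIV_cmult DERIV_diff)
      also have "?c * (g ?\<omega> s * ?k - g ?\<omega> (-1) * ?k) = (t * (2 * snd ?\<omega>)) * (g ?\<omega> s - g ?\<omega> (-1))"
      proof -
        define u where "u = sqrt t"
        have tu: "t = u * u" using t by (simp add: u_def)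
        show ?thesis unfolding u_def[symmetric] using \<kappa> by (simp add: tu field_simps)
      qed
      finally show "((\<lambda>h. ?c * \<Phi> s (z + h *\<^sub>R e, r)) has_real_derivative
          (t * (2 * snd ?\<omega>)) * (g ?\<omega> s - g ?\<omega> (-1))) (at 0)" .
    next
      fix \<omega> :: "(real \<times> real) \<times> real"
      have "\<bar>?c * \<Phi> s \<omega>\<bar> \<le> ?c * (B * 2)"
        unfolding abs_mult using \<Phi>B[of s \<omega>] s \<kappa> t by (intro mult_mono) auto
      then show "\<bar>?c * \<Phi> s \<omega>\<bar> \<le> ?c * (B * 2) + 4 * t * B" using t B by (simp add: add_increasing2)
      have "\<bar>(t * (2 * snd \<omega>)) * (g \<omega> s - g \<omega> (-1))\<bar> \<le> (t * (2 * \<bar>snd \<omega>\<bar>)) * (2 * B)"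
        unfolding abs_mult using gB[of \<omega> s] gB[of \<omega> "-1"] t by (intro mult_mono) auto
      also have "\<dots> = 4 * t * B * \<bar>snd \<omega>\<bar>" by simp
      also have "\<dots> \<le> (?c * (B * 2) + 4 * t * B) * (1 + \<bar>snd \<omega>\<bar>)"
        using t B \<kappa> by (intro mult_mono) auto
      finally show "\<bar>(t * (2 * snd \<omega>)) * (g \<omega> s - g \<omega> (-1))\<bar> \<le> (?c * (B * 2) + 4 * t * B) * (1 + \<bar>snd \<omega>\<bar>)" .
    qed (intro continuous_intros c\<Phi> cg2)+
    also have "\<dots> = ?c * (\<integral>\<omega>. (fst \<omega> \<bullet> e) * \<Phi> s \<omega> \<partial>heatM)"
      by (simp only: mult.left_commute[of _ ?c] integral_mult_right_zero)
    also have "(\<integral>\<omega>. (t * (2 * snd \<omega>)) * (g \<omega> s - g \<omega> (-1)) \<partial>heatM) =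
        (\<integral>\<omega>. t * ((2 * snd \<omega>) * g \<omega> s - (2 * snd \<omega>) * g \<omega> (-1)) \<partial>heatM)"
      by (simp add: algebra_simps)
    also have "\<dots> = t * ((\<integral>\<omega>. (2 * snd \<omega>) * g \<omega> s \<partial>heatM) - (\<integral>\<omega>. (2 * snd \<omega>) * g \<omega> (-1) \<partial>heatM))"
      using i[of s] i[of "-1"] by (subst integral_mult_right_zero) (subst Bochner_Integration.integral_diff, auto)
    finally show ?thesis
      by (simp add: heat_avg_def g_def q_def \<tau>_def right_diff_distrib)
  qed
  have "((\<lambda>s. \<integral>\<omega>. (fst \<omega> \<bullet> e) * \<Phi> s \<omega> \<partial>heatM) has_real_derivative (\<integral>\<omega>. (fst \<omega> \<bullet> e) * g \<omega> 0 \<partial>heatM)) (at 0)"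
  proof (rule has_real_derivative_integral_param[where a="-1" and b=1 and W="\<lambda>\<omega>. 2 * heat_weight \<omega> * B"])
    show "integrable heatM (\<lambda>\<omega>. (fst \<omega> \<bullet> e) * \<Phi> s \<omega>)" if "s \<in> {-1<..<1}" for s
    proof (rule integrable_bound_real[where W="\<lambda>\<omega>. heat_weight \<omega> * (B * 2)"])
      show "\<bar>(fst \<omega> \<bullet> e) * \<Phi> s \<omega>\<bar> \<le> heat_weight \<omega> * (B * 2)" for \<omega>
        unfolding abs_mult using heat_weight_ge[where w=\<omega>] e \<Phi>B[of s \<omega>] that B by (intro mult_mono) auto
    qed (use integrable_heat_weight in \<open>auto intro!: measurable_heatM continuous_intros c\<Phi>\<close>)
    show "((\<lambda>s. (fst \<omega> \<bullet> e) * \<Phi> s \<omega>) has_real_derivative (fst \<omega> \<bullet> e) * g \<omega> s) (at s)" if "s \<in> {-1<..<1}" for s \<omega>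
      using d\<Phi>[OF that] by (rule DERIV_cmult)
    show "\<bar>(fst \<omega> \<bullet> e) * g \<omega> s\<bar> \<le> 2 * heat_weight \<omega> * B" for s \<omega>
      unfolding abs_mult using heat_weight_ge(1)[of \<omega>] heat_weight_ge(3)[OF e, of \<omega>] gB[of \<omega> s]
      by (intro mult_mono) auto
    show "(\<lambda>\<omega>. (fst \<omega> \<bullet> e) * g \<omega> 0) \<in> borel_measurable heatM"
      by (intro measurable_heatM continuous_intros cg2)
  qed (use integrable_heat_weight in auto)
  then have D: "((\<lambda>s. t * heat_avg \<kappa> snd (\<lambda>\<omega>. 2 * snd \<omega>) G t (p + (-1) *\<^sub>R e) +
      (2 * sqrt t / \<kappa>) * (\<integral>\<omega>. (fst \<omega> \<bullet> e) * \<Phi> s \<omega> \<partial>heatM)) has_real_derivative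
      0 + (2 * sqrt t / \<kappa>) * (\<integral>\<omega>. (fst \<omega> \<bullet> e) * g \<omega> 0 \<partial>heatM)) (at 0)"
    by (intro DERIV_add DERIV_const DERIV_cmult)
  have "\<forall>\<^sub>F s in nhds (0::real). s \<in> {-1<..<1}"
    by (rule eventually_nhds_in_open) auto
  then have ev: "\<forall>\<^sub>F s in nhds 0. t * heat_avg \<kappa> snd (\<lambda>\<omega>. 2 * snd \<omega>) G t (p + s *\<^sub>R e) =
      t * heat_avg \<kappa> snd (\<lambda>\<omega>. 2 * snd \<omega>) G t (p + (-1) *\<^sub>R e) +
      (2 * sqrt t / \<kappa>) * (\<integral>\<omega>. (fst \<omega> \<bullet> e) * \<Phi> s \<omega> \<partial>heatM)"
    by eventually_elim (use key in \<open>simp add: algebra_simps\<close>)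
  have "((\<lambda>h. t * heat_avg \<kappa> snd (\<lambda>\<omega>. 2 * snd \<omega>) G t (p + h *\<^sub>R e)) has_real_derivative
      0 + (2 * sqrt t / \<kappa>) * (\<integral>\<omega>. (fst \<omega> \<bullet> e) * g \<omega> 0 \<partial>heatM)) (at 0)"
    by (rule DERIV_cong_ev[OF refl ev refl, THEN iffD2, OF D])
  then show ?thesis by (simp add: heat_avg_def g_def q_def \<tau>_def)
qed

subsection \<open>Duhamel's formula\<close>

lemma set_lebesgue_integral_Icc:
  fixes f :: "real \<Rightarrow> real"
  assumes "continuous_on {a..b} f"
  shows "(\<integral>x. indicator {a..b} x * f x \<partial>lborel) = integral {a..b} f"
proof -
  have "set_integrable lborel {a..b} f"
    unfolding set_integrable_def by (rule borel_integrable_compact[OF compact_Icc assms])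
  from set_borel_integral_eq_integral(2)[OF this] show ?thesis by (simp add: set_lebesgue_integral_def)
qed

lemma integral_scale:
  fixes f :: "real \<Rightarrow> real"
  assumes "0 \<le> c" "continuous_on {0..c} f"
  shows "integral {0..c} f = c * integral {0..1} (\<lambda>x. f (c * x))"
proof (cases "c = 0")
  case False
  then have c: "0 < c" using assms(1) by simp
  have "continuous_on {0..1} (\<lambda>x. f (c * x))"
    by (rule continuous_on_compose2[OF assms(2)]) (use c in \<open>auto intro!: continuous_intros simp: mult_left_le\<close>)
  note 1 = set_lebesgue_integral_Icc[OF this]
  have "indicator {0..c} (c * x) = (indicator {0..1} x :: real)" for x
    using c by (auto simp: indicator_def zero_le_mult_iff mult_le_cancel_left1)
  then show ?thesis
    using lborel_integral_real_affine[of c "\<lambda>x. indicator {0..c} x * f x" 0] c 1 set_lebesgue_integral_Icc[OF assms(2)] by simp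
qed simp

lemma parabolic_compose:
  fixes D :: "real \<Rightarrow> real \<Rightarrow> real"
  assumes "continuous_on ({0..} \<times> UNIV) (\<lambda>(s, r). D s r)" "continuous_on S \<sigma>" "continuous_on S \<rho>"
    "\<And>x. x \<in> S \<Longrightarrow> 0 \<le> \<sigma> x"
  shows "continuous_on S (\<lambda>x. D (\<sigma> x) (\<rho> x))"
  using continuous_on_compose2[OF assms(1) continuous_on_Pair[OF assms(2,3)]] assms(4) by auto

lemma parabolic_line:
  fixes K :: "real \<Rightarrow> real \<Rightarrow> real"
  assumes "continuous_on ({0..} \<times> UNIV) (\<lambda>(s, r). K s r :: real)"
  shows "continuous_on {0..t} (\<lambda>s. K s (sqrt (t - s)))"
  by (rule parabolic_compose[OF assms]) (auto intro!: continuous_intros)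

lemma parabolic_base:
  fixes K :: "real \<Rightarrow> real \<Rightarrow> real"
  assumes "continuous_on ({0..} \<times> UNIV) (\<lambda>(s, r). K s r :: real)"
  shows "continuous_on {0..} (\<lambda>s. K s (0 :: real))"
  by (rule parabolic_compose[OF assms]) (auto intro!: continuous_intros)

text \<open>Rescaling \<open>r\<close> by \<open>sqrt t\<close> turns the moving end point into a
  fixed one; this gives continuity in \<open>t\<close> up to and including
  \<open>t = 0\<close>.\<close>

lemma parabolic_slice:
  assumes cD: "continuous_on ({0..} \<times> UNIV) (\<lambda>(s, r). D s r :: real)"
  shows "0 \<le> t \<Longrightarrow> integral {0..sqrt t} (\<lambda>r. D (t - r\<^sup>2) r) =
      sqrt t * integral {0..1} (\<lambda>r. D (t * (1 - r\<^sup>2)) (sqrt t * r))"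
    and "continuous_on {0..T} (\<lambda>t. integral {0..sqrt t} (\<lambda>r. D (t - r\<^sup>2) r))"
proof -
  show 1: "integral {0..sqrt t} (\<lambda>r. D (t - r\<^sup>2) r) =
      sqrt t * integral {0..1} (\<lambda>r. D (t * (1 - r\<^sup>2)) (sqrt t * r))" if "0 \<le> t" for t
  proof -
    have "r\<^sup>2 \<le> t" if "0 \<le> r" "r \<le> sqrt t" for r using power_mono[OF that(2,1), of 2] \<open>0 \<le> t\<close> by simp
    then have "continuous_on {0..sqrt t} (\<lambda>r. D (t - r\<^sup>2) r)"
      by (intro parabolic_compose[OF cD] continuous_intros) auto
    from integral_scale[OF _ this] that show ?thesis by (simp add: power_mult_distrib right_diff_distrib)
  qed
  have "continuous_on ({0..T} \<times> cbox 0 1) (\<lambda>x. D (fst x * (1 - (snd x)\<^sup>2)) (sqrt (fst x) * snd x))"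
    by (rule parabolic_compose[OF cD]) (auto intro!: continuous_intros mult_nonneg_nonneg simp: power_le_one)
  then have "continuous_on {0..T} (\<lambda>t. sqrt t * integral {0..1} (\<lambda>r. D (t * (1 - r\<^sup>2)) (sqrt t * r)))"
    using integral_continuous_on_param[of "{0..T}" 0 "1::real" "\<lambda>t r. D (t * (1 - r\<^sup>2)) (sqrt t * r)"]
    by (intro continuous_intros) (simp add: case_prod_beta')
  then show "continuous_on {0..T} (\<lambda>t. integral {0..sqrt t} (\<lambda>r. D (t - r\<^sup>2) r))"
    by (rule continuous_on_eq) (simp add: 1)
qed

text \<open>
  Both sides integrate \<open>\<partial>\<^sub>r K\<close> over the region \<open>s, r \<ge> 0\<close>, \<open>s + r\<^sup>2 \<le> t\<close>; on the right the
  slices are the parabolas \<open>s + r\<^sup>2 = \<tau>\<close>.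
\<close>

lemma parabolic_Fubini:
  fixes K D :: "real \<Rightarrow> real \<Rightarrow> real"
  assumes cK: "continuous_on ({0..} \<times> UNIV) (\<lambda>(s, r). K s r)"
    and cD: "continuous_on ({0..} \<times> UNIV) (\<lambda>(s, r). D s r)"
    and d: "\<And>s r. 0 \<le> s \<Longrightarrow> (K s has_real_derivative D s r) (at r)"
    and t: "0 \<le> t"
  shows "integral {0..t} (\<lambda>s. K s (sqrt (t - s)) - K s 0) =
     integral {0..t} (\<lambda>\<tau>. integral {0..sqrt \<tau>} (\<lambda>r. D (\<tau> - r\<^sup>2) r))"
proof -
  \<comment> \<open>\<open>R1\<close> and \<open>R2\<close> are one region in the coordinates
    \<open>(\<tau>, r)\<close> and \<open>(s, r)\<close> with \<open>\<tau> = s + r\<^sup>2\<close>,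
    a shear that preserves Lebesgue measure.\<close>
  define R1 where "R1 = {(\<tau>, r). 0 \<le> r \<and> r\<^sup>2 \<le> \<tau> \<and> \<tau> \<le> (t :: real)}"
  define R2 where "R2 = {(s, r). 0 \<le> r \<and> 0 \<le> s \<and> s + r\<^sup>2 \<le> (t :: real)}"
  define f1 where "f1 = (\<lambda>(\<tau>, r). indicator R1 (\<tau>, r) * D (\<tau> - r\<^sup>2) r)"
  define f2 where "f2 = (\<lambda>(s, r). indicator R2 (s, r) * D s r)"
  have r: "r \<le> sqrt t" if "r\<^sup>2 \<le> t" for r using that by (rule real_le_rsqrt)
  have "closed R1" unfolding R1_def case_prod_beta
    by (intro closed_Collect_conj closed_Collect_le continuous_intros)
  moreover have "R1 \<subseteq> {0..t} \<times> {0..sqrt t}" using r by (force simp: R1_def intro: order_trans[OF zero_le_power2])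
  ultimately have K1: "compact R1"
    using compact_Times[OF compact_Icc compact_Icc] by (metis Int_absorb1 closed_Int_compact inf_commute)
  have "closed R2" unfolding R2_def case_prod_beta
    by (intro closed_Collect_conj closed_Collect_le continuous_intros)
  moreover have "R2 \<subseteq> {0..t} \<times> {0..sqrt t}"
  proof
    fix x assume "x \<in> R2"
    then have x: "0 \<le> fst x" "0 \<le> snd x" "fst x + (snd x)\<^sup>2 \<le> t" by (auto simp: R2_def)
    then have "fst x \<le> t" "(snd x)\<^sup>2 \<le> t" using zero_le_power2[of "snd x"] by linarith+
    then show "x \<in> {0..t} \<times> {0..sqrt t}" using x r by (simp add: mem_Times_iff)
  qed
  ultimately have K2: "compact R2"
    using compact_Times[OF compact_Icc compact_Icc] by (metis Int_absorb1 closed_Int_compact inf_commute)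
  have c1: "continuous_on R1 (\<lambda>(\<tau>, r). D (\<tau> - r\<^sup>2) r)"
  proof -
    have "continuous_on R1 (\<lambda>x. (fst x - (snd x)\<^sup>2, snd x))" by (intro continuous_intros)
    from continuous_on_compose2[OF cD this] show ?thesis by (force simp: R1_def case_prod_beta)
  qed
  have c2: "continuous_on R2 (\<lambda>(s, r). D s r)"
    by (rule continuous_on_subset[OF cD]) (auto simp: R2_def)
  have i1: "integrable (lborel \<Otimes>\<^sub>M lborel) f1"
    using borel_integrable_compact[OF K1 c1] by (simp add: f1_def lborel_prod case_prod_beta')
  have i2: "integrable (lborel \<Otimes>\<^sub>M lborel) f2"
    using borel_integrable_compact[OF K2 c2] by (simp add: f2_def lborel_prod case_prod_beta')
  have cD1: "continuous_on S (D s)" if "0 \<le> s" for s S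
  proof -
    have "continuous_on S (\<lambda>r. (s, r))" by (intro continuous_intros)
    from continuous_on_compose2[OF cD this] that show ?thesis by force
  qed
  have inner1: "(\<integral>r. f1 (\<tau>, r) \<partial>lborel) = indicator {0..t} \<tau> * integral {0..sqrt \<tau>} (\<lambda>r. D (\<tau> - r\<^sup>2) r)" for \<tau>
  proof (cases "\<tau> \<in> {0..t}")
    case True
    have *: "r \<in> {0..sqrt \<tau>} \<longleftrightarrow> 0 \<le> r \<and> r\<^sup>2 \<le> \<tau>" for r
      using True by (auto simp: real_le_rsqrt) (metis power_mono real_sqrt_pow2)
    have "f1 (\<tau>, r) = indicator {0..sqrt \<tau>} r * D (\<tau> - r\<^sup>2) r" for r
      using True * by (auto simp: f1_def R1_def indicator_def)
    moreover have "continuous_on {0..sqrt \<tau>} (\<lambda>r. D (\<tau> - r\<^sup>2) r)"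
    proof -
      have "continuous_on {0..sqrt \<tau>} (\<lambda>r. (\<tau> - r\<^sup>2, r))" by (intro continuous_intros)
      from continuous_on_compose2[OF cD this] * show ?thesis by force
    qed
    ultimately show ?thesis using set_lebesgue_integral_Icc True by simp
  next
    case False
    have "f1 (\<tau>, r) = 0" for r
      using False order_trans[OF zero_le_power2[of r]] by (auto simp: f1_def R1_def indicator_def)
    then show ?thesis using False by simp
  qed
  have inner2: "(\<integral>r. f2 (s, r) \<partial>lborel) = indicator {0..t} s * (K s (sqrt (t - s)) - K s 0)" for s
  proof (cases "s \<in> {0..t}")
    case True
    have *: "r \<in> {0..sqrt (t - s)} \<longleftrightarrow> 0 \<le> r \<and> s + r\<^sup>2 \<le> t" for r
      using True real_le_rsqrt[of r "t - s"] power_mono[of r "sqrt (t - s)" 2] by (auto simp: algebra_simps)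
    have "f2 (s, r) = indicator {0..sqrt (t - s)} r * D s r" for r
      using True * by (auto simp: f2_def R2_def indicator_def)
    moreover have "integral {0..sqrt (t - s)} (D s) = K s (sqrt (t - s)) - K s 0"
      using fundamental_theorem_of_calculus[of 0 "sqrt (t - s)" "K s" "D s"] True d[of s]
      by (intro integral_unique)
        (auto simp: has_real_derivative_iff_has_vector_derivative[symmetric] intro: has_field_derivative_at_within)
    ultimately show ?thesis using set_lebesgue_integral_Icc[OF cD1] True by simp
  next
    case False
    have "f2 (s, r) = 0" for r
    proof -
      have "s \<le> t" if "s + r\<^sup>2 \<le> t" using that zero_le_power2[of r] by linarith
      then show ?thesis using False by (auto simp: f2_def R2_def indicator_def)
    qed
    then show ?thesis using False by simp
  qed
  have shift: "(\<integral>\<tau>. f1 (\<tau>, r) \<partial>lborel) = (\<integral>s. f2 (s, r) \<partial>lborel)" for r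
    using lborel_integral_real_affine[of 1 "\<lambda>\<tau>. f1 (\<tau>, r)" "r\<^sup>2"]
    by (simp add: f1_def f2_def R1_def R2_def indicator_def add.commute conj_commute cong: conj_cong)
  have cV: "continuous_on {0..t} (\<lambda>\<tau>. integral {0..sqrt \<tau>} (\<lambda>r. D (\<tau> - r\<^sup>2) r))"
    by (rule parabolic_slice(2)[OF cD])
  have cK': "continuous_on {0..t} (\<lambda>s. K s (sqrt (t - s)) - K s 0)"
    by (rule continuous_on_diff[OF parabolic_line[OF cK] continuous_on_subset[OF parabolic_base[OF cK]]]) auto
  have "integral {0..t} (\<lambda>s. K s (sqrt (t - s)) - K s 0) = (\<integral>s. (\<integral>r. f2 (s, r) \<partial>lborel) \<partial>lborel)"
    by (simp only: inner2 set_lebesgue_integral_Icc[OF cK'])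
  also have "\<dots> = (\<integral>r. (\<integral>s. f2 (s, r) \<partial>lborel) \<partial>lborel)"
    using lborel_pair.Fubini_integral[of "\<lambda>s r. f2 (s, r)"] i2 by simp
  also have "\<dots> = (\<integral>r. (\<integral>s. f1 (s, r) \<partial>lborel) \<partial>lborel)" by (simp only: shift)
  also have "\<dots> = (\<integral>\<tau>. (\<integral>r. f1 (\<tau>, r) \<partial>lborel) \<partial>lborel)"
    using lborel_pair.Fubini_integral[of "\<lambda>s r. f1 (s, r)"] i1 by simp
  also have "\<dots> = integral {0..t} (\<lambda>\<tau>. integral {0..sqrt \<tau>} (\<lambda>r. D (\<tau> - r\<^sup>2) r))"
    by (simp only: inner1 set_lebesgue_integral_Icc[OF cV])
  finally show ?thesis .
qed

text \<open>With \<open>s = t * (1 - r\<^sup>2)\<close> the integrand is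
  \<open>K s (sqrt (t - s))\<close>, and the derivative of \<open>sqrt (t - s)\<close> in
  \<open>t\<close> is singular at \<open>s = t\<close>. \<open>parabolic_Fubini\<close> avoids it:
  the expression becomes the integral over \<open>{0..t}\<close> of a continuous function of time,
  to which the fundamental theorem applies.\<close>

lemma parabolic_duhamel:
  fixes K D :: "real \<Rightarrow> real \<Rightarrow> real"
  assumes cK: "continuous_on ({0..} \<times> UNIV) (\<lambda>(s, r). K s r)"
    and cD: "continuous_on ({0..} \<times> UNIV) (\<lambda>(s, r). D s r)"
    and d: "\<And>s r. 0 \<le> s \<Longrightarrow> (K s has_real_derivative D s r) (at r)"
    and t: "0 < t"
  shows "((\<lambda>t. t * integral {0..1} (\<lambda>r. 2 * r * K (t * (1 - r\<^sup>2)) (sqrt t * r))) has_real_derivative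
     K t 0 + sqrt t * integral {0..1} (\<lambda>r. D (t * (1 - r\<^sup>2)) (sqrt t * r))) (at t)"
proof -
  define V where "V = (\<lambda>t. integral {0..sqrt t} (\<lambda>r. D (t - r\<^sup>2) r))"
  have cV: "continuous_on {0..T} V" for T unfolding V_def by (rule parabolic_slice(2)[OF cD])
  have cK0: "continuous_on {0..T} (\<lambda>s. K s 0)" for T by (rule continuous_on_subset[OF parabolic_base[OF cK]]) auto
  have W: "t * integral {0..1} (\<lambda>r. 2 * r * K (t * (1 - r\<^sup>2)) (sqrt t * r)) = integral {0..t} (\<lambda>s. K s 0 + V s)"
    if t: "0 < t" for t
  proof -
    let ?h = "\<lambda>s. K s (sqrt (t - s))"
    have ch: "continuous_on {0..t} ?h" by (rule parabolic_line[OF cK])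
    define H where "H x = integral {0..x} ?h" for x
    have dH: "(H has_real_derivative ?h x) (at x within {0..t})" if "x \<in> {0..t}" for x
      unfolding H_def by (rule integral_has_real_derivative[OF ch that])
    have img: "(\<lambda>r. t * (1 - r\<^sup>2)) ` {0..1} \<subseteq> {0..t}"
      using t by (auto simp: power_le_one mult_left_le)
    have "((\<lambda>r. - H (t * (1 - r\<^sup>2))) has_real_derivative 2 * t * r * ?h (t * (1 - r\<^sup>2))) (at r within {0..1})" if "r \<in> {0..1}" for r
    proof -
      have "(H has_real_derivative ?h (t * (1 - r\<^sup>2))) (at (t * (1 - r\<^sup>2)) within (\<lambda>r. t * (1 - r\<^sup>2)) ` {0..1})"
        by (rule has_field_derivative_subset[OF dH img]) (use img that in blast)
      moreover have "((\<lambda>r. t * (1 - r\<^sup>2)) has_real_derivative - 2 * t * r) (at r within {0..1})"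
        by (auto intro!: derivative_eq_intros)
      ultimately have "((\<lambda>r. H (t * (1 - r\<^sup>2))) has_real_derivative ?h (t * (1 - r\<^sup>2)) * (- 2 * t * r)) (at r within {0..1})"
        by (rule DERIV_image_chain[unfolded o_def])
      from DERIV_minus[OF this] show ?thesis by (simp add: mult_ac)
    qed
    then have "((\<lambda>r. 2 * t * r * ?h (t * (1 - r\<^sup>2))) has_integral - H (t * (1 - 1\<^sup>2)) - - H (t * (1 - 0\<^sup>2))) {0..1}"
      by (intro fundamental_theorem_of_calculus) (auto simp: has_real_derivative_iff_has_vector_derivative)
    then have "integral {0..1} (\<lambda>r. 2 * t * r * ?h (t * (1 - r\<^sup>2))) = H t"
      by (simp add: integral_unique H_def)
    moreover have "2 * t * r * ?h (t * (1 - r\<^sup>2)) = t * (2 * r * K (t * (1 - r\<^sup>2)) (sqrt t * r))" if "r \<in> {0..1}" for r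
      using that by (simp add: right_diff_distrib real_sqrt_mult)
    then have "integral {0..1} (\<lambda>r. 2 * t * r * ?h (t * (1 - r\<^sup>2))) =
        integral {0..1} (\<lambda>r. t * (2 * r * K (t * (1 - r\<^sup>2)) (sqrt t * r)))"
      by (rule integral_cong)
    ultimately have "H t = integral {0..1} (\<lambda>r. t * (2 * r * K (t * (1 - r\<^sup>2)) (sqrt t * r)))"
      by simp
    moreover have "H t = integral {0..t} (\<lambda>s. (?h s - K s 0)) + integral {0..t} (\<lambda>s. K s 0)"
      unfolding H_def using ch cK0[of t]
      by (subst integral_add[symmetric]) (auto intro!: integrable_continuous_real continuous_intros)
    moreover have "integral {0..t} (\<lambda>s. (?h s - K s 0)) = integral {0..t} V"
      unfolding V_def using parabolic_Fubini[OF cK cD d] t by simp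
    moreover have "integral {0..t} (\<lambda>s. K s 0 + V s) = integral {0..t} (\<lambda>s. K s 0) + integral {0..t} V"
      using cV[of t] cK0[of t] by (intro integral_add integrable_continuous_real) auto
    ultimately show ?thesis by simp
  qed
  have "((\<lambda>t. integral {0..t} (\<lambda>s. K s 0 + V s)) has_real_derivative K t 0 + V t) (at t within {0..t+1})"
    by (rule integral_has_real_derivative) (use cV[of "t+1"] cK0[of "t+1"] t in \<open>auto intro!: continuous_intros\<close>)
  then have D: "((\<lambda>t. integral {0..t} (\<lambda>s. K s 0 + V s)) has_real_derivative K t 0 + V t) (at t)"
    using t at_within_interior[of t "{0..t+1}"] by (simp add: interior_atLeastAtMost_real)
  have ev: "\<forall>\<^sub>F t in nhds t. t * integral {0..1} (\<lambda>r. 2 * r * K (t * (1 - r\<^sup>2)) (sqrt t * r)) = integral {0..t} (\<lambda>s. K s 0 + V s)"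
    using eventually_nhds_in_open[of "{0<..}" t] t by (auto elim!: eventually_mono simp: W)
  have "((\<lambda>t. t * integral {0..1} (\<lambda>r. 2 * r * K (t * (1 - r\<^sup>2)) (sqrt t * r))) has_real_derivative K t 0 + V t) (at t)"
    by (rule DERIV_cong_ev[OF refl ev refl, THEN iffD2, OF D])
  then show ?thesis using parabolic_slice(1)[OF cD, of t] t by (simp add: V_def)
qed

subsection \<open>The heat flow of an initial datum\<close>

text \<open>Total differentiability follows from the existence of both partial derivatives and the
  continuity of \<open>Dy f\<close>. It is wanted because Gaussian displacements point in arbitrary
  directions.\<close>

lemma C_torus_1_has_derivative:
  assumes f: "C_torus 1 f"
  shows "(f has_derivative (\<lambda>h. fst h * Dx f p + snd h * Dy f p)) (at p)"
proof -
  obtain x y where p: "p = (x, y)" by (cases p)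
  have cy: "continuous_on UNIV (Dy f)" using C_torus_1D[OF f] by (simp add: C_torus_0)
  have "((\<lambda>(x, y). f (x, y)) has_derivative
     (\<lambda>(tx, ty). (*) (Dx f (x, y)) tx + blinfun_apply (blinfun_mult_right (Dy f (x, y))) ty)) (at (x, y) within UNIV \<times> UNIV)"
  proof (rule has_derivative_partialsI)
    show "((\<lambda>x. f (x, y)) has_derivative (*) (Dx f (x, y))) (at x within UNIV)"
      using has_Dx[OF f] by (simp add: has_field_derivative_def)
    show "((\<lambda>y. f (x, y)) has_derivative blinfun_apply (blinfun_mult_right (Dy f (x, y)))) (at y within UNIV)" for x y
      using has_Dy[OF f] by (simp add: has_field_derivative_def)
    have "continuous (at (x, y)) (\<lambda>q. blinfun_mult_right (Dy f q))"
      using cy by (intro continuous_intros) (simp add: continuous_on_eq_continuous_at)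
    then show "continuous (at (x, y) within UNIV \<times> UNIV) (\<lambda>(x, y). blinfun_mult_right (Dy f (x, y)))"
      by (simp add: case_prod_beta')
  qed auto
  then show ?thesis by (simp add: p case_prod_beta' mult.commute)
qed

lemma C_torus_1_line:
  assumes f: "C_torus 1 f"
  shows "((\<lambda>s. f (p + s *\<^sub>R z)) has_real_derivative (\<Sum>e\<in>Basis. (z \<bullet> e) * dd e f (p + s *\<^sub>R z))) (at s)"
proof -
  have "((\<lambda>s. p + s *\<^sub>R z) has_derivative (\<lambda>h. h *\<^sub>R z)) (at s)"
    by (auto intro!: derivative_eq_intros)
  from has_derivative_compose[OF this C_torus_1_has_derivative[OF f]]
  have "((\<lambda>s. f (p + s *\<^sub>R z)) has_derivative
      (\<lambda>h. fst (h *\<^sub>R z) * Dx f (p + s *\<^sub>R z) + snd (h *\<^sub>R z) * Dy f (p + s *\<^sub>R z))) (at s)" .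
  then show ?thesis
    by (rule has_derivative_imp_has_field_derivative)
      (cases z; simp add: Basis_real2 algebra_simps)
qed

lemma unif_integral:
  fixes f :: "real \<Rightarrow> real"
  assumes "continuous_on UNIV f"
  shows "(\<integral>r. f r \<partial>unif) = integral {0..1} f"
proof -
  have [measurable]: "f \<in> borel_measurable borel" by (rule borel_measurable_continuous_onI[OF assms])
  have "unif = density lborel (\<lambda>x. ennreal (indicator {0..1} x))"
    by (simp add: uniform_measure_def ennreal_indicator divide_ennreal_def)
  then have "(\<integral>r. f r \<partial>unif) = (\<integral>x. indicator {0..1} x * f x \<partial>lborel)"
    by (simp add: integral_density)
  also have "\<dots> = integral {0..1} f" by (rule set_lebesgue_integral_Icc[OF continuous_on_subset[OF assms]]) simp
  finally show ?thesis .
qed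

text \<open>For a fixed displacement \<open>z\<close> this is \<open>parabolic_duhamel\<close> on
  the line through \<open>p\<close> in direction \<open>z\<close>; the average over \<open>z\<close>
  is taken afterwards. The sum is the diffusion term in disguise: \<open>heat_avg_smoothing\<close>,
  applied to \<open>dd e\<close> of the source, identifies its summands with
  \<open>\<kappa>\<^sup>2 / 2\<close> times second derivatives of the Duhamel term.\<close>

lemma heat_time_deriv:
  assumes F: "C_space 1 {0..} F" and \<kappa>: "0 < \<kappa>" and t: "0 < t"
  shows "((\<lambda>t. t * heat_avg \<kappa> snd (\<lambda>\<omega>. 2 * snd \<omega>) F t p) has_real_derivative
     F t p + (\<Sum>e\<in>Basis. \<kappa> * sqrt t * heat_avg \<kappa> snd (\<lambda>\<omega>. fst \<omega> \<bullet> e) (\<lambda>s. dd e (F s)) t p)) (at t)"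
proof -
  have F0: "C_space 0 {0..} F" using C_space_imp_0[OF F] .
  have F1: "C_space 0 {0..} (\<lambda>s. dd e (F s))" for e using F by (simp add: C_space_dd)
  have cs: "continuous_on UNIV (snd :: (real \<times> real) \<times> real \<Rightarrow> real)" by (intro continuous_intros)
  define inner where "inner = (\<lambda>(w :: (real \<times> real) \<times> real \<Rightarrow> real) (G :: real \<Rightarrow> real \<times> real \<Rightarrow> real) t z. \<integral>r. w (z, r) * G (t * max 0 (1 - r\<^sup>2)) (p + (\<kappa> * sqrt t * r) *\<^sub>R z) \<partial>unif)"
  have inner: "integrable gauss2 (inner w G t)" "heat_avg \<kappa> snd w G t p = (\<integral>z. inner w G t z \<partial>gauss2)"
    if "heat_wt w" "C_space 0 {0..} G" "0 \<le> t" for w G t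
    using heatP.integrable_fst'[OF heat_avg_integrable[OF cs that, where \<kappa>=\<kappa> and p=p, unfolded heatM_def]]
      heatP.integral_fst'[OF heat_avg_integrable[OF cs that, where \<kappa>=\<kappa> and p=p, unfolded heatM_def]]
    by (simp_all add: inner_def heat_avg_def heatM_def)
  have inner_HK: "inner w G t z = integral {0..1} (\<lambda>r. w (z, r) * G (t * (1 - r\<^sup>2)) (p + (\<kappa> * sqrt t * r) *\<^sub>R z))"
    if w: "heat_wt w" and G: "C_space 0 {0..} G" and t: "0 \<le> t" for w G t z
  proof -
    have 1: "continuous_on UNIV (\<lambda>r::real. t * max 0 (1 - r\<^sup>2))" by (intro continuous_intros)
    have 2: "continuous_on UNIV (\<lambda>r::real. p + (\<kappa> * sqrt t * r) *\<^sub>R z)" by (intro continuous_intros)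
    have "continuous_on UNIV (\<lambda>r. (z, r :: real))" by (intro continuous_intros)
    from continuous_on_compose2[OF _ this, of UNIV w] w
    have 3: "continuous_on UNIV (\<lambda>r. w (z, r))" by (simp add: heat_wt_def)
    have "inner w G t z = integral {0..1} (\<lambda>r. w (z, r) * G (t * max 0 (1 - r\<^sup>2)) (p + (\<kappa> * sqrt t * r) *\<^sub>R z))"
      unfolding inner_def
      by (rule unif_integral[OF continuous_on_mult[OF 3 C_space_0_compose[OF G 1 2]]]) (simp add: heat_time'[OF t])
    also have "\<dots> = integral {0..1} (\<lambda>r. w (z, r) * G (t * (1 - r\<^sup>2)) (p + (\<kappa> * sqrt t * r) *\<^sub>R z))"
      by (rule integral_cong) (simp add: max_def power_le_one)
    finally show ?thesis .
  qed
  obtain B0 where B0: "0 \<le> B0" "\<And>s p. s \<in> {0..t+1} \<Longrightarrow> \<bar>F s p\<bar> \<le> B0"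
    using C_space_bounded_Icc[OF F0, of "t+1"] by blast
  have "\<exists>B. 0 \<le> B \<and> (\<forall>s\<in>{0..t+1}. \<forall>p. \<forall>e\<in>Basis. \<bar>dd e (F s) p\<bar> \<le> B)"
  proof -
    obtain Bx where Bx: "0 \<le> Bx" "\<And>s p. s \<in> {0..t+1} \<Longrightarrow> \<bar>dd (1, 0) (F s) p\<bar> \<le> Bx"
      using C_space_bounded_Icc[OF F1, of "t+1"] by blast
    obtain By where By: "0 \<le> By" "\<And>s p. s \<in> {0..t+1} \<Longrightarrow> \<bar>dd (0, 1) (F s) p\<bar> \<le> By"
      using C_space_bounded_Icc[OF F1, of "t+1"] by blast
    have "\<bar>dd e (F s) p\<bar> \<le> max Bx By" if "s \<in> {0..t+1}" "e \<in> Basis" for s p e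
      using Basis_cases[OF that(2)] Bx(2)[OF that(1), of p] By(2)[OF that(1), of p] by auto
    then show ?thesis using Bx(1) by (intro exI[of _ "max Bx By"]) auto
  qed
  then obtain B where B: "0 \<le> B" "\<And>s p e. s \<in> {0..t+1} \<Longrightarrow> e \<in> Basis \<Longrightarrow> \<bar>dd e (F s) p\<bar> \<le> B" by blast
  let ?X = "\<lambda>t z. t * inner (\<lambda>\<omega>. 2 * snd \<omega>) F t z"
  let ?X' = "\<lambda>t z. F t p + (\<Sum>e\<in>Basis. \<kappa> * sqrt t * inner (\<lambda>\<omega>. fst \<omega> \<bullet> e) (\<lambda>s. dd e (F s)) t z)"
  have "((\<lambda>t. \<integral>z. ?X t z \<partial>gauss2) has_real_derivative (\<integral>z. ?X' t z \<partial>gauss2)) (at t)"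
  proof (rule has_real_derivative_integral_param[where a=0 and b="t+1" and X'="?X'"
      and W="\<lambda>z. B0 + (\<kappa> * sqrt (t+1) * B) * (\<bar>fst z\<bar> + \<bar>snd z\<bar>)"])
    show "integrable gauss2 (?X s)" if "s \<in> {0<..<t+1}" for s
      using inner(1)[OF heat_wt(2) F0, of s] that by simp
    show "?X' t \<in> borel_measurable gauss2"
      using inner(1)[OF heat_wt(3) F1, of _ t] t
      by (intro borel_measurable_add borel_measurable_sum borel_measurable_times borel_measurable_const borel_measurable_integrable) auto
    show "integrable gauss2 (\<lambda>z. B0 + (\<kappa> * sqrt (t+1) * B) * (\<bar>fst z\<bar> + \<bar>snd z\<bar>))"
      by (rule Bochner_Integration.integrable_add[OF gauss2.P.integrable_const integrable_mult_right[OF integrable_gauss2_abs]])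
  next
    fix s and z :: "real \<times> real" assume s: "s \<in> {0<..<t+1}"
    then have s0: "0 < s" by simp
    let ?K = "\<lambda>s r. F s (p + (\<kappa> * r) *\<^sub>R z)"
    let ?D = "\<lambda>s r. \<Sum>e\<in>Basis. (z \<bullet> e) * (\<kappa> * dd e (F s) (p + (\<kappa> * r) *\<^sub>R z))"
    have c: "continuous_on ({0..} \<times> UNIV) (\<lambda>x. G (fst x) (p + (\<kappa> * snd x) *\<^sub>R z))" if "C_space 0 {0..} G" for G
    proof -
      have 1: "continuous_on ({0..} \<times> UNIV) (\<lambda>x::real \<times> real. fst x)" by (intro continuous_intros)
      have 2: "continuous_on ({0..} \<times> UNIV) (\<lambda>x::real \<times> real. p + (\<kappa> * snd x) *\<^sub>R z)" by (intro continuous_intros)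
      show ?thesis by (rule C_space_0_compose[OF that 1 2]) auto
    qed
    have "((\<lambda>t. t * integral {0..1} (\<lambda>r. 2 * r * ?K (t * (1 - r\<^sup>2)) (sqrt t * r))) has_real_derivative
       ?K s 0 + sqrt s * integral {0..1} (\<lambda>r. ?D (s * (1 - r\<^sup>2)) (sqrt s * r))) (at s)"
    proof (rule parabolic_duhamel)
      show "continuous_on ({0..} \<times> UNIV) (\<lambda>(s, r). ?K s r)"
        using c[OF F0] by (simp add: case_prod_beta')
      show "continuous_on ({0..} \<times> UNIV) (\<lambda>(s, r). ?D s r)"
        unfolding case_prod_beta' by (intro continuous_on_sum continuous_on_mult continuous_on_const c[OF F1])
      show "(?K s has_real_derivative ?D s r) (at r)" if "0 \<le> s" for s r
      proof -
        have "C_torus 1 (F s)" using C_space_at[OF F] that by simp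
        from C_torus_1_line[OF this, of p "\<kappa> *\<^sub>R z" r] show ?thesis by (simp add: mult_ac)
      qed
    qed (use s in simp)
    also have "?K s 0 + sqrt s * integral {0..1} (\<lambda>r. ?D (s * (1 - r\<^sup>2)) (sqrt s * r)) = ?X' s z"
    proof -
      have "integral {0..1} (\<lambda>r. ?D (s * (1 - r\<^sup>2)) (sqrt s * r)) =
          (\<Sum>e\<in>Basis. integral {0..1} (\<lambda>r. (z \<bullet> e) * (\<kappa> * dd e (F (s * (1 - r\<^sup>2))) (p + (\<kappa> * (sqrt s * r)) *\<^sub>R z))))"
      proof (rule integral_sum)
        fix e :: "real \<times> real"
        have 1: "continuous_on {0..1} (\<lambda>r::real. s * (1 - r\<^sup>2))" by (intro continuous_intros)
        have 2: "continuous_on {0..1} (\<lambda>r::real. p + (\<kappa> * (sqrt s * r)) *\<^sub>R z)" by (intro continuous_intros)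
        have "continuous_on {0..1} (\<lambda>r. dd e (F (s * (1 - r\<^sup>2))) (p + (\<kappa> * (sqrt s * r)) *\<^sub>R z))"
          by (rule C_space_0_compose[OF F1 1 2]) (use s in \<open>auto simp: power_le_one\<close>)
        then show "(\<lambda>r. (z \<bullet> e) * (\<kappa> * dd e (F (s * (1 - r\<^sup>2))) (p + (\<kappa> * (sqrt s * r)) *\<^sub>R z))) integrable_on {0..1}"
          by (intro integrable_continuous_real continuous_intros)
      qed simp
      also have "\<dots> = (\<Sum>e\<in>Basis. \<kappa> * inner (\<lambda>\<omega>. fst \<omega> \<bullet> e) (\<lambda>s. dd e (F s)) s z)"
        using s by (intro sum.cong refl, subst inner_HK[OF heat_wt(3) F1])
          (auto simp: mult_ac simp flip: integral_mult_right)
      finally show ?thesis by (simp add: sum_distrib_left mult_ac)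
    qed
    finally have D: "((\<lambda>t. t * integral {0..1} (\<lambda>r. 2 * r * ?K (t * (1 - r\<^sup>2)) (sqrt t * r))) has_real_derivative ?X' s z) (at s)" .
    have "\<forall>\<^sub>F t in nhds s. t \<in> {0<..}" by (rule eventually_nhds_in_open) (use s in auto)
    then have ev: "\<forall>\<^sub>F t in nhds s. ?X t z = t * integral {0..1} (\<lambda>r. 2 * r * ?K (t * (1 - r\<^sup>2)) (sqrt t * r))"
      by eventually_elim (subst inner_HK[OF heat_wt(2) F0], simp, simp add: mult.assoc)
    show "((\<lambda>t. ?X t z) has_real_derivative ?X' s z) (at s)"
      by (rule DERIV_cong_ev[OF refl ev refl, THEN iffD2, OF D])
    have "\<bar>inner (\<lambda>\<omega>. fst \<omega> \<bullet> e) (\<lambda>s. dd e (F s)) s z\<bar> \<le> \<bar>z \<bullet> e\<bar> * B" if e: "e \<in> Basis" for e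
    proof -
      have "norm (inner (\<lambda>\<omega>. fst \<omega> \<bullet> e) (\<lambda>s. dd e (F s)) s z) \<le> (\<bar>z \<bullet> e\<bar> * B) * (1 - 0)"
        unfolding inner_HK[OF heat_wt(3)[OF e] F1 less_imp_le[OF s0]] fst_conv
      proof (rule integral_bound)
        have 1: "continuous_on {0..1} (\<lambda>r::real. s * (1 - r\<^sup>2))" by (intro continuous_intros)
        have 2: "continuous_on {0..1} (\<lambda>r::real. p + (\<kappa> * sqrt s * r) *\<^sub>R z)" by (intro continuous_intros)
        show "continuous_on {0..1} (\<lambda>r. (z \<bullet> e) * dd e (F (s * (1 - r\<^sup>2))) (p + (\<kappa> * sqrt s * r) *\<^sub>R z))"
          by (rule continuous_on_mult[OF continuous_on_const C_space_0_compose[OF F1 1 2]])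
            (use s in \<open>auto simp: power_le_one\<close>)
        fix r :: real assume r: "r \<in> {0..1}"
        have "s * (1 - r\<^sup>2) \<le> s" using s0 by (simp add: mult_left_le)
        then have "s * (1 - r\<^sup>2) \<le> t + 1" using s by (simp only: greaterThanLessThan_iff) linarith
        then have "s * (1 - r\<^sup>2) \<in> {0..t+1}" using s r by (auto simp: power_le_one)
        from B(2)[OF this e] show "norm ((z \<bullet> e) * dd e (F (s * (1 - r\<^sup>2))) (p + (\<kappa> * sqrt s * r) *\<^sub>R z)) \<le> \<bar>z \<bullet> e\<bar> * B"
          unfolding real_norm_def abs_mult by (intro mult_left_mono) auto
      qed simp
      then show ?thesis by simp
    qed
    then have *: "\<bar>\<kappa> * sqrt s * inner (\<lambda>\<omega>. fst \<omega> \<bullet> e) (\<lambda>s. dd e (F s)) s z\<bar> \<le> \<kappa> * sqrt (t+1) * (\<bar>z \<bullet> e\<bar> * B)" if "e \<in> Basis" for e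
      unfolding abs_mult using that \<kappa> s B by (intro mult_mono) auto
    have "\<bar>?X' s z\<bar> \<le> \<bar>F s p\<bar> + (\<Sum>e\<in>Basis. \<bar>\<kappa> * sqrt s * inner (\<lambda>\<omega>. fst \<omega> \<bullet> e) (\<lambda>s. dd e (F s)) s z\<bar>)"
      by (rule order_trans[OF abs_triangle_ineq]) (intro add_left_mono sum_abs)
    also have "\<dots> \<le> B0 + (\<Sum>e\<in>Basis. \<kappa> * sqrt (t+1) * (\<bar>z \<bullet> e\<bar> * B))"
      using s by (intro add_mono B0 sum_mono *) auto
    also have "\<dots> = B0 + (\<kappa> * sqrt (t+1) * B) * (\<bar>fst z\<bar> + \<bar>snd z\<bar>)"
      by (cases z) (simp add: Basis_real2 algebra_simps)
    finally show "\<bar>?X' s z\<bar> \<le> B0 + (\<kappa> * sqrt (t+1) * B) * (\<bar>fst z\<bar> + \<bar>snd z\<bar>)" .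
  qed (use t in auto)
  note D = this
  have "\<forall>\<^sub>F s in nhds t. s \<in> {0<..}" by (rule eventually_nhds_in_open) (use t in auto)
  then have ev: "\<forall>\<^sub>F s in nhds t. s * heat_avg \<kappa> snd (\<lambda>\<omega>. 2 * snd \<omega>) F s p = (\<integral>z. ?X s z \<partial>gauss2)"
    by eventually_elim (simp add: inner(2)[OF heat_wt(2) F0])
  have "(\<integral>z. ?X' t z \<partial>gauss2) = F t p + (\<Sum>e\<in>Basis. \<kappa> * sqrt t * heat_avg \<kappa> snd (\<lambda>\<omega>. fst \<omega> \<bullet> e) (\<lambda>s. dd e (F s)) t p)"
    using t inner[OF heat_wt(3) F1, of _ t]
    by (subst Bochner_Integration.integral_add)
      (auto intro!: Bochner_Integration.integrable_sum sum.cong simp: Bochner_Integration.integral_sum gauss2.P.prob_space)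
  then show ?thesis using DERIV_cong_ev[OF refl ev refl, THEN iffD2, OF D] by simp
qed

lemma C_torus_bounded:
  assumes "C_torus k g" shows "\<exists>B. 0 \<le> B \<and> (\<forall>p. \<bar>g p\<bar> \<le> B)"
  using C_space_bounded_Icc[OF C_space_const[OF assms], of 0] by auto

lemma dd_bounded:
  fixes f :: "real \<times> real \<Rightarrow> real \<Rightarrow> real \<times> real \<Rightarrow> real"
  assumes "\<And>e. e \<in> Basis \<Longrightarrow> C_space k {0..} (f e)"
  shows "\<exists>B. 0 \<le> B \<and> (\<forall>e\<in>Basis. \<forall>s\<in>{0..T}. \<forall>p. \<bar>f e s p\<bar> \<le> B)"
proof -
  obtain Bx where Bx: "0 \<le> Bx" "\<And>s p. s \<in> {0..T} \<Longrightarrow> \<bar>f (1, 0) s p\<bar> \<le> Bx"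
    using C_space_bounded_Icc[OF assms[of "(1, 0)"], of T] by (auto simp: Basis_real2)
  obtain By where By: "0 \<le> By" "\<And>s p. s \<in> {0..T} \<Longrightarrow> \<bar>f (0, 1) s p\<bar> \<le> By"
    using C_space_bounded_Icc[OF assms[of "(0, 1)"], of T] by (auto simp: Basis_real2)
  have "\<bar>f e s p\<bar> \<le> max Bx By" if "s \<in> {0..T}" "e \<in> Basis" for s p e
    using Basis_cases[OF that(2)] Bx(2)[OF that(1), of p] By(2)[OF that(1), of p] by auto
  then show ?thesis using Bx(1) by (intro exI[of _ "max Bx By"]) auto
qed

definition heat_init :: "real \<Rightarrow> (real \<times> real \<Rightarrow> real) \<Rightarrow> real \<Rightarrow> real \<times> real \<Rightarrow> real" where
  "heat_init \<kappa> g = heat_avg \<kappa> (\<lambda>_. 1) (\<lambda>_. 1) (\<lambda>_. g)"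

lemma heat_init_eq: "heat_init \<kappa> g t p = (\<integral>\<omega>. g (p + (\<kappa> * sqrt t) *\<^sub>R fst \<omega>) \<partial>heatM)"
  by (simp add: heat_init_def heat_avg_def)

lemma heat_init_0: "heat_init \<kappa> g 0 p = g p"
  by (simp add: heat_init_eq heatM.prob_space)

lemma heat_init_cont: "C_torus k g \<Longrightarrow> C_space 0 {0..} (heat_init \<kappa> g)"
  unfolding heat_init_def by (rule heat_avg_cont[OF _ heat_wt(1)]) (auto intro: C_space_const C_torus_imp_0)

lemma heat_init_dd:
  assumes "C_torus 1 g" "0 \<le> t" "e \<in> Basis"
  shows "((\<lambda>h. heat_init \<kappa> g t (p + h *\<^sub>R e)) has_real_derivative heat_init \<kappa> (dd e g) t p) (at 0)"
  unfolding heat_init_def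
  by (rule heat_avg_dd[OF _ heat_wt(1) C_space_const[OF assms(1)] assms(2,3)]) simp

text \<open>Differentiating \<open>sqrt t\<close> produces the singular factor
  \<open>1 / (2 * sqrt t)\<close>. Integration by parts supplies a compensating
  \<open>\<kappa> * sqrt t\<close> and turns the first derivatives of the datum into second
  ones.\<close>

lemma heat_init_time_deriv:
  assumes g: "C_torus 2 g" and \<kappa>: "0 < \<kappa>" and t: "0 < t"
  shows "((\<lambda>t. heat_init \<kappa> g t p) has_real_derivative (\<kappa>\<^sup>2 / 2) * (\<Sum>e\<in>Basis. heat_init \<kappa> (dd e (dd e g)) t p)) (at t)"
proof -
  have g1: "C_torus 1 g" and dg1: "C_torus 1 (dd e g)" for e
    using C_torus_2D[OF g] by (auto simp: dd_def)
  have g0: "C_torus 0 g" and dg0: "C_torus 0 (dd e g)" and ddg0: "C_torus 0 (dd e (dd e' g))" for e e'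
    using C_torus_1D[OF g1] C_torus_1D[OF dg1] by (auto simp: dd_def)
  have c: "continuous_on UNIV (\<lambda>\<omega> :: (real \<times> real) \<times> real. G (p + c *\<^sub>R fst \<omega>))" if "C_torus 0 G" for G c p
  proof -
    have 1: "continuous_on UNIV G" using that by (simp add: C_torus_0)
    have 2: "continuous_on UNIV (\<lambda>\<omega> :: (real \<times> real) \<times> real. p + c *\<^sub>R fst \<omega>)" by (intro continuous_intros)
    show ?thesis using continuous_on_compose2[OF 1 2] by simp
  qed
  obtain B where B: "0 \<le> B" "\<And>p e. e \<in> Basis \<Longrightarrow> \<bar>dd e g p\<bar> \<le> B"
    using dd_bounded[of 0 "\<lambda>e _. dd e g" 0] C_space_const[OF dg0] by (auto simp del: One_nat_def)
  let ?X' = "\<lambda>t \<omega>. (\<Sum>e\<in>Basis. (fst \<omega> \<bullet> e) * dd e g (p + (\<kappa> * sqrt t) *\<^sub>R fst \<omega>)) * (\<kappa> * (inverse (sqrt t) / 2))"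
  have "((\<lambda>t. \<integral>\<omega>. g (p + (\<kappa> * sqrt t) *\<^sub>R fst \<omega>) \<partial>heatM) has_real_derivative (\<integral>\<omega>. ?X' t \<omega> \<partial>heatM)) (at t)"
  \<comment> \<open>On this interval \<open>inverse (sqrt s)\<close> stays bounded, as the majorant
    requires.\<close>
  proof (rule has_real_derivative_integral_param[where a="t/2" and b="2*t" and X'="?X'"
      and W="\<lambda>\<omega>. (\<Sum>e\<in>(Basis::(real\<times>real) set). heat_weight \<omega> * B) * (\<kappa> * (inverse (sqrt (t/2)) / 2))"])
    obtain C where "\<And>p. \<bar>g p\<bar> \<le> C" using C_torus_bounded[OF g] by blast
    then show "integrable heatM (\<lambda>\<omega>. g (p + (\<kappa> * sqrt s) *\<^sub>R fst \<omega>))" for s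
      by (intro heatM.integrable_const_bound[of _ C] measurable_heatM c g0) auto
    show "?X' t \<in> borel_measurable heatM"
      by (intro measurable_heatM continuous_on_mult continuous_on_sum continuous_on_const c dg0 continuous_intros)
    show "integrable heatM (\<lambda>\<omega>. (\<Sum>e\<in>(Basis::(real\<times>real) set). heat_weight \<omega> * B) * (\<kappa> * (inverse (sqrt (t/2)) / 2)))"
      using integrable_heat_weight by (intro integrable_mult_left Bochner_Integration.integrable_sum) auto
    fix s and \<omega> :: "(real \<times> real) \<times> real" assume s: "s \<in> {t/2<..<2*t}"
    then have s0: "0 < s" using t by simp
    have "((\<lambda>s. \<kappa> * sqrt s) has_real_derivative \<kappa> * (inverse (sqrt s) / 2)) (at s)"
      by (intro DERIV_cmult DERIV_real_sqrt s0)
    from DERIV_chain2[OF C_torus_1_line[OF g1] this]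
    show "((\<lambda>t. g (p + (\<kappa> * sqrt t) *\<^sub>R fst \<omega>)) has_real_derivative ?X' s \<omega>) (at s)" .
    have "inverse (sqrt s) \<le> inverse (sqrt (t/2))"
      using s t by (intro le_imp_inverse_le) auto
    then have i: "\<bar>\<kappa> * (inverse (sqrt s) / 2)\<bar> \<le> \<kappa> * (inverse (sqrt (t/2)) / 2)"
      using s0 \<kappa> by simp
    have *: "\<bar>(fst \<omega> \<bullet> e) * dd e g (p + (\<kappa> * sqrt s) *\<^sub>R fst \<omega>)\<bar> \<le> heat_weight \<omega> * B" if "e \<in> Basis" for e
      unfolding abs_mult using heat_weight_ge(1)[of \<omega>]
      by (intro mult_mono heat_weight_ge(3) B that) simp_all
    have "\<bar>\<Sum>e\<in>Basis. (fst \<omega> \<bullet> e) * dd e g (p + (\<kappa> * sqrt s) *\<^sub>R fst \<omega>)\<bar> \<le> (\<Sum>e\<in>(Basis::(real\<times>real) set). heat_weight \<omega> * B)"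
      by (rule order_trans[OF sum_abs sum_mono]) (rule *)
    then show "\<bar>?X' s \<omega>\<bar> \<le> (\<Sum>e\<in>(Basis::(real\<times>real) set). heat_weight \<omega> * B) * (\<kappa> * (inverse (sqrt (t/2)) / 2))"
      unfolding abs_mult[of "sum _ _"] using B(1) heat_weight_ge(1)[of \<omega>]
      by (intro mult_mono i) (simp_all add: sum_nonneg)
  qed (use t in auto)
  also have "(\<integral>\<omega>. ?X' t \<omega> \<partial>heatM) = (\<kappa>\<^sup>2 / 2) * (\<Sum>e\<in>Basis. heat_init \<kappa> (dd e (dd e g)) t p)"
  proof -
    let ?c = "\<kappa> * sqrt t"
    have ibp: "(\<integral>\<omega>. (fst \<omega> \<bullet> e) * dd e g (p + ?c *\<^sub>R fst \<omega>) \<partial>heatM) = ?c * heat_init \<kappa> (dd e (dd e g)) t p"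
      and int: "integrable heatM (\<lambda>\<omega>. (fst \<omega> \<bullet> e) * dd e g (p + ?c *\<^sub>R fst \<omega>))"
      if e: "e \<in> Basis" for e
    proof -
      obtain C where C: "0 \<le> C" "\<And>p. \<bar>dd e (dd e g) p\<bar> \<le> C" using C_torus_bounded[OF ddg0] by blast
      have "(\<integral>\<omega>. ?c * dd e (dd e g) (p + ?c *\<^sub>R fst \<omega>) \<partial>heatM) = (\<integral>\<omega>. (fst \<omega> \<bullet> e) * dd e g (p + ?c *\<^sub>R fst \<omega>) \<partial>heatM)"
      proof (rule heatM_ibp[OF e, where B="B + ?c * C"])
        show "((\<lambda>h. dd e g (p + ?c *\<^sub>R fst (z + h *\<^sub>R e, r))) has_real_derivative ?c * dd e (dd e g) (p + ?c *\<^sub>R fst (z, r))) (at 0)" for z r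
        proof -
          have 1: "((\<lambda>h. ?c * h) has_real_derivative ?c) (at 0)" by (auto intro!: derivative_eq_intros)
          have 2: "((\<lambda>h. dd e g ((p + ?c *\<^sub>R z) + h *\<^sub>R e)) has_real_derivative dd e (dd e g) (p + ?c *\<^sub>R z)) (at (?c * 0))"
            using has_dd[OF dg1 e, where p="p + ?c *\<^sub>R z" and h=0] by simp
          show ?thesis using DERIV_chain2[OF 2 1] by (simp add: algebra_simps)
        qed
        show "\<bar>dd e g (p + ?c *\<^sub>R fst \<omega>)\<bar> \<le> B + ?c * C" for \<omega> :: "(real \<times> real) \<times> real"
          using B(2)[OF e, of "p + ?c *\<^sub>R fst \<omega>"] C \<kappa> t by (simp add: add_increasing2)
        have "\<bar>?c * dd e (dd e g) (p + ?c *\<^sub>R fst \<omega>)\<bar> \<le> (B + ?c * C) * 1" for \<omega> :: "(real \<times> real) \<times> real"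
        proof -
          have 1: "?c * \<bar>dd e (dd e g) (p + ?c *\<^sub>R fst \<omega>)\<bar> \<le> ?c * C"
            using \<kappa> t by (intro mult_left_mono C(2)) auto
          have 2: "\<bar>?c * dd e (dd e g) (p + ?c *\<^sub>R fst \<omega>)\<bar> = ?c * \<bar>dd e (dd e g) (p + ?c *\<^sub>R fst \<omega>)\<bar>"
            using \<kappa> t by (simp add: abs_mult)
          show ?thesis unfolding mult_1_right
            by (rule order_trans[OF eq_refl[OF 2] order_trans[OF 1]]) (use B(1) in simp)
        qed
        also have "(B + ?c * C) * 1 \<le> (B + ?c * C) * (1 + \<bar>r\<bar>)" for r
          using C \<kappa> t B(1) by (intro mult_left_mono) auto
        finally show "\<bar>?c * dd e (dd e g) (p + ?c *\<^sub>R fst \<omega>)\<bar> \<le> (B + ?c * C) * (1 + \<bar>snd \<omega>\<bar>)" for \<omega> :: "(real \<times> real) \<times> real" .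
      qed (intro continuous_on_mult continuous_on_const c dg0 ddg0)+
      then show "(\<integral>\<omega>. (fst \<omega> \<bullet> e) * dd e g (p + ?c *\<^sub>R fst \<omega>) \<partial>heatM) = ?c * heat_init \<kappa> (dd e (dd e g)) t p"
        by (simp add: heat_init_eq)
      show "integrable heatM (\<lambda>\<omega>. (fst \<omega> \<bullet> e) * dd e g (p + ?c *\<^sub>R fst \<omega>))"
      proof (rule integrable_bound_real)
        show "integrable heatM (\<lambda>\<omega>. heat_weight \<omega> * B)" using integrable_heat_weight by simp
        show "\<bar>(fst \<omega> \<bullet> e) * dd e g (p + ?c *\<^sub>R fst \<omega>)\<bar> \<le> heat_weight \<omega> * B" for \<omega>
          unfolding abs_mult using heat_weight_ge(1)[of \<omega>] by (intro mult_mono heat_weight_ge(3) B e) auto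
      qed (intro measurable_heatM continuous_intros continuous_on_mult c dg0)
    qed
    have "(\<integral>\<omega>. ?X' t \<omega> \<partial>heatM) = (\<Sum>e\<in>Basis. ?c * heat_init \<kappa> (dd e (dd e g)) t p) * (\<kappa> * (inverse (sqrt t) / 2))"
      using int by (subst integral_mult_left_zero, subst Bochner_Integration.integral_sum) (auto simp: ibp)
    also have "\<dots> = (\<kappa>\<^sup>2 / 2) * (\<Sum>e\<in>Basis. heat_init \<kappa> (dd e (dd e g)) t p)"
      using t by (simp add: field_simps power2_eq_square flip: sum_distrib_left)
    finally show ?thesis .
  qed
  finally show ?thesis by (simp add: heat_init_eq)
qed

subsection \<open>Existence of passive scalars\<close>

lemma C_space_time_fun: "continuous_on J c \<Longrightarrow> C_space 0 J (\<lambda>t p. c t)"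
  unfolding C_space_0 periodic_def case_prod_beta
  using continuous_on_compose2[of J c "J \<times> (UNIV :: (real \<times> real) set)" fst, OF _ continuous_on_fst[OF continuous_on_id]]
  by auto

lemma continuous_on_snd_UNIV: "continuous_on UNIV (snd :: (real \<times> real) \<times> real \<Rightarrow> real)"
  by (intro continuous_intros)

text \<open>Duhamel's integral over \<open>{0..t}\<close> of the heat semigroup applied to
  \<open>G\<close>, after the substitution built into \<open>heat_avg\<close>.\<close>

definition heat_duhamel :: "real \<Rightarrow> (real \<Rightarrow> real \<times> real \<Rightarrow> real) \<Rightarrow> real \<Rightarrow> real \<times> real \<Rightarrow> real" where
  "heat_duhamel \<kappa> G t p = t * heat_avg \<kappa> snd (\<lambda>\<omega>. 2 * snd \<omega>) G t p"

text \<open>By \<open>heat_avg_smoothing\<close> the derivative of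
  \<open>heat_duhamel \<kappa> G\<close> along \<open>e\<close>, in a form that is defined and
  continuous for every continuous \<open>G\<close>.\<close>

definition heat_duhamel' :: "real \<Rightarrow> real \<times> real \<Rightarrow> (real \<Rightarrow> real \<times> real \<Rightarrow> real) \<Rightarrow> real \<Rightarrow> real \<times> real \<Rightarrow> real" where
  "heat_duhamel' \<kappa> e G t p = (2 * sqrt t / \<kappa>) * heat_avg \<kappa> snd (\<lambda>\<omega>. fst \<omega> \<bullet> e) G t p"

lemma heat_duhamel_cont: "C_space 0 {0..} G \<Longrightarrow> C_space 0 {0..} (heat_duhamel \<kappa> G)"
  unfolding heat_duhamel_def[abs_def]
  by (intro C_space_mult C_space_time_fun heat_avg_cont[OF continuous_on_snd_UNIV heat_wt(2)] continuous_intros)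

lemma heat_duhamel'_cont: "e \<in> Basis \<Longrightarrow> C_space 0 {0..} G \<Longrightarrow> C_space 0 {0..} (heat_duhamel' \<kappa> e G)"
  unfolding heat_duhamel'_def[abs_def] divide_inverse
  by (intro C_space_mult C_space_time_fun heat_avg_cont[OF continuous_on_snd_UNIV heat_wt(3)] continuous_intros)

lemma heat_avg_cong:
  assumes "0 \<le> t" "\<And>s. 0 \<le> s \<Longrightarrow> G s = H s"
  shows "heat_avg \<kappa> a w G t p = heat_avg \<kappa> a w H t p"
  unfolding heat_avg_def using heat_time'[OF assms(1)] assms(2) by simp

text \<open>A source growing like \<open>exp (\<theta> * s)\<close>, taken at
  \<open>s = t * (1 - r\<^sup>2)\<close>, leaves \<open>exp (- (\<theta> * t * r\<^sup>2))\<close>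
  once \<open>exp (\<theta> * t)\<close> is pulled out. This is the average of that factor against
  the majorant of all weights, with \<open>\<mu> = \<theta> * t\<close>; the \<open>min 1\<close>
  mirrors the \<open>max 0\<close> in \<open>heat_avg\<close>.\<close>

definition gauss_tail :: "real \<Rightarrow> real" where
  "gauss_tail \<mu> = (\<integral>\<omega>. 2 * heat_weight \<omega> * exp (- (\<mu> * min 1 ((snd \<omega>)\<^sup>2))) \<partial>heatM)"

lemma gauss_tail_integrable:
  assumes "0 \<le> \<mu>"
  shows "integrable heatM (\<lambda>\<omega>. 2 * heat_weight \<omega> * exp (- (\<mu> * min 1 ((snd \<omega>)\<^sup>2))))"
proof (rule integrable_bound_real)
  show "integrable heatM (\<lambda>\<omega>. 2 * heat_weight \<omega>)" using integrable_heat_weight by simp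
  show "\<bar>2 * heat_weight \<omega> * exp (- (\<mu> * min 1 ((snd \<omega>)\<^sup>2)))\<bar> \<le> 2 * heat_weight \<omega>" for \<omega>
    using heat_weight_ge(1)[of \<omega>] assms by (simp add: abs_mult mult_left_le)
  have "continuous_on UNIV heat_weight" unfolding heat_weight_def by (intro continuous_intros)
  then show "(\<lambda>\<omega>. 2 * heat_weight \<omega> * exp (- (\<mu> * min 1 ((snd \<omega>)\<^sup>2)))) \<in> borel_measurable heatM"
    by (intro measurable_heatM continuous_intros) auto
qed

lemma gauss_tail_nonneg: "0 \<le> gauss_tail \<mu>"
  unfolding gauss_tail_def
  using heat_weight_ge(1) by (intro integral_nonneg_AE AE_I2) (auto intro!: mult_nonneg_nonneg order_trans[OF _ heat_weight_ge(1)])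

lemma gauss_tail_antimono:
  assumes "0 \<le> \<mu>" "\<mu> \<le> \<mu>'" shows "gauss_tail \<mu>' \<le> gauss_tail \<mu>"
  unfolding gauss_tail_def
proof (rule integral_mono)
  show "2 * heat_weight \<omega> * exp (- (\<mu>' * min 1 ((snd \<omega>)\<^sup>2))) \<le> 2 * heat_weight \<omega> * exp (- (\<mu> * min 1 ((snd \<omega>)\<^sup>2)))" for \<omega>
    using heat_weight_ge(1)[of \<omega>] assms by (intro mult_left_mono) (auto intro: mult_right_mono)
qed (use assms gauss_tail_integrable in auto)

lemma gauss_tail_tendsto: "(gauss_tail \<longlongrightarrow> 0) at_top"
proof -
  \<comment> \<open>Only on this null set does the exponential fail to tend to 0.\<close>
  have "AE \<omega> in heatM. snd \<omega> \<noteq> 0"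
  proof -
    have "emeasure unif {0} = 0" by simp
    then have "emeasure heatM (UNIV \<times> {0}) = 0"
      unfolding heatM_def
      by (subst unif.emeasure_pair_measure_Times) (simp_all only: sets_gauss2, auto)
    moreover have "UNIV \<times> {0 :: real} \<in> sets heatM"
      unfolding sets_heatM by (intro borel_closed closed_Times) auto
    ultimately have "UNIV \<times> {0} \<in> null_sets heatM" by auto
    then show ?thesis by (rule AE_I') (auto simp: mem_Times_iff)
  qed
  then have lim: "AE \<omega> in heatM. ((\<lambda>\<mu>. 2 * heat_weight \<omega> * exp (- (\<mu> * min 1 ((snd \<omega>)\<^sup>2)))) \<longlongrightarrow> 0) at_top"
  proof eventually_elim
    case (elim \<omega>)
    then have "0 < min 1 ((snd \<omega>)\<^sup>2)" by simp
    then have "filterlim (\<lambda>\<mu>. - (\<mu> * min 1 ((snd \<omega>)\<^sup>2))) at_bot at_top"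
      using filterlim_tendsto_pos_mult_at_top[OF tendsto_const _ filterlim_ident]
      unfolding filterlim_uminus_at_bot by (simp only: minus_minus mult.commute[of _ "min _ _"])
    from filterlim_compose[OF exp_at_bot this] show ?case
      by (intro tendsto_mult_right_zero)
  qed
  have "((\<lambda>\<mu>. \<integral>\<omega>. 2 * heat_weight \<omega> * exp (- (\<mu> * min 1 ((snd \<omega>)\<^sup>2))) \<partial>heatM) \<longlongrightarrow> (\<integral>\<omega>. 0 \<partial>heatM)) at_top"
  proof (rule integral_dominated_convergence_at_top[where w="\<lambda>\<omega>. 2 * heat_weight \<omega>"])
    show "\<forall>\<^sub>F \<mu> in at_top. AE \<omega> in heatM. norm (2 * heat_weight \<omega> * exp (- (\<mu> * min 1 ((snd \<omega>)\<^sup>2)))) \<le> 2 * heat_weight \<omega>"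
      using eventually_ge_at_top[of 0]
    proof eventually_elim
      case (elim \<mu>)
      then show ?case using order_trans[OF zero_le_one heat_weight_ge(1)] by (intro AE_I2) (simp add: abs_mult mult_left_le)
    qed
    have "continuous_on UNIV heat_weight" unfolding heat_weight_def by (intro continuous_intros)
    then show "(\<lambda>\<omega>. 2 * heat_weight \<omega> * exp (- (\<mu> * min 1 ((snd \<omega>)\<^sup>2)))) \<in> borel_measurable heatM" for \<mu>
      by (intro measurable_heatM continuous_intros) auto
  qed (use lim integrable_heat_weight in auto)
  then show ?thesis by (simp add: gauss_tail_def[abs_def])
qed

text \<open>Up to a small time \<open>t0\<close> the factor \<open>sqrt t\<close> is small enough.
  For later times the tail is: \<open>\<mu>\<close> is chosen large, and
  \<open>\<theta> = \<mu> / t0\<close> gives \<open>\<theta> * t \<ge> \<mu>\<close> from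
  \<open>t0\<close> on.\<close>

lemma gauss_tail_small:
  assumes "0 < q" "0 \<le> T"
  obtains \<theta> where "0 \<le> \<theta>" "\<And>t. t \<in> {0..T} \<Longrightarrow> sqrt t * gauss_tail (\<theta> * t) \<le> q"
proof -
  define J where "J = gauss_tail 0 + 1"
  have J: "0 < J" using gauss_tail_nonneg[of 0] by (simp add: J_def)
  define t0 where "t0 = (q / J)\<^sup>2"
  have t0: "0 < t0" "sqrt t0 = q / J" using assms J by (auto simp: t0_def)
  have "\<forall>\<^sub>F \<mu> in at_top. gauss_tail \<mu> < q / (sqrt T + 1)"
    using order_tendstoD(2)[OF gauss_tail_tendsto] assms by (simp add: add_nonneg_pos)
  then have "\<forall>\<^sub>F \<mu> in at_top. gauss_tail \<mu> < q / (sqrt T + 1) \<and> 0 \<le> \<mu>"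
    using eventually_ge_at_top[of 0] by eventually_elim simp
  then obtain \<mu> where \<mu>: "gauss_tail \<mu> < q / (sqrt T + 1)" "0 \<le> \<mu>"
    by (auto simp: eventually_at_top_linorder)
  show ?thesis
  proof (rule that[of "\<mu> / t0"])
    show "0 \<le> \<mu> / t0" using \<mu> t0 by simp
    fix t assume t: "t \<in> {0..T}"
    show "sqrt t * gauss_tail (\<mu> / t0 * t) \<le> q"
    proof (cases "t \<le> t0")
      case True
      have "sqrt t * gauss_tail (\<mu> / t0 * t) \<le> sqrt t0 * J"
      proof (rule mult_mono)
        show "gauss_tail (\<mu> / t0 * t) \<le> J"
          using gauss_tail_antimono[of 0 "\<mu> / t0 * t"] t \<mu> t0 by (simp add: J_def)
      qed (use real_sqrt_le_mono[OF True] assms J t0 gauss_tail_nonneg in auto)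
      then show ?thesis using t0 J by simp
    next
      case False
      have "\<mu> \<le> \<mu> / t0 * t" using False t0 \<mu> mult_left_mono[of t0 t \<mu>] by (simp add: field_simps)
      then have "gauss_tail (\<mu> / t0 * t) \<le> q / (sqrt T + 1)"
        using gauss_tail_antimono[of \<mu> "\<mu> / t0 * t"] \<mu> by linarith
      then have "sqrt t * gauss_tail (\<mu> / t0 * t) \<le> (sqrt T + 1) * (q / (sqrt T + 1))"
        using t assms gauss_tail_nonneg by (intro mult_mono) (auto simp: add_increasing2)
      then show ?thesis using assms by (simp add: add_nonneg_eq_0_iff)
    qed
  qed
qed

text \<open>In the sup norm weighted by \<open>exp (- (\<theta> * s))\<close> the average has a norm
  that becomes small for large \<open>\<theta>\<close>, so that the Duhamel operators become
  contractions on time intervals of any length.\<close>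

lemma heat_avg_exp_bound:
  assumes G: "C_space 0 {0..} G" and w: "heat_wt w" and t: "0 \<le> t" and l: "0 \<le> \<theta>"
    and b: "\<And>s p. s \<in> {0..t} \<Longrightarrow> \<bar>G s p\<bar> \<le> A * exp (\<theta> * s)"
  shows "\<bar>heat_avg \<kappa> snd w G t p\<bar> \<le> A * exp (\<theta> * t) * gauss_tail (\<theta> * t)"
proof -
  have "\<bar>heat_avg \<kappa> snd w G t p\<bar> \<le> (\<integral>\<omega>. A * exp (\<theta> * t) * (2 * heat_weight \<omega> * exp (- (\<theta> * t * min 1 ((snd \<omega>)\<^sup>2)))) \<partial>heatM)"
  proof (rule heat_avg_bound[OF G continuous_on_snd_UNIV w t])
    show "integrable heatM (\<lambda>\<omega>. A * exp (\<theta> * t) * (2 * heat_weight \<omega> * exp (- (\<theta> * t * min 1 ((snd \<omega>)\<^sup>2)))))"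
      using gauss_tail_integrable[of "\<theta> * t"] t l by (intro integrable_mult_right) auto
    fix \<omega> :: "(real \<times> real) \<times> real" and p
    have e: "t * max 0 (1 - (snd \<omega>)\<^sup>2) = t - t * min 1 ((snd \<omega>)\<^sup>2)"
      by (simp add: max_def min_def algebra_simps)
    have "\<bar>w \<omega>\<bar> * \<bar>G (t * max 0 (1 - (snd \<omega>)\<^sup>2)) p\<bar> \<le> (2 * heat_weight \<omega>) * (A * exp (\<theta> * (t * max 0 (1 - (snd \<omega>)\<^sup>2))))"
    proof (rule mult_mono)
      show "\<bar>w \<omega>\<bar> \<le> 2 * heat_weight \<omega>" using w unfolding heat_wt_def by blast
      show "\<bar>G (t * max 0 (1 - (snd \<omega>)\<^sup>2)) p\<bar> \<le> A * exp (\<theta> * (t * max 0 (1 - (snd \<omega>)\<^sup>2)))"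
        by (rule b[OF heat_time[OF t]])
    qed (use heat_weight_ge(1)[of \<omega>] in simp_all)
    also have "\<dots> = A * exp (\<theta> * t) * (2 * heat_weight \<omega> * exp (- (\<theta> * t * min 1 ((snd \<omega>)\<^sup>2))))"
      unfolding e by (simp add: right_diff_distrib exp_diff exp_minus field_simps)
    finally show "\<bar>w \<omega>\<bar> * \<bar>G (t * max 0 (1 - (snd \<omega>)\<^sup>2)) p\<bar> \<le> A * exp (\<theta> * t) * (2 * heat_weight \<omega> * exp (- (\<theta> * t * min 1 ((snd \<omega>)\<^sup>2))))" .
  qed
  then show ?thesis by (simp add: gauss_tail_def)
qed

lemma C_space_uniform_limit:
  assumes c: "\<And>n. C_space 0 {0..} (f n)"
    and u: "\<And>T. uniform_limit ({0..T} \<times> UNIV) (\<lambda>n (t, p). f n t p) (\<lambda>(t, p). g t p) sequentially"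
  shows "C_space 0 {0..} g"
proof (rule C_space_local)
  fix T
  have "continuous_on ({0..T} \<times> UNIV) (\<lambda>(t, p). g t p)"
    by (rule uniform_limit_theorem[OF always_eventually u])
      (use C_space_mono[OF c, of "{0..T}"] in \<open>auto simp: C_space_0\<close>)
  moreover have "periodic (g t)" if t: "t \<in> {0..T}" for t
  proof -
    have lim: "(\<lambda>n. f n t p) \<longlonglongrightarrow> g t p" for p
      using tendsto_uniform_limitI[OF u[of T], of "(t, p)"] t by simp
    have "periodic (f n t)" for n using c[of n] t by (simp add: C_space_0)
    then have "f n t (x + 1, y) = f n t (x, y)" "f n t (x, y + 1) = f n t (x, y)" for n x y
      unfolding periodic_def by blast+
    then show ?thesis unfolding periodic_def
      using lim LIMSEQ_unique by (metis (no_types, lifting) ext)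
  qed
  ultimately show "C_space 0 {0..T} g" by (simp add: C_space_0)
qed

section \<open>Picard iteration for the gradient of the advection term\<close>

context
  fixes V :: "real \<times> real \<Rightarrow> real \<Rightarrow> real \<times> real \<Rightarrow> real" and g :: "real \<times> real \<Rightarrow> real" and \<kappa> :: real
  assumes V: "\<And>e. e \<in> Basis \<Longrightarrow> C_space 1 {0..} (V e)" and g: "C_torus 2 g" and \<kappa>: "0 < \<kappa>"
begin

text \<open>The unknown is not the solution \<open>f\<close> but \<open>G e\<close>, the derivative
  along \<open>e\<close> of the advection term of \<open>f\<close>. Duhamel's formula expresses the
  gradient of \<open>f\<close> by \<open>heat_duhamel\<close> of \<open>G\<close>, and one further
  derivative costs only \<open>heat_duhamel'\<close>, so the product rule closes the equation on
  merely continuous \<open>G\<close>. A fixed point then yields an \<open>f\<close> with two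
  derivatives down to time 0.\<close>

definition picard :: "(real \<times> real \<Rightarrow> real \<Rightarrow> real \<times> real \<Rightarrow> real) \<Rightarrow> real \<times> real \<Rightarrow> real \<Rightarrow> real \<times> real \<Rightarrow> real" where
  "picard G e t p = (\<Sum>e'\<in>Basis. dd e (V e' t) p * (heat_init \<kappa> (dd e' g) t p - heat_duhamel \<kappa> (G e') t p)
     + V e' t p * (heat_init \<kappa> (dd e (dd e' g)) t p - heat_duhamel' \<kappa> e (G e') t p))"

lemma g_dd: "C_torus 1 (dd e g)" "C_torus 0 (dd e (dd e' g))"
  using C_torus_2D[OF g] C_torus_1D by (auto simp: dd_def)

lemma V_0: "e \<in> Basis \<Longrightarrow> C_space 0 {0..} (V e)" "e \<in> Basis \<Longrightarrow> C_space 0 {0..} (\<lambda>t. dd e' (V e t))"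
  using C_space_imp_0[OF V] C_space_dd[OF V[unfolded One_nat_def]] by blast+

lemma picard_cont:
  assumes "\<And>e. e \<in> Basis \<Longrightarrow> C_space 0 {0..} (G e)" "e \<in> Basis"
  shows "C_space 0 {0..} (picard G e)"
  unfolding picard_def[abs_def]
  by (intro C_space_sum C_space_add C_space_mult C_space_diff V_0 heat_init_cont[OF g_dd(1)] heat_init_cont[OF g_dd(2)]
      heat_duhamel_cont heat_duhamel'_cont assms)

text \<open>One constant \<open>C\<close> serves all exponential weights, so that
  \<open>\<theta>\<close> can be chosen afterwards in terms of \<open>C\<close>.\<close>

lemma picard_lipschitz:
  "\<exists>C. 0 \<le> C \<and> (\<forall>G H A \<theta>. (\<forall>e\<in>Basis. C_space 0 {0..} (G e) \<and> C_space 0 {0..} (H e)) \<longrightarrow> 0 \<le> \<theta> \<longrightarrow> 0 \<le> A \<longrightarrow>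
     (\<forall>e\<in>Basis. \<forall>s\<in>{0..T}. \<forall>p. \<bar>G e s p - H e s p\<bar> \<le> A * exp (\<theta> * s)) \<longrightarrow>
     (\<forall>e\<in>Basis. \<forall>t\<in>{0..T}. \<forall>p. \<bar>picard G e t p - picard H e t p\<bar> \<le> C * (sqrt t * gauss_tail (\<theta> * t)) * (A * exp (\<theta> * t))))"
proof -
  obtain L0 where L0: "0 \<le> L0" "\<And>e s p. e \<in> Basis \<Longrightarrow> s \<in> {0..T} \<Longrightarrow> \<bar>V e s p\<bar> \<le> L0"
    using dd_bounded[of 0 V T] V_0(1) by blast
  have "\<exists>B. 0 \<le> B \<and> (\<forall>e'\<in>Basis. \<forall>s\<in>{0..T}. \<forall>p. \<bar>dd e (V e' s) p\<bar> \<le> B)" for e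
    using dd_bounded[of 0 "\<lambda>e' t. dd e (V e' t)" T] V_0(2) by blast
  then obtain L1 where L1: "\<And>e. 0 \<le> L1 e" "\<And>e e' s p. e' \<in> Basis \<Longrightarrow> s \<in> {0..T} \<Longrightarrow> \<bar>dd e (V e' s) p\<bar> \<le> L1 e"
    by metis
  define L where "L = L0 + (\<Sum>e\<in>Basis. L1 e)"
  have L: "0 \<le> L" "\<And>e s p. e \<in> Basis \<Longrightarrow> s \<in> {0..T} \<Longrightarrow> \<bar>V e s p\<bar> \<le> L"
    "\<And>e e' s p. e \<in> Basis \<Longrightarrow> e' \<in> Basis \<Longrightarrow> s \<in> {0..T} \<Longrightarrow> \<bar>dd e (V e' s) p\<bar> \<le> L"
  proof -
    show "0 \<le> L" using L0 L1 by (simp add: L_def sum_nonneg)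
    show "\<bar>V e s p\<bar> \<le> L" if "e \<in> Basis" "s \<in> {0..T}" for e s p
      using L0(2)[OF that, of p] L1(1) by (simp add: L_def sum_nonneg add_increasing2)
    show "\<bar>dd e (V e' s) p\<bar> \<le> L" if "e \<in> Basis" "e' \<in> Basis" "s \<in> {0..T}" for e e' s p
      using L1(2)[OF that(2,3), of e p] member_le_sum[of e Basis L1] that L1(1) L0(1) by (simp add: L_def add_increasing)
  qed
  define C where "C = 2 * L * (sqrt T + 2 / \<kappa>)"
  show ?thesis
  proof (cases "0 \<le> T")
    case T: True
    have "0 \<le> C" using L \<kappa> T by (simp add: C_def)
    moreover have "\<bar>picard G e t p - picard H e t p\<bar> \<le> C * (sqrt t * gauss_tail (\<theta> * t)) * (A * exp (\<theta> * t))"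
      if G: "\<And>e. e \<in> Basis \<Longrightarrow> C_space 0 {0..} (G e)" and H: "\<And>e. e \<in> Basis \<Longrightarrow> C_space 0 {0..} (H e)"
        and l: "0 \<le> \<theta>" and A: "0 \<le> A"
        and b: "\<And>e s p. e \<in> Basis \<Longrightarrow> s \<in> {0..T} \<Longrightarrow> \<bar>G e s p - H e s p\<bar> \<le> A * exp (\<theta> * s)"
        and e: "e \<in> Basis" and t: "t \<in> {0..T}" for G H \<theta> A e t p
    proof -
      define X where "X = A * exp (\<theta> * t) * gauss_tail (\<theta> * t)"
      have X: "0 \<le> X" using A gauss_tail_nonneg by (simp add: X_def)
      have t0: "0 \<le> t" using t by simp
      have avg: "\<bar>heat_avg \<kappa> snd w (G e') t p - heat_avg \<kappa> snd w (H e') t p\<bar> \<le> X" if "e' \<in> Basis" "heat_wt w" for w e'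
        unfolding X_def heat_avg_diff[OF continuous_on_snd_UNIV that(2) G[OF that(1)] H[OF that(1)] t0]
        by (rule heat_avg_exp_bound[OF C_space_diff[OF G[OF that(1)] H[OF that(1)]] that(2) t0 l])
          (use b[OF that(1)] t in auto)
      have 1: "\<bar>heat_duhamel \<kappa> (G e') t p - heat_duhamel \<kappa> (H e') t p\<bar> \<le> sqrt T * (sqrt t * X)" if e': "e' \<in> Basis" for e'
      proof -
        have "\<bar>heat_duhamel \<kappa> (G e') t p - heat_duhamel \<kappa> (H e') t p\<bar> \<le> t * X"
          unfolding heat_duhamel_def right_diff_distrib[symmetric] abs_mult
          using t0 avg[OF e' heat_wt(2)] by (simp add: mult_left_mono)
        also have "t * X \<le> sqrt T * (sqrt t * X)"
        proof -
          have "t * X = sqrt t * (sqrt t * X)" using t0 by (simp flip: mult.assoc)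
          also have "\<dots> \<le> sqrt T * (sqrt t * X)" using t X by (intro mult_right_mono) auto
          finally show ?thesis .
        qed
        finally show ?thesis .
      qed
      have 2: "\<bar>heat_duhamel' \<kappa> e (G e') t p - heat_duhamel' \<kappa> e (H e') t p\<bar> \<le> (2 / \<kappa>) * (sqrt t * X)" if e': "e' \<in> Basis" for e'
      proof -
        have "\<bar>heat_duhamel' \<kappa> e (G e') t p - heat_duhamel' \<kappa> e (H e') t p\<bar> =
            (2 * sqrt t / \<kappa>) * \<bar>heat_avg \<kappa> snd (\<lambda>\<omega>. fst \<omega> \<bullet> e) (G e') t p - heat_avg \<kappa> snd (\<lambda>\<omega>. fst \<omega> \<bullet> e) (H e') t p\<bar>"
          unfolding heat_duhamel'_def right_diff_distrib[symmetric] abs_mult using t0 \<kappa> by simp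
        also have "\<dots> \<le> (2 * sqrt t / \<kappa>) * X" using t0 \<kappa> by (intro mult_left_mono avg e' heat_wt(3) e) simp
        finally show ?thesis by simp
      qed
      let ?S = "\<Sum>e'\<in>Basis. dd e (V e' t) p * (heat_duhamel \<kappa> (H e') t p - heat_duhamel \<kappa> (G e') t p)
          + V e' t p * (heat_duhamel' \<kappa> e (H e') t p - heat_duhamel' \<kappa> e (G e') t p)"
      have eq: "picard G e t p - picard H e t p = (\<Sum>e'\<in>Basis. dd e (V e' t) p * (heat_duhamel \<kappa> (H e') t p - heat_duhamel \<kappa> (G e') t p)
          + V e' t p * (heat_duhamel' \<kappa> e (H e') t p - heat_duhamel' \<kappa> e (G e') t p))"
        unfolding picard_def sum_subtractf[symmetric] by (intro sum.cong refl) (simp add: algebra_simps)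
      have "\<bar>?S\<bar> \<le> (\<Sum>e'\<in>(Basis :: (real \<times> real) set). L * (sqrt T * (sqrt t * X)) + L * ((2 / \<kappa>) * (sqrt t * X)))"
      proof (rule order_trans[OF sum_abs sum_mono])
        fix e' :: "real \<times> real" assume e': "e' \<in> Basis"
        have 3: "\<bar>dd e (V e' t) p * (heat_duhamel \<kappa> (H e') t p - heat_duhamel \<kappa> (G e') t p)\<bar> \<le> L * (sqrt T * (sqrt t * X))"
          unfolding abs_mult using L 1[OF e'] e e' t by (intro mult_mono) (auto simp: abs_minus_commute)
        have 4: "\<bar>V e' t p * (heat_duhamel' \<kappa> e (H e') t p - heat_duhamel' \<kappa> e (G e') t p)\<bar> \<le> L * ((2 / \<kappa>) * (sqrt t * X))"
          unfolding abs_mult using L 2[OF e'] e e' t by (intro mult_mono) (auto simp: abs_minus_commute)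
        show "\<bar>dd e (V e' t) p * (heat_duhamel \<kappa> (H e') t p - heat_duhamel \<kappa> (G e') t p)
          + V e' t p * (heat_duhamel' \<kappa> e (H e') t p - heat_duhamel' \<kappa> e (G e') t p)\<bar> \<le> L * (sqrt T * (sqrt t * X)) + L * ((2 / \<kappa>) * (sqrt t * X))"
          using 3 4 by linarith
      qed
      also have "\<dots> = C * (sqrt t * gauss_tail (\<theta> * t)) * (A * exp (\<theta> * t))"
        by (simp add: Basis_real2 C_def X_def algebra_simps)
      finally show ?thesis unfolding eq .
    qed
    ultimately show ?thesis by (intro exI[of _ C]) blast
  qed auto
qed

text \<open>The iterates, and with them the telescoping series \<open>L\<close>, do not depend on
  the time horizon. On each \<open>{0..T}\<close> a weight adapted to \<open>T\<close> makes
  successive differences shrink by half, so a single global fixed point results.\<close>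

lemma picard_fixpoint:
  obtains G where "\<And>e. e \<in> Basis \<Longrightarrow> C_space 0 {0..} (G e)"
    "\<And>e t p. e \<in> Basis \<Longrightarrow> 0 \<le> t \<Longrightarrow> picard G e t p = G e t p"
proof -
  define G where "G n = (picard ^^ n) (\<lambda>_ _ _. 0)" for n
  have G_Suc: "G (Suc n) = picard (G n)" for n by (simp add: G_def)
  have G0: "G 0 = (\<lambda>_ _ _. 0)" by (simp add: G_def)
  have Gc: "C_space 0 {0..} (G n e)" if "e \<in> Basis" for n e
    using that by (induction n arbitrary: e) (auto simp: G0 C_space_const' G_Suc intro: picard_cont)
  define L where "L e t p = (\<Sum>n. G (Suc n) e t p - G n e t p)" for e t p
  have unif: "uniform_limit ({0..T} \<times> UNIV) (\<lambda>n (t, p). G n e t p) (\<lambda>(t, p). L e t p) sequentially"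
    if T: "0 \<le> T" and e: "e \<in> Basis" for T e
  proof -
    obtain C where C: "0 \<le> C" "\<And>G H A \<theta>. (\<forall>e\<in>Basis. C_space 0 {0..} (G e) \<and> C_space 0 {0..} (H e)) \<Longrightarrow> 0 \<le> \<theta> \<Longrightarrow> 0 \<le> A \<Longrightarrow>
        (\<forall>e\<in>Basis. \<forall>s\<in>{0..T}. \<forall>p. \<bar>G e s p - H e s p\<bar> \<le> A * exp (\<theta> * s)) \<Longrightarrow>
        (\<forall>e\<in>Basis. \<forall>t\<in>{0..T}. \<forall>p. \<bar>picard G e t p - picard H e t p\<bar> \<le> C * (sqrt t * gauss_tail (\<theta> * t)) * (A * exp (\<theta> * t)))"
      using picard_lipschitz[of T] by metis
    \<comment> \<open>The resulting contraction factor is \<open>C / (2 * (C + 1))\<close>, at most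
      1/2; adding 1 also covers \<open>C = 0\<close>.\<close>
    obtain \<theta> where \<theta>: "0 \<le> \<theta>" "\<And>t. t \<in> {0..T} \<Longrightarrow> sqrt t * gauss_tail (\<theta> * t) \<le> 1 / (2 * (C + 1))"
      using gauss_tail_small[of "1 / (2 * (C + 1))" T] C T by (metis add_nonneg_pos divide_pos_pos mult_pos_pos zero_less_numeral zero_less_one)
    obtain B where B: "0 \<le> B" "\<And>e s p. e \<in> Basis \<Longrightarrow> s \<in> {0..T} \<Longrightarrow> \<bar>G 1 e s p\<bar> \<le> B"
      using dd_bounded[of 0 "G 1" T] Gc by blast
    have step: "\<forall>e\<in>Basis. \<forall>s\<in>{0..T}. \<forall>p. \<bar>G (Suc n) e s p - G n e s p\<bar> \<le> (B * (1/2)^n) * exp (\<theta> * s)" for n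
    proof (induction n)
      case 0
      show ?case
      proof (intro ballI allI)
        fix e :: "real \<times> real" and s p assume e: "e \<in> Basis" and s: "s \<in> {0..T}"
        have "B * 1 \<le> B * exp (\<theta> * s)" using B(1) \<theta>(1) s by (intro mult_left_mono) auto
        then show "\<bar>G (Suc 0) e s p - G 0 e s p\<bar> \<le> (B * (1/2)^0) * exp (\<theta> * s)"
          using B(2)[OF e s, of p] by (simp add: G0)
      qed
    next
      case (Suc n)
      have q: "C * (sqrt s * gauss_tail (\<theta> * s)) \<le> 1/2" if "s \<in> {0..T}" for s
      proof -
        have "C * (sqrt s * gauss_tail (\<theta> * s)) \<le> C * (1 / (2 * (C + 1)))" using \<theta>(2)[OF that] C(1) by (rule mult_left_mono)
        also have "\<dots> \<le> 1/2" using C(1) by (simp add: field_simps)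
        finally show ?thesis .
      qed
      show ?case
      proof (intro ballI allI)
        fix e :: "real \<times> real" and s p assume e: "e \<in> Basis" and s: "s \<in> {0..T}"
        have 1: "\<bar>picard (G (Suc n)) e s p - picard (G n) e s p\<bar> \<le>
            C * (sqrt s * gauss_tail (\<theta> * s)) * ((B * (1/2)^n) * exp (\<theta> * s))"
        proof -
          have "0 \<le> B * (1/2)^n" using B(1) by simp
          from C(2)[OF _ \<theta>(1) this Suc] show ?thesis using Gc e s by blast
        qed
        have 2: "C * (sqrt s * gauss_tail (\<theta> * s)) * ((B * (1/2)^n) * exp (\<theta> * s)) \<le> 1/2 * ((B * (1/2)^n) * exp (\<theta> * s))"
          using q[OF s] B(1) by (intro mult_right_mono) auto
        show "\<bar>G (Suc (Suc n)) e s p - G (Suc n) e s p\<bar> \<le> (B * (1/2)^Suc n) * exp (\<theta> * s)"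
          using order_trans[OF 1 2] by (simp add: G_Suc mult_ac)
      qed
    qed
    have "uniform_limit ({0..T} \<times> UNIV) (\<lambda>n x. \<Sum>k<n. G (Suc k) e (fst x) (snd x) - G k e (fst x) (snd x))
        (\<lambda>x. \<Sum>k. G (Suc k) e (fst x) (snd x) - G k e (fst x) (snd x)) sequentially"
    proof (rule Weierstrass_m_test)
      show "summable (\<lambda>n. (B * exp (\<theta> * T)) * (1/2)^n)" by (intro summable_mult summable_geometric) auto
      fix n and x :: "real \<times> real \<times> real" assume x: "x \<in> {0..T} \<times> UNIV"
      then have x': "fst x \<in> {0..T}" by auto
      have "\<bar>G (Suc n) e (fst x) (snd x) - G n e (fst x) (snd x)\<bar> \<le> (B * (1/2)^n) * exp (\<theta> * fst x)"
        using step e x' by blast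
      also have "\<dots> \<le> (B * (1/2)^n) * exp (\<theta> * T)" using x' \<theta>(1) B(1) by (intro mult_left_mono) (auto intro: mult_left_mono)
      finally show "norm (G (Suc n) e (fst x) (snd x) - G n e (fst x) (snd x)) \<le> (B * exp (\<theta> * T)) * (1/2)^n"
        by (simp add: mult_ac)
    qed
    moreover have "(\<Sum>k<n. G (Suc k) e t p - G k e t p) = G n e t p" for n t p
      by (subst sum_lessThan_telescope) (simp add: G0)
    ultimately show ?thesis by (simp add: L_def case_prod_beta')
  qed
  have Lc: "C_space 0 {0..} (L e)" if "e \<in> Basis" for e
  proof (rule C_space_uniform_limit[OF Gc[OF that]])
    show "uniform_limit ({0..T} \<times> UNIV) (\<lambda>n (t, p). G n e t p) (\<lambda>(t, p). L e t p) sequentially" for T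
    proof (cases "0 \<le> T")
      case True then show ?thesis using unif that by blast
    next
      case False then show ?thesis by simp
    qed
  qed
  have fixp: "picard L e t p = L e t p" if e: "e \<in> Basis" and t: "0 \<le> t" for e t p
  proof -
    obtain C where C: "0 \<le> C" "\<And>G H A \<theta>. (\<forall>e\<in>Basis. C_space 0 {0..} (G e) \<and> C_space 0 {0..} (H e)) \<Longrightarrow> 0 \<le> \<theta> \<Longrightarrow> 0 \<le> A \<Longrightarrow>
        (\<forall>e\<in>Basis. \<forall>s\<in>{0..t}. \<forall>p. \<bar>G e s p - H e s p\<bar> \<le> A * exp (\<theta> * s)) \<Longrightarrow>
        (\<forall>e\<in>Basis. \<forall>s\<in>{0..t}. \<forall>p. \<bar>picard G e s p - picard H e s p\<bar> \<le> C * (sqrt s * gauss_tail (\<theta> * s)) * (A * exp (\<theta> * s)))"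
      using picard_lipschitz[of t] by metis
    define K where "K = C * (sqrt t * gauss_tail 0) + 1"
    have K: "0 < K" using C t gauss_tail_nonneg[of 0] by (simp add: K_def add_nonneg_pos)
    \<comment> \<open>Here only the continuity of \<open>picard\<close> under uniform convergence
      matters, so the Lipschitz estimate is taken with the trivial weight
      \<open>\<theta> = 0\<close>.\<close>
    have "(\<lambda>n. picard (G n) e t p) \<longlonglongrightarrow> picard L e t p"
    proof (rule tendstoI)
      fix \<epsilon> :: real assume \<epsilon>: "0 < \<epsilon>"
      have ev: "\<forall>\<^sub>F n in sequentially. \<forall>x\<in>{0..t} \<times> UNIV. dist (case x of (s, p) \<Rightarrow> G n e' s p) (case x of (s, p) \<Rightarrow> L e' s p) < \<epsilon> / (2 * K)"
        if "e' \<in> Basis" for e'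
        using uniform_limitD[OF unif[OF t that], of "\<epsilon> / (2 * K)"] \<epsilon> K by simp
      have "\<forall>\<^sub>F n in sequentially. \<forall>e'\<in>Basis. \<forall>x\<in>{0..t} \<times> UNIV. dist (case x of (s, p) \<Rightarrow> G n e' s p) (case x of (s, p) \<Rightarrow> L e' s p) < \<epsilon> / (2 * K)"
        by (rule eventually_ball_finite) (use ev in auto)
      then show "\<forall>\<^sub>F n in sequentially. dist (picard (G n) e t p) (picard L e t p) < \<epsilon>"
      proof eventually_elim
        case (elim n)
        have "\<forall>e'\<in>Basis. \<forall>s\<in>{0..t}. \<forall>p. \<bar>G n e' s p - L e' s p\<bar> \<le> \<epsilon> / (2 * K) * exp (0 * s)"
        proof (intro ballI allI)
          fix e' :: "real \<times> real" and s p assume e': "e' \<in> Basis" and s: "s \<in> {0..t}"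
          have "dist (G n e' s p) (L e' s p) < \<epsilon> / (2 * K)"
            using bspec[OF bspec[OF elim e'], of "(s, p)"] s by simp
          then show "\<bar>G n e' s p - L e' s p\<bar> \<le> \<epsilon> / (2 * K) * exp (0 * s)" by (simp add: dist_real_def)
        qed
        then have "\<forall>e\<in>Basis. \<forall>s\<in>{0..t}. \<forall>p. \<bar>picard (G n) e s p - picard L e s p\<bar> \<le> C * (sqrt s * gauss_tail (0 * s)) * (\<epsilon> / (2 * K) * exp (0 * s))"
          using Gc Lc \<epsilon> K by (intro C(2)) auto
        then have "\<bar>picard (G n) e t p - picard L e t p\<bar> \<le> C * (sqrt t * gauss_tail (0 * t)) * (\<epsilon> / (2 * K) * exp (0 * t))"
          using e t by (simp only: atLeastAtMost_iff order_refl)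
        also have "\<dots> = (K - 1) * (\<epsilon> / (2 * K))" by (simp add: K_def)
        also have "\<dots> \<le> K * (\<epsilon> / (2 * K))" using \<epsilon> K by (intro mult_right_mono) auto
        also have "\<dots> < \<epsilon>" using \<epsilon> K by simp
        finally show ?case by (simp add: dist_real_def)
      qed
    qed
    moreover have "(\<lambda>n. G (Suc n) e t p) \<longlonglongrightarrow> L e t p"
      by (rule LIMSEQ_Suc) (use tendsto_uniform_limitI[OF unif[OF t e], of "(t, p)"] t in simp)
    ultimately show ?thesis unfolding G_Suc by (rule LIMSEQ_unique)
  qed
  show ?thesis by (rule that[of L]) (use Lc fixp in auto)
qed

text \<open>\<open>F\<close> is the advection term formed with the candidate gradient
  \<open>a\<close>. The fixed point equation says that the derivatives of \<open>F\<close> are the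
  functions \<open>G e\<close>; hence the gradient of Duhamel's \<open>f\<close> with source
  \<open>F\<close> is \<open>a\<close>, and \<open>F\<close> is the advection term of
  \<open>f\<close> itself.\<close>

lemma advection_diffusion_exists_aux:
  obtains f where "C_space 2 {0..} f" "f 0 = g"
    "\<And>t p. 0 < t \<Longrightarrow> ((\<lambda>s. f s p) has_real_derivative
        (\<kappa>\<^sup>2 / 2) * (\<Sum>e\<in>Basis. dd e (dd e (f t)) p) - (\<Sum>e\<in>Basis. V e t p * dd e (f t) p)) (at t)"
proof -
  obtain G where Gc: "\<And>e. e \<in> Basis \<Longrightarrow> C_space 0 {0..} (G e)"
    and Gp: "\<And>e t p. e \<in> Basis \<Longrightarrow> 0 \<le> t \<Longrightarrow> picard G e t p = G e t p"
    using picard_fixpoint by blast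
  define a where "a e t p = heat_init \<kappa> (dd e g) t p - heat_duhamel \<kappa> (G e) t p" for e t p
  define a' where "a' e e' t p = heat_init \<kappa> (dd e' (dd e g)) t p - heat_duhamel' \<kappa> e' (G e) t p" for e e' t p
  have a0: "C_space 0 {0..} (a e)" if "e \<in> Basis" for e
    unfolding a_def[abs_def] by (intro C_space_diff heat_init_cont[OF g_dd(1)] heat_duhamel_cont Gc that)
  have a'0: "C_space 0 {0..} (a' e e')" if "e \<in> Basis" "e' \<in> Basis" for e e'
    unfolding a'_def[abs_def] by (intro C_space_diff heat_init_cont[OF g_dd(2)] heat_duhamel'_cont Gc that)
  have da: "((\<lambda>h. a e t (p + h *\<^sub>R e')) has_real_derivative a' e e' t p) (at 0)"
    if "t \<in> {0..}" "e \<in> Basis" "e' \<in> Basis" for e e' t p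
    unfolding a_def a'_def heat_duhamel_def heat_duhamel'_def
    by (intro DERIV_diff heat_init_dd[OF g_dd(1)] heat_avg_smoothing Gc that \<kappa>) (use that in auto)
  have a1: "C_space 1 {0..} (a e)" if "e \<in> Basis" for e
    using C_space_SucI_dd(1)[where f="a e" and f'="a' e" and k=0, OF a0[OF that] da[OF _ that] a'0[OF that]] by simp
  have dda: "dd e' (a e t) = a' e e' t" if "e \<in> Basis" "e' \<in> Basis" "0 \<le> t" for e e' t
    using C_space_SucI_dd(2)[where f="a e" and f'="a' e" and k=0, OF a0[OF that(1)] da[OF _ that(1)] a'0[OF that(1)], of t e'] that by simp
  define F where "F t p = (\<Sum>e'\<in>Basis. V e' t p * a e' t p)" for t p
  have F1: "C_space 1 {0..} F"
    unfolding F_def[abs_def] by (intro C_space_sum C_space_mult V a1)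
  have ddF: "dd e (F t) = G e t" if e: "e \<in> Basis" and t: "0 \<le> t" for e t
  proof
    fix p
    have Ft: "C_torus 1 (F t)" and Vt: "\<And>e'. e' \<in> Basis \<Longrightarrow> C_torus 1 (V e' t)" and at: "\<And>e'. e' \<in> Basis \<Longrightarrow> C_torus 1 (a e' t)"
      using C_space_at[OF F1] C_space_at[OF V] C_space_at[OF a1] t by auto
    have "((\<lambda>h. F t (p + h *\<^sub>R e)) has_real_derivative (\<Sum>e'\<in>Basis. dd e (V e' t) (p + 0 *\<^sub>R e) * a e' t (p + 0 *\<^sub>R e) + dd e (a e' t) (p + 0 *\<^sub>R e) * V e' t (p + 0 *\<^sub>R e))) (at 0)"
      unfolding F_def by (intro DERIV_sum DERIV_mult has_dd Vt at e)
    moreover have "((\<lambda>h. F t (p + h *\<^sub>R e)) has_real_derivative dd e (F t) (p + 0 *\<^sub>R e)) (at 0)"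
      by (rule has_dd[OF Ft e])
    ultimately have "dd e (F t) p = (\<Sum>e'\<in>Basis. dd e (V e' t) p * a e' t p + dd e (a e' t) p * V e' t p)"
      using DERIV_unique by fastforce
    also have "\<dots> = picard G e t p"
      unfolding picard_def by (intro sum.cong refl) (simp add: dda e t, simp add: a_def a'_def)
    finally show "dd e (F t) p = G e t p" using Gp[OF e t] by simp
  qed
  define f where "f t p = heat_init \<kappa> g t p - heat_duhamel \<kappa> F t p" for t p
  have f0: "C_space 0 {0..} f"
    unfolding f_def[abs_def] by (intro C_space_diff heat_init_cont[OF g] heat_duhamel_cont C_space_imp_0[OF F1])
  have g1: "C_torus 1 g" using C_torus_2D[OF g] by simp
  have df: "((\<lambda>h. f t (p + h *\<^sub>R e)) has_real_derivative a e t p) (at 0)"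
    if t: "t \<in> {0..}" and e: "e \<in> Basis" for e t p
  proof -
    have "((\<lambda>h. f t (p + h *\<^sub>R e)) has_real_derivative heat_init \<kappa> (dd e g) t p - t * heat_avg \<kappa> snd (\<lambda>\<omega>. 2 * snd \<omega>) (\<lambda>s. dd e (F s)) t p) (at 0)"
      unfolding f_def heat_duhamel_def
      by (intro DERIV_diff DERIV_cmult heat_init_dd[OF g1] heat_avg_dd[OF continuous_on_snd_UNIV heat_wt(2) F1] e) (use t in auto)
    also have "heat_avg \<kappa> snd (\<lambda>\<omega>. 2 * snd \<omega>) (\<lambda>s. dd e (F s)) t p = heat_avg \<kappa> snd (\<lambda>\<omega>. 2 * snd \<omega>) (G e) t p"
      by (rule heat_avg_cong) (use t ddF e in auto)
    finally show ?thesis by (simp add: a_def heat_duhamel_def)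
  qed
  have f2: "C_space 2 {0..} f"
    using C_space_SucI_dd(1)[where f=f and f'=a and k=1, OF f0 df a1] by (simp add: numeral_2_eq_2)
  have ddf: "dd e (f t) = a e t" if "e \<in> Basis" "0 \<le> t" for e t
    using C_space_SucI_dd(2)[where f=f and f'=a and k=1, OF f0 df a1, of t e] that by simp
  have "((\<lambda>s. f s p) has_real_derivative
        (\<kappa>\<^sup>2 / 2) * (\<Sum>e\<in>Basis. dd e (dd e (f t)) p) - (\<Sum>e\<in>Basis. V e t p * dd e (f t) p)) (at t)"
    if t: "0 < t" for t p
  proof -
    have "((\<lambda>s. f s p) has_real_derivative (\<kappa>\<^sup>2 / 2) * (\<Sum>e\<in>Basis. heat_init \<kappa> (dd e (dd e g)) t p) -
       (F t p + (\<Sum>e\<in>Basis. \<kappa> * sqrt t * heat_avg \<kappa> snd (\<lambda>\<omega>. fst \<omega> \<bullet> e) (\<lambda>s. dd e (F s)) t p))) (at t)"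
      unfolding f_def heat_duhamel_def by (intro DERIV_diff heat_init_time_deriv g \<kappa> t heat_time_deriv F1)
    also have "(\<Sum>e\<in>Basis. \<kappa> * sqrt t * heat_avg \<kappa> snd (\<lambda>\<omega>. fst \<omega> \<bullet> e) (\<lambda>s. dd e (F s)) t p) =
        (\<kappa>\<^sup>2 / 2) * (\<Sum>e\<in>Basis. heat_duhamel' \<kappa> e (G e) t p)"
      unfolding sum_distrib_left
    proof (intro sum.cong refl)
      fix e :: "real \<times> real" assume e: "e \<in> Basis"
      have "heat_avg \<kappa> snd (\<lambda>\<omega>. fst \<omega> \<bullet> e) (\<lambda>s. dd e (F s)) t p = heat_avg \<kappa> snd (\<lambda>\<omega>. fst \<omega> \<bullet> e) (G e) t p"
        by (rule heat_avg_cong) (use t ddF e in auto)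
      then show "\<kappa> * sqrt t * heat_avg \<kappa> snd (\<lambda>\<omega>. fst \<omega> \<bullet> e) (\<lambda>s. dd e (F s)) t p = \<kappa>\<^sup>2 / 2 * heat_duhamel' \<kappa> e (G e) t p"
        using \<kappa> by (simp add: heat_duhamel'_def field_simps power2_eq_square)
    qed
    also have "(\<kappa>\<^sup>2 / 2) * (\<Sum>e\<in>Basis. heat_init \<kappa> (dd e (dd e g)) t p) - (F t p + (\<kappa>\<^sup>2 / 2) * (\<Sum>e\<in>Basis. heat_duhamel' \<kappa> e (G e) t p))
        = (\<kappa>\<^sup>2 / 2) * (\<Sum>e\<in>Basis. dd e (dd e (f t)) p) - (\<Sum>e\<in>Basis. V e t p * dd e (f t) p)"
      using t by (simp add: ddf dda F_def a'_def sum_subtractf right_diff_distrib)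
    finally show ?thesis .
  qed
  moreover have "f 0 = g" by (auto simp: f_def heat_init_0 heat_duhamel_def)
  ultimately show ?thesis using that f2 by blast
qed

end

text \<open>With \<open>\<kappa> = sqrt (2 * \<nu>)\<close> the diffusion coefficient
  \<open>\<kappa>\<^sup>2 / 2\<close> is \<open>\<nu>\<close>. The regularity down to time 0 goes
  beyond the definition of a solution; it lets backward uniqueness start at the initial
  time.\<close>

theorem passive_scalar_exists:
  assumes v: "torus_vector_field v" and g: "C_torus 2 g" and \<nu>: "0 < \<nu>"
  obtains f where "C_space 2 {0..} f" "f 0 = g" "passive_scalar_solution v \<nu> f"
proof -
  define V where "V e t p = v t p \<bullet> e" for e t p
  have V: "C_space 1 {0..} (V e)" if "e \<in> Basis" for e
  proof -
    have "V (1, 0) = (\<lambda>t p. fst (v t p))" "V (0, 1) = (\<lambda>t p. snd (v t p))"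
      by (auto simp: V_def fun_eq_iff inner_prod_def)
    then show ?thesis using Basis_cases[OF that] v by (auto simp: torus_vector_field_def)
  qed
  have \<kappa>: "0 < sqrt (2 * \<nu>)" using \<nu> by simp
  show thesis
  proof (rule advection_diffusion_exists_aux[of V g "sqrt (2 * \<nu>)", OF V g \<kappa>])
    fix f
    assume f: "C_space 2 {0..} f" "f 0 = g"
      and d: "\<And>t p. 0 < t \<Longrightarrow> ((\<lambda>s. f s p) has_real_derivative
        ((sqrt (2 * \<nu>))\<^sup>2 / 2) * (\<Sum>e\<in>Basis. dd e (dd e (f t)) p) - (\<Sum>e\<in>Basis. V e t p * dd e (f t) p)) (at t)"
    have e: "((sqrt (2 * \<nu>))\<^sup>2 / 2) * (\<Sum>e\<in>Basis. dd e (dd e (f t)) p) - (\<Sum>e\<in>Basis. V e t p * dd e (f t) p) =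
        \<nu> * laplacian (f t) p - (fst (v t p) * Dx (f t) p + snd (v t p) * Dy (f t) p) - 0" for t p
      using \<nu> by (simp add: Basis_real2 V_def laplacian_def inner_prod_def)
    have "passive_scalar_solution v \<nu> f"
      unfolding passive_scalar_solution_def adv_diff_solution_def
    proof (intro conjI ballI allI)
      show "C_space 2 (interior {0..}) f" by (rule C_space_mono[OF f(1) interior_subset])
      show "((\<lambda>s. f s p) has_real_derivative \<nu> * laplacian (f t) p - (fst (v t p) * Dx (f t) p + snd (v t p) * Dy (f t) p) - 0) (at t)"
        if "t \<in> interior {0..}" for t p
        using d[of t p] that unfolding e by simp
    qed (rule C_space_imp_0[OF f(1)])
    then show thesis by (rule that[OF f])
  qed
qed

subsection \<open>Energy identities\<close>

text \<open>The time set is a parameter because restricted, shifted and time-reversed fields all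
  occur.\<close>

definition flow_on :: "real set \<Rightarrow> (real \<Rightarrow> real \<times> real \<Rightarrow> real \<times> real) \<Rightarrow> bool" where
  "flow_on J u \<longleftrightarrow> C_space 1 J (\<lambda>t p. fst (u t p)) \<and> C_space 1 J (\<lambda>t p. snd (u t p)) \<and>
     (\<forall>t\<in>J. \<forall>p. Dx (\<lambda>q. fst (u t q)) p + Dy (\<lambda>q. snd (u t q)) p = 0)"

definition advect :: "(real \<times> real \<Rightarrow> real \<times> real) \<Rightarrow> (real \<times> real \<Rightarrow> real) \<Rightarrow> real \<times> real \<Rightarrow> real" where
  "advect w f p = fst (w p) * Dx f p + snd (w p) * Dy f p"

text \<open>Used on open time intervals; continuity up to the end points is stated separately where
  it enters. The source \<open>r\<close> is carried along so that species and passive scalars share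
  the energy identities.\<close>

definition strong_sol :: "real set \<Rightarrow> (real \<Rightarrow> real \<times> real \<Rightarrow> real \<times> real) \<Rightarrow> real \<Rightarrow>
    (real \<Rightarrow> real \<times> real \<Rightarrow> real) \<Rightarrow> (real \<Rightarrow> real \<times> real \<Rightarrow> real) \<Rightarrow> bool" where
  "strong_sol J u \<nu> r f \<longleftrightarrow> C_space 2 J f \<and> C_space 0 J r \<and>
     (\<forall>t\<in>J. \<forall>p. ((\<lambda>s. f s p) has_real_derivative \<nu> * laplacian (f t) p - advect (u t) (f t) p - r t p) (at t))"

definition energy :: "(real \<times> real \<Rightarrow> real) \<Rightarrow> real" where
  "energy f = torus_integral (\<lambda>p. (f p)\<^sup>2)"

definition dirichlet :: "(real \<times> real \<Rightarrow> real) \<Rightarrow> real" where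
  "dirichlet f = torus_integral (\<lambda>p. (Dx f p)\<^sup>2 + (Dy f p)\<^sup>2)"

lemma flow_onD:
  assumes "flow_on J u" "t \<in> J"
  shows "C_torus 1 (\<lambda>p. fst (u t p))" "C_torus 1 (\<lambda>p. snd (u t p))"
    "Dx (\<lambda>q. fst (u t q)) p + Dy (\<lambda>q. snd (u t q)) p = 0"
  using assms C_space_at unfolding flow_on_def by blast+

lemma flow_on_mono: "flow_on J u \<Longrightarrow> J' \<subseteq> J \<Longrightarrow> flow_on J' u"
  unfolding flow_on_def using C_space_mono by blast

lemma strong_sol_mono: "strong_sol J u \<nu> r f \<Longrightarrow> J' \<subseteq> J \<Longrightarrow> strong_sol J' u \<nu> r f"
  unfolding strong_sol_def using C_space_mono by blast

lemma strong_sol_time: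
  "strong_sol J u \<nu> r f \<Longrightarrow> t \<in> J \<Longrightarrow>
    ((\<lambda>s. f s p) has_real_derivative \<nu> * laplacian (f t) p - advect (u t) (f t) p - r t p) (at t)"
  unfolding strong_sol_def by blast

lemma C_space_advect:
  assumes "flow_on J u" "C_space 1 J f" shows "C_space 0 J (\<lambda>t. advect (u t) (f t))"
  unfolding advect_def[abs_def] using assms
  by (auto simp: flow_on_def intro!: C_space_add C_space_mult C_space_Dx_1 C_space_Dy_1 intro: C_space_imp_0)

lemma C_torus_advect:
  assumes "flow_on J u" "t \<in> J" "C_torus 1 f" shows "C_torus 0 (advect (u t) f)"
  unfolding advect_def[abs_def]
  using C_torus_1D[OF flow_onD(1)[OF assms(1,2)]] C_torus_1D[OF flow_onD(2)[OF assms(1,2)]] C_torus_1D[OF assms(3)]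
  by (simp add: C_torus_add C_torus_mult)

lemma strong_sol_rhs:
  assumes "flow_on J u" "strong_sol J u \<nu> r f"
  shows "C_space 0 J (\<lambda>t p. \<nu> * laplacian (f t) p - advect (u t) (f t) p - r t p)"
  using assms unfolding strong_sol_def
  by (intro C_space_diff C_space_cmult C_space_laplacian C_space_advect) (auto dest: C_space_2_1)

text \<open>As \<open>u t\<close> is divergence free, the sum of the two integrands is the
  divergence of \<open>u t\<close> times the product of the functions.\<close>

lemma torus_advect_skew:
  assumes "flow_on J u" "t \<in> J" and f: "C_torus 1 f" and g: "C_torus 1 g"
  shows "torus_integral (\<lambda>p. advect (u t) f p * g p) = - torus_integral (\<lambda>p. f p * advect (u t) g p)"
proof -
  note u = flow_onD[OF assms(1,2)]
  let ?u = "\<lambda>p. fst (u t p)" and ?v = "\<lambda>p. snd (u t p)"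
  note * = C_torus_1D[OF f] C_torus_1D[OF g] C_torus_1D[OF u(1)] C_torus_1D[OF u(2)]
  have "advect (u t) f p * g p + f p * advect (u t) g p =
     Dx (\<lambda>p. ?u p * (f p * g p)) p + Dy (\<lambda>p. ?v p * (f p * g p)) p" for p
  proof -
    have "Dy ?v p = - Dx ?u p" using u(3)[of p] by simp
    then show ?thesis using u(1,2) f g
      by (simp add: Dx_mult Dy_mult C_torus_mult advect_def) (simp add: algebra_simps)
  qed
  then have "torus_integral (\<lambda>p. advect (u t) f p * g p + f p * advect (u t) g p) =
     torus_integral (\<lambda>p. Dx (\<lambda>p. ?u p * (f p * g p)) p + Dy (\<lambda>p. ?v p * (f p * g p)) p)" by simp
  also have "\<dots> = 0"
  proof -
    have 1: "C_torus 1 (\<lambda>p. ?u p * (f p * g p))" "C_torus 1 (\<lambda>p. ?v p * (f p * g p))"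
      using u f g by (auto intro!: C_torus_mult simp del: One_nat_def)
    show ?thesis
      using C_torus_1D[OF 1(1)] C_torus_1D[OF 1(2)] torus_integral_Dx[OF 1(1)] torus_integral_Dy[OF 1(2)]
      by (simp add: torus_integral_add)
  qed
  finally show ?thesis
    using * C_torus_advect[OF assms(1,2) f] C_torus_advect[OF assms(1,2) g]
    by (subst (asm) torus_integral_add) (auto intro: C_torus_mult)
qed

lemma torus_advect_self:
  assumes "flow_on J u" "t \<in> J" "C_torus 1 f"
  shows "torus_integral (\<lambda>p. advect (u t) f p * f p) = 0"
  using torus_advect_skew[OF assms assms(3)] by (simp add: mult.commute)

lemma torus_advect_zero:
  assumes "flow_on J u" "t \<in> J" "C_torus 1 f"
  shows "torus_integral (advect (u t) f) = 0"
proof -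
  have "Dx (\<lambda>_. 1) = (\<lambda>_. 0)" "Dy (\<lambda>_. 1) = (\<lambda>_. 0)" by (auto intro: Dx_eqI Dy_eqI)
  then have "advect (u t) (\<lambda>_. 1) = (\<lambda>_. 0)" by (auto simp: advect_def)
  then show ?thesis
    using torus_advect_skew[OF assms C_torus_const[of 1 1]] by (simp add: torus_integral_const)
qed

lemma torus_green:
  assumes f: "C_torus 2 f" and g: "C_torus 1 g"
  shows "torus_integral (\<lambda>p. laplacian f p * g p) = - torus_integral (\<lambda>p. Dx f p * Dx g p + Dy f p * Dy g p)"
proof -
  have f1: "C_torus 1 (Dx f)" "C_torus 1 (Dy f)" using C_torus_2D[OF f] by auto
  note * = C_torus_1D[OF f1(1)] C_torus_1D[OF f1(2)] C_torus_1D[OF g]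
  have "torus_integral (\<lambda>p. laplacian f p * g p) = torus_integral (\<lambda>p. Dx (Dx f) p * g p + Dy (Dy f) p * g p)"
    by (simp add: laplacian_def algebra_simps)
  also have "\<dots> = torus_integral (\<lambda>p. Dx (Dx f) p * g p) + torus_integral (\<lambda>p. Dy (Dy f) p * g p)"
    using * by (intro torus_integral_add C_torus_mult) auto
  also have "\<dots> = - torus_integral (\<lambda>p. Dx f p * Dx g p) - torus_integral (\<lambda>p. Dy f p * Dy g p)"
    using torus_ibp_x[OF f1(1) g] torus_ibp_y[OF f1(2) g] by simp
  also have "\<dots> = - torus_integral (\<lambda>p. Dx f p * Dx g p + Dy f p * Dy g p)"
    using * by (subst torus_integral_add) (auto intro: C_torus_mult)
  finally show ?thesis .
qed

lemma torus_green_self: "C_torus 2 f \<Longrightarrow> torus_integral (\<lambda>p. laplacian f p * f p) = - dirichlet f"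
  using torus_green[of f f] C_torus_2D[of f] by (simp add: dirichlet_def power2_eq_square)

lemma torus_green_sym:
  assumes "C_torus 2 f" "C_torus 2 g"
  shows "torus_integral (\<lambda>p. laplacian f p * g p) = torus_integral (\<lambda>p. f p * laplacian g p)"
  using torus_green[of f g] torus_green[of g f] C_torus_2D[of f] C_torus_2D[of g] assms
  by (simp add: mult.commute)

lemma torus_laplacian_zero: "C_torus 2 f \<Longrightarrow> torus_integral (laplacian f) = 0"
proof -
  assume f: "C_torus 2 f"
  have "Dx (\<lambda>_. 1) = (\<lambda>_. 0)" "Dy (\<lambda>_. 1) = (\<lambda>_. 0)" by (auto intro: Dx_eqI Dy_eqI)
  then show ?thesis using torus_green[OF f C_torus_const[of 1 1]] by (simp add: torus_integral_const)
qed

lemma energy_nonneg: "C_torus 0 f \<Longrightarrow> 0 \<le> energy f"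
  unfolding energy_def by (intro torus_integral_nonneg C_torus_power2) auto

lemma dirichlet_nonneg: "C_torus 1 f \<Longrightarrow> 0 \<le> dirichlet f"
  unfolding dirichlet_def using C_torus_1D[of f]
  by (intro torus_integral_nonneg C_torus_add C_torus_power2) auto

lemma energy_continuous: "C_space 0 J f \<Longrightarrow> continuous_on J (\<lambda>t. energy (f t))"
  unfolding energy_def by (intro torus_integral_continuous C_space_power2)

lemma dirichlet_continuous: "C_space 1 J f \<Longrightarrow> continuous_on J (\<lambda>t. dirichlet (f t))"
  unfolding dirichlet_def
  by (intro torus_integral_continuous C_space_power2 C_space_add C_space_Dx_1 C_space_Dy_1)

lemma mass_deriv:
  assumes u: "flow_on J u" and s: "strong_sol J u \<nu> r f" and J: "open J" "t \<in> J"
  shows "((\<lambda>t. torus_integral (f t)) has_real_derivative - torus_integral (r t)) (at t)"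
proof -
  have f2: "C_space 2 J f" using s by (simp add: strong_sol_def)
  have ft: "C_torus 2 (f t)" "C_torus 0 (r t)" using s J C_space_at by (auto simp: strong_sol_def)
  have f1: "C_torus 1 (f t)" using C_torus_2D ft by blast
  have "((\<lambda>t. torus_integral (f t)) has_real_derivative
      torus_integral (\<lambda>p. \<nu> * laplacian (f t) p - advect (u t) (f t) p - r t p)) (at t)"
    by (rule torus_integral_deriv[OF J C_space_imp_0[OF f2] strong_sol_rhs[OF u s] strong_sol_time[OF s]])
  also have "torus_integral (\<lambda>p. \<nu> * laplacian (f t) p - advect (u t) (f t) p - r t p) = - torus_integral (r t)"
    using C_torus_laplacian[OF ft(1)] C_torus_advect[OF u J(2) f1] ft
    by (simp add: torus_integral_diff torus_integral_cmult C_torus_intros torus_laplacian_zero torus_advect_zero[OF u J(2) f1])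
  finally show ?thesis .
qed

lemma energy_deriv:
  assumes u: "flow_on J u" and s: "strong_sol J u \<nu> r f" and J: "open J" "t \<in> J"
  shows "((\<lambda>t. energy (f t)) has_real_derivative - 2 * \<nu> * dirichlet (f t) - 2 * torus_integral (\<lambda>p. f t p * r t p)) (at t)"
proof -
  have f2: "C_space 2 J f" using s by (simp add: strong_sol_def)
  have f0: "C_space 0 J f" using C_space_imp_0[OF f2] .
  have ft: "C_torus 2 (f t)" "C_torus 0 (r t)" using s J C_space_at by (auto simp: strong_sol_def)
  have f1: "C_torus 1 (f t)" "C_torus 0 (f t)" using C_torus_2D ft C_torus_imp_0 by blast+
  note * = C_torus_laplacian[OF ft(1)] C_torus_advect[OF u J(2) f1(1)]
  let ?f' = "\<lambda>t p. \<nu> * laplacian (f t) p - advect (u t) (f t) p - r t p"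
  have "((\<lambda>t. torus_integral (\<lambda>p. (f t p)\<^sup>2)) has_real_derivative
      torus_integral (\<lambda>p. 2 * (f t p * ?f' t p))) (at t)"
  proof (rule torus_integral_deriv[OF J C_space_power2[OF f0] C_space_cmult[OF C_space_mult[OF f0 strong_sol_rhs[OF u s]]]])
    fix t p assume "t \<in> J"
    from DERIV_power[OF strong_sol_time[OF s this], where n=2]
    show "((\<lambda>t. (f t p)\<^sup>2) has_real_derivative 2 * (f t p * ?f' t p)) (at t)" by (simp add: mult_ac)
  qed
  also have "(\<lambda>p. 2 * (f t p * ?f' t p)) = (\<lambda>p. 2 * \<nu> * (laplacian (f t) p * f t p) - 2 * (advect (u t) (f t) p * f t p) - 2 * (f t p * r t p))"
    by (auto simp: algebra_simps)
  also have "torus_integral \<dots> = 2 * \<nu> * torus_integral (\<lambda>p. laplacian (f t) p * f t p)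
      - 2 * torus_integral (\<lambda>p. advect (u t) (f t) p * f t p) - 2 * torus_integral (\<lambda>p. f t p * r t p)"
    using * ft f1 by (simp add: torus_integral_diff torus_integral_cmult C_torus_intros)
  also have "\<dots> = - 2 * \<nu> * dirichlet (f t) - 2 * torus_integral (\<lambda>p. f t p * r t p)"
    by (simp add: torus_green_self[OF ft(1)] torus_advect_self[OF u J(2) f1(1)])
  finally show ?thesis unfolding energy_def .
qed

text \<open>The first derivatives of \<open>f\<close> are not known to be differentiable in time, so
  the Dirichlet integral cannot be differentiated under the integral sign. Green's formula writes it
  as a part linear in \<open>f s\<close> plus a quadratic remainder \<open>N\<close>. In
  \<open>N\<close> the factor \<open>f s - f t\<close> is of order \<open>s - t\<close> and the
  difference of the Laplacians tends to 0 by continuity, so \<open>N\<close> has derivative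
  0.\<close>

lemma dirichlet_deriv:
  assumes u: "flow_on J u" and s: "strong_sol J u \<nu> r f" and J: "open J" "t \<in> J"
  shows "((\<lambda>t. dirichlet (f t)) has_real_derivative
     - 2 * torus_integral (\<lambda>p. (\<nu> * laplacian (f t) p - advect (u t) (f t) p - r t p) * laplacian (f t) p)) (at t)"
proof -
  have f2: "C_space 2 J f" using s by (simp add: strong_sol_def)
  have f0: "C_space 0 J f" using C_space_imp_0[OF f2] .
  have ft: "C_torus 2 (f s)" if "s \<in> J" for s using C_space_at[OF f2 that] .
  have ft0: "C_torus 0 (f s)" "C_torus 0 (laplacian (f s))" if "s \<in> J" for s
    using C_torus_imp_0[OF ft[OF that]] C_torus_laplacian[OF ft[OF that]] .
  let ?f' = "\<lambda>t p. \<nu> * laplacian (f t) p - advect (u t) (f t) p - r t p"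
  define c where "c s = torus_integral (\<lambda>p. f s p * laplacian (f t) p)" for s
  define N where "N s = torus_integral (\<lambda>p. (f s p - f t p) * (laplacian (f s) p - laplacian (f t) p))" for s
  define M where "M s = torus_integral (\<lambda>p. (laplacian (f s) p - laplacian (f t) p)\<^sup>2)" for s
  have dec: "dirichlet (f s) = dirichlet (f t) - 2 * (c s - c t) - N s" if sJ: "s \<in> J" for s
  proof -
    note a = ft0[OF sJ] ft0[OF J(2)]
    have "N s = torus_integral (\<lambda>p. f s p * laplacian (f s) p - f t p * laplacian (f s) p - f s p * laplacian (f t) p + f t p * laplacian (f t) p)"
      unfolding N_def by (simp add: algebra_simps)
    also have "\<dots> = torus_integral (\<lambda>p. f s p * laplacian (f s) p) - torus_integral (\<lambda>p. f t p * laplacian (f s) p)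
       - torus_integral (\<lambda>p. f s p * laplacian (f t) p) + torus_integral (\<lambda>p. f t p * laplacian (f t) p)"
      using a by (simp add: torus_integral_diff torus_integral_add C_torus_intros)
    also have "\<dots> = - dirichlet (f s) - 2 * c s + c t"
      using torus_green_self[OF ft[OF sJ]] torus_green_sym[OF ft[OF sJ] ft[OF J(2)]]
      by (simp add: c_def mult.commute)
    finally show ?thesis using torus_green_self[OF ft[OF J(2)]] by (simp add: c_def mult.commute)
  qed
  have dc: "(c has_real_derivative torus_integral (\<lambda>p. ?f' t p * laplacian (f t) p)) (at t)"
    unfolding c_def[abs_def]
  proof (rule torus_integral_deriv[OF J, where f'="\<lambda>s p. ?f' s p * laplacian (f t) p"])
    show "C_space 0 J (\<lambda>s p. f s p * laplacian (f t) p)"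
      by (intro C_space_mult f0 C_space_const ft0 J)
    show "C_space 0 J (\<lambda>s p. ?f' s p * laplacian (f t) p)"
      by (intro C_space_mult strong_sol_rhs[OF u s] C_space_const ft0 J)
    show "((\<lambda>s. f s p * laplacian (f t) p) has_real_derivative ?f' s p * laplacian (f t) p) (at s)" if "s \<in> J" for s p
      by (rule DERIV_cmult_right[OF strong_sol_time[OF s that]])
  qed
  obtain e where e: "0 < e" "cball t e \<subseteq> J" using J open_contains_cball by blast
  obtain B where B: "0 \<le> B" "\<And>s p. s \<in> cball t e \<Longrightarrow> \<bar>?f' s p\<bar> \<le> B"
    by (rule C_space_bounded[OF strong_sol_rhs[OF u s] compact_cball e(2)]) blast
  have lip: "\<bar>f s p - f t p\<bar> \<le> B * \<bar>s - t\<bar>" if "s \<in> ball t e" for s p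
  proof -
    have "norm (f s p - f t p) \<le> B * norm (s - t)"
      by (rule field_differentiable_bound[where S="cball t e" and f'="\<lambda>s. ?f' s p"])
        (use that e B in \<open>auto intro!: has_field_derivative_at_within strong_sol_time[OF s]\<close>)
    then show ?thesis by simp
  qed
  have Nb: "\<bar>N s\<bar> \<le> B * \<bar>s - t\<bar> * sqrt (M s)" if sb: "s \<in> ball t e" for s
  proof -
    have sJ: "s \<in> J" using sb e by auto
    note a = ft0[OF sJ] ft0[OF J(2)]
    have "torus_integral (\<lambda>p. (f s p - f t p)\<^sup>2) \<le> torus_integral (\<lambda>p. (B * \<bar>s - t\<bar>)\<^sup>2)"
      using a lip[OF sb] by (intro torus_integral_mono C_torus_intros) (auto simp: abs_le_square_iff[symmetric] abs_mult B)
    then have 1: "torus_integral (\<lambda>p. (f s p - f t p)\<^sup>2) \<le> (B * \<bar>s - t\<bar>)\<^sup>2" by (simp add: torus_integral_const)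
    have M0: "0 \<le> M s" unfolding M_def using a by (intro torus_integral_nonneg C_torus_intros) auto
    have "(N s)\<^sup>2 \<le> torus_integral (\<lambda>p. (f s p - f t p)\<^sup>2) * M s"
      unfolding N_def M_def using a by (intro torus_Cauchy_Schwarz C_torus_intros) auto
    also have "\<dots> \<le> (B * \<bar>s - t\<bar>)\<^sup>2 * M s" using 1 M0 by (rule mult_right_mono)
    also have "\<dots> = (B * \<bar>s - t\<bar> * sqrt (M s))\<^sup>2" using M0 by (simp add: power_mult_distrib)
    finally have "\<bar>N s\<bar> \<le> \<bar>B * \<bar>s - t\<bar> * sqrt (M s)\<bar>" by (simp only: abs_le_square_iff)
    then show ?thesis using B M0 by simp
  qed
  have "continuous_on J M"
    unfolding M_def[abs_def] by (intro torus_integral_continuous C_space_power2 C_space_diff C_space_laplacian f2 C_space_const ft0 J)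
  then have "isCont M t" using J by (simp add: continuous_on_eq_continuous_at)
  then have "((\<lambda>s. B * sqrt (M s)) \<longlongrightarrow> B * sqrt (M t)) (at t)" by (intro tendsto_intros) (simp add: isCont_def)
  then have limM: "((\<lambda>s. B * sqrt (M s)) \<longlongrightarrow> 0) (at t)" by (simp add: M_def torus_integral_const)
  have dN: "(N has_real_derivative 0) (at t)"
    unfolding has_field_derivative_iff
  proof (rule Lim_null_comparison[OF _ limM])
    have "\<forall>\<^sub>F s in at t. s \<in> ball t e - {t}" using e by (intro eventually_at_in_open) auto
    then show "\<forall>\<^sub>F s in at t. norm ((N s - N t) / (s - t)) \<le> B * sqrt (M s)"
    proof eventually_elim
      case (elim s)
      have "N t = 0" by (simp add: N_def torus_integral_const)
      then show ?case using Nb[of s] elim by (simp add: abs_divide divide_le_eq mult_ac)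
    qed
  qed
  have D: "((\<lambda>s. dirichlet (f t) - 2 * (c s - c t) - N s) has_real_derivative
      0 - 2 * (torus_integral (\<lambda>p. ?f' t p * laplacian (f t) p) - 0) - 0) (at t)"
    by (intro DERIV_diff DERIV_const DERIV_cmult dc dN)
  have ev: "\<forall>\<^sub>F s in nhds t. dirichlet (f s) = dirichlet (f t) - 2 * (c s - c t) - N s"
    using eventually_nhds_in_open[OF J] by eventually_elim (rule dec)
  show ?thesis using DERIV_cong_ev[OF refl ev refl, THEN iffD2, OF D] by simp
qed

lemma has_derivative_nonpos_le:
  fixes f :: "real \<Rightarrow> real"
  assumes "a \<le> b" "continuous_on {a..b} f"
    and "\<And>x. a < x \<Longrightarrow> x < b \<Longrightarrow> \<exists>y. (f has_real_derivative y) (at x) \<and> y \<le> 0"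
  shows "f b \<le> f a"
  using assms DERIV_nonpos_imp_decreasing_open[of a b f] by (cases "a = b") auto

lemma energy_antimono:
  assumes u: "flow_on {a<..<b} u" and s: "strong_sol {a<..<b} u \<nu> r f" and c: "C_space 0 {a..b} f"
    and \<nu>: "0 \<le> \<nu>" and r: "\<And>t p. t \<in> {a<..<b} \<Longrightarrow> 0 \<le> f t p * r t p" and ab: "a \<le> b"
  shows "energy (f b) \<le> energy (f a)"
proof (rule has_derivative_nonpos_le[OF ab energy_continuous[OF c]])
  fix t assume t: "a < t" "t < b"
  then have tJ: "t \<in> {a<..<b}" by simp
  have ft: "C_torus 2 (f t)" "C_torus 0 (r t)" using s tJ C_space_at by (auto simp: strong_sol_def)
  have "0 \<le> torus_integral (\<lambda>p. f t p * r t p)"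
    using ft C_torus_imp_0 r[OF tJ] by (intro torus_integral_nonneg C_torus_mult) auto
  moreover have "0 \<le> \<nu> * dirichlet (f t)"
    using \<nu> C_torus_2D[OF ft(1)] by (intro mult_nonneg_nonneg dirichlet_nonneg) auto
  ultimately show "\<exists>y. ((\<lambda>t. energy (f t)) has_real_derivative y) (at t) \<and> y \<le> 0"
    using energy_deriv[OF u s open_greaterThanLessThan tJ] by (intro exI conjI) auto
qed

text \<open>
  \<open>\<integral> f(t) \<psi>(s - t)\<close> does not depend on \<open>t\<close>.
\<close>

lemma duality_pairing:
  assumes u: "flow_on {0<..<s} u" and s: "0 \<le> s"
    and f: "strong_sol {0<..<s} u \<nu> (\<lambda>_ _. 0) f" "C_space 0 {0..s} f"
    and h: "strong_sol {0<..<s} w \<nu> (\<lambda>_ _. 0) h" "C_space 0 {0..s} h"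
    and w: "\<And>t. t \<in> {0<..<s} \<Longrightarrow> w t = (\<lambda>p. - u (s - t) p)"
  shows "torus_integral (\<lambda>p. f s p * h 0 p) = torus_integral (\<lambda>p. f 0 p * h s p)"
proof (cases "s = 0")
  case False
  then have s: "0 < s" using s by simp
  define m where "m t = torus_integral (\<lambda>p. f t p * h (s - t) p)" for t
  have h': "C_space k {0<..<s} (\<lambda>t. g (s - t))" if "C_space k {0<..<s} g" for k g
    by (rule C_space_time[OF that]) (auto intro!: continuous_intros)
  have hc: "C_space 0 {0..s} (\<lambda>t. h (s - t))"
    by (rule C_space_time[OF h(2)]) (auto intro!: continuous_intros)
  have f2: "C_space 2 {0<..<s} f" and h2: "C_space 2 {0<..<s} (\<lambda>t. h (s - t))"
    using f(1) h(1) h' by (auto simp: strong_sol_def)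
  have wf: "C_space 1 {0<..<s} (\<lambda>t p. fst (w t p)) \<and> C_space 1 {0<..<s} (\<lambda>t p. snd (w t p))"
  proof -
    have "C_space 1 {0<..<s} (\<lambda>t p. - fst (u (s - t) p))" "C_space 1 {0<..<s} (\<lambda>t p. - snd (u (s - t) p))"
      using u h'[of 1 "\<lambda>t p. fst (u t p)"] h'[of 1 "\<lambda>t p. snd (u t p)"] by (auto simp: flow_on_def intro: C_space_minus)
    then show ?thesis
      using C_space_cong[of "{0<..<s}" "\<lambda>t p. fst (w t p)" "\<lambda>t p. - fst (u (s - t) p)" 1]
        C_space_cong[of "{0<..<s}" "\<lambda>t p. snd (w t p)" "\<lambda>t p. - snd (u (s - t) p)" 1] w by simp
  qed
  let ?F = "\<lambda>t p. \<nu> * laplacian (f t) p - advect (u t) (f t) p"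
  \<comment> \<open>The time derivative of \<open>h (s - t)\<close> is \<open>- ?H\<close>:
    reversing time flips the sign of the diffusion, while the advection, reversed in the field as
    well, keeps the sign it has in the equation for \<open>f\<close>.\<close>
  let ?H = "\<lambda>t p. \<nu> * laplacian (h (s - t)) p + advect (u t) (h (s - t)) p"
  have Fc: "C_space 0 {0<..<s} ?F" and Hc: "C_space 0 {0<..<s} ?H"
    by (intro C_space_add C_space_diff C_space_cmult C_space_laplacian C_space_advect[OF u] C_space_2_1 f2 h2)+
  have dm: "(m has_real_derivative torus_integral (\<lambda>p. ?F t p * h (s - t) p + (- ?H t p) * f t p)) (at t)" if t: "t \<in> {0<..<s}" for t
    unfolding m_def[abs_def]
  proof (rule torus_integral_deriv[OF open_greaterThanLessThan t, where f'="\<lambda>t p. ?F t p * h (s - t) p + (- ?H t p) * f t p"])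
    show "C_space 0 {0<..<s} (\<lambda>t p. f t p * h (s - t) p)"
      by (intro C_space_mult C_space_imp_0[OF f2] C_space_imp_0[OF h2])
    show "C_space 0 {0<..<s} (\<lambda>t p. ?F t p * h (s - t) p + (- ?H t p) * f t p)"
      by (intro C_space_add C_space_mult C_space_minus Fc Hc C_space_imp_0[OF f2] C_space_imp_0[OF h2])
    fix t p assume t: "t \<in> {0<..<s}"
    then have t': "s - t \<in> {0<..<s}" by simp
    have adv: "advect (w (s - t)) g p = - advect (u t) g p" for g p
      using w[OF t'] by (simp add: advect_def)
    have "((\<lambda>t. f t p) has_real_derivative ?F t p) (at t)" using strong_sol_time[OF f(1) t, of p] by simp
    moreover have "((\<lambda>t. h (s - t) p) has_real_derivative (- ?H t p)) (at t)"
    proof -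
      have "((\<lambda>t. h t p) has_real_derivative ?H t p) (at (s - t))"
        using strong_sol_time[OF h(1) t', of p] by (simp add: adv)
      moreover have "((\<lambda>t. s - t) has_real_derivative - 1) (at t)" by (auto intro!: derivative_eq_intros)
      ultimately show ?thesis using DERIV_chain2[where f="\<lambda>t. h t p" and g="\<lambda>t. s - t" and x=t and s=UNIV] by fastforce
    qed
    ultimately show "((\<lambda>t. f t p * h (s - t) p) has_real_derivative ?F t p * h (s - t) p + (- ?H t p) * f t p) (at t)"
      by (rule DERIV_mult)
  qed
  have z: "torus_integral (\<lambda>p. ?F t p * h (s - t) p + (- ?H t p) * f t p) = 0" if t: "t \<in> {0<..<s}" for t
  proof -
    have ft: "C_torus 2 (f t)" and ht: "C_torus 2 (h (s - t))" using C_space_at[OF f2 t] C_space_at[OF h2 t] .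
    have f1: "C_torus 1 (f t)" "C_torus 0 (f t)" and h1: "C_torus 1 (h (s - t))" "C_torus 0 (h (s - t))"
      using C_torus_2D[OF ft] C_torus_2D[OF ht] C_torus_1D by blast+
    note * = C_torus_laplacian[OF ft] C_torus_laplacian[OF ht] C_torus_advect[OF u t f1(1)] C_torus_advect[OF u t h1(1)] f1(2) h1(2)
    have "torus_integral (\<lambda>p. ?F t p * h (s - t) p + (- ?H t p) * f t p) =
       torus_integral (\<lambda>p. \<nu> * (laplacian (f t) p * h (s - t) p) - advect (u t) (f t) p * h (s - t) p
         - \<nu> * (f t p * laplacian (h (s - t)) p) - f t p * advect (u t) (h (s - t)) p)"
      by (simp add: algebra_simps)
    also have "\<dots> = \<nu> * torus_integral (\<lambda>p. laplacian (f t) p * h (s - t) p) - torus_integral (\<lambda>p. advect (u t) (f t) p * h (s - t) p)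
         - \<nu> * torus_integral (\<lambda>p. f t p * laplacian (h (s - t)) p) - torus_integral (\<lambda>p. f t p * advect (u t) (h (s - t)) p)"
      using * by (simp add: torus_integral_diff torus_integral_cmult C_torus_intros)
    also have "\<dots> = 0" using torus_green_sym[OF ft ht] torus_advect_skew[OF u t f1(1) h1(1)] by simp
    finally show ?thesis .
  qed
  have "continuous_on {0..s} m"
    unfolding m_def[abs_def] by (intro torus_integral_continuous C_space_mult f(2) hc)
  moreover have "(m has_real_derivative 0) (at t)" if "0 < t" "t < s" for t
    using dm[of t] z[of t] that by simp
  ultimately have "m s = m 0" using DERIV_isconst_end[OF s, of m] by simp
  then show ?thesis by (simp add: m_def)
qed simp

text \<open>
  Backward uniqueness through the frequency function \<open>dirichlet f / energy f\<close>, which grows at most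
  exponentially. Adding \<open>\<eta>\<close> to the denominator avoids having to know that it is positive.
\<close>

lemma backward_uniqueness:
  assumes u: "flow_on {a<..<b} u" and f: "strong_sol {a<..<b} u \<nu> (\<lambda>_ _. 0) f" and c: "C_space 1 {a..b} f"
    and \<nu>: "0 < \<nu>" and ab: "a \<le> b" and E: "0 < energy (f a)"
    and U: "\<And>t p. t \<in> {a<..<b} \<Longrightarrow> (fst (u t p))\<^sup>2 + (snd (u t p))\<^sup>2 \<le> U"
  shows "energy (f a) * exp (- (2 * \<nu> * (b - a) * (dirichlet (f a) / energy (f a)) * exp (U * (b - a) / (2 * \<nu>)))) \<le> energy (f b)"
proof (rule field_le_epsilon)
  fix \<eta> :: real assume \<eta>: "0 < \<eta>"
  let ?J = "{a<..<b}"
  define A where "A t = energy (f t) + \<eta>" for t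
  define D where "D t = dirichlet (f t)" for t
  define k where "k = U / (2 * \<nu>)"
  have c0: "C_space 0 {a..b} f" using C_space_imp_0[OF c] .
  have A0: "0 < A t" if "t \<in> {a..b}" for t
    using energy_nonneg[OF C_space_at[OF c0 that]] \<eta> by (simp add: A_def)
  have D0: "0 \<le> D t" if "t \<in> {a..b}" for t
    using dirichlet_nonneg[OF C_space_at[OF c that]] by (simp add: D_def)
  have cA: "continuous_on {a..b} A" and cD: "continuous_on {a..b} D"
    unfolding A_def[abs_def] D_def[abs_def] by (intro continuous_intros energy_continuous dirichlet_continuous c c0)+
  have dA: "(A has_real_derivative - 2 * \<nu> * D t) (at t)" if t: "t \<in> ?J" for t
    using DERIV_add[OF energy_deriv[OF u f open_greaterThanLessThan t] DERIV_const[of \<eta>]]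
    by (simp add: A_def[abs_def] D_def torus_integral_const)
  define D' where "D' t = - 2 * torus_integral (\<lambda>p. (\<nu> * laplacian (f t) p - advect (u t) (f t) p - 0) * laplacian (f t) p)" for t
  have dD: "(D has_real_derivative D' t) (at t)" if t: "t \<in> ?J" for t
    using dirichlet_deriv[OF u f open_greaterThanLessThan t] by (simp add: D_def[abs_def] D'_def)
  have key: "D' t + 2 * \<nu> * (D t / A t) * D t \<le> k * D t" if t: "t \<in> ?J" for t
  proof -
    define Q where "Q = D t / A t"
    have tc: "t \<in> {a..b}" using t by auto
    have Q0: "0 \<le> Q" using D0[OF tc] A0[OF tc] by (simp add: Q_def)
    have QA: "Q * A t = D t" using A0[OF tc] by (simp add: Q_def)
    have ft: "C_torus 2 (f t)" using f t C_space_at by (auto simp: strong_sol_def)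
    have f1: "C_torus 1 (f t)" "C_torus 0 (f t)" "C_torus 0 (Dx (f t))" "C_torus 0 (Dy (f t))"
      using C_torus_2D[OF ft] C_torus_1D by blast+
    note cl = C_torus_laplacian[OF ft] C_torus_advect[OF u t f1(1)] f1(2-4)
    define L where "L = torus_integral (\<lambda>p. (laplacian (f t) p)\<^sup>2)"
    define W where "W = torus_integral (\<lambda>p. (laplacian (f t) p + Q * f t p)\<^sup>2)"
    have W: "W = L - 2 * Q * D t + Q\<^sup>2 * energy (f t)"
    proof -
      have "W = torus_integral (\<lambda>p. (laplacian (f t) p)\<^sup>2 + (2 * Q) * (laplacian (f t) p * f t p) + Q\<^sup>2 * (f t p)\<^sup>2)"
        unfolding W_def by (simp add: power2_eq_square algebra_simps)
      also have "\<dots> = L + (2 * Q) * torus_integral (\<lambda>p. laplacian (f t) p * f t p) + Q\<^sup>2 * energy (f t)"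
        using cl by (simp add: torus_integral_add torus_integral_cmult C_torus_intros L_def energy_def)
      finally show ?thesis using torus_green_self[OF ft] by (simp add: D_def)
    qed
    \<comment> \<open>Skew symmetry lets \<open>Q * f\<close> be added to the Laplacian at no cost.
      After Young's inequality the term \<open>\<nu> * W\<close> cancels the dissipation
      \<open>\<nu> * L\<close> and leaves
      \<open>2 * \<nu> * (Q\<^sup>2 * energy (f t) - 2 * Q * D t)\<close>, which is what compensates
      the decay of the energy in the quotient.\<close>
    have "torus_integral (\<lambda>p. advect (u t) (f t) p * laplacian (f t) p) =
        torus_integral (\<lambda>p. advect (u t) (f t) p * (laplacian (f t) p + Q * f t p))"
    proof -
      have "torus_integral (\<lambda>p. advect (u t) (f t) p * (laplacian (f t) p + Q * f t p)) =
         torus_integral (\<lambda>p. advect (u t) (f t) p * laplacian (f t) p + Q * (advect (u t) (f t) p * f t p))"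
        by (simp add: algebra_simps)
      also have "\<dots> = torus_integral (\<lambda>p. advect (u t) (f t) p * laplacian (f t) p) + Q * torus_integral (\<lambda>p. advect (u t) (f t) p * f t p)"
        using cl by (simp add: torus_integral_add torus_integral_cmult C_torus_intros)
      finally show ?thesis using torus_advect_self[OF u t f1(1)] by simp
    qed
    also have "\<dots> \<le> torus_integral (\<lambda>p. \<nu> * (laplacian (f t) p + Q * f t p)\<^sup>2 + (U / (4 * \<nu>)) * ((Dx (f t) p)\<^sup>2 + (Dy (f t) p)\<^sup>2))"
    proof (rule torus_integral_mono)
      fix p
      let ?v = "advect (u t) (f t) p" and ?w = "laplacian (f t) p + Q * f t p" and ?g = "(Dx (f t) p)\<^sup>2 + (Dy (f t) p)\<^sup>2"
      have "?v\<^sup>2 \<le> ((fst (u t p))\<^sup>2 + (snd (u t p))\<^sup>2) * ?g"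
      proof -
        have "((fst (u t p))\<^sup>2 + (snd (u t p))\<^sup>2) * ?g - ?v\<^sup>2 = (fst (u t p) * Dy (f t) p - snd (u t p) * Dx (f t) p)\<^sup>2"
          by (simp add: advect_def power2_eq_square algebra_simps)
        then show ?thesis by (metis diff_ge_0_iff_ge zero_le_power2)
      qed
      also have "\<dots> \<le> U * ?g" using U[OF t, of p] by (intro mult_right_mono) auto
      finally have v: "?v\<^sup>2 \<le> U * ?g" .
      have "0 \<le> (2 * \<nu> * ?w - ?v)\<^sup>2" by simp
      then have "4 * \<nu> * (?v * ?w) \<le> 4 * \<nu> * (\<nu> * ?w\<^sup>2) + ?v\<^sup>2" by (simp add: power2_eq_square algebra_simps)
      then have "4 * \<nu> * (?v * ?w) \<le> 4 * \<nu> * (\<nu> * ?w\<^sup>2) + U * ?g" using v by linarith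
      also have "\<dots> = 4 * \<nu> * (\<nu> * ?w\<^sup>2 + (U / (4 * \<nu>)) * ?g)" using \<nu> by (simp add: field_simps)
      finally show "?v * ?w \<le> \<nu> * ?w\<^sup>2 + (U / (4 * \<nu>)) * ?g" using \<nu> by (subst (asm) mult_le_cancel_left_pos) auto
    qed (intro C_torus_intros cl)+
    also have "\<dots> = \<nu> * W + (U / (4 * \<nu>)) * D t"
    proof -
      have lin: "torus_integral (\<lambda>p. \<nu> * X p + c * Y p) = \<nu> * torus_integral X + c * torus_integral Y"
        if "C_torus 0 X" "C_torus 0 Y" for X Y c
        using that by (simp add: torus_integral_add torus_integral_cmult C_torus_intros)
      show ?thesis unfolding W_def D_def dirichlet_def by (rule lin) (intro C_torus_intros cl)+
    qed
    finally have adv: "torus_integral (\<lambda>p. advect (u t) (f t) p * laplacian (f t) p) \<le> \<nu> * W + (U / (4 * \<nu>)) * D t" .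
    have "D' t = - 2 * (\<nu> * L - torus_integral (\<lambda>p. advect (u t) (f t) p * laplacian (f t) p))"
    proof -
      have "torus_integral (\<lambda>p. (\<nu> * laplacian (f t) p - advect (u t) (f t) p - 0) * laplacian (f t) p) =
        torus_integral (\<lambda>p. \<nu> * (laplacian (f t) p)\<^sup>2 - advect (u t) (f t) p * laplacian (f t) p)"
        by (simp add: power2_eq_square algebra_simps)
      then show ?thesis using cl by (simp add: D'_def L_def torus_integral_diff torus_integral_cmult C_torus_intros)
    qed
    also have "\<dots> \<le> - 2 * (\<nu> * L) + 2 * (\<nu> * W + (U / (4 * \<nu>)) * D t)" using adv by simp
    also have "\<dots> = k * D t + 2 * \<nu> * (Q\<^sup>2 * energy (f t) - 2 * Q * D t)"
      using \<nu> by (simp add: W k_def field_simps)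
    also have "Q\<^sup>2 * energy (f t) - 2 * Q * D t \<le> - (Q * D t)"
    proof -
      have "Q\<^sup>2 * energy (f t) \<le> Q * (Q * A t)"
        using \<eta> Q0 by (simp add: A_def power2_eq_square algebra_simps)
      then show ?thesis unfolding QA by simp
    qed
    finally show ?thesis using \<nu> by (simp add: Q_def mult_left_mono)
  qed
  \<comment> \<open>The frequency with an integrating factor: by \<open>key\<close> it grows at most
    at the rate \<open>k\<close>.\<close>
  define Q where "Q t = D t / A t * exp (- k * (t - a))" for t
  have Qle: "Q t \<le> Q a" if t: "t \<in> {a..b}" for t
  proof (rule has_derivative_nonpos_le[where f=Q])
    show "continuous_on {a..t} Q"
      unfolding Q_def[abs_def] using t A0
      by (intro continuous_intros continuous_on_subset[OF cA] continuous_on_subset[OF cD]) (auto simp: less_imp_neq[THEN not_sym])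
    fix x assume x: "a < x" "x < t"
    then have xJ: "x \<in> ?J" "x \<in> {a..b}" using t by auto
    have "(Q has_real_derivative ((D' x * A x - D x * (- 2 * \<nu> * D x)) / (A x * A x)) * exp (- k * (x - a)) +
        (exp (- k * (x - a)) * (- k)) * (D x / A x)) (at x)"
      unfolding Q_def[abs_def]
    proof (intro DERIV_mult DERIV_divide dD dA xJ)
      show "((\<lambda>t. exp (- k * (t - a))) has_real_derivative exp (- k * (x - a)) * (- k)) (at x)"
        by (auto intro!: derivative_eq_intros)
    qed (use A0[OF xJ(2)] in simp)
    moreover have "((D' x * A x - D x * (- 2 * \<nu> * D x)) / (A x * A x)) * exp (- k * (x - a)) +
        (exp (- k * (x - a)) * (- k)) * (D x / A x) = exp (- k * (x - a)) / A x * (D' x + 2 * \<nu> * (D x / A x) * D x - k * D x)"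
      using A0[OF xJ(2)] by (simp add: field_simps)
    moreover have "\<dots> \<le> 0" using key[OF xJ(1)] A0[OF xJ(2)] by (intro mult_nonneg_nonpos) auto
    ultimately show "\<exists>y. (Q has_real_derivative y) (at x) \<and> y \<le> 0" by metis
  qed (use t in auto)
  define K where "K = D a / energy (f a) * exp (k * (b - a))"
  have DK: "D t \<le> K * A t" if t: "t \<in> {a..b}" for t
  proof -
    have aa: "a \<in> {a..b}" using ab by simp
    \<comment> \<open>\<open>U\<close> dominates squares only at times in the open interval, so its
      sign is known only when there are such times.\<close>
    have U0: "0 \<le> k" if "a < b"
    proof -
      have "0 \<le> (fst (u ((a+b)/2) 0))\<^sup>2 + (snd (u ((a+b)/2) 0))\<^sup>2" by simp
      also have "\<dots> \<le> U" using that by (intro U) auto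
      finally show ?thesis using \<nu> by (simp add: k_def)
    qed
    have "D t / A t = Q t * exp (k * (t - a))" by (simp add: Q_def mult.assoc flip: exp_add)
    also have "\<dots> \<le> Q a * exp (k * (t - a))" using Qle[OF t] by (intro mult_right_mono) auto
    also have "\<dots> = D a / A a * exp (k * (t - a))" by (simp add: Q_def)
    also have "\<dots> \<le> K" unfolding K_def
    proof (intro mult_mono)
      show "D a / A a \<le> D a / energy (f a)"
        using D0[OF aa] E \<eta> by (intro divide_left_mono) (auto simp: A_def)
      show "exp (k * (t - a)) \<le> exp (k * (b - a))"
      proof (cases "a < b")
        case False
        then have "t = b" using t by auto
        then show ?thesis by simp
      qed (use t U0 in \<open>auto intro: mult_left_mono\<close>)
    qed (use D0[OF aa] E in auto)
    finally show ?thesis using A0[OF t] by (simp add: divide_le_eq)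
  qed
  \<comment> \<open>By \<open>DK\<close> the energy decays at most at the rate
    \<open>2 * \<nu> * K\<close>, that is, \<open>A t * exp (2 * \<nu> * K * (t - a))\<close> is
    nondecreasing; the minus signs adapt this to \<open>has_derivative_nonpos_le\<close>.\<close>
  have "- (A b * exp (2 * \<nu> * K * (b - a))) \<le> - (A a * exp (2 * \<nu> * K * (a - a)))"
  proof (rule has_derivative_nonpos_le[where f="\<lambda>t. - (A t * exp (2 * \<nu> * K * (t - a)))", OF ab])
    show "continuous_on {a..b} (\<lambda>t. - (A t * exp (2 * \<nu> * K * (t - a))))" by (intro continuous_intros cA)
    fix x assume x: "a < x" "x < b"
    then have xJ: "x \<in> ?J" "x \<in> {a..b}" by auto
    have 1: "((\<lambda>t. - (A t * exp (2 * \<nu> * K * (t - a)))) has_real_derivative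
       - ((- 2 * \<nu> * D x) * exp (2 * \<nu> * K * (x - a)) + (exp (2 * \<nu> * K * (x - a)) * (2 * \<nu> * K)) * A x)) (at x)"
    proof (intro DERIV_minus DERIV_mult dA xJ)
      show "((\<lambda>t. exp (2 * \<nu> * K * (t - a))) has_real_derivative exp (2 * \<nu> * K * (x - a)) * (2 * \<nu> * K)) (at x)"
        by (auto intro!: derivative_eq_intros)
    qed
    have 2: "- ((- 2 * \<nu> * D x) * exp (2 * \<nu> * K * (x - a)) + (exp (2 * \<nu> * K * (x - a)) * (2 * \<nu> * K)) * A x)
       = (2 * \<nu> * exp (2 * \<nu> * K * (x - a))) * (D x - K * A x)" by (simp add: algebra_simps)
    have 3: "(2 * \<nu> * exp (2 * \<nu> * K * (x - a))) * (D x - K * A x) \<le> 0" using DK[OF xJ(2)] \<nu> by (intro mult_nonneg_nonpos) auto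
    show "\<exists>y. ((\<lambda>t. - (A t * exp (2 * \<nu> * K * (t - a)))) has_real_derivative y) (at x) \<and> y \<le> 0"
      using 1[unfolded 2] 3 by (intro exI conjI)
  qed
  note mono = this
  define X where "X = 2 * \<nu> * K * (b - a)"
  have "A a * exp (2 * \<nu> * K * (a - a)) \<le> A b * exp X"
    unfolding X_def using mono by (simp only: neg_le_iff_le)
  then have "A a \<le> A b * exp X" by (simp only: diff_self mult_zero_right exp_zero mult_1_right)
  then have "A a * exp (- X) \<le> (A b * exp X) * exp (- X)" by (rule mult_right_mono) simp
  then have "A a * exp (- X) \<le> A b" by (simp add: mult.assoc exp_minus_inverse)
  moreover have "energy (f a) * exp (- X) \<le> A a * exp (- X)"
    using \<eta> by (intro mult_right_mono) (auto simp: A_def)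
  ultimately have "energy (f a) * exp (- X) \<le> energy (f b) + \<eta>" unfolding A_def by linarith
  moreover have "K = dirichlet (f a) / energy (f a) * exp (U * (b - a) / (2 * \<nu>))"
    by (simp add: K_def k_def D_def)
  then have "X = 2 * \<nu> * (b - a) * (dirichlet (f a) / energy (f a)) * exp (U * (b - a) / (2 * \<nu>))"
    unfolding X_def by (simp only: mult_ac)
  ultimately show "energy (f a) * exp (- (2 * \<nu> * (b - a) * (dirichlet (f a) / energy (f a)) * exp (U * (b - a) / (2 * \<nu>)))) \<le> energy (f b) + \<eta>"
    by simp
qed

subsection \<open>Reachable states are dense\<close>

lemma energy_add:
  assumes "C_torus 0 f" "C_torus 0 g"
  shows "energy (\<lambda>p. f p + g p) = energy f + 2 * torus_integral (\<lambda>p. f p * g p) + energy g"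
proof -
  have "energy (\<lambda>p. f p + g p) = torus_integral (\<lambda>p. (f p)\<^sup>2 + 2 * (f p * g p) + (g p)\<^sup>2)"
    unfolding energy_def by (simp add: power2_eq_square algebra_simps)
  then show ?thesis
    using assms by (simp add: energy_def torus_integral_add torus_integral_cmult C_torus_intros)
qed

lemma energy_cmult: "C_torus 0 f \<Longrightarrow> energy (\<lambda>p. c * f p) = c\<^sup>2 * energy f"
  by (simp add: energy_def power_mult_distrib torus_integral_cmult C_torus_intros)

lemma energy_diff:
  assumes "C_torus 0 f" "C_torus 0 g"
  shows "energy (\<lambda>p. f p - g p) = energy f - 2 * torus_integral (\<lambda>p. f p * g p) + energy g"
  using energy_add[OF assms(1) C_torus_cmult[OF assms(2), of "-1"]] energy_cmult[OF assms(2), of "-1"]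
    torus_integral_minus[of "\<lambda>p. f p * g p"] assms by (simp add: C_torus_intros)

lemma energy_add_le:
  assumes "C_torus 0 f" "C_torus 0 g"
  shows "energy (\<lambda>p. f p + g p) \<le> 2 * energy f + 2 * energy g"
  using energy_add[OF assms] energy_diff[OF assms] energy_nonneg[OF C_torus_diff[OF assms]] by simp

lemma L2_norm_energy: "L2_norm f = sqrt (energy f)"
  by (simp add: L2_norm_def energy_def)

lemma L2_norm_nonneg: "C_torus 0 f \<Longrightarrow> 0 \<le> L2_norm f"
  by (simp add: L2_norm_energy energy_nonneg)

lemma L2_norm_triangle:
  assumes "C_torus 0 f" "C_torus 0 g"
  shows "L2_norm (\<lambda>p. f p + g p) \<le> L2_norm f + L2_norm g"
proof -
  have "(torus_integral (\<lambda>p. f p * g p))\<^sup>2 \<le> energy f * energy g"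
    unfolding energy_def by (rule torus_Cauchy_Schwarz[OF assms])
  then have "torus_integral (\<lambda>p. f p * g p) \<le> sqrt (energy f) * sqrt (energy g)"
    unfolding real_sqrt_mult[symmetric] by (rule real_le_rsqrt)
  then have "energy (\<lambda>p. f p + g p) \<le> (sqrt (energy f) + sqrt (energy g))\<^sup>2"
    using energy_nonneg[OF assms(1)] energy_nonneg[OF assms(2)]
    by (simp add: energy_add[OF assms] power2_sum)
  then show ?thesis unfolding L2_norm_energy
    by (rule real_le_lsqrt[rotated]) (simp_all add: energy_nonneg assms)
qed

lemma L2_norm_minus_commute: "L2_norm (\<lambda>p. f p - g p) = L2_norm (\<lambda>p. g p - f p)"
  unfolding L2_norm_energy energy_def by (simp add: power2_commute)

lemma flow_on_original: "torus_vector_field u \<Longrightarrow> divergence_free u \<Longrightarrow> flow_on {0..} u"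
  by (simp add: flow_on_def torus_vector_field_def divergence_free_def)

lemma flow_on_time:
  assumes "flow_on J u" "continuous_on J' \<phi>" "\<phi> ` J' \<subseteq> J"
  shows "flow_on J' (\<lambda>t. u (\<phi> t))"
  unfolding flow_on_def
proof (intro conjI ballI allI)
  show "C_space 1 J' (\<lambda>t p. fst (u (\<phi> t) p))" "C_space 1 J' (\<lambda>t p. snd (u (\<phi> t) p))"
    using assms C_space_time[of 1 J "\<lambda>t p. fst (u t p)" J' \<phi>] C_space_time[of 1 J "\<lambda>t p. snd (u t p)" J' \<phi>]
    by (simp_all add: flow_on_def)
  fix t p assume "t \<in> J'"
  then have "\<phi> t \<in> J" using assms(3) by auto
  then show "Dx (\<lambda>q. fst (u (\<phi> t) q)) p + Dy (\<lambda>q. snd (u (\<phi> t) q)) p = 0" by (rule flow_onD(3)[OF assms(1)])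
qed

lemma flow_on_minus:
  assumes "flow_on J u" shows "flow_on J (\<lambda>t p. - u t p)"
  unfolding flow_on_def
proof (intro conjI ballI allI)
  show "C_space 1 J (\<lambda>t p. fst (- u t p))" "C_space 1 J (\<lambda>t p. snd (- u t p))"
    using assms C_space_minus[of 1 J "\<lambda>t p. fst (u t p)"] C_space_minus[of 1 J "\<lambda>t p. snd (u t p)"]
    by (simp_all add: flow_on_def)
  fix t p assume t: "t \<in> J"
  have "Dx (\<lambda>q. - fst (u t q)) p = - Dx (\<lambda>q. fst (u t q)) p"
    using Dx_cmult[OF flow_onD(1)[OF assms t], of "-1"] by simp
  moreover have "Dy (\<lambda>q. - snd (u t q)) p = - Dy (\<lambda>q. snd (u t q)) p"
    using Dy_cmult[OF flow_onD(2)[OF assms t], of "-1"] by simp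
  ultimately show "Dx (\<lambda>q. fst (- u t q)) p + Dy (\<lambda>q. snd (- u t q)) p = 0"
    using flow_onD(3)[OF assms t, of p] by simp
qed

lemma flow_on_vector_field: "flow_on {0..} u \<Longrightarrow> torus_vector_field u"
  by (simp add: flow_on_def torus_vector_field_def)

lemma passive_strong:
  assumes "C_space 2 {0..} f" "passive_scalar_solution u \<nu> f"
  shows "strong_sol {0<..} u \<nu> (\<lambda>_ _. 0) f"
  using assms C_space_mono[OF assms(1), of "{0<..}"] C_space_const'[of 0 "{0<..}" 0]
  by (auto simp: strong_sol_def passive_scalar_solution_def adv_diff_solution_def advect_def interior_real_atLeast)

lemma strong_passive:
  assumes "C_space 2 {0..} f" "strong_sol {0<..} u \<nu> (\<lambda>_ _. 0) f"
  shows "passive_scalar_solution u \<nu> f"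
  using assms C_space_imp_0[OF assms(1)]
  by (auto simp: strong_sol_def passive_scalar_solution_def adv_diff_solution_def advect_def interior_real_atLeast)

lemma advect_lin:
  assumes "C_torus 1 f" "C_torus 1 g"
  shows "advect w (\<lambda>p. a * f p + b * g p) p = a * advect w f p + b * advect w g p"
  using assms by (simp add: advect_def Dx_add Dy_add Dx_cmult Dy_cmult C_torus_cmult algebra_simps)

lemma strong_sol_lin:
  assumes f: "strong_sol J u \<nu> r f" and g: "strong_sol J u \<nu> r' g"
  shows "strong_sol J u \<nu> (\<lambda>t p. a * r t p + b * r' t p) (\<lambda>t p. a * f t p + b * g t p)"
  unfolding strong_sol_def
proof (intro conjI ballI allI)
  show "C_space 2 J (\<lambda>t p. a * f t p + b * g t p)" "C_space 0 J (\<lambda>t p. a * r t p + b * r' t p)"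
    using f g by (auto simp: strong_sol_def intro: C_space_add C_space_cmult)
  fix t p assume t: "t \<in> J"
  have 2: "C_torus 2 (f t)" "C_torus 2 (g t)" using f g t C_space_at by (auto simp: strong_sol_def)
  have 1: "C_torus 1 (f t)" "C_torus 1 (g t)" using C_torus_2D 2 by blast+
  have "((\<lambda>s. a * f s p + b * g s p) has_real_derivative
      a * (\<nu> * laplacian (f t) p - advect (u t) (f t) p - r t p) + b * (\<nu> * laplacian (g t) p - advect (u t) (g t) p - r' t p)) (at t)"
    by (intro DERIV_add DERIV_cmult strong_sol_time[OF f t] strong_sol_time[OF g t])
  then show "((\<lambda>s. a * f s p + b * g s p) has_real_derivative
      \<nu> * laplacian (\<lambda>p. a * f t p + b * g t p) p - advect (u t) (\<lambda>p. a * f t p + b * g t p) p - (a * r t p + b * r' t p)) (at t)"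
    using 1 2 by (simp add: advect_lin laplacian_add laplacian_cmult C_torus_cmult algebra_simps)
qed

lemma mass_conserved:
  assumes u: "flow_on {a<..<b} u" and s: "strong_sol {a<..<b} u \<nu> (\<lambda>_ _. 0) f" and c: "C_space 0 {a..b} f" and ab: "a \<le> b"
  shows "torus_integral (f b) = torus_integral (f a)"
proof (cases "a = b")
  case False
  then have "a < b" using ab by simp
  then show ?thesis
    using DERIV_isconst_end[of a b "\<lambda>t. torus_integral (f t)"] torus_integral_continuous[OF c]
      mass_deriv[OF u s open_greaterThanLessThan] by (simp add: torus_integral_const)
qed simp

lemma field_bounded:
  assumes "flow_on {0..} u"
  obtains U where "0 \<le> U" "\<And>t p. t \<in> {0..T} \<Longrightarrow> (fst (u t p))\<^sup>2 + (snd (u t p))\<^sup>2 \<le> U"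
proof -
  have c: "C_space 1 {0..} (\<lambda>t p. fst (u t p))" "C_space 1 {0..} (\<lambda>t p. snd (u t p))"
    using assms by (auto simp: flow_on_def)
  have "C_space 1 {0..} (\<lambda>t p. (fst (u t p))\<^sup>2 + (snd (u t p))\<^sup>2)"
    by (intro C_space_add C_space_power2 c)
  from C_space_bounded_Icc[OF this, of T] obtain B where B: "0 \<le> B"
    "\<forall>s\<in>{0..T}. \<forall>p. \<bar>(fst (u s p))\<^sup>2 + (snd (u s p))\<^sup>2\<bar> \<le> B" by blast
  show ?thesis by (rule that[OF B(1)]) (use B(2) abs_le_D1 in blast)
qed

definition reachable :: "(real \<Rightarrow> real \<times> real \<Rightarrow> real \<times> real) \<Rightarrow> real \<Rightarrow> (real \<Rightarrow> real \<times> real \<Rightarrow> real) \<Rightarrow> bool" where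
  "reachable u \<nu> f \<longleftrightarrow> C_space 2 {0..} f \<and> strong_sol {0<..} u \<nu> (\<lambda>_ _. 0) f \<and> torus_integral (f 0) = 0"

text \<open>
  The estimate in the definition of relaxation enhancing flows is only available for solutions that start
  at time 0. Their states at time \<open>s\<close> are dense among mean-zero functions: for nearly optimal
  approximations with remainder \<open>r\<close>, the solution of the time-reversed equation starting from \<open>r\<close> is
  small at time \<open>s\<close> by duality, hence also at small positive times by backward uniqueness.
\<close>

context
  fixes u :: "real \<Rightarrow> real \<times> real \<Rightarrow> real \<times> real" and \<nu> s :: real and g :: "real \<times> real \<Rightarrow> real"
  assumes u: "flow_on {0..} u" and \<nu>: "0 < \<nu>" and s: "0 < s" and g: "C_torus 2 g" and gm: "torus_integral g = 0"
begin

abbreviation reach :: "(real \<Rightarrow> real \<times> real \<Rightarrow> real) \<Rightarrow> bool" where "reach \<equiv> reachable u \<nu>"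

definition remainder :: "(real \<Rightarrow> real \<times> real \<Rightarrow> real) \<Rightarrow> real \<times> real \<Rightarrow> real" where
  "remainder f p = g p - f s p"

text \<open>The squared \<open>L\<^sup>2\<close> distance of \<open>g\<close> from the states
  reached at time \<open>s\<close>.\<close>

definition infimum :: real where "infimum = Inf ((\<lambda>f. energy (remainder f)) ` Collect reach)"

text \<open>The truncation keeps the time argument in the domain of \<open>u\<close> after time
  \<open>s\<close>, so that the existence theorem, which wants a field for all nonnegative times,
  applies.\<close>

definition reversed :: "real \<Rightarrow> real \<times> real \<Rightarrow> real \<times> real" where
  "reversed t p = - u (max 0 (s - t)) p"

lemma u_sub: "flow_on {a<..<b} u" if "0 \<le> a"
  by (rule flow_on_mono[OF u]) (use that in auto)

lemma reversed_flow: "flow_on {0..} reversed"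
  unfolding reversed_def[abs_def]
  by (rule flow_on_minus[OF flow_on_time[OF u]]) (auto intro!: continuous_intros)

lemma remainder_C: "reach f \<Longrightarrow> C_torus 2 (remainder f)" "reach f \<Longrightarrow> C_torus 0 (remainder f)"
  unfolding remainder_def[abs_def] reachable_def using s
  by (auto intro!: C_torus_diff g C_torus_imp_0[OF g] intro: C_space_at C_torus_imp_0[OF C_space_at])

lemma reach_lin: "reach f \<Longrightarrow> reach h \<Longrightarrow> reach (\<lambda>t p. a * f t p + b * h t p)"
  using strong_sol_lin[of "{0<..}" u \<nu> "\<lambda>_ _. 0" f "\<lambda>_ _. 0" h a b] C_space_at[of 2 "{0..}" f 0] C_space_at[of 2 "{0..}" h 0]
  by (auto simp: reachable_def torus_integral_add torus_integral_cmult C_torus_imp_0 C_torus_cmult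
      intro: C_space_add C_space_cmult)

lemma reach_from:
  assumes "C_torus 2 h" "torus_integral h = 0" obtains f where "reach f" "f 0 = h"
proof (rule passive_scalar_exists[OF flow_on_vector_field[OF u] assms(1) \<nu>])
  fix f assume "C_space 2 {0..} f" "f 0 = h" "passive_scalar_solution u \<nu> f"
  then show thesis using that[of f] passive_strong assms by (auto simp: reachable_def)
qed

lemma reach_zero: "\<exists>f. reach f"
  using reach_from[OF C_torus_const[of 2 0]] by (auto simp: torus_integral_const)

lemma infimum_bdd: "bdd_below ((\<lambda>f. energy (remainder f)) ` Collect reach)"
  by (rule bdd_belowI[of _ 0]) (auto intro: energy_nonneg remainder_C)

lemma infimum_le: "reach f \<Longrightarrow> infimum \<le> energy (remainder f)"
  unfolding infimum_def by (rule cInf_lower[OF _ infimum_bdd]) auto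

lemma infimum_approx:
  assumes "0 < e" obtains f where "reach f" "energy (remainder f) < infimum + e"
proof -
  have "(\<lambda>f. energy (remainder f)) ` Collect reach \<noteq> {}" using reach_zero by auto
  from cInf_lessD[OF this, of "infimum + e"] show ?thesis
    using that assms by (auto simp: infimum_def)
qed

definition backward :: "(real \<Rightarrow> real \<times> real \<Rightarrow> real) \<Rightarrow> (real \<Rightarrow> real \<times> real \<Rightarrow> real) \<Rightarrow> bool" where
  "backward f h \<longleftrightarrow> C_space 2 {0..} h \<and> strong_sol {0<..} reversed \<nu> (\<lambda>_ _. 0) h \<and> h 0 = remainder f"

lemma backward_exists:
  assumes "reach f" obtains h where "backward f h"
proof (rule passive_scalar_exists[OF flow_on_vector_field[OF reversed_flow] remainder_C(1)[OF assms] \<nu>])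
  fix h assume "C_space 2 {0..} h" "h 0 = remainder f" "passive_scalar_solution reversed \<nu> h"
  then show thesis using that[of h] passive_strong by (auto simp: backward_def)
qed

text \<open>The state \<open>h s\<close> has mean zero and may serve as initial datum of a
  competitor \<open>k\<close>. Duality turns the pairing of the remainder with \<open>k s\<close>
  into \<open>energy (h s)\<close>, and \<open>energy (k s)\<close> is no larger. Subtracting
  \<open>k s\<close> thus lowers the energy of the remainder by at least
  \<open>energy (h s)\<close>, which near the infimum has to be small.\<close>

lemma backward_small:
  assumes f: "reach f" and h: "backward f h" and e: "energy (remainder f) \<le> infimum + e"
  shows "energy (h s) \<le> e"
proof -
  have hC: "C_space 2 {0..} h" "C_space 0 {0..} h" using h by (auto simp: backward_def dest: C_space_imp_0)
  have hs: "C_torus 2 (h s)" using C_space_at[OF hC(1)] s by simp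
  have h': "strong_sol {0<..<s} reversed \<nu> (\<lambda>_ _. 0) h" "C_space 0 {0..s} h"
    using h hC by (auto simp: backward_def elim: strong_sol_mono C_space_mono)
  have "torus_integral (h s) = torus_integral (h 0)"
    by (rule mass_conserved[OF flow_on_mono[OF reversed_flow] h']) (use s in auto)
  also have "\<dots> = 0"
  proof -
    have fC: "C_space 2 {0..} f" "C_space 0 {0..} f" using f by (auto simp: reachable_def dest: C_space_imp_0)
    have "torus_integral (f s) = torus_integral (f 0)"
      by (rule mass_conserved[OF u_sub]) (use f fC s in \<open>auto simp: reachable_def elim: strong_sol_mono C_space_mono\<close>)
    then have "torus_integral (f s) = 0" using f by (simp add: reachable_def)
    moreover have "torus_integral (remainder f) = torus_integral g - torus_integral (f s)"
      unfolding remainder_def[abs_def]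
      by (rule torus_integral_diff) (use C_torus_imp_0[OF g] C_space_at[OF fC(2)] s in auto)
    ultimately show ?thesis using h gm by (simp add: backward_def)
  qed
  finally obtain k where k: "reach k" "k 0 = h s" using reach_from[OF hs] by blast
  have kC: "C_space 0 {0..s} k" "strong_sol {0<..<s} u \<nu> (\<lambda>_ _. 0) k" "C_torus 0 (k s)"
    using k s by (auto simp: reachable_def elim!: strong_sol_mono intro: C_space_mono[OF C_space_imp_0] C_torus_imp_0[OF C_space_at])
  have rC: "C_torus 0 (remainder f)" using remainder_C(2)[OF f] .
  have dual: "torus_integral (\<lambda>p. k s p * h 0 p) = torus_integral (\<lambda>p. k 0 p * h s p)"
    by (rule duality_pairing[OF u_sub _ kC(2,1) h']) (use s in \<open>auto simp: reversed_def[abs_def]\<close>)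
  then have q: "torus_integral (\<lambda>p. remainder f p * k s p) = energy (h s)"
    using h k by (simp add: backward_def energy_def power2_eq_square mult.commute)
  have "energy (k s) \<le> energy (k 0)"
    by (rule energy_antimono[OF u_sub kC(2,1)]) (use \<nu> s in auto)
  then have ks: "energy (k s) \<le> energy (h s)" using k by simp
  have "reach (\<lambda>t p. 1 * f t p + 1 * k t p)" by (rule reach_lin[OF f k(1)])
  from infimum_le[OF this] have "infimum \<le> energy (\<lambda>p. remainder f p - k s p)"
    by (simp add: remainder_def[abs_def] algebra_simps)
  also have "\<dots> = energy (remainder f) - 2 * energy (h s) + energy (k s)"
    by (simp add: energy_diff[OF rC kC(3)] q)
  finally show ?thesis using ks e by simp
qed

text \<open>The parallelogram law: the midpoint of two nearly optimal states is again reachable,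
  hence not better than the infimum.\<close>

lemma remainder_Cauchy:
  assumes f: "reach f" and k: "reach k" and e: "energy (remainder f) \<le> infimum + e" "energy (remainder k) \<le> infimum + e"
  shows "energy (\<lambda>p. remainder f p - remainder k p) \<le> 4 * e"
proof -
  note C = remainder_C(2)[OF f] remainder_C(2)[OF k]
  have "reach (\<lambda>t p. (1/2) * f t p + (1/2) * k t p)" by (rule reach_lin[OF f k])
  from infimum_le[OF this] have "infimum \<le> energy (\<lambda>p. (1/2) * (remainder f p + remainder k p))"
    by (simp add: remainder_def[abs_def] field_simps)
  also have "\<dots> = energy (\<lambda>p. remainder f p + remainder k p) / 4"
    using C by (subst energy_cmult) (auto intro: C_torus_add simp: power2_eq_square)
  finally show ?thesis using energy_add[OF C] energy_diff[OF C] e by simp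
qed

text \<open>If \<open>energy (h \<tau>)\<close> exceeded \<open>\<theta>\<close>, backward
  uniqueness would bound \<open>energy (h s)\<close> from below by a constant independent of
  \<open>f\<close> and \<open>h\<close>, against \<open>backward_small\<close>. What has to be
  uniform is the frequency at the starting time of that argument.\<close>

lemma backward_early_small:
  assumes \<theta>: "0 < \<theta>" and \<tau>: "0 < \<tau>" "\<tau> < s"
  obtains e where "0 < e" "\<And>f h. reach f \<Longrightarrow> backward f h \<Longrightarrow> energy (remainder f) \<le> infimum + e \<Longrightarrow> energy (h \<tau>) \<le> \<theta>"
proof -
  obtain U where U: "0 \<le> U" "\<And>t p. t \<in> {0..s} \<Longrightarrow> (fst (reversed t p))\<^sup>2 + (snd (reversed t p))\<^sup>2 \<le> U"
    using field_bounded[OF reversed_flow] by blast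
  define B where "B = (infimum + 1) / (2 * \<nu> * \<tau>)"
  have inf0: "0 \<le> infimum"
    unfolding infimum_def using reach_zero by (intro cInf_greatest) (auto intro: energy_nonneg remainder_C)
  have B: "0 \<le> B" using inf0 \<nu> \<tau> by (simp add: B_def)
  \<comment> \<open>The lower bound from backward uniqueness for energy at least
    \<open>\<theta>\<close>, frequency at most \<open>B / \<theta>\<close> and an interval of length
    at most \<open>s\<close>.\<close>
  define \<theta>' where "\<theta>' = \<theta> * exp (- (2 * \<nu> * s * (B / \<theta>) * exp (U * s / (2 * \<nu>))))"
  have \<theta>': "0 < \<theta>'" using \<theta> by (simp add: \<theta>'_def)
  show ?thesis
  proof (rule that[of "min 1 (\<theta>' / 2)"])
    show "0 < min 1 (\<theta>' / 2)" using \<theta>' by simp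
    fix f h assume f: "reach f" and h: "backward f h" and e: "energy (remainder f) \<le> infimum + min 1 (\<theta>' / 2)"
    have hC: "C_space 2 {0..} h" "C_space 0 {0..} h" using h by (auto simp: backward_def dest: C_space_imp_0)
    have hS: "strong_sol {a<..<b} reversed \<nu> (\<lambda>_ _. 0) h" if "0 \<le> a" for a b
      using h that by (auto simp: backward_def elim!: strong_sol_mono)
    have rS: "flow_on {a<..<b} reversed" if "0 \<le> a" for a b
      by (rule flow_on_mono[OF reversed_flow]) (use that in auto)
    have dE: "((\<lambda>t. energy (h t)) has_real_derivative - 2 * \<nu> * dirichlet (h t)) (at t)" if "0 < t" for t
      using energy_deriv[OF rS hS open_greaterThanLessThan, of 0 t "t+1"] that by (simp add: torus_integral_const)
    have cE: "continuous_on {0..\<tau>} (\<lambda>t. energy (h t))"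
      by (rule energy_continuous[OF C_space_mono[OF hC(2)]]) auto
    \<comment> \<open>At most \<open>infimum + 1\<close> of energy is lost up to time
      \<open>\<tau>\<close>, so at some time before \<open>\<tau>\<close> the Dirichlet integral is
      at most \<open>B\<close>, whatever its initial value.\<close>
    obtain z l where z: "0 < z" "z < \<tau>" and l: "((\<lambda>t. energy (h t)) has_real_derivative l) (at z)"
      and lz: "energy (h \<tau>) - energy (h 0) = (\<tau> - 0) * l"
      using MVT[OF \<tau>(1) cE] dE real_differentiable_def by blast
    have "l = - 2 * \<nu> * dirichlet (h z)" using DERIV_unique[OF l dE[OF z(1)]] .
    with lz have "2 * \<nu> * \<tau> * dirichlet (h z) = energy (h 0) - energy (h \<tau>)" by (simp add: algebra_simps)
    also have "\<dots> \<le> infimum + 1"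
      using energy_nonneg[OF C_space_at[OF hC(2)], of \<tau>] \<tau> e h by (simp add: backward_def)
    finally have dz: "dirichlet (h z) \<le> B"
      using \<nu> \<tau> by (simp add: B_def field_simps)
    show "energy (h \<tau>) \<le> \<theta>"
    proof (rule ccontr)
      assume "\<not> energy (h \<tau>) \<le> \<theta>"
      moreover have "energy (h \<tau>) \<le> energy (h z)"
        by (rule energy_antimono[OF rS hS C_space_mono[OF hC(2)]]) (use z \<nu> in auto)
      ultimately have ez: "\<theta> < energy (h z)" by linarith
      have hz: "C_space 1 {z..s} h" by (rule C_space_mono[OF C_space_2_1[OF hC(1)]]) (use z in auto)
      have "\<theta>' \<le> energy (h z) * exp (- (2 * \<nu> * (s - z) * (dirichlet (h z) / energy (h z)) * exp (U * (s - z) / (2 * \<nu>))))"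
        unfolding \<theta>'_def
      proof (rule mult_mono)
        have "0 \<le> dirichlet (h z)" using C_torus_2D[OF C_space_at[OF hC(1), of z]] z by (intro dirichlet_nonneg) auto
        then have "2 * \<nu> * (s - z) * (dirichlet (h z) / energy (h z)) * exp (U * (s - z) / (2 * \<nu>)) \<le>
            2 * \<nu> * s * (B / \<theta>) * exp (U * s / (2 * \<nu>))"
          using z \<tau> \<nu> dz ez \<theta> B U(1) by (intro mult_mono frac_le) (auto intro!: divide_right_mono mult_left_mono)
        then show "exp (- (2 * \<nu> * s * (B / \<theta>) * exp (U * s / (2 * \<nu>)))) \<le>
           exp (- (2 * \<nu> * (s - z) * (dirichlet (h z) / energy (h z)) * exp (U * (s - z) / (2 * \<nu>))))" by simp
      qed (use ez \<theta> in auto)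
      also have "\<dots> \<le> energy (h s)"
        by (rule backward_uniqueness[OF rS hS hz \<nu>]) (use z \<tau> ez \<theta> U in auto)
      also have "\<dots> \<le> min 1 (\<theta>' / 2)" by (rule backward_small[OF f h e])
      finally show False using \<theta>' by simp
    qed
  qed
qed

text \<open>Smallness at time \<open>\<tau>\<close> must be carried back to time 0, but continuity
  at 0 is not uniform in the approximation. So \<open>\<tau>\<close> is fixed by one backward
  solution \<open>h0\<close>, and a better approximation \<open>f\<close> is chosen only then.
  Nearly optimal remainders are close, and the equation does not increase their distance, so
  \<open>h\<close> and \<open>h0\<close> are close both at 0 and at \<open>\<tau>\<close>. The four
  errors add up to at most \<open>40 * \<epsilon>\<close>.\<close>

lemma reach_dense:
  assumes \<eta>: "0 < \<eta>" obtains f where "reach f" "energy (remainder f) < \<eta>"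
proof -
  define \<epsilon> where "\<epsilon> = \<eta> / 100"
  have \<epsilon>: "0 < \<epsilon>" using \<eta> by (simp add: \<epsilon>_def)
  obtain f0 where f0: "reach f0" "energy (remainder f0) < infimum + \<epsilon>" using infimum_approx[OF \<epsilon>] by blast
  obtain h0 where h0: "backward f0 h0" using backward_exists[OF f0(1)] by blast
  have h0C: "C_space 2 {0..} h0" "C_space 0 {0..} h0" using h0 by (auto simp: backward_def dest: C_space_imp_0)
  have h0t: "C_torus 0 (h0 t)" if "0 \<le> t" for t using C_space_at[OF h0C(2)] that by simp
  have "continuous_on {0..} (\<lambda>t. energy (\<lambda>p. h0 0 p - h0 t p))"
    using h0t[of 0] by (intro energy_continuous C_space_diff h0C C_space_const) auto
  then obtain d where d: "0 < d" "\<And>t. 0 \<le> t \<Longrightarrow> \<bar>t\<bar> < d \<Longrightarrow> \<bar>energy (\<lambda>p. h0 0 p - h0 t p) - energy (\<lambda>p. h0 0 p - h0 0 p)\<bar> < \<epsilon>"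
    using \<epsilon> unfolding continuous_on_iff by (force simp: dist_real_def)
  define \<tau> where "\<tau> = min (d / 2) (s / 2)"
  have \<tau>: "0 < \<tau>" "\<tau> < s" "\<tau> < d" using d s by (auto simp: \<tau>_def)
  have e0: "energy (\<lambda>p. h0 0 p - h0 \<tau> p) \<le> \<epsilon>"
    using d(2)[of \<tau>] \<tau> by (simp add: energy_def torus_integral_const)
  obtain e where e: "0 < e" "\<And>f h. reach f \<Longrightarrow> backward f h \<Longrightarrow> energy (remainder f) \<le> infimum + e \<Longrightarrow> energy (h \<tau>) \<le> \<epsilon>"
    using backward_early_small[OF \<epsilon> \<tau>(1,2)] by blast
  obtain f where f: "reach f" "energy (remainder f) < infimum + min e \<epsilon>"
    using infimum_approx[of "min e \<epsilon>"] e \<epsilon> by auto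
  obtain h where h: "backward f h" using backward_exists[OF f(1)] by blast
  have hC: "C_space 2 {0..} h" "C_space 0 {0..} h" using h by (auto simp: backward_def dest: C_space_imp_0)
  have ht: "C_torus 0 (h t)" if "0 \<le> t" for t using C_space_at[OF hC(2)] that by simp
  have e1: "energy (h \<tau>) \<le> \<epsilon>" by (rule e(2)[OF f(1) h]) (use f in auto)
  have e2: "energy (\<lambda>p. h 0 p - h0 0 p) \<le> 4 * \<epsilon>"
    using remainder_Cauchy[OF f(1) f0(1), of \<epsilon>] f f0 h h0 by (simp add: backward_def)
  have e3: "energy (\<lambda>p. h0 \<tau> p - h \<tau> p) \<le> 4 * \<epsilon>"
  proof -
    have "strong_sol {0<..} reversed \<nu> (\<lambda>_ _. 1 * 0 + (-1) * 0) (\<lambda>t p. 1 * h0 t p + (-1) * h t p)"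
      by (rule strong_sol_lin) (use h h0 in \<open>auto simp: backward_def\<close>)
    then have "strong_sol {0<..<\<tau>} reversed \<nu> (\<lambda>_ _. 0) (\<lambda>t p. h0 t p - h t p)"
      by (auto elim!: strong_sol_mono)
    note D = this
    have "flow_on {0<..<\<tau>} reversed" by (rule flow_on_mono[OF reversed_flow]) auto
    from energy_antimono[OF this D]
    have "energy (\<lambda>p. h0 \<tau> p - h \<tau> p) \<le> energy (\<lambda>p. h0 0 p - h 0 p)"
      using \<nu> \<tau> C_space_mono[OF C_space_diff[OF h0C(2) hC(2)], of "{0..\<tau>}"] by auto
    also have "\<dots> = energy (\<lambda>p. h 0 p - h0 0 p)" by (simp add: energy_def power2_commute)
    finally show ?thesis using e2 by simp
  qed
  have "energy (remainder f) = energy (\<lambda>p. ((h 0 p - h0 0 p) + (h0 0 p - h0 \<tau> p)) + ((h0 \<tau> p - h \<tau> p) + h \<tau> p))"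
    using h by (simp add: backward_def)
  also have "\<dots> \<le> 2 * energy (\<lambda>p. (h 0 p - h0 0 p) + (h0 0 p - h0 \<tau> p)) + 2 * energy (\<lambda>p. (h0 \<tau> p - h \<tau> p) + h \<tau> p)"
    using \<tau> by (intro energy_add_le C_torus_add C_torus_diff ht h0t) auto
  also have "\<dots> \<le> 2 * (2 * energy (\<lambda>p. h 0 p - h0 0 p) + 2 * energy (\<lambda>p. h0 0 p - h0 \<tau> p))
      + 2 * (2 * energy (\<lambda>p. h0 \<tau> p - h \<tau> p) + 2 * energy (h \<tau>))"
    using \<tau> by (intro add_mono mult_left_mono energy_add_le C_torus_diff ht h0t) auto
  also have "\<dots> < \<eta>" using e0 e1 e2 e3 \<eta> by (simp add: \<epsilon>_def)
  finally show ?thesis using that f(1) by blast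
qed

end

text \<open>The difference from a solution started at time 0 is itself a passive scalar and its
  \<open>L\<^sup>2\<close> norm does not increase, so an approximation at time \<open>s\<close> is
  as good at time \<open>s + t\<close>.\<close>

lemma relaxation_from_any_time:
  assumes u: "flow_on {0..} u" and \<nu>: "0 < \<nu>" and C: "0 \<le> C" and k: "0 \<le> k"
    and relax: "\<And>f s t. passive_scalar_solution u \<nu> f \<Longrightarrow> torus_integral (f 0) = 0 \<Longrightarrow> 0 \<le> s \<Longrightarrow> 0 \<le> t \<Longrightarrow>
        L2_norm (f (s + t)) \<le> C * L2_norm (f s) * exp (- (k * t))"
    and s: "0 \<le> s" and t: "0 \<le> t"
    and f: "strong_sol {s<..<s+t} u \<nu> (\<lambda>_ _. 0) f" "C_space 0 {s..s+t} f" "C_torus 2 (f s)" "torus_integral (f s) = 0"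
  shows "L2_norm (f (s + t)) \<le> C * L2_norm (f s) * exp (- (k * t))"
proof -
  have approx: "\<exists>h. reachable u \<nu> h \<and> energy (\<lambda>p. f s p - h s p) < \<eta>" if \<eta>: "0 < \<eta>" for \<eta>
  proof (cases "s = 0")
    case True
    obtain h where h: "C_space 2 {0..} h" "h 0 = f s" "passive_scalar_solution u \<nu> h"
      by (rule passive_scalar_exists[OF flow_on_vector_field[OF u] f(3) \<nu>]) (rule that)
    then have "reachable u \<nu> h" using passive_strong f(4) by (simp add: reachable_def)
    then show ?thesis using True \<eta> h(2) by (intro exI[of _ h]) (simp add: energy_def torus_integral_const)
  next
    case False
    then have s0: "0 < s" using s by simp
    from reach_dense[OF u \<nu> s0 f(3,4) \<eta>, unfolded remainder_def[OF u \<nu> s0 f(3,4), abs_def]] show ?thesis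
      by blast
  qed
  have fb: "C_torus 0 (f (s + t))" and fa: "C_torus 0 (f s)"
    using C_space_at[OF f(2), of "s+t"] C_space_at[OF f(2), of s] t by auto
  show ?thesis
  proof (rule field_le_epsilon)
    fix e :: real assume e: "0 < e"
    \<comment> \<open>The approximation error enters once at time \<open>s\<close>, multiplied by at
      most \<open>C\<close>, and once at time \<open>s + t\<close>.\<close>
    define \<eta> where "\<eta> = e / (C + 1)"
    have \<eta>: "0 < \<eta>" using e C by (simp add: \<eta>_def)
    obtain h where h: "reachable u \<nu> h" "energy (\<lambda>p. f s p - h s p) < \<eta>\<^sup>2" using approx[of "\<eta>\<^sup>2"] \<eta> by auto
    have hC: "C_space 2 {0..} h" "strong_sol {0<..} u \<nu> (\<lambda>_ _. 0) h" "torus_integral (h 0) = 0"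
      using h(1) by (auto simp: reachable_def)
    have h0: "C_space 0 {0..} h" using C_space_imp_0[OF hC(1)] .
    have ha: "C_torus 0 (h s)" and hb: "C_torus 0 (h (s + t))" using C_space_at[OF h0] s t by auto
    have "strong_sol {s<..<s+t} u \<nu> (\<lambda>_ _. 1 * 0 + (-1) * 0) (\<lambda>t p. 1 * f t p + (-1) * h t p)"
      by (rule strong_sol_lin[OF f(1) strong_sol_mono[OF hC(2)]]) (use s in auto)
    then have D: "strong_sol {s<..<s+t} u \<nu> (\<lambda>_ _. 0) (\<lambda>t p. f t p - h t p)" by simp
    have us: "flow_on {s<..<s+t} u" by (rule flow_on_mono[OF u]) (use s in auto)
    have hs: "C_space 0 {s..s+t} h" by (rule C_space_mono[OF h0]) (use s in auto)
    have "energy (\<lambda>p. f (s+t) p - h (s+t) p) \<le> energy (\<lambda>p. f s p - h s p)"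
      by (rule energy_antimono[OF us D C_space_diff[OF f(2) hs]]) (use \<nu> t in auto)
    then have "L2_norm (\<lambda>p. f (s+t) p - h (s+t) p) \<le> L2_norm (\<lambda>p. f s p - h s p)"
      by (simp add: L2_norm_energy)
    moreover have "L2_norm (\<lambda>p. f s p - h s p) \<le> \<eta>"
      unfolding L2_norm_energy using h(2) \<eta> by (intro real_le_lsqrt) (auto intro!: energy_nonneg C_torus_diff fa ha)
    ultimately have d: "L2_norm (\<lambda>p. f (s+t) p - h (s+t) p) \<le> \<eta>" "L2_norm (\<lambda>p. h s p - f s p) \<le> \<eta>"
      using L2_norm_minus_commute[of "h s" "f s"] by auto
    have hs: "L2_norm (h s) \<le> L2_norm (f s) + \<eta>"
      using L2_norm_triangle[OF fa C_torus_diff[OF ha fa]] d(2) by simp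
    have "L2_norm (f (s+t)) \<le> L2_norm (h (s+t)) + L2_norm (\<lambda>p. f (s+t) p - h (s+t) p)"
      using L2_norm_triangle[OF hb C_torus_diff[OF fb hb]] by simp
    also have "L2_norm (h (s+t)) \<le> C * L2_norm (h s) * exp (- (k * t))"
      by (rule relax[OF strong_passive[OF hC(1,2)] hC(3) s t])
    also have "\<dots> \<le> C * (L2_norm (f s) + \<eta>) * exp (- (k * t))"
      using hs C by (intro mult_right_mono mult_left_mono) auto
    also have "\<dots> = C * L2_norm (f s) * exp (- (k * t)) + C * \<eta> * exp (- (k * t))" by (simp add: algebra_simps)
    also have "C * \<eta> * exp (- (k * t)) \<le> C * \<eta> * 1"
      using C \<eta> k t by (intro mult_left_mono) auto
    finally have "L2_norm (f (s+t)) \<le> C * L2_norm (f s) * exp (- (k * t)) + (C * \<eta> + \<eta>)" using d(1) by simp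
    also have "C * \<eta> + \<eta> = e"
    proof -
      have "C * \<eta> + \<eta> = (C + 1) * \<eta>" by (simp add: algebra_simps)
      then show ?thesis using C by (simp add: \<eta>_def)
    qed
    finally show "L2_norm (f (s+t)) \<le> C * L2_norm (f s) * exp (- (k * t)) + e" .
  qed
qed

text \<open>By backward uniqueness a fixed datum decays slowly on the time interval \<open>[0, \<nu>]\<close>.\<close>

lemma sine_datum:
  obtains g :: "real \<times> real \<Rightarrow> real" where "C_torus 2 g" "torus_integral g = 0" "0 < energy g"
proof -
  let ?k = "2 * pi"
  let ?s = "\<lambda>p :: real \<times> real. sin (?k * fst p)" and ?c = "\<lambda>p :: real \<times> real. cos (?k * fst p)"
  have per: "sin (?k * (x + 1)) = sin (?k * x)" "cos (?k * (x + 1)) = cos (?k * x)" for x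
    by (simp_all add: distrib_left)
  have "C_torus k (\<lambda>p. a * ?s p) \<and> C_torus k (\<lambda>p. a * ?c p)" for k a
  proof (induction k arbitrary: a)
    case 0
    then show ?case by (auto simp: C_torus_0 periodic_def per intro!: continuous_intros)
  next
    case (Suc k)
    have 0: "C_space 0 UNIV (\<lambda>t. (\<lambda>p. a * ?s p))" "C_space 0 UNIV (\<lambda>t. (\<lambda>p. a * ?c p))"
      unfolding C_torus_def[symmetric] by (auto simp: C_torus_0 periodic_def per intro!: continuous_intros)
    have "C_torus (Suc k) (\<lambda>p. a * ?s p)" unfolding C_torus_def
      by (rule C_space_SucI[OF 0(1), where fx="\<lambda>_ p. (a * ?k) * ?c p" and fy="\<lambda>_ _. 0"])
        (use Suc[of "a * ?k"] in \<open>auto simp: C_torus_def intro: C_space_const' intro!: derivative_eq_intros\<close>)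
    moreover have "C_torus (Suc k) (\<lambda>p. a * ?c p)" unfolding C_torus_def
      by (rule C_space_SucI[OF 0(2), where fx="\<lambda>_ p. (- a * ?k) * ?s p" and fy="\<lambda>_ _. 0"])
        (use Suc[of "- a * ?k"] in \<open>auto simp: C_torus_def intro: C_space_const' intro!: derivative_eq_intros\<close>)
    ultimately show ?case by simp
  qed
  from this[of 2 1] this[of 1 1] this[of 0 1] have C: "C_torus 2 ?s" "C_torus 1 ?s" "C_torus 1 ?c" "C_torus 0 ?s" "C_torus 0 ?c" by auto
  have D: "Dx ?c = (\<lambda>p. - ?k * ?s p)" "Dx ?s = (\<lambda>p. ?k * ?c p)"
    by (rule Dx_eqI; auto intro!: derivative_eq_intros)+
  have "torus_integral (\<lambda>p. - ?k * ?s p) = 0" using torus_integral_Dx[OF C(3)] by (simp only: D)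
  then have m: "torus_integral ?s = 0" by (subst (asm) torus_integral_cmult[OF C(4)]) simp
  \<comment> \<open>Sine and cosine have equal energy by integration by parts, and their squares add
    up to 1; positivity follows without evaluating an integral.\<close>
  have "torus_integral (\<lambda>p. (- ?k * ?s p) * ?s p) = - torus_integral (\<lambda>p. ?c p * (?k * ?c p))"
    using torus_ibp_x[OF C(3,2)] by (simp only: D)
  then have "torus_integral (\<lambda>p. - ?k * (?s p)\<^sup>2) = - torus_integral (\<lambda>p. ?k * (?c p)\<^sup>2)"
    by (simp add: power2_eq_square mult_ac)
  then have eq: "energy ?s = torus_integral (\<lambda>p. (?c p)\<^sup>2)"
    by (subst (asm) (1 2) torus_integral_cmult) (auto simp: energy_def intro: C_torus_power2 C)
  have "energy ?s + torus_integral (\<lambda>p. (?c p)\<^sup>2) = torus_integral (\<lambda>p. 1)"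
    unfolding energy_def by (subst torus_integral_add[symmetric]) (auto intro: C_torus_power2 C)
  then have "0 < energy ?s" using eq by (simp add: torus_integral_const)
  then show ?thesis using that[of ?s] C m by blast
qed

lemma relaxation_rate_bound:
  assumes u: "flow_on {0..} u" and C: "1 \<le> C" and \<delta>: "0 < \<delta>"
  obtains D where "0 < D" "\<And>\<nu> k. 0 < \<nu> \<Longrightarrow> \<nu> \<le> 1 \<Longrightarrow>
     (\<And>f s t. passive_scalar_solution u \<nu> f \<Longrightarrow> torus_integral (f 0) = 0 \<Longrightarrow> 0 \<le> s \<Longrightarrow> 0 \<le> t \<Longrightarrow>
        L2_norm (f (s + t)) \<le> C * L2_norm (f s) * exp (- (\<delta> * k * t))) \<Longrightarrow> k \<le> D / \<nu>"
proof -
  obtain g where g: "C_torus 2 g" "torus_integral g = 0" "0 < energy g" using sine_datum by blast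
  obtain U where U: "0 \<le> U" "\<And>t p. t \<in> {0..1} \<Longrightarrow> (fst (u t p))\<^sup>2 + (snd (u t p))\<^sup>2 \<le> U"
    using field_bounded[OF u] by blast
  define q where "q = dirichlet g / energy g"
  have q: "0 \<le> q" using g C_torus_2D[OF g(1)] by (simp add: q_def dirichlet_nonneg)
  \<comment> \<open>The quotient is the bound on \<open>k * \<nu>\<close> obtained from comparing
    the exponents at the end; the added 1 makes \<open>D\<close> positive.\<close>
  define D where "D = (2 * ln C + 2 * q * exp (U / 2)) / (2 * \<delta>) + 1"
  have D: "0 < D" using C q \<delta> by (simp add: D_def add_nonneg_pos)
  have "k \<le> D / \<nu>" if \<nu>: "0 < \<nu>" "\<nu> \<le> 1"
    and relax: "\<And>f s t. passive_scalar_solution u \<nu> f \<Longrightarrow> torus_integral (f 0) = 0 \<Longrightarrow> 0 \<le> s \<Longrightarrow> 0 \<le> t \<Longrightarrow>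
        L2_norm (f (s + t)) \<le> C * L2_norm (f s) * exp (- (\<delta> * k * t))" for \<nu> k
  proof -
    obtain f where f: "C_space 2 {0..} f" "f 0 = g" "passive_scalar_solution u \<nu> f"
      using passive_scalar_exists[OF flow_on_vector_field[OF u] g(1) \<nu>(1)] by blast
    have fs: "strong_sol {0<..<\<nu>} u \<nu> (\<lambda>_ _. 0) f"
      by (rule strong_sol_mono[OF passive_strong[OF f(1,3)]]) auto
    have fc: "C_space 1 {0..\<nu>} f" by (rule C_space_mono[OF C_space_2_1[OF f(1)]]) auto
    \<comment> \<open>On an interval of length \<open>\<nu>\<close> the exponent
      \<open>U * (b - a) / (2 * \<nu>)\<close> is \<open>U / 2\<close>, independent of
      \<open>\<nu>\<close>.\<close>
    have "energy (f 0) * exp (- (2 * \<nu> * (\<nu> - 0) * (dirichlet (f 0) / energy (f 0)) * exp (U * (\<nu> - 0) / (2 * \<nu>)))) \<le> energy (f \<nu>)"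
      by (rule backward_uniqueness[OF flow_on_mono[OF u] fs fc \<nu>(1)]) (use \<nu> U g f in auto)
    then have low: "energy g * exp (- (2 * \<nu> * \<nu> * q * exp (U / 2))) \<le> energy (f \<nu>)"
      using f \<nu> by (simp add: q_def)
    have "L2_norm (f (0 + \<nu>)) \<le> C * L2_norm (f 0) * exp (- (\<delta> * k * \<nu>))"
      using relax[OF f(3), of 0 \<nu>] f(2) g \<nu> by simp
    then have "(L2_norm (f \<nu>))\<^sup>2 \<le> (C * L2_norm g * exp (- (\<delta> * k * \<nu>)))\<^sup>2"
      using f(2) C_space_at[OF C_space_imp_0[OF f(1)], of \<nu>] \<nu> by (intro power_mono) (auto intro: L2_norm_nonneg)
    then have up: "energy (f \<nu>) \<le> C\<^sup>2 * energy g * (exp (- (\<delta> * k * \<nu>)))\<^sup>2"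
      using energy_nonneg[OF C_space_at[OF C_space_imp_0[OF f(1)], of \<nu>]] \<nu> g
      by (simp add: L2_norm_energy power_mult_distrib)
    have "exp (- (2 * \<nu> * \<nu> * q * exp (U / 2))) \<le> C\<^sup>2 * (exp (- (\<delta> * k * \<nu>)))\<^sup>2"
    proof -
      have "energy g * exp (- (2 * \<nu> * \<nu> * q * exp (U / 2))) \<le> energy g * (C\<^sup>2 * (exp (- (\<delta> * k * \<nu>)))\<^sup>2)"
        using low up by (simp add: mult_ac)
      then show ?thesis using g(3) by simp
    qed
    also have "\<dots> = exp (2 * ln C + 2 * (- (\<delta> * k * \<nu>)))"
    proof -
      have "2 * ln C + 2 * (- (\<delta> * k * \<nu>)) = (ln C + ln C) + (- (\<delta> * k * \<nu>) + - (\<delta> * k * \<nu>))" by simp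
      then show ?thesis using C by (simp only: exp_add power2_eq_square) simp
    qed
    finally have "- (2 * \<nu> * \<nu> * q * exp (U / 2)) \<le> 2 * ln C + 2 * (- (\<delta> * k * \<nu>))" by simp
    then have "2 * \<delta> * (k * \<nu>) \<le> 2 * ln C + (\<nu> * \<nu>) * (2 * q * exp (U / 2))" by (simp add: algebra_simps)
    also have "(\<nu> * \<nu>) * (2 * q * exp (U / 2)) \<le> 1 * (2 * q * exp (U / 2))"
      using \<nu> q by (intro mult_right_mono mult_le_one) auto
    finally have "k * \<nu> \<le> (2 * ln C + 2 * q * exp (U / 2)) / (2 * \<delta>)" using \<delta> by (simp add: field_simps)
    also have "\<dots> \<le> D" by (simp add: D_def)
    finally show ?thesis using \<nu> by (simp add: field_simps)
  qed
  then show ?thesis using that D by blast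
qed

subsection \<open>A weak Nash inequality\<close>

lemma unit_integral_le:
  fixes f :: "real \<Rightarrow> real"
  assumes c: "continuous_on {-(1/2)..1/2} f" "\<And>x. x \<in> {-(1/2)..1/2} \<Longrightarrow> f x \<le> c"
  shows "integral {-(1/2)..1/2} f \<le> c"
proof -
  have "integral {-(1/2)..1/2} f \<le> integral {-(1/2)..1/2} (\<lambda>_::real. c)"
    by (rule integral_le) (use assms in \<open>auto intro: integrable_continuous_real\<close>)
  then show ?thesis by simp
qed

lemma oscillation_le:
  fixes f f' :: "real \<Rightarrow> real"
  assumes d: "\<And>x. (f has_real_derivative f' x) (at x)" and c: "continuous_on UNIV f'"
    and x: "x \<in> {a..b}" "x' \<in> {a..b}"
  shows "f x - f x' \<le> integral {a..b} (\<lambda>x. \<bar>f' x\<bar>)"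
proof -
  have i: "(\<lambda>x. \<bar>f' x\<bar>) integrable_on {p..q}" "f' integrable_on {p..q}" for p q
    by (auto intro!: integrable_continuous_real continuous_intros continuous_on_subset[OF c])
  have le: "\<bar>f q - f p\<bar> \<le> integral {a..b} (\<lambda>x. \<bar>f' x\<bar>)" if "p \<le> q" "a \<le> p" "q \<le> b" for p q
  proof -
    have "norm (integral {p..q} f') \<le> integral {p..q} (\<lambda>x. \<bar>f' x\<bar>)"
      by (rule integral_norm_bound_integral) (use i in auto)
    also have "\<dots> \<le> integral {a..b} (\<lambda>x. \<bar>f' x\<bar>)"
      by (rule integral_subset_le) (use i that in auto)
    finally show ?thesis using integral_antiderivative[OF d that(1)] by simp
  qed
  show ?thesis using le[of x x'] le[of x' x] x by (cases "x \<le> x'") auto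
qed

lemma mean_value_oscillation:
  fixes f :: "real \<Rightarrow> real"
  assumes d: "\<And>x. (f has_real_derivative f' x) (at x)" and c: "continuous_on UNIV f'" and x: "x \<in> {-(1/2)..1/2}"
  shows "f x \<le> integral {-(1/2)..1/2} f + integral {-(1/2)..1/2} (\<lambda>x. \<bar>f' x\<bar>)"
proof -
  have cf: "continuous_on {-(1/2)..1/2} f" using d DERIV_isCont continuous_at_imp_continuous_on by blast
  have "integral {-(1/2)..1/2} (\<lambda>x'. f x - f x') \<le> integral {-(1/2)..1/2} (\<lambda>x. \<bar>f' x\<bar>)"
    by (rule unit_integral_le) (use oscillation_le[OF d c x] cf in \<open>auto intro!: continuous_intros\<close>)
  moreover have "integral {-(1/2)..1/2} (\<lambda>x'. f x - f x') = f x - integral {-(1/2)..1/2} f"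
    using cf by (subst integral_diff) (auto intro: integrable_continuous_real)
  ultimately show ?thesis by simp
qed

lemma C_torus_line:
  assumes "C_torus 0 f"
  shows "continuous_on S (\<lambda>x. f (x, y))" "continuous_on S (\<lambda>y. f (x, y))"
proof -
  have c: "continuous_on UNIV f" using assms by (simp add: C_torus_0)
  have "continuous_on S (\<lambda>x. (x, y))" "continuous_on S (\<lambda>y. (x, y))" by (intro continuous_intros)+
  then show "continuous_on S (\<lambda>x. f (x, y))" "continuous_on S (\<lambda>y. f (x, y))"
    using continuous_on_compose2[OF c] by blast+
qed

lemma C_torus_slice:
  assumes f: "C_torus 0 f"
  shows "C_torus 0 (\<lambda>p. integral {-(1/2)..1/2} (\<lambda>x. f (x, snd p)))"
    and "C_torus 0 (\<lambda>p. integral {-(1/2)..1/2} (\<lambda>y. f (fst p, y)))"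
    and "C_torus 0 (\<lambda>p. f (fst p, y))" and "C_torus 0 (\<lambda>p. f (x, snd p))"
proof -
  have c: "continuous_on UNIV f" and p: "periodic f" using f by (auto simp: C_torus_0)
  have 1: "continuous_on (UNIV \<times> cbox (-(1/2)) (1/2)) (\<lambda>q :: (real \<times> real) \<times> real. (snd q, snd (fst q)))"
   and 2: "continuous_on (UNIV \<times> cbox (-(1/2)) (1/2)) (\<lambda>q :: (real \<times> real) \<times> real. (fst (fst q), snd q))"
   and 3: "continuous_on UNIV (\<lambda>q :: real \<times> real. (fst q, y))"
   and 4: "continuous_on UNIV (\<lambda>q :: real \<times> real. (x, snd q))"
    by (intro continuous_intros)+
  note int = integral_continuous_on_param[of UNIV "-(1/2)" "1/2 :: real"]
  show "C_torus 0 (\<lambda>p. integral {-(1/2)..1/2} (\<lambda>x. f (x, snd p)))"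
    using int[of "\<lambda>q x. f (x, snd q)"] continuous_on_compose2[OF c 1] p
    by (simp add: C_torus_0 periodic_def case_prod_beta')
  show "C_torus 0 (\<lambda>p. integral {-(1/2)..1/2} (\<lambda>y. f (fst p, y)))"
    using int[of "\<lambda>q y. f (fst q, y)"] continuous_on_compose2[OF c 2] p
    by (simp add: C_torus_0 periodic_def case_prod_beta')
  show "C_torus 0 (\<lambda>p. f (fst p, y))" "C_torus 0 (\<lambda>p. f (x, snd p))"
    using continuous_on_compose2[OF c 3] continuous_on_compose2[OF c 4] p
    by (simp_all add: C_torus_0 periodic_def)
qed

lemma torus_integral_snd:
  assumes "C_torus 0 (\<lambda>p. h (snd p))" shows "torus_integral (\<lambda>p. h (snd p)) = integral {-(1/2)..1/2} h"
  using torus_integral_iterated(1)[OF assms] by simp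

lemma torus_integral_fst:
  assumes "C_torus 0 (\<lambda>p. h (fst p))" shows "torus_integral (\<lambda>p. h (fst p)) = integral {-(1/2)..1/2} h"
  using torus_integral_iterated(2)[OF assms] by simp

lemma torus_square_le:
  assumes "C_torus 0 f" shows "(torus_integral (\<lambda>p. \<bar>f p\<bar>))\<^sup>2 \<le> energy f"
  using torus_Cauchy_Schwarz[OF C_torus_abs[OF assms] C_torus_const[of 0 1]]
  by (simp add: energy_def torus_integral_const)

text \<open>On a horizontal line, \<open>f\<close> is at most its mean \<open>F y\<close> plus its
  variation \<open>G y\<close>, so the energy is at most the integral of \<open>F * (F + G)\<close>.
  The same bound in the other direction gives \<open>F \<le> M + g\<close>, and Cauchy-Schwarz
  treats the product \<open>F * G\<close>. For large \<open>g\<close> the result is of order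
  \<open>sqrt M * g powr (3/2)\<close>, where Nash's inequality has \<open>M * g\<close>.\<close>

lemma weak_nash:
  assumes f: "C_torus 1 f" and f0: "\<And>p. 0 \<le> f p"
  defines "M \<equiv> torus_integral f" and "g \<equiv> sqrt (dirichlet f)"
  shows "energy f \<le> (M + g) * M + sqrt ((M + g) * M) * g"
proof -
  let ?I = "{-(1/2)..1/2 :: real}"
  note fc = C_torus_1D[OF f]
  have fx: "C_torus 0 (Dx f)" and fy: "C_torus 0 (Dy f)" and fc0: "C_torus 0 f" using fc by auto
  have cx: "continuous_on UNIV (\<lambda>x. Dx f (x, y))" and cy: "continuous_on UNIV (\<lambda>y. Dy f (x, y))" for x y
    using C_torus_line fx fy by blast+
  define F where "F y = integral ?I (\<lambda>x. f (x, y))" for y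
  define G where "G y = integral ?I (\<lambda>x. \<bar>Dx f (x, y)\<bar>)" for y
  have FC: "C_torus 0 (\<lambda>p. F (snd p))" and GC: "C_torus 0 (\<lambda>p. G (snd p))"
    unfolding F_def G_def by (rule C_torus_slice(1)[OF fc0] C_torus_slice(1)[OF C_torus_abs[OF fx]])+
  have F0: "0 \<le> F y" for y unfolding F_def using f0 C_torus_line(1)[OF fc0]
    by (intro Henstock_Kurzweil_Integration.integral_nonneg integrable_continuous_real) auto
  have G0: "0 \<le> G y" for y unfolding G_def using C_torus_line(1)[OF C_torus_abs[OF fx]]
    by (intro Henstock_Kurzweil_Integration.integral_nonneg integrable_continuous_real) auto
  have M0: "0 \<le> M" unfolding M_def by (intro torus_integral_nonneg fc0 f0)
  have dir: "0 \<le> dirichlet f" by (rule dirichlet_nonneg[OF f])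
  have g0: "0 \<le> g" and g2: "g\<^sup>2 = dirichlet f" using dir by (auto simp: g_def)
  have dsum: "dirichlet f = energy (Dx f) + energy (Dy f)"
    using fx fy by (simp add: dirichlet_def energy_def torus_integral_add C_torus_power2)
  have MF: "M = integral ?I F" unfolding M_def F_def[abs_def] by (rule torus_integral_iterated(1)[OF fc0])
  have fle: "f (x, y) \<le> F y + G y" if "x \<in> ?I" for x y
    unfolding F_def G_def by (rule mean_value_oscillation[OF has_Dx[OF f] cx that])
  define L where "L = torus_integral (\<lambda>p. \<bar>Dy f p\<bar>)"
  have "L\<^sup>2 \<le> g\<^sup>2" using torus_square_le[OF fy] energy_nonneg[OF fx] by (simp add: L_def g2 dsum)
  then have Lg: "L \<le> g" using g0 by (rule power2_le_imp_le)
  have Fle: "F y \<le> M + g" if y: "y \<in> ?I" for y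
  proof -
    have "F y \<le> integral ?I (\<lambda>x. integral ?I (\<lambda>y. f (x, y)) + integral ?I (\<lambda>y. \<bar>Dy f (x, y)\<bar>))"
      unfolding F_def
    proof (rule integral_le)
      show "(\<lambda>x. f (x, y)) integrable_on ?I" by (intro integrable_continuous_real C_torus_line fc0)
      show "(\<lambda>x. integral ?I (\<lambda>y. f (x, y)) + integral ?I (\<lambda>y. \<bar>Dy f (x, y)\<bar>)) integrable_on ?I"
        using C_torus_line(1)[OF C_torus_slice(2)[OF fc0], where y=0 and S="?I"]
          C_torus_line(1)[OF C_torus_slice(2)[OF C_torus_abs[OF fy]], where y=0 and S="?I"]
        by (intro integrable_continuous_real continuous_intros) auto
      show "f (x, y) \<le> integral ?I (\<lambda>y. f (x, y)) + integral ?I (\<lambda>y. \<bar>Dy f (x, y)\<bar>)" for x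
        by (rule mean_value_oscillation[OF has_Dy[OF f] cy y])
    qed
    also have "\<dots> = integral ?I (\<lambda>x. integral ?I (\<lambda>y. f (x, y))) + integral ?I (\<lambda>x. integral ?I (\<lambda>y. \<bar>Dy f (x, y)\<bar>))"
      using C_torus_line(1)[OF C_torus_slice(2)[OF fc0], where y=0 and S="?I"]
        C_torus_line(1)[OF C_torus_slice(2)[OF C_torus_abs[OF fy]], where y=0 and S="?I"]
      by (intro integral_add integrable_continuous_real) auto
    also have "\<dots> = M + L"
      unfolding M_def L_def using torus_integral_iterated(2)[OF fc0] torus_integral_iterated(2)[OF C_torus_abs[OF fy]] by simp
    finally show ?thesis using Lg by simp
  qed
  have cF: "continuous_on ?I F" and cG: "continuous_on ?I G"
    using C_torus_line(2)[OF FC, where x=0] C_torus_line(2)[OF GC, where x=0] by simp_all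
  have "energy f = integral ?I (\<lambda>y. integral ?I (\<lambda>x. (f (x, y))\<^sup>2))"
    unfolding energy_def by (rule torus_integral_iterated(1)[OF C_torus_power2[OF fc0]])
  also have "\<dots> \<le> integral ?I (\<lambda>y. (F y)\<^sup>2 + F y * G y)"
  proof (rule integral_le)
    show "(\<lambda>y. integral ?I (\<lambda>x. (f (x, y))\<^sup>2)) integrable_on ?I"
      using C_torus_line(2)[OF C_torus_slice(1)[OF C_torus_power2[OF fc0]], where x=0 and S="?I"]
      by (intro integrable_continuous_real) auto
    show "(\<lambda>y. (F y)\<^sup>2 + F y * G y) integrable_on ?I" by (intro integrable_continuous_real continuous_intros cF cG)
    fix y
    have "integral ?I (\<lambda>x. (f (x, y))\<^sup>2) \<le> integral ?I (\<lambda>x. (F y + G y) * f (x, y))"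
    proof (rule integral_le)
      show "(f (x, y))\<^sup>2 \<le> (F y + G y) * f (x, y)" if "x \<in> ?I" for x
        unfolding power2_eq_square using fle[OF that] f0 by (rule mult_right_mono)
    qed (intro integrable_continuous_real C_torus_line C_torus_power2 fc0 continuous_intros)+
    also have "\<dots> = (F y + G y) * F y" by (simp add: F_def)
    finally show "integral ?I (\<lambda>x. (f (x, y))\<^sup>2) \<le> (F y)\<^sup>2 + F y * G y" by (simp add: power2_eq_square algebra_simps)
  qed
  also have "\<dots> = energy (\<lambda>p. F (snd p)) + torus_integral (\<lambda>p. F (snd p) * G (snd p))"
    unfolding energy_def torus_integral_snd[OF C_torus_power2[OF FC]] torus_integral_snd[OF C_torus_mult[OF FC GC]]
    by (intro integral_add integrable_continuous_real continuous_intros cF cG)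
  finally have e: "energy f \<le> energy (\<lambda>p. F (snd p)) + torus_integral (\<lambda>p. F (snd p) * G (snd p))" .
  have eF: "energy (\<lambda>p. F (snd p)) \<le> (M + g) * M"
  proof -
    have "energy (\<lambda>p. F (snd p)) = integral ?I (\<lambda>y. (F y)\<^sup>2)"
      unfolding energy_def by (rule torus_integral_snd[OF C_torus_power2[OF FC]])
    also have "\<dots> \<le> integral ?I (\<lambda>y. (M + g) * F y)"
      by (rule integral_le) (use Fle F0 cF in \<open>auto simp: power2_eq_square intro!: integrable_continuous_real continuous_intros mult_right_mono\<close>)
    also have "\<dots> = (M + g) * M" by (simp add: MF)
    finally show ?thesis .
  qed
  have eG: "energy (\<lambda>p. G (snd p)) \<le> g\<^sup>2"
  proof -
    have "energy (\<lambda>p. G (snd p)) = integral ?I (\<lambda>y. (G y)\<^sup>2)"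
      unfolding energy_def by (rule torus_integral_snd[OF C_torus_power2[OF GC]])
    also have "\<dots> \<le> integral ?I (\<lambda>y. integral ?I (\<lambda>x. (Dx f (x, y))\<^sup>2))"
    proof (rule integral_le)
      show "(\<lambda>y. integral ?I (\<lambda>x. (Dx f (x, y))\<^sup>2)) integrable_on ?I"
        using C_torus_line(2)[OF C_torus_slice(1)[OF C_torus_power2[OF fx]], where x=0 and S="?I"]
        by (intro integrable_continuous_real) auto
      fix y
      have C: "C_torus 0 (\<lambda>p. Dx f (fst p, y))" by (rule C_torus_slice(3)[OF fx])
      show "(G y)\<^sup>2 \<le> integral ?I (\<lambda>x. (Dx f (x, y))\<^sup>2)"
        using torus_square_le[OF C] torus_integral_fst[OF C_torus_abs[OF C]] torus_integral_fst[OF C_torus_power2[OF C]]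
        by (simp add: G_def energy_def)
    qed (intro integrable_continuous_real continuous_intros cG)
    also have "\<dots> = energy (Dx f)" unfolding energy_def by (rule torus_integral_iterated(1)[OF C_torus_power2[OF fx], symmetric])
    also have "\<dots> \<le> g\<^sup>2" using energy_nonneg[OF fy] by (simp add: g2 dsum)
    finally show ?thesis .
  qed
  have "(torus_integral (\<lambda>p. F (snd p) * G (snd p)))\<^sup>2 \<le> energy (\<lambda>p. F (snd p)) * energy (\<lambda>p. G (snd p))"
    unfolding energy_def by (rule torus_Cauchy_Schwarz[OF FC GC])
  also have "\<dots> \<le> ((M + g) * M) * g\<^sup>2" using eF eG M0 g0 by (intro mult_mono energy_nonneg GC) auto
  finally have "torus_integral (\<lambda>p. F (snd p) * G (snd p)) \<le> sqrt (((M + g) * M) * g\<^sup>2)" by (rule real_le_rsqrt)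
  then show ?thesis using e eF g0 by (simp add: real_sqrt_mult)
qed

text \<open>Large energy forces \<open>g \<ge> M\<close>, after which every \<open>M + g\<close> can
  be replaced by \<open>2 * g\<close> and only a pure power of the Dirichlet integral
  remains.\<close>

lemma weak_nash_cubic:
  assumes f: "C_torus 1 f" and f0: "\<And>p. 0 \<le> f p" and M: "torus_integral f \<le> M" "0 < M"
    and big: "6 * M\<^sup>2 \<le> energy f"
  shows "(energy f)^4 \<le> 1024 * M\<^sup>2 * (dirichlet f)^3"
proof -
  define m where "m = torus_integral f"
  define g where "g = sqrt (dirichlet f)"
  define a where "a = energy f"
  have m0: "0 \<le> m" unfolding m_def using C_torus_1D[OF f] f0 by (intro torus_integral_nonneg) auto
  have g0: "0 \<le> g" using dirichlet_nonneg[OF f] by (simp add: g_def)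
  have "a \<le> (m + g) * m + sqrt ((m + g) * m) * g" unfolding a_def m_def g_def by (rule weak_nash[OF f f0])
  also have "\<dots> \<le> (M + g) * M + sqrt ((M + g) * M) * g"
    using M m0 g0 by (intro add_mono mult_mono real_sqrt_le_mono) (auto simp: m_def)
  also have "\<dots> \<le> 2 * (sqrt ((M + g) * M) * (M + g))"
  proof -
    have "(M + g) * M = sqrt ((M + g) * M) * sqrt ((M + g) * M)" using M g0 by simp
    also have "\<dots> \<le> sqrt ((M + g) * M) * (M + g)"
    proof (rule mult_left_mono)
      have "(M + g) * M \<le> (M + g)\<^sup>2" using M g0 by (simp add: power2_eq_square)
      then show "sqrt ((M + g) * M) \<le> M + g" using M g0 by (intro real_le_lsqrt) auto
    qed (use M g0 in auto)
    finally have "(M + g) * M \<le> sqrt ((M + g) * M) * (M + g)" .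
    moreover have "sqrt ((M + g) * M) * g \<le> sqrt ((M + g) * M) * (M + g)" using M g0 by (intro mult_left_mono) auto
    ultimately show ?thesis by simp
  qed
  finally have "a\<^sup>2 \<le> (2 * (sqrt ((M + g) * M) * (M + g)))\<^sup>2"
    using energy_nonneg[of f] C_torus_1D[OF f] by (intro power_mono) (auto simp: a_def)
  also have "\<dots> = 4 * M * (M + g)^3"
    using M g0 by (simp add: power_mult_distrib power2_eq_square power3_eq_cube)
  finally have a2: "a\<^sup>2 \<le> 4 * M * (M + g)^3" .
  have "(6 * M\<^sup>2)\<^sup>2 \<le> a\<^sup>2" using big M by (intro power_mono) (auto simp: a_def)
  then have "36 * M^4 \<le> 4 * M * (M + g)^3" using a2 by (simp add: power_mult_distrib flip: power_mult)
  moreover have "36 * M^4 = 4 * M * (9 * M^3)" by (simp add: eval_nat_numeral)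
  ultimately have "4 * M * (9 * M^3) \<le> 4 * M * (M + g)^3" by simp
  \<comment> \<open>The constant 6 in the hypothesis is chosen for this: its square divided by 4
    exceeds 8, the cube of 2.\<close>
  then have "9 * M^3 \<le> (M + g)^3" using M by (subst (asm) mult_le_cancel_left_pos) auto
  moreover have "(2 * M)^3 \<le> 9 * M^3" using M by (simp add: power_mult_distrib)
  ultimately have "(2 * M)^3 \<le> (M + g)^3" by linarith
  then have "2 * M \<le> M + g" using M g0 by (subst (asm) power_mono_iff) auto
  then have "(M + g)^3 \<le> (2 * g)^3" using M g0 by (intro power_mono) auto
  then have "4 * M * (M + g)^3 \<le> 4 * M * (2 * g)^3" using M by (intro mult_left_mono) auto
  then have "a\<^sup>2 \<le> 32 * M * g^3" using a2 by (simp add: power_mult_distrib)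
  then have "(a\<^sup>2)\<^sup>2 \<le> (32 * M * g^3)\<^sup>2" by (intro power_mono) auto
  moreover have "(g^3)\<^sup>2 = (dirichlet f)^3"
  proof -
    have "g\<^sup>2 = dirichlet f" using dirichlet_nonneg[OF f] by (simp add: g_def)
    then show ?thesis by (metis power_mult mult.commute)
  qed
  ultimately show ?thesis by (simp add: a_def power_mult_distrib flip: power_mult)
qed

text \<open>Energy above \<open>6 * M\<^sup>2\<close> at time \<open>b\<close> means energy above it
  all along, so the Nash bound is available throughout. It turns the energy identity into
  \<open>E' \<le> - 2 * \<nu> * k * E powr (4/3)\<close>, under which \<open>E powr (-1/3)\<close>
  grows at least linearly, regardless of its initial value.\<close>

lemma smoothing:
  assumes u: "flow_on {a<..<b} u" and s: "strong_sol {a<..<b} u \<nu> r f" and c: "C_space 0 {a..b} f"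
    and \<nu>: "0 < \<nu>" and ab: "a < b" and f0: "\<And>t p. t \<in> {a..b} \<Longrightarrow> 0 \<le> f t p" and r0: "\<And>t p. t \<in> {a<..<b} \<Longrightarrow> 0 \<le> r t p"
    and M: "0 < M" "\<And>t. t \<in> {a..b} \<Longrightarrow> torus_integral (f t) \<le> M"
  shows "energy (f b) \<le> (6 + 3456 / (\<nu> * (b - a))^3) * M\<^sup>2"
proof (cases "energy (f b) \<le> 6 * M\<^sup>2")
  case True
  have "0 \<le> 3456 / (\<nu> * (b - a))^3 * M\<^sup>2" using \<nu> ab by simp
  then show ?thesis using True by (simp add: algebra_simps)
next
  case False
  have big: "6 * M\<^sup>2 < energy (f t)" if t: "t \<in> {a..b}" for t
  proof -
    have "energy (f b) \<le> energy (f t)"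
      by (rule energy_antimono[OF flow_on_mono[OF u] strong_sol_mono[OF s] C_space_mono[OF c]])
        (use t \<nu> f0 r0 in \<open>auto intro!: mult_nonneg_nonneg\<close>)
    then show ?thesis using False by simp
  qed
  have pos: "0 < energy (f t)" if t: "t \<in> {a..b}" for t
    using big[OF t] zero_le_power2[of M] by linarith
  \<comment> \<open>The constant in \<open>dirichlet f \<ge> k * energy f powr (4/3)\<close>. The
    factor 3456 in the conclusion is \<open>1024 * (3/2)^3\<close>.\<close>
  define k where "k = root 3 (1 / (1024 * M\<^sup>2))"
  have k3: "k^3 = 1 / (1024 * M\<^sup>2)"
    unfolding k_def by (rule real_root_pow_pos2) auto
  have k0: "0 \<le> k" by (simp add: k_def)
  define z where "z t = energy (f t) powr (-1/3)" for t
  have cE: "continuous_on {a..b} (\<lambda>t. energy (f t))" by (rule energy_continuous[OF c])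
  have "(2 * \<nu> * k / 3) * b - z b \<le> (2 * \<nu> * k / 3) * a - z a"
  proof (rule has_derivative_nonpos_le[where f="\<lambda>t. (2 * \<nu> * k / 3) * t - z t"])
    show "continuous_on {a..b} (\<lambda>t. (2 * \<nu> * k / 3) * t - z t)"
      unfolding z_def[abs_def]
      by (intro continuous_on_diff continuous_on_mult continuous_on_powr cE continuous_on_const continuous_on_id)
        (use pos in \<open>auto simp: less_imp_neq[THEN not_sym]\<close>)
    fix t assume t: "a < t" "t < b"
    then have tJ: "t \<in> {a<..<b}" and tc: "t \<in> {a..b}" by auto
    have ft: "C_torus 2 (f t)" "C_torus 0 (r t)" using s tJ C_space_at by (auto simp: strong_sol_def)
    have f1: "C_torus 1 (f t)" "C_torus 0 (f t)" using C_torus_2D ft C_torus_imp_0 by blast+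
    define l where "l = - 2 * \<nu> * dirichlet (f t) - 2 * torus_integral (\<lambda>p. f t p * r t p)"
    have dE: "((\<lambda>t. energy (f t)) has_real_derivative l) (at t)"
      unfolding l_def by (rule energy_deriv[OF u s open_greaterThanLessThan tJ])
    have "0 \<le> torus_integral (\<lambda>p. f t p * r t p)"
      using f1 ft f0[OF tc] r0[OF tJ] by (intro torus_integral_nonneg C_torus_mult) auto
    then have l: "l \<le> - 2 * \<nu> * dirichlet (f t)" by (simp add: l_def)
    have "(z has_real_derivative (-1/3) * energy (f t) powr (-1/3 - 1) * l) (at t)"
      unfolding z_def[abs_def] using DERIV_fun_powr[OF dE pos[OF tc], of "-1/3"] by simp
    then have D: "((\<lambda>t. (2 * \<nu> * k / 3) * t - z t) has_real_derivative (2 * \<nu> * k / 3) * 1 - (-1/3) * energy (f t) powr (-1/3 - 1) * l) (at t)"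
      by (intro DERIV_diff DERIV_cmult DERIV_ident)
    define w where "w = energy (f t) powr (-4/3)"
    have w0: "0 \<le> w" by (simp add: w_def)
    have "k \<le> w * dirichlet (f t)"
    proof -
      have w3: "w^3 * (energy (f t))^4 = 1"
      proof -
        have "w^3 = energy (f t) powr (-4)" unfolding w_def using pos[OF tc] by (subst powr_power) auto
        moreover have "(energy (f t))^4 = energy (f t) powr 4" using pos[OF tc] by (simp add: powr_numeral)
        ultimately have "w^3 * (energy (f t))^4 = energy (f t) powr (-4 + 4)" by (simp only: powr_add)
        then show ?thesis using pos[OF tc] by simp
      qed
      have "(energy (f t))^4 \<le> 1024 * M\<^sup>2 * (dirichlet (f t))^3"
        by (rule weak_nash_cubic[OF f1(1) f0[OF tc] M(2)[OF tc] M(1)]) (use big[OF tc] in simp)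
      then have "w^3 * (energy (f t))^4 \<le> w^3 * (1024 * M\<^sup>2 * (dirichlet (f t))^3)"
        using w0 by (intro mult_left_mono) auto
      then have "k^3 \<le> (w * dirichlet (f t))^3"
        using M(1) unfolding w3 by (simp add: k3 power_mult_distrib divide_le_eq mult_ac)
      then show ?thesis
        using w0 k0 dirichlet_nonneg[OF f1(1)] by (subst (asm) power_mono_iff) auto
    qed
    then have "2 * \<nu> * k \<le> 2 * \<nu> * (w * dirichlet (f t))" using \<nu> by (intro mult_left_mono) auto
    also have "\<dots> = w * (2 * \<nu> * dirichlet (f t))" by simp
    also have "\<dots> \<le> w * (- l)" using l w0 by (intro mult_left_mono) auto
    finally have "(2 * \<nu> * k / 3) * 1 - (-1/3) * w * l \<le> 0" by simp
    moreover have "energy (f t) powr (-1/3 - 1) = w" by (simp add: w_def)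
    ultimately show "\<exists>y. ((\<lambda>t. (2 * \<nu> * k / 3) * t - z t) has_real_derivative y) (at t) \<and> y \<le> 0"
      using D by (intro exI conjI) auto
  qed (use ab in auto)
  moreover have "0 \<le> z a" by (simp add: z_def)
  ultimately have "2 * \<nu> * k / 3 * (b - a) \<le> z b" by (simp add: algebra_simps)
  then have "(2 * \<nu> * k / 3 * (b - a))^3 \<le> (z b)^3" using \<nu> k0 ab by (intro power_mono) auto
  also have "(z b)^3 = 1 / energy (f b)"
    using pos[of b] ab unfolding z_def by (subst powr_power) (auto simp: powr_minus_divide)
  also have "(2 * \<nu> * k / 3 * (b - a))^3 = (\<nu> * (b - a))^3 / (3456 * M\<^sup>2)"
    by (simp add: power_mult_distrib power_divide k3)
  finally have "energy (f b) \<le> 3456 / (\<nu> * (b - a))^3 * M\<^sup>2"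
    using pos[of b] ab \<nu> M(1) by (simp add: field_simps)
  moreover have "0 \<le> 6 * M\<^sup>2" by simp
  ultimately show ?thesis unfolding distrib_right by linarith
qed

subsection \<open>Comparison\<close>

lemma second_derivative_at_min:
  fixes h h' :: "real \<Rightarrow> real"
  assumes d: "\<And>x. (h has_real_derivative h' x) (at x)" and d2: "(h' has_real_derivative c) (at x)"
    and m: "\<And>y. h x \<le> h y"
  shows "h' x = 0" "0 \<le> c"
proof -
  show z: "h' x = 0" by (rule DERIV_local_min[OF d, of 1]) (use m in auto)
  show "0 \<le> c"
  proof (rule ccontr)
    assume "\<not> 0 \<le> c"
    then obtain e where e: "0 < e" "\<And>k. 0 < k \<Longrightarrow> k < e \<Longrightarrow> h' (x + k) < h' x"
      using DERIV_neg_dec_right[OF d2] by auto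
    obtain y where y: "x < y" "y < x + e / 2" "h (x + e / 2) - h x = (x + e / 2 - x) * h' y"
      using MVT2[of x "x + e / 2" h h'] d e by auto
    have "h' y < 0" using e(2)[of "y - x"] y z e(1) by simp
    then have "h (x + e / 2) < h x" using y(3) e(1) by (simp add: mult_pos_neg algebra_simps) (smt (verit) mult_pos_neg half_gt_zero)
    then show False using m[of "x + e / 2"] by simp
  qed
qed

text \<open>The weak maximum principle with a strict perturbation: were
  \<open>f + \<eta> * (t - a)\<close> negative somewhere, it would have a negative minimum,
  necessarily after time \<open>a\<close>. There the gradient vanishes and the Laplacian is
  nonnegative, so the time derivative is at least \<open>\<eta>\<close> and earlier values are
  smaller. The minimum is taken over times up to \<open>t1 < b\<close>, where the equation holds;
  the time \<open>b\<close> is reached by continuity.\<close>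

lemma comparison:
  assumes s: "strong_sol {a<..<b} u \<nu> r f" and c: "C_space 0 {a..b} f" and \<nu>: "0 \<le> \<nu>"
    and r: "\<And>t p. t \<in> {a<..<b} \<Longrightarrow> r t p \<le> 0" and i: "\<And>p. 0 \<le> f a p" and t: "t \<in> {a..b}"
  shows "0 \<le> f t p"
proof -
  have open_case: "0 \<le> f t1 p" if t1: "a < t1" "t1 < b" for t1 p
  proof -
    have key: "- (\<eta> * (t1 - a)) \<le> f t1 p" if \<eta>: "0 < \<eta>" for \<eta>
    proof -
      define \<phi> where "\<phi> q = f (fst q) (snd q) + \<eta> * (fst q - a)" for q :: "real \<times> (real \<times> real)"
      let ?K = "{a..t1} \<times> torus_cell"
      have cf: "C_space 0 {a..t1} f" by (rule C_space_mono[OF c]) (use t1 in auto)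
      have "continuous_on ?K \<phi>"
        unfolding \<phi>_def[abs_def] using C_space_0_cell[OF cf] by (intro continuous_intros) (simp add: case_prod_beta')
      moreover have "compact ?K" by (intro compact_Times compact_Icc compact_cbox)
      moreover have "(a, 0, 0) \<in> ?K" using t1 by (simp add: cbox_Pair_eq)
      then have "?K \<noteq> {}" by blast
      ultimately obtain q where q: "q \<in> ?K" "\<And>x. x \<in> ?K \<Longrightarrow> \<phi> q \<le> \<phi> x"
        using continuous_attains_inf[of ?K \<phi>] by blast
      obtain t' x' y' where q': "q = (t', x', y')" by (cases q)
      have t': "a \<le> t'" "t' \<le> t1" using q(1) by (auto simp: q')
      have min: "\<phi> q \<le> f s p + \<eta> * (s - a)" if "s \<in> {a..t1}" for s p
      proof -
        have "periodic (f s)" using cf that by (auto simp: C_space_0)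
        from periodic_cell[OF this, of p] obtain p' where "p' \<in> torus_cell" "f s p' = f s p" by metis
        then show ?thesis using q(2)[of "(s, p')"] that by (simp add: \<phi>_def mem_Times_iff)
      qed
      have "0 \<le> \<phi> q"
      proof (rule ccontr)
        assume neg: "\<not> 0 \<le> \<phi> q"
        have "a \<noteq> t'" using neg i[of "(x', y')"] by (auto simp: \<phi>_def q')
        then have tJ: "t' \<in> {a<..<b}" using t' t1 by auto
        have ft: "C_torus 2 (f t')" using s tJ C_space_at by (auto simp: strong_sol_def)
        have f1: "C_torus 1 (f t')" "C_torus 1 (Dx (f t'))" "C_torus 1 (Dy (f t'))" using C_torus_2D[OF ft] by auto
        have m: "f t' (x', y') \<le> f t' p" for p using min[of t' p] t' by (simp add: \<phi>_def q')
        have X: "Dx (f t') (x', y') = 0" "0 \<le> Dx (Dx (f t')) (x', y')"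
          using second_derivative_at_min[OF has_Dx[OF f1(1)] has_Dx[OF f1(2)] m] by auto
        have Y: "Dy (f t') (x', y') = 0" "0 \<le> Dy (Dy (f t')) (x', y')"
          using second_derivative_at_min[OF has_Dy[OF f1(1)] has_Dy[OF f1(3)] m] by auto
        define l where "l = \<nu> * laplacian (f t') (x', y') - advect (u t') (f t') (x', y') - r t' (x', y') + \<eta>"
        have "0 \<le> \<nu> * laplacian (f t') (x', y')" using X Y \<nu> by (simp add: laplacian_def)
        then have l: "0 < l" using X Y r[OF tJ, of "(x', y')"] \<eta> by (simp add: l_def advect_def)
        have "((\<lambda>s. f s (x', y') + \<eta> * (s - a)) has_real_derivative l) (at t')"
          unfolding l_def by (intro DERIV_add strong_sol_time[OF s tJ]) (auto intro!: derivative_eq_intros)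
        from DERIV_pos_inc_left[OF this l] obtain d where d: "0 < d"
          "\<And>h. 0 < h \<Longrightarrow> h < d \<Longrightarrow> f (t' - h) (x', y') + \<eta> * (t' - h - a) < f t' (x', y') + \<eta> * (t' - a)"
          by auto
        define h where "h = min (d / 2) (t' - a)"
        have h: "0 < h" "h < d" "h \<le> t' - a" using d(1) tJ by (auto simp: h_def)
        show False
          using d(2)[OF h(1,2)] min[of "t' - h" "(x', y')"] h t' by (simp add: \<phi>_def q')
      qed
      then show ?thesis using min[of t1 p] t1 by simp
    qed
    show ?thesis
    proof (rule ccontr)
      assume n: "\<not> 0 \<le> f t1 p"
      \<comment> \<open>With this choice the lower bound in \<open>key\<close> is half of the
        negative value \<open>f t1 p\<close>.\<close>
      define \<eta> where "\<eta> = - f t1 p / (2 * (t1 - a))"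
      have "0 < \<eta>" unfolding \<eta>_def using n t1 by (intro divide_pos_pos) auto
      moreover have "\<eta> * (t1 - a) = - f t1 p / 2" unfolding \<eta>_def using t1 by (simp add: divide_simps)
      ultimately show False using key n by fastforce
    qed
  qed
  show ?thesis
  proof (cases "a < b")
    case True
    have "continuous_on {a..b} (\<lambda>t. f t p)"
      by (rule C_space_0_compose[OF c continuous_on_id continuous_on_const])
    moreover have "{a..b} = closure {a<..<b}" using True by simp
    ultimately have "continuous_on (closure {a<..<b}) (\<lambda>t. f t p)" by simp
    then show ?thesis
      using continuous_ge_on_closure[of "{a<..<b}" "\<lambda>t. f t p" t 0] open_case t True by auto
  next
    case False
    then show ?thesis using t i by (metis atLeastAtMost_iff le_less_trans not_le_imp_less order_antisym)
  qed
qed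

subsection \<open>Equidistribution of a species that loses little mass\<close>

lemma strong_sol_const: "strong_sol J u \<nu> (\<lambda>_ _. 0) (\<lambda>_ _. c)"
proof -
  have D: "Dx (\<lambda>_. c) = (\<lambda>_. 0)" "Dy (\<lambda>_. c) = (\<lambda>_. 0)" "Dx (\<lambda>_. 0) = (\<lambda>_. 0)" "Dy (\<lambda>_. 0) = (\<lambda>_. 0)"
    by (auto intro: Dx_eqI Dy_eqI)
  show ?thesis by (simp add: strong_sol_def C_space_const' advect_def laplacian_def D)
qed

lemma strong_sol_shift:
  assumes "strong_sol {0<..} (\<lambda>t. u (s + t)) \<nu> (\<lambda>_ _. 0) f"
  shows "strong_sol {s<..} u \<nu> (\<lambda>_ _. 0) (\<lambda>t. f (t - s))"
  unfolding strong_sol_def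
proof (intro conjI ballI allI C_space_const')
  show "C_space 2 {s<..} (\<lambda>t. f (t - s))"
    by (rule C_space_time[of _ "{0<..}"]) (use assms in \<open>auto simp: strong_sol_def intro!: continuous_intros\<close>)
  fix t p assume "t \<in> {s<..}"
  then have "t - s \<in> {0<..}" by simp
  from strong_sol_time[OF assms this, of p]
  have "((\<lambda>t. f t p) has_real_derivative \<nu> * laplacian (f (t - s)) p - advect (u t) (f (t - s)) p - 0) (at (t + (- s)))" by simp
  from this[unfolded DERIV_shift]
  show "((\<lambda>t. f (t - s) p) has_real_derivative \<nu> * laplacian (f (t - s)) p - advect (u t) (f (t - s)) p - 0) (at t)" by simp
qed

lemma mass_antimono:
  assumes u: "flow_on {a<..<b} u" and s: "strong_sol {a<..<b} u \<nu> r f" and c: "C_space 0 {a..b} f"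
    and r: "\<And>t p. t \<in> {a<..<b} \<Longrightarrow> 0 \<le> r t p" and ab: "a \<le> b"
  shows "torus_integral (f b) \<le> torus_integral (f a)"
proof (rule has_derivative_nonpos_le[OF ab torus_integral_continuous[OF c]])
  fix t assume t: "a < t" "t < b"
  then have tJ: "t \<in> {a<..<b}" by simp
  have "C_torus 0 (r t)" using s tJ C_space_at by (auto simp: strong_sol_def)
  then show "\<exists>y. ((\<lambda>t. torus_integral (f t)) has_real_derivative y) (at t) \<and> y \<le> 0"
    using mass_deriv[OF u s open_greaterThanLessThan tJ] torus_integral_nonneg r[OF tJ] by (intro exI conjI) auto
qed

text \<open>\<open>h\<close> is the smoothing time and \<open>l\<close> the relaxation time. From
  \<open>s = a + h\<close> on, \<open>n\<close> is compared with the passive scalar started from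
  \<open>n s\<close>, split into its mean \<open>m\<close> and a mean-zero part
  \<open>\<phi>\<close>. This needs no upper bound on the reaction: its sign gives one-sided
  comparison, and the lost mass measures the gap.\<close>

lemma equidistribution:
  assumes u: "flow_on {0..} u" and \<nu>: "0 < \<nu>" and C: "0 \<le> C" and k: "0 \<le> k"
    and relax: "\<And>f s t. passive_scalar_solution u \<nu> f \<Longrightarrow> torus_integral (f 0) = 0 \<Longrightarrow> 0 \<le> s \<Longrightarrow> 0 \<le> t \<Longrightarrow>
        L2_norm (f (s + t)) \<le> C * L2_norm (f s) * exp (- (k * t))"
    and n: "strong_sol {a<..<b} u \<nu> r n" "C_space 0 {a..b} n"
    and n0: "\<And>t p. t \<in> {a..b} \<Longrightarrow> 0 \<le> n t p" and r0: "\<And>t p. t \<in> {a<..<b} \<Longrightarrow> 0 \<le> r t p"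
    and a: "0 \<le> a" and h: "0 < h" "0 \<le> l" "a + h < b"
    and M: "0 < torus_integral (n a)" and drop: "15/16 * torus_integral (n a) < torus_integral (n b)"
    and small: "C * exp (- (k * l)) * sqrt (6 + 3456 / (\<nu> * h)^3) \<le> 3 / 64"
  obtains m where "15/16 * torus_integral (n a) \<le> m" "m \<le> torus_integral (n a)"
    "\<And>t. t \<in> {a + h + l..b} \<Longrightarrow> torus_integral (\<lambda>p. \<bar>n t p - m\<bar>) \<le> m / 8"
proof -
  define M where "M = torus_integral (n a)"
  define s where "s = a + h"
  define m where "m = torus_integral (n s)"
  have s: "a < s" "s < b" "0 \<le> s" using h a by (auto simp: s_def)
  have usub: "flow_on {x<..<y} u" if "0 \<le> x" for x y
    by (rule flow_on_mono[OF u]) (use that in auto)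
  have nsub: "strong_sol {x<..<y} u \<nu> r n" "C_space 0 {x..y} n" if "a \<le> x" "y \<le> b" for x y
    using that by (auto intro!: strong_sol_mono[OF n(1)] C_space_mono[OF n(2)])
  have mono: "torus_integral (n y) \<le> torus_integral (n x)" if "a \<le> x" "x \<le> y" "y \<le> b" for x y
    by (rule mass_antimono[OF usub nsub]) (use that a r0 in auto)
  have mM: "m \<le> M" unfolding m_def M_def by (rule mono) (use s in auto)
  have mM': "15/16 * M \<le> m" using mono[of s b] s drop by (simp add: m_def M_def)
  have M0: "0 < M" using M by (simp add: M_def)
  have m0: "0 < m" using mM' M0 by linarith
  have ns2: "C_torus 2 (n s)" using n(1) s C_space_at by (auto simp: strong_sol_def)
  have ns: "C_torus 0 (n s)" by (rule C_torus_imp_0[OF ns2])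
  have nt: "C_torus 0 (n t)" if "t \<in> {a..b}" for t by (rule C_space_at[OF n(2) that])
  have es: "energy (n s) \<le> (6 + 3456 / (\<nu> * h)^3) * M\<^sup>2"
    using smoothing[OF usub nsub \<nu>, of a s M] mono s a r0 n0 M0 by (auto simp: M_def s_def)
  define g where "g p = n s p - m" for p
  have g2: "C_torus 2 g" unfolding g_def[abs_def] by (intro C_torus_diff ns2 C_torus_const)
  have gm: "torus_integral g = 0"
    unfolding g_def[abs_def] using ns by (simp add: torus_integral_diff C_torus_const torus_integral_const m_def)
  have gE: "energy g \<le> energy (n s)"
  proof -
    have "energy g = energy (n s) - 2 * torus_integral (\<lambda>p. n s p * m) + energy (\<lambda>p. m)"
      unfolding g_def[abs_def] by (rule energy_diff[OF ns C_torus_const])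
    also have "torus_integral (\<lambda>p. n s p * m) = m * m"
      using torus_integral_cmult[OF ns, of m] by (simp add: m_def mult.commute)
    also have "energy (\<lambda>p. m) = m * m" by (simp add: energy_def torus_integral_const power2_eq_square)
    finally show ?thesis using m0 by simp
  qed
  \<comment> \<open>Existence is available for data at time 0, hence the shifted field. The
    relaxation hypothesis concerns \<open>u\<close> itself, so the decay of the shifted-back
    solution comes from \<open>relaxation_from_any_time\<close>.\<close>
  have us: "flow_on {0..} (\<lambda>t. u (s + t))"
    by (rule flow_on_time[OF u]) (use s in \<open>auto intro!: continuous_intros\<close>)
  obtain f where f: "C_space 2 {0..} f" "f 0 = g" "passive_scalar_solution (\<lambda>t. u (s + t)) \<nu> f"
    by (rule passive_scalar_exists[OF flow_on_vector_field[OF us] g2 \<nu>]) (rule that)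
  define \<phi> where "\<phi> t = f (t - s)" for t
  have \<phi>s: "\<phi> s = g" using f(2) by (simp add: \<phi>_def)
  have "strong_sol {s<..} u \<nu> (\<lambda>_ _. 0) \<phi>"
    unfolding \<phi>_def[abs_def] by (rule strong_sol_shift[OF passive_strong[OF f(1,3)]])
  then have \<phi>: "strong_sol {s<..<y} u \<nu> (\<lambda>_ _. 0) \<phi>" for y by (rule strong_sol_mono) auto
  have \<phi>c: "C_space 0 {s..y} \<phi>" for y
    unfolding \<phi>_def[abs_def] by (rule C_space_time[OF C_space_imp_0[OF f(1)]]) (auto intro!: continuous_intros)
  show ?thesis
  proof (rule that[of m])
    show "15/16 * torus_integral (n a) \<le> m" "m \<le> torus_integral (n a)" using mM mM' by (simp_all add: M_def)
    fix t assume t: "t \<in> {a + h + l..b}"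
    then have st: "s \<le> t" "t \<le> b" using h by (auto simp: s_def)
    have \<phi>t: "C_torus 0 (\<phi> t)" using C_space_at[OF \<phi>c[of t]] st by simp
    have tab: "t \<in> {a..b}" using st s by simp
    \<comment> \<open>The reaction only lowers \<open>n\<close>, so \<open>\<psi>\<close> is
      nonnegative, and its integral is the mass lost by \<open>n\<close> since time
      \<open>s\<close>, below a sixteenth of \<open>M\<close>.\<close>
    define \<psi> where "\<psi> x p = (\<phi> x p + m) - n x p" for x p
    have "strong_sol {s<..<t} u \<nu> (\<lambda>x p. 1 * (1 * 0 + 1 * 0) + (-1) * r x p) (\<lambda>x p. 1 * (1 * \<phi> x p + 1 * m) + (-1) * n x p)"
      by (intro strong_sol_lin \<phi> strong_sol_const nsub) (use s st in auto)
    then have \<psi>sol: "strong_sol {s<..<t} u \<nu> (\<lambda>x p. - r x p) \<psi>" by (simp add: \<psi>_def[abs_def])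
    have \<psi>c: "C_space 0 {s..t} \<psi>"
      unfolding \<psi>_def[abs_def] by (intro C_space_diff C_space_add \<phi>c C_space_const' nsub) (use s st in auto)
    have \<psi>0: "0 \<le> \<psi> t p" for p
      by (rule comparison[OF \<psi>sol \<psi>c]) (use \<nu> r0 s st in \<open>auto simp: \<psi>_def \<phi>s g_def\<close>)
    have "torus_integral (\<phi> t) = 0"
      using mass_conserved[OF usub[OF s(3)] \<phi> \<phi>c st(1)] gm by (simp add: \<phi>s)
    then have \<psi>m: "torus_integral (\<psi> t) = m - torus_integral (n t)"
      unfolding \<psi>_def[abs_def] using \<phi>t nt[OF tab]
      by (simp add: torus_integral_diff torus_integral_add C_torus_add C_torus_const torus_integral_const)
    have "L2_norm (\<phi> (s + (t - s))) \<le> C * L2_norm (\<phi> s) * exp (- (k * (t - s)))"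
      by (rule relaxation_from_any_time[OF u \<nu> C k relax])
        (use s st \<phi>[of t] \<phi>c[of t] g2 gm in \<open>simp_all add: \<phi>s\<close>)
    then have "L2_norm (\<phi> t) \<le> C * L2_norm g * exp (- (k * (t - s)))" by (simp add: \<phi>s)
    also have "\<dots> \<le> C * (sqrt (6 + 3456 / (\<nu> * h)^3) * M) * exp (- (k * l))"
    proof (intro mult_mono)
      have "L2_norm g \<le> sqrt ((6 + 3456 / (\<nu> * h)^3) * M\<^sup>2)"
        unfolding L2_norm_energy using gE es by simp
      then show "L2_norm g \<le> sqrt (6 + 3456 / (\<nu> * h)^3) * M" using M0 by (simp add: real_sqrt_mult)
      have "k * l \<le> k * (t - s)" using t k by (intro mult_left_mono) (auto simp: s_def)
      then show "exp (- (k * (t - s))) \<le> exp (- (k * l))" by simp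
    qed (use C \<nu> h M0 in \<open>auto intro!: mult_nonneg_nonneg L2_norm_nonneg C_torus_imp_0[OF g2]\<close>)
    also have "\<dots> = (C * exp (- (k * l)) * sqrt (6 + 3456 / (\<nu> * h)^3)) * M" by (simp add: mult_ac)
    also have "\<dots> \<le> 3 / 64 * M" using small M0 by (intro mult_right_mono) auto
    finally have L2: "L2_norm (\<phi> t) \<le> 3 / 64 * M" .
    have "torus_integral (\<lambda>p. \<bar>\<phi> t p\<bar>) \<le> L2_norm (\<phi> t)"
      unfolding L2_norm_energy by (rule real_le_rsqrt[OF torus_square_le[OF \<phi>t]])
    then have 1: "torus_integral (\<lambda>p. \<bar>\<phi> t p\<bar>) \<le> 3 / 64 * M" using L2 by simp
    have "torus_integral (n b) \<le> torus_integral (n t)" by (rule mono) (use st s in auto)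
    then have 2: "torus_integral (\<psi> t) \<le> M / 16" using mM drop by (simp add: \<psi>m M_def)
    have \<psi>t: "C_torus 0 (\<psi> t)" using C_space_at[OF \<psi>c, of t] st by simp
    have "torus_integral (\<lambda>p. \<bar>n t p - m\<bar>) \<le> torus_integral (\<lambda>p. \<bar>\<phi> t p\<bar> + \<psi> t p)"
    proof (rule torus_integral_mono)
      show "\<bar>n t p - m\<bar> \<le> \<bar>\<phi> t p\<bar> + \<psi> t p" for p using \<psi>0[of p] by (simp add: \<psi>_def)
    qed (intro C_torus_add C_torus_abs C_torus_diff nt[OF tab] C_torus_const \<phi>t \<psi>t)+
    also have "\<dots> = torus_integral (\<lambda>p. \<bar>\<phi> t p\<bar>) + torus_integral (\<psi> t)"
      by (intro torus_integral_add C_torus_abs \<phi>t \<psi>t)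
    also have "\<dots> \<le> 3 / 64 * M + M / 16" using 1 2 by simp
    \<comment> \<open>The two errors add up to \<open>7/64 * M\<close>, while \<open>m / 8\<close>
      is at least \<open>15/128 * M\<close>; this fixes the value 3/64 in the hypothesis
      \<open>small\<close>.\<close>
    also have "\<dots> \<le> m / 8" using mM' M0 by simp
    finally show "torus_integral (\<lambda>p. \<bar>n t p - m\<bar>) \<le> m / 8" .
  qed
qed

text \<open>Either both values are at least half of their targets, and the product is at least a
  quarter of \<open>m * m'\<close>, or one of them deviates so much that its error term alone
  reaches \<open>m * m'\<close>.\<close>

lemma overlap_pointwise:
  fixes x y m m' :: real
  assumes "0 \<le> x" "0 \<le> y" "0 < m" "0 < m'"
  shows "m * m' - 2 * m' * \<bar>x - m\<bar> - 2 * m * \<bar>y - m'\<bar> \<le> 4 * (x * y)"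
proof (cases "m / 2 \<le> x \<and> m' / 2 \<le> y")
  case True
  then have "(m / 2) * (m' / 2) \<le> x * y" using assms by (intro mult_mono) auto
  moreover have "0 \<le> 2 * m' * \<bar>x - m\<bar>" "0 \<le> 2 * m * \<bar>y - m'\<bar>" using assms by auto
  ultimately show ?thesis by simp
next
  case False
  have "m' * m \<le> m' * (2 * \<bar>x - m\<bar>)" if "x < m / 2" using that assms by (intro mult_left_mono) auto
  moreover have "m * m' \<le> m * (2 * \<bar>y - m'\<bar>)" if "y < m' / 2" using that assms by (intro mult_left_mono) auto
  moreover have "0 \<le> 2 * m' * \<bar>x - m\<bar>" "0 \<le> 2 * m * \<bar>y - m'\<bar>" "0 \<le> 4 * (x * y)" using assms by auto
  ultimately show ?thesis using False by (auto simp: not_le mult_ac)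
qed

lemma overlap:
  assumes f: "C_torus 0 f" "\<And>p. 0 \<le> f p" and g: "C_torus 0 g" "\<And>p. 0 \<le> g p" and m: "0 < m" "0 < m'"
    and fm: "torus_integral (\<lambda>p. \<bar>f p - m\<bar>) \<le> m / 8" and gm: "torus_integral (\<lambda>p. \<bar>g p - m'\<bar>) \<le> m' / 8"
  shows "m * m' / 8 \<le> torus_integral (\<lambda>p. f p * g p)"
proof -
  have C: "C_torus 0 (\<lambda>p. \<bar>f p - m\<bar>)" "C_torus 0 (\<lambda>p. \<bar>g p - m'\<bar>)"
    by (intro C_torus_abs C_torus_diff f g C_torus_const)+
  have "torus_integral (\<lambda>p. m * m' - (2 * m') * \<bar>f p - m\<bar> - (2 * m) * \<bar>g p - m'\<bar>) \<le> torus_integral (\<lambda>p. 4 * (f p * g p))"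
    using overlap_pointwise[OF f(2) g(2) m] by (intro torus_integral_mono C_torus_intros C f g) auto
  also have "\<dots> = 4 * torus_integral (\<lambda>p. f p * g p)" by (intro torus_integral_cmult C_torus_mult f g)
  also have "torus_integral (\<lambda>p. m * m' - (2 * m') * \<bar>f p - m\<bar> - (2 * m) * \<bar>g p - m'\<bar>) =
      m * m' - (2 * m') * torus_integral (\<lambda>p. \<bar>f p - m\<bar>) - (2 * m) * torus_integral (\<lambda>p. \<bar>g p - m'\<bar>)"
    using C by (simp add: torus_integral_diff torus_integral_cmult torus_integral_const C_torus_intros)
  finally have "m * m' - (2 * m') * torus_integral (\<lambda>p. \<bar>f p - m\<bar>) - (2 * m) * torus_integral (\<lambda>p. \<bar>g p - m'\<bar>) \<le> 4 * torus_integral (\<lambda>p. f p * g p)" .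
  moreover have "(2 * m') * torus_integral (\<lambda>p. \<bar>f p - m\<bar>) \<le> (2 * m') * (m / 8)" using fm m by (intro mult_left_mono) auto
  moreover have "(2 * m) * torus_integral (\<lambda>p. \<bar>g p - m'\<bar>) \<le> (2 * m) * (m' / 8)" using gm m by (intro mult_left_mono) auto
  ultimately show ?thesis by (simp add: mult_ac)
qed

lemma reaction_drop:
  assumes u: "flow_on {c<..<b} u" and n: "strong_sol {c<..<b} u \<nu> r n" "C_space 0 {c..b} n" and n': "C_space 0 {c..b} n'"
    and n0: "\<And>t p. t \<in> {c..b} \<Longrightarrow> 0 \<le> n t p" "\<And>t p. t \<in> {c..b} \<Longrightarrow> 0 \<le> n' t p"
    and r: "\<And>t p. t \<in> {c<..<b} \<Longrightarrow> \<epsilon> * (n t p * n' t p) \<le> r t p" and \<epsilon>: "0 \<le> \<epsilon>"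
    and m: "0 < m" "0 < m'" and cb: "c \<le> b"
    and eq: "\<And>t. t \<in> {c..b} \<Longrightarrow> torus_integral (\<lambda>p. \<bar>n t p - m\<bar>) \<le> m / 8"
      "\<And>t. t \<in> {c..b} \<Longrightarrow> torus_integral (\<lambda>p. \<bar>n' t p - m'\<bar>) \<le> m' / 8"
  shows "torus_integral (n b) + \<epsilon> * (m * m' / 8) * (b - c) \<le> torus_integral (n c)"
proof -
  let ?k = "\<epsilon> * (m * m' / 8)"
  have "torus_integral (n b) + ?k * b \<le> torus_integral (n c) + ?k * c"
  proof (rule has_derivative_nonpos_le[where f="\<lambda>t. torus_integral (n t) + ?k * t", OF cb])
    show "continuous_on {c..b} (\<lambda>t. torus_integral (n t) + ?k * t)"
      by (intro continuous_intros torus_integral_continuous n)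
    fix t assume t: "c < t" "t < b"
    then have tJ: "t \<in> {c<..<b}" and tc: "t \<in> {c..b}" by auto
    have C: "C_torus 0 (n t)" "C_torus 0 (n' t)" "C_torus 0 (r t)"
      using C_space_at[OF n(2) tc] C_space_at[OF n' tc] n(1) C_space_at tJ by (auto simp: strong_sol_def)
    have "((\<lambda>t. torus_integral (n t) + ?k * t) has_real_derivative - torus_integral (r t) + ?k * 1) (at t)"
      by (intro DERIV_add DERIV_cmult DERIV_ident mass_deriv[OF u n(1) open_greaterThanLessThan tJ])
    moreover have "?k \<le> torus_integral (r t)"
    proof -
      have "?k \<le> \<epsilon> * torus_integral (\<lambda>p. n t p * n' t p)"
        using \<epsilon> by (intro mult_left_mono overlap C n0 tc m eq)
      also have "\<dots> = torus_integral (\<lambda>p. \<epsilon> * (n t p * n' t p))" by (intro torus_integral_cmult[symmetric] C_torus_mult C)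
      also have "\<dots> \<le> torus_integral (r t)" by (intro torus_integral_mono C_torus_cmult C_torus_mult C r tJ)
      finally show ?thesis .
    qed
    ultimately show "\<exists>y. ((\<lambda>t. torus_integral (n t) + ?k * t) has_real_derivative y) (at t) \<and> y \<le> 0"
      by (intro exI conjI) auto
  qed
  then show ?thesis unfolding right_diff_distrib by linarith
qed

subsection \<open>Decay of the total mass\<close>

text \<open>Since \<open>d \<le> D / \<nu>\<close> and \<open>\<bar>ln \<nu>\<bar> \<ge> 1\<close>,
  the product of \<open>\<nu>\<close> and the smoothing time is at least
  \<open>\<nu>\<^sup>2 / D\<close>, so the smoothing cost is at most \<open>P / \<nu>^3\<close>. The
  relaxation time is \<open>4 / \<delta>\<close> times the smoothing time and gains exactly
  \<open>\<nu>^4\<close>, which leaves \<open>C * P * \<nu>\<close>.\<close>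

lemma viscosity_threshold:
  assumes C: "1 \<le> C" and D: "0 < D" and \<nu>0: "0 < \<nu>0" and \<delta>: "0 < \<delta>"
  obtains \<nu>star where "0 < \<nu>star" "\<nu>star < 1" "\<nu>star \<le> \<nu>0"
    "\<And>\<nu> d. 0 < \<nu> \<Longrightarrow> \<nu> \<le> \<nu>star \<Longrightarrow> 0 < d \<Longrightarrow> d \<le> D / \<nu> \<Longrightarrow> 0 < \<bar>ln \<nu>\<bar> / d \<and>
      C * exp (- (\<delta> * d * (4 / \<delta> * (\<bar>ln \<nu>\<bar> / d)))) * sqrt (6 + 3456 / (\<nu> * (\<bar>ln \<nu>\<bar> / d))^3) \<le> 3 / 64"
proof -
  define P where "P = sqrt (6 + 3456 * D^3)"
  have P: "0 < P" using D by (simp add: P_def add_pos_pos)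
  \<comment> \<open>The bound 1/3 ensures \<open>\<bar>ln \<nu>\<bar> \<ge> 1\<close>, and the last
    term makes \<open>C * P * \<nu>\<close> at most 3/64.\<close>
  define \<nu>star where "\<nu>star = min \<nu>0 (min (1/3) (3 / (64 * C * P)))"
  show ?thesis
  proof (rule that[of \<nu>star])
    show "0 < \<nu>star" "\<nu>star < 1" "\<nu>star \<le> \<nu>0" using \<nu>0 C P by (auto simp: \<nu>star_def)
    fix \<nu> d assume \<nu>: "0 < \<nu>" "\<nu> \<le> \<nu>star" and d: "0 < d" "d \<le> D / \<nu>"
    have \<nu>1: "\<nu> \<le> 1/3" "\<nu> \<le> 3 / (64 * C * P)" using \<nu> by (auto simp: \<nu>star_def)
    have "ln \<nu> \<le> ln (1 / 3)" using \<nu> \<nu>1 by simp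
    also have "\<dots> \<le> - 1"
    proof -
      have "ln (exp 1) \<le> ln (3::real)" using exp_le by (subst ln_le_cancel_iff) auto
      then show ?thesis by (simp add: ln_div)
    qed
    finally have ln: "ln \<nu> \<le> -1" .
    define h where "h = \<bar>ln \<nu>\<bar> / d"
    have h: "0 < h" unfolding h_def using ln d by (intro divide_pos_pos) auto
    have "\<nu> / D \<le> 1 / d" using d \<nu> D by (simp add: field_simps)
    also have "\<dots> \<le> h" using ln d unfolding h_def by (intro divide_right_mono) auto
    finally have "\<nu> * (\<nu> / D) \<le> \<nu> * h" using \<nu> by (intro mult_left_mono) auto
    then have "(\<nu> * (\<nu> / D))^3 \<le> (\<nu> * h)^3" using \<nu> D by (intro power_mono) auto
    then have "3456 / (\<nu> * h)^3 \<le> 3456 / (\<nu> * (\<nu> / D))^3" using \<nu> D h by (intro divide_left_mono mult_pos_pos zero_less_power divide_pos_pos) auto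
    also have "\<dots> = 3456 * D^3 / \<nu>^6" using \<nu> D by (simp add: power_mult_distrib power_divide flip: power_add)
    finally have "6 + 3456 / (\<nu> * h)^3 \<le> 6 / \<nu>^6 + 3456 * D^3 / \<nu>^6"
    proof -
      have "\<nu>^6 \<le> 1" using \<nu> \<nu>1 by (intro power_le_one) auto
      then have "6 \<le> 6 / \<nu>^6" using \<nu> by (simp add: le_divide_eq)
      then show "6 + 3456 / (\<nu> * h)^3 \<le> 6 / \<nu>^6 + 3456 * D^3 / \<nu>^6"
        if "3456 / (\<nu> * h)^3 \<le> 3456 * D^3 / \<nu>^6" using that by simp
    qed
    also have "\<dots> = (6 + 3456 * D^3) / (\<nu>^3)\<^sup>2" by (simp add: add_divide_distrib flip: power_mult)
    finally have "sqrt (6 + 3456 / (\<nu> * h)^3) \<le> sqrt ((6 + 3456 * D^3) / (\<nu>^3)\<^sup>2)" by simp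
    also have "\<dots> = P / \<nu>^3" unfolding real_sqrt_divide P_def real_sqrt_abs using \<nu> by simp
    finally have sq: "sqrt (6 + 3456 / (\<nu> * h)^3) \<le> P / \<nu>^3" .
    have "\<delta> * d * (4 / \<delta> * h) = 4 * \<bar>ln \<nu>\<bar>" using \<delta> d by (simp add: h_def)
    then have "exp (- (\<delta> * d * (4 / \<delta> * h))) = exp (4 * ln \<nu>)" using ln by simp
    also have "\<dots> = \<nu>^4" using \<nu> exp_of_nat_mult[of 4 "ln \<nu>"] by simp
    finally have e: "exp (- (\<delta> * d * (4 / \<delta> * h))) = \<nu>^4" .
    have "C * exp (- (\<delta> * d * (4 / \<delta> * h))) * sqrt (6 + 3456 / (\<nu> * h)^3) \<le> C * \<nu>^4 * (P / \<nu>^3)"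
      unfolding e using C \<nu> by (intro mult_left_mono[OF sq]) simp
    also have "\<dots> = C * P * \<nu>" using \<nu> by (simp add: eval_nat_numeral)
    also have "\<dots> \<le> C * P * (3 / (64 * C * P))" using \<nu>1 C P by (intro mult_left_mono) auto
    also have "\<dots> = 3 / 64" using C P by simp
    finally show "0 < \<bar>ln \<nu>\<bar> / d \<and>
      C * exp (- (\<delta> * d * (4 / \<delta> * (\<bar>ln \<nu>\<bar> / d)))) * sqrt (6 + 3456 / (\<nu> * (\<bar>ln \<nu>\<bar> / d))^3) \<le> 3 / 64"
      using h unfolding h_def by blast
  qed
qed

theorem theorem1p2:
  "\<exists>C1 :: real \<Rightarrow> real. (\<forall>B2\<ge>1. 0 < C1 B2) \<and>
    (\<forall>u d. torus_vector_field u \<and> divergence_free u \<and> relaxation_enhancing d u \<longrightarrow>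
      (\<exists>\<nu>star. 0 < \<nu>star \<and> \<nu>star < 1 \<and>
        (\<forall>B1 B2. 0 < B1 \<and> 1 \<le> B2 \<longrightarrow>
          (\<exists>C2. 0 < C2 \<and>
            (\<forall>(I :: nat set) \<nu> \<epsilon> n0 n T.
              finite I \<and> I \<noteq> {} \<and> 0 \<le> T \<and>
              (\<forall>\<alpha>\<in>I. 0 < \<nu> \<alpha> \<and> \<nu> \<alpha> \<le> \<nu>star) \<and>
              (\<forall>\<alpha>\<in>I. \<forall>\<beta>\<in>I. 0 \<le> \<epsilon> \<alpha> \<beta>) \<and>
              (\<forall>\<alpha>\<in>I. C_torus 2 (n0 \<alpha>) \<and> (\<forall>p. 0 \<le> n0 \<alpha> p)) \<and>
              reaction_system_solution I {0..T} u \<nu> \<epsilon> n0 n \<and>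
              (\<forall>\<alpha>\<in>I. \<forall>t\<in>{0..T}. \<forall>p. 0 \<le> n \<alpha> t p) \<and>
              (\<forall>t\<in>{0..T}.
                 1 / B1 \<le> min_L1 I n t \<and>
                 1 \<le> (\<Sum>\<alpha>\<in>I. L1_norm (n \<alpha> t)) / min_L1 I n t \<and>
                 (\<Sum>\<alpha>\<in>I. L1_norm (n \<alpha> t)) / min_L1 I n t \<le> B2)
              \<longrightarrow>
              (\<forall>t\<in>{0..T}.
                 (\<Sum>\<alpha>\<in>I. L1_norm (n \<alpha> t)) \<le>
                   C1 B2 * (\<Sum>\<alpha>\<in>I. L1_norm (n0 \<alpha>))
                         * exp (- (1 / C2) * decay_rate I d \<nu> \<epsilon> * t)))))))"
proof (intro exI[of _ "\<lambda>_. exp 1"] conjI allI impI)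
  \<comment> \<open>Decay is counted in whole windows. An unfinished window costs a factor
    \<open>exp (1 / (16 * B2))\<close>, at most \<open>exp 1\<close>, so this constant serves every
    \<open>B2\<close>.\<close>
  show "0 < exp (1 :: real)" by simp
  fix u d assume "torus_vector_field u \<and> divergence_free u \<and> relaxation_enhancing d u"
  then have u: "flow_on {0..} u" and re: "relaxation_enhancing d u" by (auto intro: flow_on_original)
  from re obtain \<nu>0 \<delta> C where \<nu>0: "0 < \<nu>0" and \<delta>: "0 < \<delta>" and C: "1 \<le> C"
    and all: "\<forall>\<nu>. 0 < \<nu> \<and> \<nu> \<le> \<nu>0 \<longrightarrow> 0 < d \<nu> \<and>
      (\<forall>f. passive_scalar_solution u \<nu> f \<and> torus_integral (f 0) = 0 \<longrightarrow>
        (\<forall>s\<ge>0. \<forall>t\<ge>0. L2_norm (f (s + t)) \<le> C * L2_norm (f s) * exp (- (\<delta> * d \<nu> * t))))"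
    unfolding relaxation_enhancing_def by (elim exE conjE)
  from all have dpos: "0 < d \<nu>" if "0 < \<nu>" "\<nu> \<le> \<nu>0" for \<nu> using that by simp
  from all have relax: "L2_norm (f (s + t)) \<le> C * L2_norm (f s) * exp (- (\<delta> * d \<nu> * t))"
    if "0 < \<nu>" "\<nu> \<le> \<nu>0" "passive_scalar_solution u \<nu> f" "torus_integral (f 0) = 0" "0 \<le> s" "0 \<le> t" for \<nu> f s t
    using that by simp
  obtain D where D: "0 < D" and Dk: "\<And>\<nu> k. 0 < \<nu> \<Longrightarrow> \<nu> \<le> 1 \<Longrightarrow>
     (\<And>f s t. passive_scalar_solution u \<nu> f \<Longrightarrow> torus_integral (f 0) = 0 \<Longrightarrow> 0 \<le> s \<Longrightarrow> 0 \<le> t \<Longrightarrow>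
        L2_norm (f (s + t)) \<le> C * L2_norm (f s) * exp (- (\<delta> * k * t))) \<Longrightarrow> k \<le> D / \<nu>"
  proof (rule relaxation_rate_bound[OF u C \<delta>])
    fix D assume D0: "0 < D" and D1: "\<And>\<nu> k. 0 < \<nu> \<Longrightarrow> \<nu> \<le> 1 \<Longrightarrow>
     (\<And>f s t. passive_scalar_solution u \<nu> f \<Longrightarrow> torus_integral (f 0) = 0 \<Longrightarrow> 0 \<le> s \<Longrightarrow> 0 \<le> t \<Longrightarrow>
        L2_norm (f (s + t)) \<le> C * L2_norm (f s) * exp (- (\<delta> * k * t))) \<Longrightarrow> k \<le> D / \<nu>"
    show thesis by (rule that) (fact D0, fact D1)
  qed
  obtain \<nu>star where \<nu>star: "0 < \<nu>star" "\<nu>star < 1" "\<nu>star \<le> \<nu>0"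
    and small: "\<And>\<nu> d. 0 < \<nu> \<Longrightarrow> \<nu> \<le> \<nu>star \<Longrightarrow> 0 < d \<Longrightarrow> d \<le> D / \<nu> \<Longrightarrow> 0 < \<bar>ln \<nu>\<bar> / d \<and>
      C * exp (- (\<delta> * d * (4 / \<delta> * (\<bar>ln \<nu>\<bar> / d)))) * sqrt (6 + 3456 / (\<nu> * (\<bar>ln \<nu>\<bar> / d))^3) \<le> 3 / 64"
    by (rule viscosity_threshold[OF C D \<nu>0 \<delta>]) (rule that)
  show "\<exists>\<nu>star. 0 < \<nu>star \<and> \<nu>star < 1 \<and>
        (\<forall>B1 B2. 0 < B1 \<and> 1 \<le> B2 \<longrightarrow>
          (\<exists>C2. 0 < C2 \<and>
            (\<forall>(I :: nat set) \<nu> \<epsilon> n0 n T.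
              finite I \<and> I \<noteq> {} \<and> 0 \<le> T \<and>
              (\<forall>\<alpha>\<in>I. 0 < \<nu> \<alpha> \<and> \<nu> \<alpha> \<le> \<nu>star) \<and>
              (\<forall>\<alpha>\<in>I. \<forall>\<beta>\<in>I. 0 \<le> \<epsilon> \<alpha> \<beta>) \<and>
              (\<forall>\<alpha>\<in>I. C_torus 2 (n0 \<alpha>) \<and> (\<forall>p. 0 \<le> n0 \<alpha> p)) \<and>
              reaction_system_solution I {0..T} u \<nu> \<epsilon> n0 n \<and>
              (\<forall>\<alpha>\<in>I. \<forall>t\<in>{0..T}. \<forall>p. 0 \<le> n \<alpha> t p) \<and>
              (\<forall>t\<in>{0..T}.
                 1 / B1 \<le> min_L1 I n t \<and>
                 1 \<le> (\<Sum>\<alpha>\<in>I. L1_norm (n \<alpha> t)) / min_L1 I n t \<and>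
                 (\<Sum>\<alpha>\<in>I. L1_norm (n \<alpha> t)) / min_L1 I n t \<le> B2)
              \<longrightarrow>
              (\<forall>t\<in>{0..T}.
                 (\<Sum>\<alpha>\<in>I. L1_norm (n \<alpha> t)) \<le>
                   exp 1 * (\<Sum>\<alpha>\<in>I. L1_norm (n0 \<alpha>))
                         * exp (- (1 / C2) * decay_rate I d \<nu> \<epsilon> * t)))))"
  proof (rule exI[of _ \<nu>star], intro conjI allI impI \<nu>star)
    fix B1 B2 :: real assume "0 < B1 \<and> 1 \<le> B2"
    then have B1: "0 < B1" and B2: "1 \<le> B2" by auto
    \<comment> \<open>A window of length \<open>K * (X + 1 / E)\<close> has room for smoothing and
      relaxation of every species, at most \<open>(1 + 4 / \<delta>) * X\<close>, and then for a
      reaction phase of length at least \<open>B1 / E\<close>.\<close>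
    define K where "K = max (1 + 4 / \<delta>) B1"
    have K: "0 < K" "1 + 4 / \<delta> \<le> K" "B1 \<le> K" using B1 by (auto simp: K_def)
    show "\<exists>C2. 0 < C2 \<and>
            (\<forall>(I :: nat set) \<nu> \<epsilon> n0 n T.
              finite I \<and> I \<noteq> {} \<and> 0 \<le> T \<and>
              (\<forall>\<alpha>\<in>I. 0 < \<nu> \<alpha> \<and> \<nu> \<alpha> \<le> \<nu>star) \<and>
              (\<forall>\<alpha>\<in>I. \<forall>\<beta>\<in>I. 0 \<le> \<epsilon> \<alpha> \<beta>) \<and>
              (\<forall>\<alpha>\<in>I. C_torus 2 (n0 \<alpha>) \<and> (\<forall>p. 0 \<le> n0 \<alpha> p)) \<and>
              reaction_system_solution I {0..T} u \<nu> \<epsilon> n0 n \<and>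
              (\<forall>\<alpha>\<in>I. \<forall>t\<in>{0..T}. \<forall>p. 0 \<le> n \<alpha> t p) \<and>
              (\<forall>t\<in>{0..T}.
                 1 / B1 \<le> min_L1 I n t \<and>
                 1 \<le> (\<Sum>\<alpha>\<in>I. L1_norm (n \<alpha> t)) / min_L1 I n t \<and>
                 (\<Sum>\<alpha>\<in>I. L1_norm (n \<alpha> t)) / min_L1 I n t \<le> B2)
              \<longrightarrow>
              (\<forall>t\<in>{0..T}.
                 (\<Sum>\<alpha>\<in>I. L1_norm (n \<alpha> t)) \<le>
                   exp 1 * (\<Sum>\<alpha>\<in>I. L1_norm (n0 \<alpha>))
                         * exp (- (1 / C2) * decay_rate I d \<nu> \<epsilon> * t)))"
    proof (intro exI[of _ "16 * B2 * K"] conjI allI impI ballI)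
      show "0 < 16 * B2 * K" using B2 K by simp
      fix I :: "nat set" and \<nu> \<epsilon> n0 n T t0
      assume H: "finite I \<and> I \<noteq> {} \<and> 0 \<le> T \<and>
              (\<forall>\<alpha>\<in>I. 0 < \<nu> \<alpha> \<and> \<nu> \<alpha> \<le> \<nu>star) \<and>
              (\<forall>\<alpha>\<in>I. \<forall>\<beta>\<in>I. 0 \<le> \<epsilon> \<alpha> \<beta>) \<and>
              (\<forall>\<alpha>\<in>I. C_torus 2 (n0 \<alpha>) \<and> (\<forall>p. 0 \<le> n0 \<alpha> p)) \<and>
              reaction_system_solution I {0..T} u \<nu> \<epsilon> n0 n \<and>
              (\<forall>\<alpha>\<in>I. \<forall>t\<in>{0..T}. \<forall>p. 0 \<le> n \<alpha> t p) \<and>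
              (\<forall>t\<in>{0..T}.
                 1 / B1 \<le> min_L1 I n t \<and>
                 1 \<le> (\<Sum>\<alpha>\<in>I. L1_norm (n \<alpha> t)) / min_L1 I n t \<and>
                 (\<Sum>\<alpha>\<in>I. L1_norm (n \<alpha> t)) / min_L1 I n t \<le> B2)"
        and t0: "t0 \<in> {0..T}"
      then have I: "finite I" "I \<noteq> {}" and \<nu>: "\<And>\<alpha>. \<alpha> \<in> I \<Longrightarrow> 0 < \<nu> \<alpha>" "\<And>\<alpha>. \<alpha> \<in> I \<Longrightarrow> \<nu> \<alpha> \<le> \<nu>star"
        and \<epsilon>: "\<And>\<alpha> \<beta>. \<alpha> \<in> I \<Longrightarrow> \<beta> \<in> I \<Longrightarrow> 0 \<le> \<epsilon> \<alpha> \<beta>"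
        and sol: "reaction_system_solution I {0..T} u \<nu> \<epsilon> n0 n"
        and n_nonneg: "\<And>\<alpha> t p. \<alpha> \<in> I \<Longrightarrow> t \<in> {0..T} \<Longrightarrow> 0 \<le> n \<alpha> t p"
        and minB1: "\<And>t. t \<in> {0..T} \<Longrightarrow> 1 / B1 \<le> min_L1 I n t"
        and ratio: "\<And>t. t \<in> {0..T} \<Longrightarrow> (\<Sum>\<alpha>\<in>I. L1_norm (n \<alpha> t)) / min_L1 I n t \<le> B2"
        by blast+
      define r where "r \<alpha> t p = (\<Sum>\<beta>\<in>I. \<epsilon> \<alpha> \<beta> * n \<alpha> t p * n \<beta> t p)" for \<alpha> t p
      define M where "M \<alpha> t = torus_integral (n \<alpha> t)" for \<alpha> t
      define S where "S t = (\<Sum>\<alpha>\<in>I. M \<alpha> t)" for t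
      have cont: "C_space 0 {0..T} (n \<alpha>)" if "\<alpha> \<in> I" for \<alpha>
        using sol that by (simp add: reaction_system_solution_def adv_diff_solution_def)
      have contJ: "C_space 0 {0<..<T} (n \<alpha>)" if "\<alpha> \<in> I" for \<alpha>
        by (rule C_space_mono[OF cont[OF that]]) auto
      have rC: "C_space 0 {0<..<T} (r \<alpha>)" if "\<alpha> \<in> I" for \<alpha>
        unfolding r_def[abs_def] by (intro C_space_sum C_space_mult C_space_const' contJ that)
      have strong: "strong_sol {0<..<T} u (\<nu> \<alpha>) (r \<alpha>) (n \<alpha>)" if "\<alpha> \<in> I" for \<alpha>
        using sol that rC[OF that]
        by (auto simp: reaction_system_solution_def adv_diff_solution_def strong_sol_def advect_def r_def)
      have r_nonneg: "0 \<le> r \<alpha> t p" if "\<alpha> \<in> I" "t \<in> {0..T}" for \<alpha> t p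
        unfolding r_def using that \<epsilon> n_nonneg by (intro sum_nonneg mult_nonneg_nonneg) auto
      have L1: "L1_norm (n \<alpha> t) = M \<alpha> t" if "\<alpha> \<in> I" "t \<in> {0..T}" for \<alpha> t
        using n_nonneg[OF that] by (simp add: L1_norm_def M_def)
      have SL: "(\<Sum>\<alpha>\<in>I. L1_norm (n \<alpha> t)) = S t" if "t \<in> {0..T}" for t
        using L1 that by (simp add: S_def)
      have T0: "0 \<in> {0..T}" using t0 by simp
      have S0: "(\<Sum>\<alpha>\<in>I. L1_norm (n0 \<alpha>)) = S 0"
        using SL[OF T0] sol by (simp add: reaction_system_solution_def)
      have min_le: "min_L1 I n t \<le> M \<alpha> t" if "\<alpha> \<in> I" "t \<in> {0..T}" for \<alpha> t
        unfolding min_L1_def using I that by (intro Min_le) (auto simp: L1[symmetric])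
      have MB1: "1 / B1 \<le> M \<alpha> t" if "\<alpha> \<in> I" "t \<in> {0..T}" for \<alpha> t
        using min_le[OF that] minB1[OF that(2)] by linarith
      have Mpos: "0 < M \<alpha> t" if "\<alpha> \<in> I" "t \<in> {0..T}" for \<alpha> t
        using MB1[OF that] B1 by (smt (verit) divide_pos_pos)
      have SB2: "S t \<le> B2 * M \<alpha> t" if "\<alpha> \<in> I" "t \<in> {0..T}" for \<alpha> t
      proof -
        have "0 < min_L1 I n t" using minB1[OF that(2)] B1 by (smt (verit) divide_pos_pos)
        then have "S t \<le> B2 * min_L1 I n t" using ratio[OF that(2)] SL[OF that(2)] by (simp add: divide_le_eq)
        also have "\<dots> \<le> B2 * M \<alpha> t" using min_le[OF that] B2 by (intro mult_left_mono) auto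
        finally show ?thesis .
      qed
      have usub: "flow_on {x<..<y} u" if "0 \<le> x" for x y
        by (rule flow_on_mono[OF u]) (use that in auto)
      have nsub: "strong_sol {x<..<y} u (\<nu> \<alpha>) (r \<alpha>) (n \<alpha>)" "C_space 0 {x..y} (n \<alpha>)"
        if "\<alpha> \<in> I" "0 \<le> x" "y \<le> T" for \<alpha> x y
        using that by (auto intro!: strong_sol_mono[OF strong] C_space_mono[OF cont])
      have M_anti: "M \<alpha> y \<le> M \<alpha> x" if "\<alpha> \<in> I" "0 \<le> x" "x \<le> y" "y \<le> T" for \<alpha> x y
        unfolding M_def using that r_nonneg
        by (intro mass_antimono[OF usub nsub]) auto
      have S_anti: "S y \<le> S x" if "0 \<le> x" "x \<le> y" "y \<le> T" for x y
        unfolding S_def using that by (intro sum_mono M_anti) auto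
      have S_nonneg: "0 \<le> S t" if "t \<in> {0..T}" for t
        unfolding S_def using Mpos that by (intro sum_nonneg) (auto intro: less_imp_le)
      have "S t0 \<le> exp 1 * S 0 * exp (- (1 / (16 * B2 * K)) * decay_rate I d \<nu> \<epsilon> * t0)"
      proof (cases "minmax I \<epsilon> = 0")
        case True
        have "S t0 \<le> 1 * S 0" using S_anti[of 0 t0] t0 by simp
        also have "\<dots> \<le> exp 1 * S 0" using S_nonneg[OF T0] by (intro mult_right_mono) auto
        finally show ?thesis using True by (simp add: decay_rate_def)
      next
        case False
        define E where "E = minmax I \<epsilon>"
        define X where "X = Max ((\<lambda>\<alpha>. \<bar>ln (\<nu> \<alpha>)\<bar> / d (\<nu> \<alpha>)) ` I)"
        \<comment> \<open>\<open>E\<close> is a lower bound for every row maximum, so any species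
          can play this part, with a partner \<open>\<beta>\<close> that attains its row maximum;
          the two may coincide.\<close>
        obtain \<alpha> where \<alpha>: "\<alpha> \<in> I" using I by blast
        have Emax: "E \<le> Max (\<epsilon> \<gamma> ` I)" if "\<gamma> \<in> I" for \<gamma>
          unfolding E_def minmax_def using I that by (intro Min_le) auto
        have "Max (\<epsilon> \<alpha> ` I) \<in> \<epsilon> \<alpha> ` I" using I by (intro Max_in) auto
        then obtain \<beta> where \<beta>: "\<beta> \<in> I" "Max (\<epsilon> \<alpha> ` I) = \<epsilon> \<alpha> \<beta>" by auto
        have E\<beta>: "E \<le> \<epsilon> \<alpha> \<beta>" using Emax[OF \<alpha>] \<beta> by simp
        have E: "0 < E"
        proof -
          have "E \<in> (\<lambda>\<alpha>. Max (\<epsilon> \<alpha> ` I)) ` I" unfolding E_def minmax_def using I by (intro Min_in) auto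
          then obtain \<gamma> where \<gamma>: "\<gamma> \<in> I" "E = Max (\<epsilon> \<gamma> ` I)" by auto
          have "\<epsilon> \<gamma> \<gamma> \<le> E" unfolding \<gamma>(2) using I \<gamma>(1) by (intro Max_ge) auto
          then have "0 \<le> E" using \<epsilon>[OF \<gamma>(1) \<gamma>(1)] by linarith
          then show ?thesis using False by (simp add: E_def)
        qed
        define h where "h \<gamma> = \<bar>ln (\<nu> \<gamma>)\<bar> / d (\<nu> \<gamma>)" for \<gamma>
        have hX: "h \<gamma> \<le> X" if "\<gamma> \<in> I" for \<gamma> unfolding X_def h_def using I that by (intro Max_ge) auto
        have d0: "0 < d (\<nu> \<gamma>)" if "\<gamma> \<in> I" for \<gamma> using dpos \<nu>[OF that] \<nu>star by force
        have sm: "0 < h \<gamma>" "C * exp (- (\<delta> * d (\<nu> \<gamma>) * (4 / \<delta> * h \<gamma>))) * sqrt (6 + 3456 / (\<nu> \<gamma> * h \<gamma>)^3) \<le> 3 / 64"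
          if "\<gamma> \<in> I" for \<gamma>
        proof -
          have "d (\<nu> \<gamma>) \<le> D / \<nu> \<gamma>"
            by (rule Dk[OF _ _ relax]) (use \<nu>[OF that] \<nu>star in auto)
          from small[OF \<nu>[OF that] d0[OF that] this]
          show "0 < h \<gamma>" "C * exp (- (\<delta> * d (\<nu> \<gamma>) * (4 / \<delta> * h \<gamma>))) * sqrt (6 + 3456 / (\<nu> \<gamma> * h \<gamma>)^3) \<le> 3 / 64"
            unfolding h_def by blast+
        qed
        have X: "0 < X" using sm(1)[OF \<alpha>] hX[OF \<alpha>] by linarith
        define \<tau> where "\<tau> = K * (X + 1 / E)"
        have \<tau>: "0 < \<tau>" using K X E by (simp add: \<tau>_def add_pos_pos)
        \<comment> \<open>The species that drops loses a sixteenth of its mass, and its mass is at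
          least the fraction \<open>1 / B2\<close> of the total.\<close>
        define q where "q = 1 - 1 / (16 * B2)"
        have q: "0 \<le> q" using B2 by (simp add: q_def)
        have step: "S (s + \<tau>) \<le> q * S s" if s: "0 \<le> s" "s + \<tau> \<le> T" for s
        proof -
          \<comment> \<open>By time \<open>c\<close> every species has had its own smoothing time
            \<open>h \<gamma>\<close> and relaxation time \<open>4 / \<delta> * h \<gamma>\<close>,
            since \<open>X\<close> is the largest \<open>h \<gamma>\<close>.\<close>
          define c where "c = s + (1 + 4 / \<delta>) * X"
          define b where "b = s + \<tau>"
          have cs: "s \<le> c" using X \<delta> by (simp add: c_def)
          have bc: "B1 / E \<le> b - c"
          proof -
            have "(1 + 4 / \<delta>) * X \<le> K * X" "B1 * (1 / E) \<le> K * (1 / E)" using K X E by (intro mult_right_mono; simp)+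
            then show ?thesis by (simp add: b_def c_def \<tau>_def distrib_left)
          qed
          have cb: "c < b" using bc B1 E by (smt (verit) divide_pos_pos)
          have bT: "b \<le> T" using s by (simp add: b_def)
          have equi: "\<exists>m. 15/16 * M \<gamma> s \<le> m \<and> m \<le> M \<gamma> s \<and> (\<forall>t\<in>{c..b}. torus_integral (\<lambda>p. \<bar>n \<gamma> t p - m\<bar>) \<le> m / 8)"
            if \<gamma>: "\<gamma> \<in> I" and dr: "15/16 * M \<gamma> s < M \<gamma> b" for \<gamma>
          proof -
            have hl: "s + h \<gamma> + 4 / \<delta> * h \<gamma> \<le> c"
            proof -
              have "(1 + 4 / \<delta>) * h \<gamma> \<le> (1 + 4 / \<delta>) * X" using hX[OF \<gamma>] \<delta> by (intro mult_left_mono) auto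
              then show ?thesis by (simp add: c_def algebra_simps)
            qed
            have l0: "0 \<le> 4 / \<delta> * h \<gamma>" using sm(1)[OF \<gamma>] \<delta> by simp
            have hb: "s + h \<gamma> < b" using hl l0 cb by linarith
            have relax\<gamma>: "L2_norm (f (x + y)) \<le> C * L2_norm (f x) * exp (- (\<delta> * d (\<nu> \<gamma>) * y))"
              if "passive_scalar_solution u (\<nu> \<gamma>) f" "torus_integral (f 0) = 0" "0 \<le> x" "0 \<le> y" for f x y
              by (rule relax[OF _ _ that]) (use \<nu>[OF \<gamma>] \<nu>star in auto)
            obtain m where "15/16 * torus_integral (n \<gamma> s) \<le> m" "m \<le> torus_integral (n \<gamma> s)"
              "\<And>t. t \<in> {s + h \<gamma> + 4 / \<delta> * h \<gamma>..b} \<Longrightarrow> torus_integral (\<lambda>p. \<bar>n \<gamma> t p - m\<bar>) \<le> m / 8"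
            proof (rule equidistribution[OF u \<nu>(1)[OF \<gamma>] _ _ _ nsub[OF \<gamma> s(1) bT] _ _ s(1) sm(1)[OF \<gamma>] l0 hb _ _ sm(2)[OF \<gamma>]])
              show "0 \<le> C" using C by simp
              show "L2_norm (f (x + y)) \<le> C * L2_norm (f x) * exp (- (\<delta> * d (\<nu> \<gamma>) * y))"
                if "passive_scalar_solution u (\<nu> \<gamma>) f" "torus_integral (f 0) = 0" "0 \<le> x" "0 \<le> y" for f x y
                by (rule relax\<gamma>[OF that])
              show "0 \<le> \<delta> * d (\<nu> \<gamma>)" using \<delta> d0[OF \<gamma>] by simp
              show "0 \<le> n \<gamma> t p" if "t \<in> {s..b}" for t p using n_nonneg[OF \<gamma>] that s bT by auto
              show "0 \<le> r \<gamma> t p" if "t \<in> {s<..<b}" for t p using r_nonneg[OF \<gamma>] that s bT by auto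
              show "0 < torus_integral (n \<gamma> s)" using Mpos[OF \<gamma>, of s] s \<tau> by (simp add: M_def)
              show "15/16 * torus_integral (n \<gamma> s) < torus_integral (n \<gamma> b)" using dr by (simp add: M_def)
              fix m assume m: "15/16 * torus_integral (n \<gamma> s) \<le> m" "m \<le> torus_integral (n \<gamma> s)"
                "\<And>t. t \<in> {s + h \<gamma> + 4 / \<delta> * h \<gamma>..b} \<Longrightarrow> torus_integral (\<lambda>p. \<bar>n \<gamma> t p - m\<bar>) \<le> m / 8"
              show thesis by (rule that) (fact m)+
            qed
            then show ?thesis using hl by (intro exI[of _ m]) (auto simp: M_def)
          qed
          \<comment> \<open>Otherwise all species are nearly constant on \<open>{c..b}\<close>. The
            reaction with \<open>\<beta>\<close> would then remove at least
            \<open>m * (15 / 128)\<close> from \<open>\<alpha>\<close>, with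
            \<open>m \<ge> 15/16 * M \<alpha> s\<close>, which is more than a sixteenth of
            \<open>M \<alpha> s\<close>.\<close>
          have "\<exists>\<gamma>\<in>I. M \<gamma> b \<le> 15/16 * M \<gamma> s"
          proof (rule ccontr)
            assume "\<not> (\<exists>\<gamma>\<in>I. M \<gamma> b \<le> 15/16 * M \<gamma> s)"
            then have no: "15/16 * M \<gamma> s < M \<gamma> b" if "\<gamma> \<in> I" for \<gamma> using that by (auto simp: not_le)
            obtain m where m: "15/16 * M \<alpha> s \<le> m" "m \<le> M \<alpha> s" "\<And>t. t \<in> {c..b} \<Longrightarrow> torus_integral (\<lambda>p. \<bar>n \<alpha> t p - m\<bar>) \<le> m / 8"
              using equi[OF \<alpha> no[OF \<alpha>]] by blast
            obtain m' where m': "15/16 * M \<beta> s \<le> m'" "m' \<le> M \<beta> s" "\<And>t. t \<in> {c..b} \<Longrightarrow> torus_integral (\<lambda>p. \<bar>n \<beta> t p - m'\<bar>) \<le> m' / 8"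
              using equi[OF \<beta>(1) no[OF \<beta>(1)]] by blast
            have sT: "s \<in> {0..T}" using s \<tau> by simp
            have m0: "0 < m" "0 < m'" using m(1) m'(1) Mpos[OF \<alpha> sT] Mpos[OF \<beta>(1) sT] by linarith+
            have c0: "0 \<le> c" using cs s by simp
            have "torus_integral (n \<alpha> b) + \<epsilon> \<alpha> \<beta> * (m * m' / 8) * (b - c) \<le> torus_integral (n \<alpha> c)"
            proof (rule reaction_drop[OF usub[OF c0] nsub[OF \<alpha> c0 bT] nsub(2)[OF \<beta>(1) c0 bT]])
              show "0 \<le> n \<alpha> t p" "0 \<le> n \<beta> t p" if "t \<in> {c..b}" for t p
                using n_nonneg[OF \<alpha>] n_nonneg[OF \<beta>(1)] that c0 bT by auto
              show "\<epsilon> \<alpha> \<beta> * (n \<alpha> t p * n \<beta> t p) \<le> r \<alpha> t p" if "t \<in> {c<..<b}" for t p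
              proof -
                have tT: "t \<in> {0..T}" using that c0 bT by auto
                have "\<epsilon> \<alpha> \<beta> * n \<alpha> t p * n \<beta> t p \<le> r \<alpha> t p"
                  unfolding r_def
                  by (rule member_le_sum[where f="\<lambda>\<beta>. \<epsilon> \<alpha> \<beta> * n \<alpha> t p * n \<beta> t p", OF \<beta>(1) _ I(1)])
                    (use \<epsilon>[OF \<alpha>] n_nonneg[OF \<alpha> tT] n_nonneg[OF _ tT] in auto)
                then show ?thesis by (simp add: mult.assoc)
              qed
            qed (use m0 m m' \<epsilon>[OF \<alpha> \<beta>(1)] cb in auto)
            moreover have "B1 \<le> \<epsilon> \<alpha> \<beta> * (b - c)"
            proof -
              have "B1 = E * (B1 / E)" using E by simp
              also have "\<dots> \<le> \<epsilon> \<alpha> \<beta> * (b - c)" using E\<beta> bc E B1 by (intro mult_mono) auto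
              finally show ?thesis .
            qed
            then have "B1 * (m * m' / 8) \<le> \<epsilon> \<alpha> \<beta> * (b - c) * (m * m' / 8)"
              using m0 by (intro mult_right_mono) auto
            \<comment> \<open>The lower bound \<open>1 / B1\<close> on the mass of
              \<open>\<beta>\<close> enters here: it gives \<open>B1 * m' \<ge> 15 / 16\<close>, so
              the amount consumed is proportional to \<open>m\<close> alone.\<close>
            moreover have "m * (15 / 128) \<le> B1 * (m * m' / 8)"
            proof -
              have "15 / 16 * (1 / B1) \<le> m'" using m'(1) MB1[OF \<beta>(1) sT] by linarith
              then have "15 / 16 \<le> B1 * m'" using B1 by (simp add: field_simps)
              then have "m / 8 * (15 / 16) \<le> m / 8 * (B1 * m')" using m0 by (intro mult_left_mono) auto
              then show ?thesis by (simp add: mult_ac)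
            qed
            moreover have "torus_integral (n \<alpha> c) \<le> M \<alpha> s"
              using M_anti[OF \<alpha>, of s c] s cs cb bT by (simp add: M_def)
            ultimately have "M \<alpha> b + m * (15 / 128) \<le> M \<alpha> s" by (simp add: M_def mult_ac)
            then show False using no[OF \<alpha>] m(1) Mpos[OF \<alpha> sT] by linarith
          qed
          then obtain \<gamma> where \<gamma>: "\<gamma> \<in> I" "M \<gamma> b \<le> 15/16 * M \<gamma> s" by blast
          have sT: "s \<in> {0..T}" using s \<tau> by simp
          \<comment> \<open>Which species drops may change from window to window; all the others at
            least do not gain mass.\<close>
          have "S b = M \<gamma> b + (\<Sum>\<alpha>\<in>I - {\<gamma>}. M \<alpha> b)" unfolding S_def using I \<gamma> by (simp add: sum.remove)
          also have "\<dots> \<le> 15/16 * M \<gamma> s + (\<Sum>\<alpha>\<in>I - {\<gamma>}. M \<alpha> s)"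
            using \<gamma> s \<tau> bT by (intro add_mono sum_mono M_anti) (auto simp: b_def)
          also have "\<dots> = S s - M \<gamma> s / 16" unfolding S_def using I \<gamma> by (simp add: sum.remove)
          also have "\<dots> \<le> S s - S s / B2 / 16"
          proof -
            have "S s / B2 \<le> M \<gamma> s" using SB2[OF \<gamma>(1) sT] B2 by (simp add: divide_le_eq mult.commute)
            then show ?thesis by simp
          qed
          also have "\<dots> = q * S s" by (simp add: q_def left_diff_distrib)
          finally show ?thesis by (simp add: b_def)
        qed
        have iter: "S (real k * \<tau>) \<le> q ^ k * S 0" if "real k * \<tau> \<le> T" for k
          using that
        proof (induction k)
          case (Suc k)
          have e: "real (Suc k) * \<tau> = real k * \<tau> + \<tau>" by (simp add: algebra_simps)
          have "S (real k * \<tau> + \<tau>) \<le> q * S (real k * \<tau>)"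
            by (rule step) (use Suc.prems \<tau> e in auto)
          also have "\<dots> \<le> q * (q ^ k * S 0)" using Suc \<tau> q e by (intro mult_left_mono) auto
          finally show ?case unfolding e by (simp add: mult.assoc)
        qed simp
        \<comment> \<open>The number of windows completed by time \<open>t0\<close>.\<close>
        define k where "k = nat \<lfloor>t0 / \<tau>\<rfloor>"
        have tt: "0 \<le> t0 / \<tau>" using t0 \<tau> by simp
        have k: "real k \<le> t0 / \<tau>" "t0 / \<tau> \<le> real k + 1" using tt by (auto simp: k_def of_nat_nat)
        have kt: "real k * \<tau> \<le> t0" using k(1) \<tau> by (simp add: le_divide_eq)
        have "S t0 \<le> S (real k * \<tau>)" using S_anti[of "real k * \<tau>" t0] kt t0 \<tau> by simp
        also have "\<dots> \<le> q ^ k * S 0" by (rule iter) (use kt t0 in auto)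
        also have "\<dots> \<le> exp (1 - t0 / (16 * B2 * \<tau>)) * S 0"
        proof (rule mult_right_mono[OF _ S_nonneg[OF T0]])
          have "q \<le> exp (- (1 / (16 * B2)))" using exp_ge_add_one_self[of "- (1 / (16 * B2))"] by (simp add: q_def)
          then have "q ^ k \<le> exp (- (1 / (16 * B2))) ^ k" using q by (intro power_mono) auto
          also have "\<dots> = exp (- (real k / (16 * B2)))" by (simp flip: exp_of_nat_mult)
          also have "\<dots> \<le> exp (1 - t0 / (16 * B2 * \<tau>))"
          proof -
            have "(t0 / \<tau> - 1) / (16 * B2) \<le> real k / (16 * B2)" using k B2 by (intro divide_right_mono) auto
            moreover have "1 / (16 * B2) \<le> 1" using B2 by simp
            ultimately show ?thesis by (simp add: diff_divide_distrib mult.commute)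
          qed
          finally show "q ^ k \<le> exp (1 - t0 / (16 * B2 * \<tau>))" .
        qed
        also have "exp (1 - t0 / (16 * B2 * \<tau>)) * S 0 = exp 1 * S 0 * exp (- (1 / (16 * B2 * K)) * decay_rate I d \<nu> \<epsilon> * t0)"
        proof -
          have "decay_rate I d \<nu> \<epsilon> = 1 / (X + 1 / E)"
            using False by (simp add: decay_rate_def X_def E_def inverse_eq_divide)
          then have "t0 / (16 * B2 * \<tau>) = (1 / (16 * B2 * K)) * decay_rate I d \<nu> \<epsilon> * t0"
            by (simp add: \<tau>_def mult.assoc)
          then have e: "- (1 / (16 * B2 * K)) * decay_rate I d \<nu> \<epsilon> * t0 = - (t0 / (16 * B2 * \<tau>))" by linarith
          have "exp (1 - x) * y = exp 1 * y * exp (- x)" for x y :: real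
            by (simp add: exp_diff exp_minus divide_inverse)
          then show ?thesis unfolding e .
        qed
        finally show ?thesis .
      qed
      then show "(\<Sum>\<alpha>\<in>I. L1_norm (n \<alpha> t0)) \<le> exp 1 * (\<Sum>\<alpha>\<in>I. L1_norm (n0 \<alpha>))
          * exp (- (1 / (16 * B2 * K)) * decay_rate I d \<nu> \<epsilon> * t0)"
        unfolding SL[OF t0] S0 .
    qed
  qed
qed

end
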